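(* Let $\mathbf{k}$ be an algebraically closed field, $\Lambda=\mathbf{k}Q/I$ a gentle algebra, $v$ a string and $(b,\mu)$ a band with $\mu\in\mathbf{k}^*$. Suppose that $v$ and ${}^\infty b^\infty$ admit decompositions $$v=v_L\bar B m A v_R\quad\text{and}\quad {}^\infty b^\infty={}^\infty b\, b_L D m\bar C b_R\, b^\infty,$$ where $A,B,C,D\in Q_1$ ($A$, $B$ possibly absent) with $C\neq\emptyset\neq D$, and $v_L,v_R,m,b_L,b_R$ are (possibly trivial) strings satisfying the overlap conditions (i)--(iii) of the context. (a) If, after suitable rotation of $b$, $m$ is a proper subword of $b$, then there is a non-split overlap extension $$0\to B(b,\mu)\to M(u)\to M(v)\to0,$$ where $u=v_L\bar B m\bar C b_R b_L D m A v_R$ is a string. (b) If $b$ is a subword of $m$, then after suitable rotation of $b$ there is a decomposition $b=b_2b_1$ such that $m=b^kb_2$ for some $k\ge1$, and there is a non-split overlap extension $$0\to B(b,\mu)\to M(u)\to M(v)\to0,$$ where $u=v_L\bar B b^{k+1}b_2Av_R$ is a string. Moreover, the collection of such extensions forms a basis of $\operatorname{Ext}^1_\Lambda(M(v),B(b,\mu))$.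
   Context: Gentle algebra: $\Lambda=\mathbf{k}Q/I$ is finite-dimensional, $Q$ a finite quiver, $I$ an admissible ideal, such that (1) at each vertex at most two arrows start and at most two arrows end; (2) for each arrow $a$ there is at most one arrow $b$ with $e(a)=s(b)$ and $ba\notin I$, and at most one arrow $c$ with $e(c)=s(a)$ and $ac\notin I$; (3) for each arrow $a$ there is at most one arrow $b$ with $e(a)=s(b)$ and $ba\in I$, and at most one arrow $c$ with $e(c)=s(a)$ and $ac\in I$; (4) $I$ is generated by paths of length two. Modules are finitely generated left modules and paths are read from right to left; $s,e$ denote start and end. Strings and bands: each arrow $a$ has a formal inverse $\bar a$ with $s(\bar a)=e(a)$, $e(\bar a)=s(a)$. A walk is a sequence $w=w_l\cdots w_1$ of letters (arrows, called direct, or inverse arrows) with $s(w_{i+1})=e(w_i)$ and no subsequence $a\bar a$ or $\bar aa$; its inverse is $\bar w=\bar w_1\cdots\bar w_l$. A string is a walk with no subwalk $u$ with $u\in I$ or $\bar u\in I$, or a trivial string $1_x$ for a vertex $x$. A band is a string $b=b_n\cdots b_1$ with $e(b_n)=s(b_1)$, $b_1\ne\bar b_n$, $b_1b_n$ a string, and $b\ne y^r$ for every substring $y$ and $r>1$. Strings are taken modulo inversion, bands modulo inversion and cyclic permutation (rotation). $M(w)$, for $w=w_l\cdots w_1$, has basis $z_0,\dots,z_l$ ($z_0$ at $s(w_1)$, $z_i$ at $e(w_i)$); an arrow $w_i$ sends $z_{i-1}$ to $z_i$, for $w_i=\bar a$ the arrow $a$ sends $z_i$ to $z_{i-1}$,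 all other actions are zero. The (quasi-simple) band module $B(b,\mu)$ is defined in the same way with basis indexed by $\mathbb{Z}/n$, the letters read cyclically, except that one chosen direct letter $b_i$ acts by $z_{i-1}\mapsto\mu z_i$. The infinite words ${}^\infty b^\infty=\cdots bbb\cdots$, ${}^\infty b=\cdots bb$, $b^\infty=bb\cdots$ are obtained by repeated concatenation (in both directions, to the left, to the right). Overlap conditions: an absent arrow is written $\emptyset$ (then the adjacent outer word is absent too). (i) If $A=\emptyset$ then $C\neq\emptyset$; (ii) if $B=\emptyset$ then $D\ne\emptyset$; (iii) if $m=1_x$ is a trivial string, then $CA\in I$ and $DB\in I$ whenever the arrows involved exist. Conventions: in (a), after rotation $b=b_LDm\bar Cb_R$. In both cases $u=v_L\bar B\,y\,Av_R$, where $y$ is a subword of ${}^\infty b^\infty$ beginning and ending in the given overlap $m$, of length $|m|+|b|$; the map $B(b,\mu)\to M(u)$ is the canonical one, $B(b,\mu)\to M(y)\hookrightarrow M(u)$, sending a basis vector of $B(b,\mu)$ to the sum of all basis vectors of $M(y)$ lying over it, weighted by the appropriate powers of $\mu$. "The collection of such extensions" has one extension for each pair of decompositions $v=v_L\bar B m A v_R$ and ${}^\infty b^\infty={}^\infty b\, b_L D m\bar C b_R\, b^\infty$ with $A,B,C,D\in Q_1$ ($A$, $B$ possibly absent), $C\neq\emptyset\neq D$, and $v_L,v_R,m,b_L,b_R$ (possibly trivial) strings satisfying the overlap conditions (i)--(iii), for all choices of representatives modulo inversion; decompositions of ${}^\infty b^\infty$ are taken up to translation by the period, and data differing by simultaneous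 inversion are identified. *)

theory Defs
  imports
    "HOL-Library.Sublist"
    "HOL-Computational_Algebra.Polynomial"
    "HOL-Algebra.QuotRing"
    "HOL-Algebra.Module"
    "Graph_Theory.Arc_Walk"
begin

text \<open>
  A finite quiver is a \<^locale>\<open>fin_digraph\<close> (multiple arrows and loops are allowed there);
  the start and end maps are \<^const>\<open>tail\<close> and \<^const>\<open>head\<close>.

  Paths, and all words below, are stored in the order in which they are traversed, i.e. in the
  reverse of the written order: the written word \<open>w\<^sub>l \<cdots> w\<^sub>1\<close> is the list \<open>[w\<^sub>1, \<dots>, w\<^sub>l]\<close>.
  A path is a start vertex together with a list of arrows; \<open>(x, [])\<close> is the trivial path at \<open>x\<close>.
  In comments \<open>w\<^sup>-\<close> denotes the formal inverse of a letter or word.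
\<close>

type_synonym ('v, 'a) path = "'v \<times> 'a list"

definition paths :: "('v, 'a) pre_digraph \<Rightarrow> ('v, 'a) path set" where
  "paths Q = {(x, p). \<exists>y. pre_digraph.awalk Q x p y}"

text \<open>In \<open>path_mult Q F G\<close> the right factor \<open>G\<close> is traversed first.\<close>

definition path_mult ::
  "('v, 'a) pre_digraph \<Rightarrow> (('v, 'a) path \<Rightarrow> 'k::field) \<Rightarrow> (('v, 'a) path \<Rightarrow> 'k) \<Rightarrow> ('v, 'a) path \<Rightarrow> 'k"
where
  "path_mult Q F G = (\<lambda>(x, p).
     \<Sum>i\<le>length p. F (pre_digraph.awlast Q x (take i p), drop i p) * G (x, take i p))"

definition path_algebra :: "('v, 'a) pre_digraph \<Rightarrow> (('v, 'a) path \<Rightarrow> 'k::field) ring" where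
  "path_algebra Q =
    \<lparr>carrier = {F. finite {\<pi>. F \<pi> \<noteq> 0} \<and> {\<pi>. F \<pi> \<noteq> 0} \<subseteq> paths Q},
     mult = path_mult Q,
     one = (\<lambda>(x, p). if x \<in> verts Q \<and> p = [] then 1 else 0),
     zero = (\<lambda>_. 0),
     add = (\<lambda>F G \<pi>. F \<pi> + G \<pi>)\<rparr>"

definition path_elt :: "('v, 'a) path \<Rightarrow> ('v, 'a) path \<Rightarrow> 'k::field" where
  "path_elt \<pi> = (\<lambda>\<rho>. if \<rho> = \<pi> then 1 else 0)"

text \<open>For arrows \<open>a\<close>, \<open>b\<close> with \<open>e(a) = s(b)\<close>, this is the membership \<open>ba \<in> I\<close>.\<close>

definition zero_rel ::
  "('v, 'a) pre_digraph \<Rightarrow> (('v, 'a) path \<Rightarrow> 'k::field) set \<Rightarrow> 'a \<Rightarrow> 'a \<Rightarrow> bool" where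
  "zero_rel Q I b a \<longleftrightarrow> path_elt (tail Q a, [a, b]) \<in> I"

text \<open>
  With \<open>J\<close> the arrow ideal, \<open>J\<^sup>N\<close> is spanned by the paths of length at least \<open>N\<close>; the conditions
  say \<open>J\<^sup>N \<subseteq> I \<subseteq> J\<^sup>2\<close>. For a finite quiver they make \<open>kQ/I\<close> finite-dimensional.
\<close>

definition admissible_ideal ::
  "('v, 'a) pre_digraph \<Rightarrow> (('v, 'a) path \<Rightarrow> 'k::field) set \<Rightarrow> bool" where
  "admissible_ideal Q I \<longleftrightarrow>
     ideal I (path_algebra Q) \<and>
     (\<exists>N\<ge>2. \<forall>\<pi>\<in>paths Q. length (snd \<pi>) \<ge> N \<longrightarrow> path_elt \<pi> \<in> I) \<and>
     (\<forall>F\<in>I. \<forall>\<pi>. F \<pi> \<noteq> 0 \<longrightarrow> length (snd \<pi>) \<ge> 2)"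

definition gentle ::
  "('v, 'a) pre_digraph \<Rightarrow> (('v, 'a) path \<Rightarrow> 'k::field) set \<Rightarrow> bool" where
  "gentle Q I \<longleftrightarrow>
     fin_digraph Q \<and> admissible_ideal Q I \<and>
     (\<forall>x\<in>verts Q. card {a \<in> arcs Q. tail Q a = x} \<le> 2 \<and> card {a \<in> arcs Q. head Q a = x} \<le> 2) \<and>
     (\<forall>a\<in>arcs Q.
        card {b \<in> arcs Q. head Q a = tail Q b \<and> \<not> zero_rel Q I b a} \<le> 1 \<and>
        card {c \<in> arcs Q. head Q c = tail Q a \<and> \<not> zero_rel Q I a c} \<le> 1) \<and>
     (\<forall>a\<in>arcs Q.
        card {b \<in> arcs Q. head Q a = tail Q b \<and> zero_rel Q I b a} \<le> 1 \<and>
        card {c \<in> arcs Q. head Q c = tail Q a \<and> zero_rel Q I a c} \<le> 1) \<and>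
     (\<exists>P \<subseteq> {\<pi> \<in> paths Q. length (snd \<pi>) = 2}. I = Idl\<^bsub>path_algebra Q\<^esub> (path_elt ` P))"

abbreviation gentle_alg ::
  "('v, 'a) pre_digraph \<Rightarrow> (('v, 'a) path \<Rightarrow> 'k::field) set \<Rightarrow> (('v, 'a) path \<Rightarrow> 'k) set ring" where
  "gentle_alg Q I \<equiv> path_algebra Q Quot I"

text \<open>The structure map \<open>k \<rightarrow> kQ/I\<close>.\<close>

definition scal ::
  "('v, 'a) pre_digraph \<Rightarrow> (('v, 'a) path \<Rightarrow> 'k::field) set \<Rightarrow> 'k \<Rightarrow> (('v, 'a) path \<Rightarrow> 'k) set" where
  "scal Q I c = I +>\<^bsub>path_algebra Q\<^esub> (\<lambda>\<pi>. c * \<one>\<^bsub>path_algebra Q\<^esub> \<pi>)"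

text \<open>\<^locale>\<open>module\<close> requires a commutative ring, so left modules are introduced separately.\<close>

locale left_module = R?: ring R + M?: abelian_group M
  for R :: "('r, 's) ring_scheme" and M :: "('r, 'm, 't) module_scheme" +
  assumes smult_closed:
      "r \<in> carrier R \<Longrightarrow> x \<in> carrier M \<Longrightarrow> r \<odot>\<^bsub>M\<^esub> x \<in> carrier M"
    and smult_l_distr:
      "r \<in> carrier R \<Longrightarrow> r' \<in> carrier R \<Longrightarrow> x \<in> carrier M \<Longrightarrow>
       (r \<oplus>\<^bsub>R\<^esub> r') \<odot>\<^bsub>M\<^esub> x = r \<odot>\<^bsub>M\<^esub> x \<oplus>\<^bsub>M\<^esub> r' \<odot>\<^bsub>M\<^esub> x"
    and smult_r_distr:
      "r \<in> carrier R \<Longrightarrow> x \<in> carrier M \<Longrightarrow> y \<in> carrier M \<Longrightarrow>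
       r \<odot>\<^bsub>M\<^esub> (x \<oplus>\<^bsub>M\<^esub> y) = r \<odot>\<^bsub>M\<^esub> x \<oplus>\<^bsub>M\<^esub> r \<odot>\<^bsub>M\<^esub> y"
    and smult_assoc:
      "r \<in> carrier R \<Longrightarrow> r' \<in> carrier R \<Longrightarrow> x \<in> carrier M \<Longrightarrow>
       (r \<otimes>\<^bsub>R\<^esub> r') \<odot>\<^bsub>M\<^esub> x = r \<odot>\<^bsub>M\<^esub> (r' \<odot>\<^bsub>M\<^esub> x)"
    and smult_one:
      "x \<in> carrier M \<Longrightarrow> \<one>\<^bsub>R\<^esub> \<odot>\<^bsub>M\<^esub> x = x"

definition mod_hom ::
  "('r, 's) ring_scheme \<Rightarrow> ('r, 'm) module \<Rightarrow> ('r, 'n) module \<Rightarrow> ('m \<Rightarrow> 'n) set" where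
  "mod_hom R M N =
    {h. h \<in> carrier M \<rightarrow> carrier N \<and>
        (\<forall>x\<in>carrier M. \<forall>y\<in>carrier M. h (x \<oplus>\<^bsub>M\<^esub> y) = h x \<oplus>\<^bsub>N\<^esub> h y) \<and>
        (\<forall>r\<in>carrier R. \<forall>x\<in>carrier M. h (r \<odot>\<^bsub>M\<^esub> x) = r \<odot>\<^bsub>N\<^esub> h x)}"

text \<open>
  A triple \<open>(i, E, p)\<close> stands for the sequence
  \<open>0 \<rightarrow> N \<rightarrow> E \<rightarrow> M \<rightarrow> 0\<close> with maps \<open>i\<close> and \<open>p\<close>.
\<close>

type_synonym ('r, 'm, 'n, 'e) ext = "('n \<Rightarrow> 'e) \<times> ('r, 'e) module \<times> ('e \<Rightarrow> 'm)"

definition extensions ::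
  "('r, 's) ring_scheme \<Rightarrow> ('r, 'm) module \<Rightarrow> ('r, 'n) module \<Rightarrow> ('r, 'm, 'n, 'e) ext set" where
  "extensions R M N =
    {(i, E, p). left_module R N \<and> left_module R E \<and> left_module R M \<and>
       i \<in> mod_hom R N E \<and> p \<in> mod_hom R E M \<and>
       inj_on i (carrier N) \<and> p ` carrier E = carrier M \<and>
       i ` carrier N = {e \<in> carrier E. p e = \<zero>\<^bsub>M\<^esub>}}"

definition split_ext ::
  "('r, 's) ring_scheme \<Rightarrow> ('r, 'm) module \<Rightarrow> ('r, 'm, 'n, 'e) ext \<Rightarrow> bool" where
  "split_ext R M = (\<lambda>(i, E, p). \<exists>s\<in>mod_hom R M E. \<forall>x\<in>carrier M. p (s x) = x)"

definition ext_equiv ::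
  "('r, 's) ring_scheme \<Rightarrow> ('r, 'm) module \<Rightarrow> ('r, 'n) module \<Rightarrow> ('r, 'm, 'n, 'e) ext rel" where
  "ext_equiv R M N =
    {((i, E, p), (i', E', p')).
       (i, E, p) \<in> extensions R M N \<and> (i', E', p') \<in> extensions R M N \<and>
       (\<exists>\<phi>\<in>mod_hom R E E'.
          (\<forall>n\<in>carrier N. \<phi> (i n) = i' n) \<and> (\<forall>e\<in>carrier E. p' (\<phi> e) = p e))}"

definition pullback ::
  "('r, 'e) module \<Rightarrow> ('e \<Rightarrow> 'm) \<Rightarrow> ('r, 'f) module \<Rightarrow> ('f \<Rightarrow> 'm) \<Rightarrow> ('r, 'e \<times> 'f) module" where
  "pullback E p F q =
    \<lparr>carrier = {(e, f). e \<in> carrier E \<and> f \<in> carrier F \<and> p e = q f},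
     mult = undefined, one = undefined,
     zero = (\<zero>\<^bsub>E\<^esub>, \<zero>\<^bsub>F\<^esub>),
     add = (\<lambda>(e, f) (e', f'). (e \<oplus>\<^bsub>E\<^esub> e', f \<oplus>\<^bsub>F\<^esub> f')),
     smult = (\<lambda>r (e, f). (r \<odot>\<^bsub>E\<^esub> e, r \<odot>\<^bsub>F\<^esub> f))\<rparr>"

text \<open>
  The Baer sum of two extensions of \<open>M\<close> by \<open>N\<close> is obtained from their direct sum by pulling back
  along the diagonal of \<open>M\<close> (this yields the extension of \<open>M\<close> by \<open>N \<oplus> N\<close> with middle term
  \<^const>\<open>pullback\<close>) and pushing out along the codiagonal of \<open>N\<close>. As usual, the push-out of an
  extension along \<open>\<alpha> : N \<rightarrow> N'\<close> is the extension \<open>E'\<close>, unique up to equivalence, which admits a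
  morphism of extensions \<open>(\<alpha>, \<phi>, id)\<close> to it. Scalar multiplication by \<open>c\<close> is the push-out along
  \<open>c : N \<rightarrow> N\<close>; the map \<open>\<sigma>\<close> is the structure map from the ground field to \<open>R\<close>.
\<close>

definition is_baer_sum ::
  "('r, 's) ring_scheme \<Rightarrow> ('r, 'n) module \<Rightarrow>
   ('r, 'm, 'n, 'e) ext \<Rightarrow> ('r, 'm, 'n, 'e) ext \<Rightarrow> ('r, 'm, 'n, 'e) ext \<Rightarrow> bool" where
  "is_baer_sum R N = (\<lambda>(i1, E1, p1) (i2, E2, p2) (i, E, p).
     \<exists>\<phi>\<in>mod_hom R (pullback E1 p1 E2 p2) E.
       (\<forall>n1\<in>carrier N. \<forall>n2\<in>carrier N. \<phi> (i1 n1, i2 n2) = i (n1 \<oplus>\<^bsub>N\<^esub> n2)) \<and>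
       (\<forall>(e1, e2)\<in>carrier (pullback E1 p1 E2 p2). p (\<phi> (e1, e2)) = p1 e1))"

definition is_scalar_mult ::
  "('r, 's) ring_scheme \<Rightarrow> ('k \<Rightarrow> 'r) \<Rightarrow> ('r, 'n) module \<Rightarrow>
   'k \<Rightarrow> ('r, 'm, 'n, 'e) ext \<Rightarrow> ('r, 'm, 'n, 'e) ext \<Rightarrow> bool" where
  "is_scalar_mult R \<sigma> N c = (\<lambda>(i, E, p) (i', E', p').
     \<exists>\<phi>\<in>mod_hom R E E'.
       (\<forall>n\<in>carrier N. \<phi> (i n) = i' (\<sigma> c \<odot>\<^bsub>N\<^esub> n)) \<and>
       (\<forall>e\<in>carrier E. p' (\<phi> e) = p e))"

text \<open>
  \<open>Ext\<^sup>1(M, N)\<close> as a vector space over the ground field. The middle terms range over the modules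
  whose elements are taken from the type \<open>'e\<close>. Below, \<open>'e\<close> is \<^typ>\<open>nat \<Rightarrow> 'k\<close>, which contains
  spaces of every finite dimension, hence a copy of every extension of finite-dimensional modules.
  The components \<^const>\<open>mult\<close> and \<^const>\<open>one\<close> of the record type are irrelevant.
\<close>

definition Ext1 ::
  "('r, 's) ring_scheme \<Rightarrow> ('k \<Rightarrow> 'r) \<Rightarrow> ('r, 'm) module \<Rightarrow> ('r, 'n) module \<Rightarrow>
   ('k, ('r, 'm, 'n, 'e) ext set) module" where
  "Ext1 R \<sigma> M N =
    \<lparr>carrier = extensions R M N // ext_equiv R M N,
     mult = undefined, one = undefined,
     zero = {X \<in> extensions R M N. split_ext R M X},
     add = (\<lambda>\<X> \<Y>. {Z \<in> extensions R M N. \<exists>X\<in>\<X>. \<exists>Y\<in>\<Y>. is_baer_sum R N X Y Z}),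
     smult = (\<lambda>c \<X>. {Z \<in> extensions R M N. \<exists>X\<in>\<X>. is_scalar_mult R \<sigma> N c X Z})\<rparr>"

definition finite_basis :: "('k, 'x) module \<Rightarrow> 'i set \<Rightarrow> ('i \<Rightarrow> 'x) \<Rightarrow> bool" where
  "finite_basis V S f \<longleftrightarrow>
     finite S \<and> f \<in> S \<rightarrow> carrier V \<and>
     (\<forall>x\<in>carrier V. \<exists>!c. c \<in> extensional S \<and> x = (\<Oplus>\<^bsub>V\<^esub>j\<in>S. c j \<odot>\<^bsub>V\<^esub> f j))"

datatype 'a letter = Dir 'a | Inv 'a

primrec linv :: "'a letter \<Rightarrow> 'a letter" where
  "linv (Dir a) = Inv a"
| "linv (Inv a) = Dir a"

primrec letter_arc :: "'a letter \<Rightarrow> 'a" where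
  "letter_arc (Dir a) = a"
| "letter_arc (Inv a) = a"

primrec lsrc :: "('v, 'a) pre_digraph \<Rightarrow> 'a letter \<Rightarrow> 'v" where
  "lsrc Q (Dir a) = tail Q a"
| "lsrc Q (Inv a) = head Q a"

primrec ltgt :: "('v, 'a) pre_digraph \<Rightarrow> 'a letter \<Rightarrow> 'v" where
  "ltgt Q (Dir a) = head Q a"
| "ltgt Q (Inv a) = tail Q a"

text \<open>A word is a start vertex with a list of letters; \<open>(x, [])\<close> is the trivial string \<open>1\<^sub>x\<close>.\<close>

type_synonym ('v, 'a) word = "'v \<times> 'a letter list"

definition word_of :: "('v, 'a) pre_digraph \<Rightarrow> 'a letter list \<Rightarrow> ('v, 'a) word" where
  "word_of Q ls = (lsrc Q (hd ls), ls)"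

definition word_vert :: "('v, 'a) pre_digraph \<Rightarrow> ('v, 'a) word \<Rightarrow> nat \<Rightarrow> 'v" where
  "word_vert Q w i = (if i = 0 then fst w else ltgt Q (snd w ! (i - 1)))"

definition word_inv :: "('v, 'a) pre_digraph \<Rightarrow> ('v, 'a) word \<Rightarrow> ('v, 'a) word" where
  "word_inv Q w = (word_vert Q w (length (snd w)), map linv (rev (snd w)))"

text \<open>The last two conditions forbid subwalks \<open>u\<close> with \<open>u \<in> I\<close>, respectively \<open>u\<^sup>- \<in> I\<close> for the
  inverse walk; only a walk \<open>u\<close> of direct (of inverse) letters can satisfy this.\<close>

definition is_string ::
  "('v, 'a) pre_digraph \<Rightarrow> (('v, 'a) path \<Rightarrow> 'k::field) set \<Rightarrow> ('v, 'a) word \<Rightarrow> bool" where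
  "is_string Q I w \<longleftrightarrow>
     (let ls = snd w in
       fst w \<in> verts Q \<and> (ls \<noteq> [] \<longrightarrow> fst w = lsrc Q (hd ls)) \<and>
       letter_arc ` set ls \<subseteq> arcs Q \<and>
       (\<forall>i. Suc i < length ls \<longrightarrow>
          lsrc Q (ls ! Suc i) = ltgt Q (ls ! i) \<and> ls ! Suc i \<noteq> linv (ls ! i)) \<and>
       (\<forall>p. p \<noteq> [] \<and> sublist (map Dir p) ls \<longrightarrow> path_elt (tail Q (hd p), p) \<notin> I) \<and>
       (\<forall>p. p \<noteq> [] \<and> sublist (map Inv (rev p)) ls \<longrightarrow> path_elt (tail Q (hd p), p) \<notin> I))"

definition is_band ::
  "('v, 'a) pre_digraph \<Rightarrow> (('v, 'a) path \<Rightarrow> 'k::field) set \<Rightarrow> 'a letter list \<Rightarrow> bool" where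
  "is_band Q I b \<longleftrightarrow>
     b \<noteq> [] \<and> is_string Q I (word_of Q b) \<and>
     ltgt Q (last b) = lsrc Q (hd b) \<and> hd b \<noteq> linv (last b) \<and>
     is_string Q I (word_of Q [last b, hd b]) \<and>
     (\<forall>y r. sublist y b \<and> r > 1 \<longrightarrow> b \<noteq> concat (replicate r y))"

text \<open>
  \<open>quiver_module Q I d vt mat\<close> is the module with basis \<open>z\<^sub>0, \<dots>, z\<^sub>d\<^sub>-\<^sub>1\<close>, where \<open>z\<^sub>i\<close> lies at the
  vertex \<open>vt i\<close> and an arrow \<open>a\<close> sends \<open>z\<^sub>i\<close> to the sum over \<open>j\<close> of \<open>mat a i j\<close> times \<open>z\<^sub>j\<close>.
  Elements are coefficient functions supported on \<open>{..<d}\<close>. A coset in \<open>kQ/I\<close> acts through an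
  arbitrary representative, which is legitimate when the ideal \<open>I\<close> acts as zero.
\<close>

definition arrow_act :: "nat \<Rightarrow> ('a \<Rightarrow> nat \<Rightarrow> nat \<Rightarrow> 'k) \<Rightarrow> 'a \<Rightarrow> (nat \<Rightarrow> 'k::field) \<Rightarrow> nat \<Rightarrow> 'k" where
  "arrow_act d mat a f = (\<lambda>j. if j < d then \<Sum>i<d. mat a i j * f i else 0)"

definition path_act ::
  "nat \<Rightarrow> (nat \<Rightarrow> 'v) \<Rightarrow> ('a \<Rightarrow> nat \<Rightarrow> nat \<Rightarrow> 'k) \<Rightarrow> ('v, 'a) path \<Rightarrow> (nat \<Rightarrow> 'k::field) \<Rightarrow> nat \<Rightarrow> 'k" where
  "path_act d vt mat = (\<lambda>(x, p) f. fold (arrow_act d mat) p (\<lambda>i. if vt i = x then f i else 0))"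

definition quiver_module ::
  "('v, 'a) pre_digraph \<Rightarrow> (('v, 'a) path \<Rightarrow> 'k::field) set \<Rightarrow>
   nat \<Rightarrow> (nat \<Rightarrow> 'v) \<Rightarrow> ('a \<Rightarrow> nat \<Rightarrow> nat \<Rightarrow> 'k) \<Rightarrow> ((('v, 'a) path \<Rightarrow> 'k) set, nat \<Rightarrow> 'k) module" where
  "quiver_module Q I d vt mat =
    \<lparr>carrier = {f. \<forall>i\<ge>d. f i = 0},
     mult = undefined, one = undefined,
     zero = (\<lambda>_. 0),
     add = (\<lambda>f g i. f i + g i),
     smult = (\<lambda>X f. let F = (SOME F. F \<in> X) in
                (\<lambda>j. \<Sum>\<pi>\<in>{\<pi>. F \<pi> \<noteq> 0}. F \<pi> * path_act d vt mat \<pi> f j))\<rparr>"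

text \<open>
  The letter at index \<open>t\<close> joins the basis vectors \<open>t\<close> and \<open>nxt t\<close>; \<open>wt t\<close> is the scalar by
  which it acts.
\<close>

definition letter_mat ::
  "'a letter list \<Rightarrow> (nat \<Rightarrow> nat) \<Rightarrow> (nat \<Rightarrow> 'k::field) \<Rightarrow> 'a \<Rightarrow> nat \<Rightarrow> nat \<Rightarrow> 'k" where
  "letter_mat ls nxt wt a i j =
     (\<Sum>t<length ls. if ls ! t = Dir a \<and> i = t \<and> j = nxt t \<or> ls ! t = Inv a \<and> i = nxt t \<and> j = t
                     then wt t else 0)"

definition string_module ::
  "('v, 'a) pre_digraph \<Rightarrow> (('v, 'a) path \<Rightarrow> 'k::field) set \<Rightarrow> ('v, 'a) word \<Rightarrow>
   ((('v, 'a) path \<Rightarrow> 'k) set, nat \<Rightarrow> 'k) module" where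
  "string_module Q I w =
     quiver_module Q I (Suc (length (snd w))) (word_vert Q w) (letter_mat (snd w) Suc (\<lambda>_. 1))"

text \<open>
  The letter of \<open>b\<close> at index \<open>t\<^sub>0\<close>, which is required to be direct whenever this definition is
  used, is the one acting by \<open>\<mu>\<close>.
\<close>

definition band_module ::
  "('v, 'a) pre_digraph \<Rightarrow> (('v, 'a) path \<Rightarrow> 'k::field) set \<Rightarrow> 'a letter list \<Rightarrow> nat \<Rightarrow> 'k \<Rightarrow>
   ((('v, 'a) path \<Rightarrow> 'k) set, nat \<Rightarrow> 'k) module" where
  "band_module Q I b t\<^sub>0 \<mu> =
     quiver_module Q I (length b) (\<lambda>i. lsrc Q (b ! i))
       (letter_mat b (\<lambda>t. Suc t mod length b) (\<lambda>t. if t = t\<^sub>0 then \<mu> else 1))"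

text \<open>
  The letter at place \<open>j\<close> of the bi-infinite word obtained by repeating \<open>b\<close>; it joins the
  vertices at places \<open>j\<close> and \<open>j + 1\<close>.
\<close>

definition inf_word :: "'a letter list \<Rightarrow> int \<Rightarrow> 'a letter" where
  "inf_word b j = b ! nat (j mod int (length b))"

text \<open>
  An overlap records a decomposition of a string \<open>v\<close>, in traversal order \<open>v\<^sub>R, A, m, B\<^sup>-, v\<^sub>L\<close>,
  and an occurrence of \<open>C\<^sup>-, m, D\<close> (in traversal order) in the bi-infinite word of \<open>b\<close>, given by
  the place \<open>ov_pos\<close> where \<open>m\<close> starts. The words \<open>b\<^sub>L\<close>, \<open>b\<^sub>R\<close> completing this occurrence to a
  decomposition of the bi-infinite word carry no further data. Restricting \<open>ov_pos\<close> to
  \<open>{..<length b}\<close> selects one decomposition for each class modulo translation by the period.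
  Subwords of strings are strings, so this need not be required of the constituents.
\<close>

record 'a overlap =
  ov_vR :: "'a letter list"
  ov_A :: "'a option"
  ov_m :: "'a letter list"
  ov_B :: "'a option"
  ov_vL :: "'a letter list"
  ov_C :: 'a
  ov_D :: 'a
  ov_pos :: nat

definition dir_opt :: "'a option \<Rightarrow> 'a letter list" where
  "dir_opt A = (case A of None \<Rightarrow> [] | Some a \<Rightarrow> [Dir a])"

definition inv_opt :: "'a option \<Rightarrow> 'a letter list" where
  "inv_opt B = (case B of None \<Rightarrow> [] | Some a \<Rightarrow> [Inv a])"

text \<open>The index of the first basis vector of \<open>M(v)\<close> belonging to \<open>m\<close>.\<close>

definition ov_start :: "'a overlap \<Rightarrow> nat" where
  "ov_start ov = length (ov_vR ov @ dir_opt (ov_A ov))"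

definition overlap_conditions ::
  "('v, 'a) pre_digraph \<Rightarrow> (('v, 'a) path \<Rightarrow> 'k::field) set \<Rightarrow>
   'a option \<Rightarrow> 'a option \<Rightarrow> 'a option \<Rightarrow> 'a option \<Rightarrow> 'a letter list \<Rightarrow> bool" where
  "overlap_conditions Q I A B C D m \<longleftrightarrow>
     (A = None \<longrightarrow> C \<noteq> None) \<and>
     (B = None \<longrightarrow> D \<noteq> None) \<and>
     (m = [] \<longrightarrow>
        (\<forall>a c. A = Some a \<and> C = Some c \<longrightarrow> zero_rel Q I c a) \<and>
        (\<forall>b d. B = Some b \<and> D = Some d \<longrightarrow> zero_rel Q I d b))"

text \<open>
  The vertex condition matters only if \<open>m\<close> is trivial: it says that the two occurrences of \<open>m\<close>
  are the same trivial string.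
\<close>

definition overlaps ::
  "('v, 'a) pre_digraph \<Rightarrow> (('v, 'a) path \<Rightarrow> 'k::field) set \<Rightarrow> ('v, 'a) word \<Rightarrow> 'a letter list \<Rightarrow>
   'a overlap set" where
  "overlaps Q I v b =
    {ov.
       snd v = ov_vR ov @ dir_opt (ov_A ov) @ ov_m ov @ inv_opt (ov_B ov) @ ov_vL ov \<and>
       (ov_A ov = None \<longrightarrow> ov_vR ov = []) \<and>
       (ov_B ov = None \<longrightarrow> ov_vL ov = []) \<and>
       ov_pos ov < length b \<and>
       inf_word b (int (ov_pos ov) - 1) = Inv (ov_C ov) \<and>
       (\<forall>i<length (ov_m ov). inf_word b (int (ov_pos ov) + int i) = ov_m ov ! i) \<and>
       inf_word b (int (ov_pos ov) + int (length (ov_m ov))) = Dir (ov_D ov) \<and>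
       word_vert Q v (ov_start ov) = lsrc Q (b ! ov_pos ov) \<and>
       overlap_conditions Q I (ov_A ov) (ov_B ov) (Some (ov_C ov)) (Some (ov_D ov)) (ov_m ov)}"

text \<open>
  The subword \<open>y\<close> of length \<open>|m| + |b|\<close> of the bi-infinite word of \<open>b\<close>, beginning with the given
  occurrence of \<open>m\<close> and ending with its translate by one period.
\<close>

definition ov_y :: "'a letter list \<Rightarrow> 'a overlap \<Rightarrow> 'a letter list" where
  "ov_y b ov =
     map (\<lambda>i. inf_word b (int (ov_pos ov) + int i)) [0..<length (ov_m ov) + length b]"

definition ov_word :: "('v, 'a) pre_digraph \<Rightarrow> 'a letter list \<Rightarrow> 'a overlap \<Rightarrow> ('v, 'a) word" where
  "ov_word Q b ov =
     word_of Q (ov_vR ov @ dir_opt (ov_A ov) @ ov_y b ov @ inv_opt (ov_B ov) @ ov_vL ov)"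

text \<open>
  The map \<open>B(b, \<mu>) \<rightarrow> M(y) \<hookrightarrow> M(u)\<close>. It sends \<open>z\<^sub>i\<close> to the sum of the basis vectors of \<open>M(y)\<close> at the
  places \<open>j\<close> of the bi-infinite word with \<open>j \<equiv> i\<close> modulo \<open>|b|\<close>, where place \<open>j\<close> has weight
  \<open>band_weight b t\<^sub>0 \<mu> j\<close>. This weight is multiplied by \<open>\<mu>\<^sup>-\<^sup>1\<close> with each copy of the letter at index
  \<open>t\<^sub>0\<close> that is crossed; up to an overall scalar this is the only choice giving a homomorphism.
\<close>

definition band_weight :: "'a letter list \<Rightarrow> nat \<Rightarrow> 'k::field \<Rightarrow> nat \<Rightarrow> 'k" where
  "band_weight b t\<^sub>0 \<mu> j = inverse \<mu> ^ ((j + (length b - 1 - t\<^sub>0)) div length b)"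

definition ov_inj ::
  "'a letter list \<Rightarrow> nat \<Rightarrow> 'k::field \<Rightarrow> 'a overlap \<Rightarrow> (nat \<Rightarrow> 'k) \<Rightarrow> nat \<Rightarrow> 'k" where
  "ov_inj b t\<^sub>0 \<mu> ov f = (\<lambda>k.
     if ov_start ov \<le> k \<and> k \<le> ov_start ov + length (ov_m ov) + length b
     then (let j = ov_pos ov + (k - ov_start ov) in band_weight b t\<^sub>0 \<mu> j * f (j mod length b))
     else 0)"

text \<open>
  The canonical map \<open>M(u) \<rightarrow> M(v)\<close>: the part of \<open>u\<close> consisting of \<open>v\<^sub>R\<close>, \<open>A\<close> and the first copy of
  \<open>m\<close> in \<open>y\<close> maps identically to the corresponding part of \<open>v\<close>, and the part consisting of the last
  copy of \<open>m\<close> in \<open>y\<close>, \<open>B\<^sup>-\<close> and \<open>v\<^sub>L\<close> maps to the corresponding part of \<open>v\<close> by \<open>-\<mu>\<close>; the factor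
  makes the composition with \<open>ov_inj\<close> vanish. The two copies of \<open>m\<close> may intersect, and there both
  contributions are added.
\<close>

definition ov_proj ::
  "('v, 'a) word \<Rightarrow> 'a letter list \<Rightarrow> 'k::field \<Rightarrow> 'a overlap \<Rightarrow> (nat \<Rightarrow> 'k) \<Rightarrow> nat \<Rightarrow> 'k" where
  "ov_proj v b \<mu> ov f = (\<lambda>s.
     if s \<le> length (snd v)
     then (if s \<le> ov_start ov + length (ov_m ov) then f s else 0) +
          (if ov_start ov \<le> s then - \<mu> * f (s + length b) else 0)
     else 0)"

definition overlap_extension ::
  "('v, 'a) pre_digraph \<Rightarrow> (('v, 'a) path \<Rightarrow> 'k::field) set \<Rightarrow> ('v, 'a) word \<Rightarrow> 'a letter list \<Rightarrow>
   nat \<Rightarrow> 'k \<Rightarrow> 'a overlap \<Rightarrow> ((('v, 'a) path \<Rightarrow> 'k) set, nat \<Rightarrow> 'k, nat \<Rightarrow> 'k, nat \<Rightarrow> 'k) ext" where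
  "overlap_extension Q I v b t\<^sub>0 \<mu> ov =
     (ov_inj b t\<^sub>0 \<mu> ov, string_module Q I (ov_word Q b ov), ov_proj v b \<mu> ov)"

text \<open>
  All overlap data for \<open>v\<close> and \<open>b\<close>, where both may be replaced by their inverses and data that differ
  by simultaneous inversion are identified: every class has exactly one member involving \<open>b\<close>
  itself, so only \<open>v\<close> ranges over its two representatives (which coincide if \<open>v\<close> is trivial).
\<close>

definition overlap_data ::
  "('v, 'a) pre_digraph \<Rightarrow> (('v, 'a) path \<Rightarrow> 'k::field) set \<Rightarrow> ('v, 'a) word \<Rightarrow> 'a letter list \<Rightarrow>
   (('v, 'a) word \<times> 'a overlap) set" where
  "overlap_data Q I v b = (SIGMA w:{v, word_inv Q v}. overlaps Q I w b)"

text \<open>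
  For data involving the inverse of \<open>v\<close>, the extension is regarded as an extension of \<open>M(v)\<close> via the
  isomorphism \<open>M(v\<^sup>-) \<rightarrow> M(v)\<close> which reverses the order of the basis.
\<close>

definition reverse_iso :: "('v, 'a) word \<Rightarrow> (nat \<Rightarrow> 'k::field) \<Rightarrow> nat \<Rightarrow> 'k" where
  "reverse_iso v f = (\<lambda>i. if i \<le> length (snd v) then f (length (snd v) - i) else 0)"

definition datum_ext ::
  "('v, 'a) pre_digraph \<Rightarrow> (('v, 'a) path \<Rightarrow> 'k::field) set \<Rightarrow> ('v, 'a) word \<Rightarrow> 'a letter list \<Rightarrow>
   nat \<Rightarrow> 'k \<Rightarrow> ('v, 'a) word \<times> 'a overlap \<Rightarrow>
   ((('v, 'a) path \<Rightarrow> 'k) set, nat \<Rightarrow> 'k, nat \<Rightarrow> 'k, nat \<Rightarrow> 'k) ext" where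
  "datum_ext Q I v b t\<^sub>0 \<mu> = (\<lambda>(w, ov).
     case overlap_extension Q I w b t\<^sub>0 \<mu> ov of (i, E, p) \<Rightarrow>
       (i, E, if w = v then p else reverse_iso v \<circ> p))"

end

theory Submission
  imports Defs
begin

text \<open>
  An extension of \<open>M\<close> by \<open>N\<close> is determined, up to equivalence, by the defect of an additive retraction onto
  \<open>N\<close> at the generators of the algebra. The retraction can be chosen compatible with scalars and vertices.
  As all relations are zero relations of length two, \<open>Ext\<^sup>1\<close> is the space of families \<open>\<delta>\<^sub>a : M \<rightarrow> N\<close> of linear
  maps, one for each arrow, with \<open>c \<delta>\<^sub>a + \<delta>\<^sub>c a = 0\<close> for \<open>ca \<in> I\<close>, modulo the families \<open>a h - h a\<close>. Baer sums
  and multiples are computed on these cocycles (\<open>baer_sum_classes\<close>, \<open>scalar_mult_class\<close>,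
  \<open>extension_has_cocycle\<close>, \<open>cohomologous_coboundary\<close>).

  For \<open>N = B(b, \<mu>)\<close> it is convenient to pass to the bi-infinite word: vectors become functions \<open>g\<close> on the
  integers with \<open>g (j + n) = g j / \<mu>\<close>, on which all letters act with weight one, and cocycles become matrices
  indexed by an arrow, a place \<open>s\<close> of the string and a place \<open>j\<close> of the band. At a vertex of a gentle quiver the
  half-edges have two sides, and a string passes from one side to the other. So at a pair of places with a
  common vertex the string, or its inverse, has the same direction as the band (\<open>aligned_either\<close>).

  A cocycle is determined by its entries at the arrows which lead from such a place \<open>j\<close> to a neighbouring
  place of the band (\<open>cocycle_zeroI\<close>). Along a maximal common subword \<open>m\<close>, the equations which make these entries
  equal to those of a coboundary are a recursion in one variable. It can always be solved from one end, except
  that one equation remains if the band leaves \<open>m\<close> by an arrow at both ends (\<open>cocycle_reduce\<close>). The maximal common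
  subwords with this property are the overlaps (\<open>overlap_right_end\<close>, \<open>right_end_overlap\<close>), so that each of them
  contributes at most one dimension. The remaining numbers cannot be changed by coboundaries, since the
  equation at the left end forces the matrix \<open>h\<close> to vanish along \<open>m\<close> (\<open>coboundary_zero_at_ends\<close>).

  In the overlap extension, one period of the word of the middle term lying behind the first copy of \<open>m\<close> gives a
  retraction onto the band module. Its defect has exactly one nonzero entry, up to translation, among those
  considered above: the one at the right end of the overlap (\<open>overlap_has_cocycle\<close>, \<open>ov_cochain_entries\<close>). Hence
  the classes of the overlap extensions form a basis, and none of them is split. The shape of the middle term in
  the two cases of the theorem follows by comparing subwords of the bi-infinite word.
\<close>

section \<open>Extensions of modules and their cocycles\<close>

lemma left_moduleD:
  assumes "left_module R M"
  shows "ring R" "abelian_group M"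
    "r \<in> carrier R \<Longrightarrow> x \<in> carrier M \<Longrightarrow> r \<odot>\<^bsub>M\<^esub> x \<in> carrier M"
  using assms by (auto simp: left_module_def left_module_axioms_def)

lemma mod_homD:
  assumes "h \<in> mod_hom R M N"
  shows "x \<in> carrier M \<Longrightarrow> h x \<in> carrier N"
    "x \<in> carrier M \<Longrightarrow> y \<in> carrier M \<Longrightarrow> h (x \<oplus>\<^bsub>M\<^esub> y) = h x \<oplus>\<^bsub>N\<^esub> h y"
    "r \<in> carrier R \<Longrightarrow> x \<in> carrier M \<Longrightarrow> h (r \<odot>\<^bsub>M\<^esub> x) = r \<odot>\<^bsub>N\<^esub> h x"
  using assms by (auto simp: mod_hom_def)

lemma additive_mapD:
  assumes "abelian_group A" "abelian_group B" "h \<in> carrier A \<rightarrow> carrier B"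
    and "\<And>x y. x \<in> carrier A \<Longrightarrow> y \<in> carrier A \<Longrightarrow> h (x \<oplus>\<^bsub>A\<^esub> y) = h x \<oplus>\<^bsub>B\<^esub> h y"
  shows "h \<zero>\<^bsub>A\<^esub> = \<zero>\<^bsub>B\<^esub>" "x \<in> carrier A \<Longrightarrow> h (\<ominus>\<^bsub>A\<^esub> x) = \<ominus>\<^bsub>B\<^esub> h x"
    "x \<in> carrier A \<Longrightarrow> y \<in> carrier A \<Longrightarrow> h (x \<ominus>\<^bsub>A\<^esub> y) = h x \<ominus>\<^bsub>B\<^esub> h y"
proof -
  interpret abelian_group_hom A B h
    using assms by (intro abelian_group_homI group_hom.intro group_hom_axioms.intro)
      (auto simp: hom_def abelian_group.a_group)
  show "h \<zero>\<^bsub>A\<^esub> = \<zero>\<^bsub>B\<^esub>" by simp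
  show *: "h (\<ominus>\<^bsub>A\<^esub> x) = \<ominus>\<^bsub>B\<^esub> h x" if "x \<in> carrier A" for x
    using that by simp
  show "h (x \<ominus>\<^bsub>A\<^esub> y) = h x \<ominus>\<^bsub>B\<^esub> h y" if "x \<in> carrier A" "y \<in> carrier A"
    using that * by (simp add: a_minus_def)
qed

lemma mod_hom_additive:
  assumes "left_module R M" "left_module R N" "h \<in> mod_hom R M N"
  shows "h \<zero>\<^bsub>M\<^esub> = \<zero>\<^bsub>N\<^esub>"
    "x \<in> carrier M \<Longrightarrow> y \<in> carrier M \<Longrightarrow> h (x \<ominus>\<^bsub>M\<^esub> y) = h x \<ominus>\<^bsub>N\<^esub> h y"
  using additive_mapD[of M N h] left_moduleD(2)[OF assms(1)] left_moduleD(2)[OF assms(2)]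
    mod_homD[OF assms(3)] by (simp_all add: Pi_iff)

text \<open>
  A family \<open>gen\<close> generates the ring \<open>R\<close>. For additive maps between modules, and for the twisted maps
  which compare extensions, it then suffices to know the behaviour under the generators.
\<close>

locale generated_ext =
  fixes R :: "('r, 's) ring_scheme" and M :: "('r, 'm) module" and N :: "('r, 'n) module"
    and \<Gamma> :: "'g set" and gen :: "'g \<Rightarrow> 'r"
  assumes M: "left_module R M" and N: "left_module R N"
    and gen_closed: "\<gamma> \<in> \<Gamma> \<Longrightarrow> gen \<gamma> \<in> carrier R"
    and gen_induct: "\<And>P r. r \<in> carrier R \<Longrightarrow> (\<And>\<gamma>. \<gamma> \<in> \<Gamma> \<Longrightarrow> P (gen \<gamma>)) \<Longrightarrow>
      (\<And>r s. r \<in> carrier R \<Longrightarrow> s \<in> carrier R \<Longrightarrow> P r \<Longrightarrow> P s \<Longrightarrow> P (r \<oplus>\<^bsub>R\<^esub> s)) \<Longrightarrow>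
      (\<And>r s. r \<in> carrier R \<Longrightarrow> s \<in> carrier R \<Longrightarrow> P r \<Longrightarrow> P s \<Longrightarrow> P (r \<otimes>\<^bsub>R\<^esub> s)) \<Longrightarrow> P r"
begin

sublocale M: left_module R M by (rule M)
sublocale N: left_module R N by (rule N)

lemma mod_hom_by_generators:
  assumes F: "left_module R F" and E: "left_module R E" and h: "h \<in> carrier F \<rightarrow> carrier E"
    and add: "\<And>x y. x \<in> carrier F \<Longrightarrow> y \<in> carrier F \<Longrightarrow> h (x \<oplus>\<^bsub>F\<^esub> y) = h x \<oplus>\<^bsub>E\<^esub> h y"
    and gen: "\<And>\<gamma> x. \<gamma> \<in> \<Gamma> \<Longrightarrow> x \<in> carrier F \<Longrightarrow> h (gen \<gamma> \<odot>\<^bsub>F\<^esub> x) = gen \<gamma> \<odot>\<^bsub>E\<^esub> h x"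
  shows "h \<in> mod_hom R F E"
proof -
  interpret F: left_module R F by (rule F)
  interpret E: left_module R E by (rule E)
  have "\<forall>x\<in>carrier F. h (r \<odot>\<^bsub>F\<^esub> x) = r \<odot>\<^bsub>E\<^esub> h x" if "r \<in> carrier R" for r
  proof (rule gen_induct[OF that])
    show "\<forall>x\<in>carrier F. h ((r \<oplus>\<^bsub>R\<^esub> s) \<odot>\<^bsub>F\<^esub> x) = (r \<oplus>\<^bsub>R\<^esub> s) \<odot>\<^bsub>E\<^esub> h x"
      if "r \<in> carrier R" "s \<in> carrier R" "\<forall>x\<in>carrier F. h (r \<odot>\<^bsub>F\<^esub> x) = r \<odot>\<^bsub>E\<^esub> h x"
        "\<forall>x\<in>carrier F. h (s \<odot>\<^bsub>F\<^esub> x) = s \<odot>\<^bsub>E\<^esub> h x" for r s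
      using h that by (auto simp: F.smult_l_distr E.smult_l_distr add F.smult_closed Pi_iff)
    show "\<forall>x\<in>carrier F. h ((r \<otimes>\<^bsub>R\<^esub> s) \<odot>\<^bsub>F\<^esub> x) = (r \<otimes>\<^bsub>R\<^esub> s) \<odot>\<^bsub>E\<^esub> h x"
      if "r \<in> carrier R" "s \<in> carrier R" "\<forall>x\<in>carrier F. h (r \<odot>\<^bsub>F\<^esub> x) = r \<odot>\<^bsub>E\<^esub> h x"
        "\<forall>x\<in>carrier F. h (s \<odot>\<^bsub>F\<^esub> x) = s \<odot>\<^bsub>E\<^esub> h x" for r s
      using h that by (auto simp: F.smult_assoc E.smult_assoc F.smult_closed Pi_iff)
  qed (simp add: gen)
  then show ?thesis
    using h add by (auto simp: mod_hom_def)
qed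

text \<open>
  An additive retraction \<open>\<rho>\<close> onto \<open>N\<close> is in general not linear; \<open>\<delta>\<close> records its defect at the generators.
  Working with the values at the generators only avoids any choice of a presentation of the ring.
\<close>

definition has_cocycle :: "('r, 'm, 'n, 'e) ext \<Rightarrow> ('g \<Rightarrow> 'm \<Rightarrow> 'n) \<Rightarrow> bool" where
  "has_cocycle = (\<lambda>(i, E, p) \<delta>. (i, E, p) \<in> extensions R M N \<and>
     (\<exists>\<rho>\<in>carrier E \<rightarrow> carrier N.
        (\<forall>x\<in>carrier E. \<forall>y\<in>carrier E. \<rho> (x \<oplus>\<^bsub>E\<^esub> y) = \<rho> x \<oplus>\<^bsub>N\<^esub> \<rho> y) \<and>
        (\<forall>n\<in>carrier N. \<rho> (i n) = n) \<and>
        (\<forall>\<gamma>\<in>\<Gamma>. \<forall>e\<in>carrier E. \<rho> (gen \<gamma> \<odot>\<^bsub>E\<^esub> e) = gen \<gamma> \<odot>\<^bsub>N\<^esub> \<rho> e \<oplus>\<^bsub>N\<^esub> \<delta> \<gamma> (p e))))"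

lemma extensionsD:
  assumes "(i, E, p) \<in> extensions R M N"
  shows "left_module R E" "i \<in> mod_hom R N E" "p \<in> mod_hom R E M" "inj_on i (carrier N)"
    "p ` carrier E = carrier M" "i ` carrier N = {e \<in> carrier E. p e = \<zero>\<^bsub>M\<^esub>}"
    "n \<in> carrier N \<Longrightarrow> p (i n) = \<zero>\<^bsub>M\<^esub>" "n \<in> carrier N \<Longrightarrow> i n \<in> carrier E"
    "e \<in> carrier E \<Longrightarrow> p e \<in> carrier M"
  using assms by (auto simp: extensions_def mod_hom_def)

text \<open>
  A retraction \<open>\<rho>\<close> of the inclusion identifies the additive group of \<open>E\<close> with \<open>M \<times> N\<close> by
  \<open>e \<mapsto> (p e, \<rho> e)\<close>.
\<close>

lemma coordinates_bij:
  assumes X: "(i, E, p) \<in> extensions R M N"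
    and \<rho>: "\<rho> \<in> carrier E \<rightarrow> carrier N"
    and add: "\<And>x y. x \<in> carrier E \<Longrightarrow> y \<in> carrier E \<Longrightarrow> \<rho> (x \<oplus>\<^bsub>E\<^esub> y) = \<rho> x \<oplus>\<^bsub>N\<^esub> \<rho> y"
    and ret: "\<And>n. n \<in> carrier N \<Longrightarrow> \<rho> (i n) = n"
    and m: "m \<in> carrier M" and n: "n \<in> carrier N"
  shows "\<exists>!e. e \<in> carrier E \<and> p e = m \<and> \<rho> e = n"
proof -
  note D = extensionsD[OF X]
  interpret E: left_module R E by (rule D(1))
  obtain e0 where e0: "e0 \<in> carrier E" "p e0 = m"
    using D(5) m by (metis imageE)
  have r0: "\<rho> e0 \<in> carrier N" using \<rho> e0 by auto
  have d: "n \<ominus>\<^bsub>N\<^esub> \<rho> e0 \<in> carrier N" using n r0 by simp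
  have "p (e0 \<oplus>\<^bsub>E\<^esub> i (n \<ominus>\<^bsub>N\<^esub> \<rho> e0)) = m"
    using mod_homD(2)[OF D(3)] D(7,8)[OF d] e0 m by simp
  moreover have "\<rho> (e0 \<oplus>\<^bsub>E\<^esub> i (n \<ominus>\<^bsub>N\<^esub> \<rho> e0)) = n"
    using add D(8)[OF d] e0 ret[OF d] n r0 by (simp add: N.M.minus_eq N.M.a_lcomm N.M.r_neg)
  moreover have "e0 \<oplus>\<^bsub>E\<^esub> i (n \<ominus>\<^bsub>N\<^esub> \<rho> e0) \<in> carrier E" using e0 D(8)[OF d] by simp
  moreover have inj: "e = e'" if e: "e \<in> carrier E" "e' \<in> carrier E" "p e = p e'" "\<rho> e = \<rho> e'" for e e'
  proof -
    have "p (e \<ominus>\<^bsub>E\<^esub> e') = \<zero>\<^bsub>M\<^esub>"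
      using mod_hom_additive(2)[OF D(1) M D(3)] e D(9)[OF e(2)] by (simp add: M.M.minus_eq M.M.r_neg)
    moreover have "e \<ominus>\<^bsub>E\<^esub> e' \<in> carrier E" using e by simp
    ultimately obtain k where k: "k \<in> carrier N" "e \<ominus>\<^bsub>E\<^esub> e' = i k" using D(6) by blast
    have re: "\<rho> e' \<in> carrier N" using \<rho> e by auto
    have "\<rho> (e \<ominus>\<^bsub>E\<^esub> e') = \<rho> e \<ominus>\<^bsub>N\<^esub> \<rho> e'"
      by (rule additive_mapD(3)[OF E.M.abelian_group_axioms N.M.abelian_group_axioms \<rho> add e(1,2)])
    then have "k = \<zero>\<^bsub>N\<^esub>" using k e ret re by (simp add: N.M.minus_eq N.M.r_neg)
    then have "e \<ominus>\<^bsub>E\<^esub> e' = \<zero>\<^bsub>E\<^esub>" using k mod_hom_additive(1)[OF N D(1) D(2)] by simp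
    then show ?thesis using e by (metis E.M.add.inv_closed E.M.add.inv_equality E.M.add.inv_inv E.M.minus_eq)
  qed
  ultimately show ?thesis
    by (intro ex1I[of _ "e0 \<oplus>\<^bsub>E\<^esub> i (n \<ominus>\<^bsub>N\<^esub> \<rho> e0)"] conjI) (assumption | rule inj | simp)+
qed

text \<open>
  The universal property behind all comparisons of extensions: a pair of a homomorphism to \<open>M\<close> and
  an additive map to \<open>N\<close> with the right twist lifts to a homomorphism to the middle term.
\<close>

lemma lift_to_extension:
  assumes X: "(i, E, p) \<in> extensions R M N"
    and \<rho>: "\<rho> \<in> carrier E \<rightarrow> carrier N"
    and add: "\<And>x y. x \<in> carrier E \<Longrightarrow> y \<in> carrier E \<Longrightarrow> \<rho> (x \<oplus>\<^bsub>E\<^esub> y) = \<rho> x \<oplus>\<^bsub>N\<^esub> \<rho> y"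
    and ret: "\<And>n. n \<in> carrier N \<Longrightarrow> \<rho> (i n) = n"
    and coc: "\<And>\<gamma> e. \<gamma> \<in> \<Gamma> \<Longrightarrow> e \<in> carrier E \<Longrightarrow>
      \<rho> (gen \<gamma> \<odot>\<^bsub>E\<^esub> e) = gen \<gamma> \<odot>\<^bsub>N\<^esub> \<rho> e \<oplus>\<^bsub>N\<^esub> \<delta> \<gamma> (p e)"
    and F: "left_module R F" and q: "q \<in> mod_hom R F M" and \<tau>: "\<tau> \<in> carrier F \<rightarrow> carrier N"
    and \<tau>_add: "\<And>x y. x \<in> carrier F \<Longrightarrow> y \<in> carrier F \<Longrightarrow> \<tau> (x \<oplus>\<^bsub>F\<^esub> y) = \<tau> x \<oplus>\<^bsub>N\<^esub> \<tau> y"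
    and \<tau>_coc: "\<And>\<gamma> x. \<gamma> \<in> \<Gamma> \<Longrightarrow> x \<in> carrier F \<Longrightarrow>
      \<tau> (gen \<gamma> \<odot>\<^bsub>F\<^esub> x) = gen \<gamma> \<odot>\<^bsub>N\<^esub> \<tau> x \<oplus>\<^bsub>N\<^esub> \<delta> \<gamma> (q x)"
  shows "\<exists>\<phi>\<in>mod_hom R F E. \<forall>x\<in>carrier F. p (\<phi> x) = q x \<and> \<rho> (\<phi> x) = \<tau> x"
proof -
  note D = extensionsD[OF X]
  interpret E: left_module R E by (rule D(1))
  interpret F: left_module R F by (rule F)
  note bij = coordinates_bij[of i E p \<rho>, OF X \<rho> add ret]
  define \<phi> where "\<phi> x = (THE e. e \<in> carrier E \<and> p e = q x \<and> \<rho> e = \<tau> x)" for x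
  have \<phi>: "\<phi> x \<in> carrier E \<and> p (\<phi> x) = q x \<and> \<rho> (\<phi> x) = \<tau> x" if "x \<in> carrier F" for x
    unfolding \<phi>_def
    by (rule theI', rule bij) (use that \<tau> mod_homD(1)[OF q] in auto)
  have eqI: "e = \<phi> x" if "x \<in> carrier F" "e \<in> carrier E" "p e = q x" "\<rho> e = \<tau> x" for e x
    using bij[of "q x" "\<tau> x"] that \<phi>[of x] \<tau> mod_homD(1)[OF q] by blast
  have "\<phi> \<in> mod_hom R F E"
  proof (rule mod_hom_by_generators[OF F D(1)])
    show "\<phi> \<in> carrier F \<rightarrow> carrier E" using \<phi> by blast
    show "\<phi> (x \<oplus>\<^bsub>F\<^esub> y) = \<phi> x \<oplus>\<^bsub>E\<^esub> \<phi> y" if "x \<in> carrier F" "y \<in> carrier F" for x y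
      by (rule eqI[symmetric])
        (use \<phi> that add \<tau>_add mod_homD(2)[OF q] mod_homD(2)[OF D(3)] in auto)
    show "\<phi> (gen \<gamma> \<odot>\<^bsub>F\<^esub> x) = gen \<gamma> \<odot>\<^bsub>E\<^esub> \<phi> x" if "\<gamma> \<in> \<Gamma>" "x \<in> carrier F" for \<gamma> x
      by (rule eqI[symmetric])
        (use \<phi> that gen_closed coc \<tau>_coc mod_homD(3)[OF q] mod_homD(3)[OF D(3)]
          F.smult_closed E.smult_closed in auto)
  qed
  then show ?thesis using \<phi> by blast
qed

lemma has_cocycleD:
  assumes "has_cocycle (i, E, p) \<delta>"
  shows "(i, E, p) \<in> extensions R M N"
    and "\<exists>\<rho>. \<rho> \<in> carrier E \<rightarrow> carrier N \<and>
        (\<forall>x\<in>carrier E. \<forall>y\<in>carrier E. \<rho> (x \<oplus>\<^bsub>E\<^esub> y) = \<rho> x \<oplus>\<^bsub>N\<^esub> \<rho> y) \<and>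
        (\<forall>n\<in>carrier N. \<rho> (i n) = n) \<and>
        (\<forall>\<gamma>\<in>\<Gamma>. \<forall>e\<in>carrier E. \<rho> (gen \<gamma> \<odot>\<^bsub>E\<^esub> e) = gen \<gamma> \<odot>\<^bsub>N\<^esub> \<rho> e \<oplus>\<^bsub>N\<^esub> \<delta> \<gamma> (p e))"
  using assms by (auto simp: has_cocycle_def)


text \<open>
  The same cocycle can be read off from a section \<open>\<sigma>\<close> of the projection, as its failure to commute
  with the generators.
\<close>

lemma has_cocycle_sectionD:
  assumes "has_cocycle (i, E, p) \<delta>"
  obtains \<sigma> where "\<sigma> \<in> carrier M \<rightarrow> carrier E"
    "\<And>x y. x \<in> carrier M \<Longrightarrow> y \<in> carrier M \<Longrightarrow> \<sigma> (x \<oplus>\<^bsub>M\<^esub> y) = \<sigma> x \<oplus>\<^bsub>E\<^esub> \<sigma> y"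
    "\<And>m. m \<in> carrier M \<Longrightarrow> p (\<sigma> m) = m"
    "\<And>\<gamma> m. \<gamma> \<in> \<Gamma> \<Longrightarrow> m \<in> carrier M \<Longrightarrow> \<delta> \<gamma> m \<in> carrier N \<Longrightarrow>
      gen \<gamma> \<odot>\<^bsub>E\<^esub> \<sigma> m = \<sigma> (gen \<gamma> \<odot>\<^bsub>M\<^esub> m) \<oplus>\<^bsub>E\<^esub> i (\<delta> \<gamma> m)"
proof -
  note X = has_cocycleD(1)[OF assms]
  obtain \<rho> where \<rho>: "\<rho> \<in> carrier E \<rightarrow> carrier N"
    and add: "\<And>x y. x \<in> carrier E \<Longrightarrow> y \<in> carrier E \<Longrightarrow> \<rho> (x \<oplus>\<^bsub>E\<^esub> y) = \<rho> x \<oplus>\<^bsub>N\<^esub> \<rho> y"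
    and ret: "\<And>n. n \<in> carrier N \<Longrightarrow> \<rho> (i n) = n"
    and coc: "\<And>\<gamma> e. \<gamma> \<in> \<Gamma> \<Longrightarrow> e \<in> carrier E \<Longrightarrow>
      \<rho> (gen \<gamma> \<odot>\<^bsub>E\<^esub> e) = gen \<gamma> \<odot>\<^bsub>N\<^esub> \<rho> e \<oplus>\<^bsub>N\<^esub> \<delta> \<gamma> (p e)"
    using has_cocycleD(2)[OF assms] by blast
  note D = extensionsD[OF X]
  interpret E: left_module R E by (rule D(1))
  note bij = coordinates_bij[of i E p \<rho>, OF X \<rho> add ret]
  define \<sigma> where "\<sigma> m = (THE e. e \<in> carrier E \<and> p e = m \<and> \<rho> e = \<zero>\<^bsub>N\<^esub>)" for m
  have \<sigma>: "\<sigma> m \<in> carrier E \<and> p (\<sigma> m) = m \<and> \<rho> (\<sigma> m) = \<zero>\<^bsub>N\<^esub>" if "m \<in> carrier M" for m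
    unfolding \<sigma>_def by (rule theI', rule bij) (use that in auto)
  have eqI: "e = e'" if "e \<in> carrier E" "e' \<in> carrier E" "p e = p e'" "\<rho> e = \<rho> e'" for e e'
    using bij[of "p e" "\<rho> e"] that D(9) \<rho> by (metis Pi_mem)
  show ?thesis
  proof (rule that[of \<sigma>])
    show "\<sigma> \<in> carrier M \<rightarrow> carrier E" using \<sigma> by blast
    show "\<sigma> (x \<oplus>\<^bsub>M\<^esub> y) = \<sigma> x \<oplus>\<^bsub>E\<^esub> \<sigma> y" if "x \<in> carrier M" "y \<in> carrier M" for x y
      by (rule eqI) (use \<sigma> that add mod_homD(2)[OF D(3)] in auto)
    show "gen \<gamma> \<odot>\<^bsub>E\<^esub> \<sigma> m = \<sigma> (gen \<gamma> \<odot>\<^bsub>M\<^esub> m) \<oplus>\<^bsub>E\<^esub> i (\<delta> \<gamma> m)"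
      if "\<gamma> \<in> \<Gamma>" "m \<in> carrier M" "\<delta> \<gamma> m \<in> carrier N" for \<gamma> m
    proof -
      have g: "gen \<gamma> \<in> carrier R" using that gen_closed by blast
      have z: "gen \<gamma> \<odot>\<^bsub>N\<^esub> \<zero>\<^bsub>N\<^esub> = \<zero>\<^bsub>N\<^esub>"
        using additive_mapD(1)[of N N "\<lambda>x. gen \<gamma> \<odot>\<^bsub>N\<^esub> x"] N.M.abelian_group_axioms
          N.smult_closed[OF g] N.smult_r_distr[OF g] by simp
      show ?thesis
        by (rule eqI)
          (use \<sigma> that g z add D(7,8) ret coc M.smult_closed E.smult_closed mod_homD(2,3)[OF D(3)] in auto)
    qed
  qed (use \<sigma> in auto)
qed

lemma has_cocycle_sectionI:
  assumes X: "(i, E, p) \<in> extensions R M N"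
    and \<sigma>: "\<sigma> \<in> carrier M \<rightarrow> carrier E"
    and add: "\<And>x y. x \<in> carrier M \<Longrightarrow> y \<in> carrier M \<Longrightarrow> \<sigma> (x \<oplus>\<^bsub>M\<^esub> y) = \<sigma> x \<oplus>\<^bsub>E\<^esub> \<sigma> y"
    and sec: "\<And>m. m \<in> carrier M \<Longrightarrow> p (\<sigma> m) = m"
    and \<delta>: "\<And>\<gamma> m. \<gamma> \<in> \<Gamma> \<Longrightarrow> m \<in> carrier M \<Longrightarrow> \<delta> \<gamma> m \<in> carrier N"
    and coc: "\<And>\<gamma> m. \<gamma> \<in> \<Gamma> \<Longrightarrow> m \<in> carrier M \<Longrightarrow>
      gen \<gamma> \<odot>\<^bsub>E\<^esub> \<sigma> m = \<sigma> (gen \<gamma> \<odot>\<^bsub>M\<^esub> m) \<oplus>\<^bsub>E\<^esub> i (\<delta> \<gamma> m)"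
  shows "has_cocycle (i, E, p) \<delta>"
proof -
  note D = extensionsD[OF X]
  interpret E: left_module R E by (rule D(1))
  have "\<exists>!n. n \<in> carrier N \<and> e = \<sigma> (p e) \<oplus>\<^bsub>E\<^esub> i n" if e: "e \<in> carrier E" for e
  proof -
    have s: "\<sigma> (p e) \<in> carrier E" using \<sigma> D(9)[OF e] by auto
    have "p (e \<ominus>\<^bsub>E\<^esub> \<sigma> (p e)) = \<zero>\<^bsub>M\<^esub>"
      using mod_hom_additive(2)[OF D(1) M D(3)] e s D(9)[OF e] sec
      by (simp add: M.M.minus_eq M.M.r_neg)
    then obtain n where n: "n \<in> carrier N" "e \<ominus>\<^bsub>E\<^esub> \<sigma> (p e) = i n"
      using D(6) e s E.M.minus_closed by blast
    have "e = \<sigma> (p e) \<oplus>\<^bsub>E\<^esub> i n"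
      using e s n(2)[symmetric] by (simp add: E.M.minus_eq E.M.a_lcomm E.M.r_neg)
    moreover have "n' = n" if "n' \<in> carrier N" "e = \<sigma> (p e) \<oplus>\<^bsub>E\<^esub> i n'" for n'
    proof -
      have "\<sigma> (p e) \<oplus>\<^bsub>E\<^esub> i n' = \<sigma> (p e) \<oplus>\<^bsub>E\<^esub> i n"
        by (rule trans[OF sym[OF that(2)] calculation])
      then have "i n' = i n" using s D(8)[OF n(1)] D(8)[OF that(1)] by simp
      then show ?thesis using D(4) n(1) that(1) by (meson inj_onD)
    qed
    ultimately show ?thesis using n by blast
  qed
  note ex1 = this
  define \<rho> where "\<rho> e = (THE n. n \<in> carrier N \<and> e = \<sigma> (p e) \<oplus>\<^bsub>E\<^esub> i n)" for e
  have "\<rho> e \<in> carrier N \<and> e = \<sigma> (p e) \<oplus>\<^bsub>E\<^esub> i (\<rho> e)" if "e \<in> carrier E" for e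
    unfolding \<rho>_def by (rule theI'[OF ex1[OF that]])
  then have \<rho>: "\<rho> e \<in> carrier N" and \<rho>_eq: "\<sigma> (p e) \<oplus>\<^bsub>E\<^esub> i (\<rho> e) = e" if "e \<in> carrier E" for e
    using that by auto
  have uniq: "\<rho> e = n" if "e \<in> carrier E" "n \<in> carrier N" "e = \<sigma> (p e) \<oplus>\<^bsub>E\<^esub> i n" for e n
    using ex1[OF that(1)] \<rho>[OF that(1)] \<rho>_eq[OF that(1)] that(2,3) by metis
  have \<sigma>c: "\<sigma> m \<in> carrier E" if "m \<in> carrier M" for m using \<sigma> that by auto
  have \<sigma>0: "\<sigma> \<zero>\<^bsub>M\<^esub> = \<zero>\<^bsub>E\<^esub>"
    by (rule additive_mapD(1)[OF M.M.abelian_group_axioms E.M.abelian_group_axioms \<sigma> add])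
  note i_add = mod_homD(2)[OF D(2)] and p_add = mod_homD(2)[OF D(3)]
  note i_sm = mod_homD(3)[OF D(2)] and p_sm = mod_homD(3)[OF D(3)]
  have "\<rho> (x \<oplus>\<^bsub>E\<^esub> y) = \<rho> x \<oplus>\<^bsub>N\<^esub> \<rho> y" if xy: "x \<in> carrier E" "y \<in> carrier E" for x y
  proof (rule uniq)
    have "x \<oplus>\<^bsub>E\<^esub> y = (\<sigma> (p x) \<oplus>\<^bsub>E\<^esub> i (\<rho> x)) \<oplus>\<^bsub>E\<^esub> (\<sigma> (p y) \<oplus>\<^bsub>E\<^esub> i (\<rho> y))"
      using \<rho>_eq xy by simp
    also have "\<dots> = (\<sigma> (p x) \<oplus>\<^bsub>E\<^esub> \<sigma> (p y)) \<oplus>\<^bsub>E\<^esub> (i (\<rho> x) \<oplus>\<^bsub>E\<^esub> i (\<rho> y))"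
      using xy \<sigma>c D(8,9) \<rho> by (simp add: E.M.a_ac)
    also have "\<dots> = \<sigma> (p (x \<oplus>\<^bsub>E\<^esub> y)) \<oplus>\<^bsub>E\<^esub> i (\<rho> x \<oplus>\<^bsub>N\<^esub> \<rho> y)"
      using xy \<rho> D(9) by (simp add: i_add p_add add)
    finally show "x \<oplus>\<^bsub>E\<^esub> y = \<sigma> (p (x \<oplus>\<^bsub>E\<^esub> y)) \<oplus>\<^bsub>E\<^esub> i (\<rho> x \<oplus>\<^bsub>N\<^esub> \<rho> y)" .
  qed (use that \<rho> in auto)
  moreover have "\<rho> (i n) = n" if "n \<in> carrier N" for n
    by (rule uniq) (use that D(7,8) \<sigma>0 in auto)
  moreover have "\<rho> (gen \<gamma> \<odot>\<^bsub>E\<^esub> e) = gen \<gamma> \<odot>\<^bsub>N\<^esub> \<rho> e \<oplus>\<^bsub>N\<^esub> \<delta> \<gamma> (p e)" if "\<gamma> \<in> \<Gamma>" "e \<in> carrier E" for \<gamma> e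
  proof (rule uniq)
    note g = gen_closed[OF that(1)]
    have "gen \<gamma> \<odot>\<^bsub>E\<^esub> e = gen \<gamma> \<odot>\<^bsub>E\<^esub> (\<sigma> (p e) \<oplus>\<^bsub>E\<^esub> i (\<rho> e))" using \<rho>_eq that by simp
    also have "\<dots> = (\<sigma> (gen \<gamma> \<odot>\<^bsub>M\<^esub> p e) \<oplus>\<^bsub>E\<^esub> i (\<delta> \<gamma> (p e))) \<oplus>\<^bsub>E\<^esub> i (gen \<gamma> \<odot>\<^bsub>N\<^esub> \<rho> e)"
      using that g \<sigma>c D(8,9) \<rho> coc by (simp add: E.smult_r_distr i_sm)
    also have "\<dots> = \<sigma> (p (gen \<gamma> \<odot>\<^bsub>E\<^esub> e)) \<oplus>\<^bsub>E\<^esub> i (gen \<gamma> \<odot>\<^bsub>N\<^esub> \<rho> e \<oplus>\<^bsub>N\<^esub> \<delta> \<gamma> (p e))"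
      using that g \<sigma>c D(8,9) \<rho> \<delta> M.smult_closed N.smult_closed
      by (simp add: i_add p_sm E.M.a_ac)
    finally show "gen \<gamma> \<odot>\<^bsub>E\<^esub> e = \<sigma> (p (gen \<gamma> \<odot>\<^bsub>E\<^esub> e)) \<oplus>\<^bsub>E\<^esub> i (gen \<gamma> \<odot>\<^bsub>N\<^esub> \<rho> e \<oplus>\<^bsub>N\<^esub> \<delta> \<gamma> (p e))" .
  qed (use that \<rho> \<delta> D(9) gen_closed E.smult_closed N.smult_closed in auto)
  ultimately show ?thesis
    unfolding has_cocycle_def using X \<rho> by (auto intro!: bexI[of _ \<rho>])
qed

definition is_cochain :: "('g \<Rightarrow> 'm \<Rightarrow> 'n) \<Rightarrow> bool" where
  "is_cochain \<delta> \<longleftrightarrow> (\<forall>\<gamma>\<in>\<Gamma>. \<forall>m\<in>carrier M. \<delta> \<gamma> m \<in> carrier N)"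

text \<open>
  Both middle terms have the coordinates \<open>M \<times> N\<close> and the same action of the generators in them.
\<close>

lemma has_cocycle_equiv:
  assumes "has_cocycle X \<delta>" "has_cocycle Y \<delta>"
  shows "(X, Y) \<in> ext_equiv R M N"
proof -
  obtain i E p i' E' p' where XY: "X = (i, E, p)" "Y = (i', E', p')"
    by (metis prod_cases3)
  note X = has_cocycleD[OF assms(1)[unfolded XY]] and Y = has_cocycleD[OF assms(2)[unfolded XY]]
  obtain \<rho> where \<rho>: "\<rho> \<in> carrier E \<rightarrow> carrier N"
    "\<And>x y. x \<in> carrier E \<Longrightarrow> y \<in> carrier E \<Longrightarrow> \<rho> (x \<oplus>\<^bsub>E\<^esub> y) = \<rho> x \<oplus>\<^bsub>N\<^esub> \<rho> y"
    "\<And>n. n \<in> carrier N \<Longrightarrow> \<rho> (i n) = n"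
    "\<And>\<gamma> e. \<gamma> \<in> \<Gamma> \<Longrightarrow> e \<in> carrier E \<Longrightarrow> \<rho> (gen \<gamma> \<odot>\<^bsub>E\<^esub> e) = gen \<gamma> \<odot>\<^bsub>N\<^esub> \<rho> e \<oplus>\<^bsub>N\<^esub> \<delta> \<gamma> (p e)"
    using X(2) by blast
  obtain \<rho>' where \<rho>': "\<rho>' \<in> carrier E' \<rightarrow> carrier N"
    "\<And>x y. x \<in> carrier E' \<Longrightarrow> y \<in> carrier E' \<Longrightarrow> \<rho>' (x \<oplus>\<^bsub>E'\<^esub> y) = \<rho>' x \<oplus>\<^bsub>N\<^esub> \<rho>' y"
    "\<And>n. n \<in> carrier N \<Longrightarrow> \<rho>' (i' n) = n"
    "\<And>\<gamma> e. \<gamma> \<in> \<Gamma> \<Longrightarrow> e \<in> carrier E' \<Longrightarrow> \<rho>' (gen \<gamma> \<odot>\<^bsub>E'\<^esub> e) = gen \<gamma> \<odot>\<^bsub>N\<^esub> \<rho>' e \<oplus>\<^bsub>N\<^esub> \<delta> \<gamma> (p' e)"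
    using Y(2) by blast
  note D = extensionsD[OF X(1)] and D' = extensionsD[OF Y(1)]
  obtain \<phi> where \<phi>: "\<phi> \<in> mod_hom R E E'" "\<And>x. x \<in> carrier E \<Longrightarrow> p' (\<phi> x) = p x"
    "\<And>x. x \<in> carrier E \<Longrightarrow> \<rho>' (\<phi> x) = \<rho> x"
    using lift_to_extension[OF Y(1) \<rho>' D(1,3) \<rho>(1,2,4)] by blast
  have "\<phi> (i n) = i' n" if n: "n \<in> carrier N" for n
  proof -
    have "\<exists>!e. e \<in> carrier E' \<and> p' e = \<zero>\<^bsub>M\<^esub> \<and> \<rho>' e = n"
      by (rule coordinates_bij[OF Y(1) \<rho>'(1-3)]) (use n in auto)
    moreover have "\<phi> (i n) \<in> carrier E'" using mod_homD(1)[OF \<phi>(1)] D(8) n by blast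
    moreover have "p' (\<phi> (i n)) = \<zero>\<^bsub>M\<^esub>" "\<rho>' (\<phi> (i n)) = n"
      using \<phi>(2,3)[OF D(8)[OF n]] D(7)[OF n] \<rho>(3)[OF n] by simp_all
    ultimately show ?thesis using D'(7,8)[OF n] \<rho>'(3)[OF n] by auto
  qed
  then show ?thesis using X(1) Y(1) \<phi> by (auto simp: ext_equiv_def XY)
qed

text \<open>
  An equivalence of extensions carries a section to a section with the same defect.
\<close>

lemma has_cocycle_transport:
  assumes X: "has_cocycle X \<delta>" and \<delta>: "is_cochain \<delta>" and XY: "(X, Y) \<in> ext_equiv R M N"
  shows "has_cocycle Y \<delta>"
proof -
  obtain i E p i' E' p' where *: "X = (i, E, p)" "Y = (i', E', p')"
    by (metis prod_cases3)
  obtain \<phi> where \<phi>: "\<phi> \<in> mod_hom R E E'" "\<And>n. n \<in> carrier N \<Longrightarrow> \<phi> (i n) = i' n"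
      "\<And>e. e \<in> carrier E \<Longrightarrow> p' (\<phi> e) = p e" and Y: "(i', E', p') \<in> extensions R M N"
    using XY by (auto simp: ext_equiv_def *)
  note D = extensionsD[OF has_cocycleD(1)[OF X[unfolded *]]]
  interpret E: left_module R E by (rule D(1))
  obtain \<sigma> where \<sigma>: "\<sigma> \<in> carrier M \<rightarrow> carrier E"
    "\<And>x y. x \<in> carrier M \<Longrightarrow> y \<in> carrier M \<Longrightarrow> \<sigma> (x \<oplus>\<^bsub>M\<^esub> y) = \<sigma> x \<oplus>\<^bsub>E\<^esub> \<sigma> y"
    "\<And>m. m \<in> carrier M \<Longrightarrow> p (\<sigma> m) = m"
    "\<And>\<gamma> m. \<gamma> \<in> \<Gamma> \<Longrightarrow> m \<in> carrier M \<Longrightarrow> \<delta> \<gamma> m \<in> carrier N \<Longrightarrow>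
      gen \<gamma> \<odot>\<^bsub>E\<^esub> \<sigma> m = \<sigma> (gen \<gamma> \<odot>\<^bsub>M\<^esub> m) \<oplus>\<^bsub>E\<^esub> i (\<delta> \<gamma> m)"
    using has_cocycle_sectionD[OF X[unfolded *]] by blast
  have c: "\<sigma> m \<in> carrier E" if "m \<in> carrier M" for m using \<sigma>(1) that by auto
  show ?thesis
    unfolding *
  proof (rule has_cocycle_sectionI[OF Y, of "\<phi> \<circ> \<sigma>"])
    show "gen \<gamma> \<odot>\<^bsub>E'\<^esub> (\<phi> \<circ> \<sigma>) m = (\<phi> \<circ> \<sigma>) (gen \<gamma> \<odot>\<^bsub>M\<^esub> m) \<oplus>\<^bsub>E'\<^esub> i' (\<delta> \<gamma> m)"
      if "\<gamma> \<in> \<Gamma>" "m \<in> carrier M" for \<gamma> m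
    proof -
      have d: "\<delta> \<gamma> m \<in> carrier N" using \<delta> that by (auto simp: is_cochain_def)
      show ?thesis
        using that d c gen_closed M.smult_closed D(8) mod_homD(2,3)[OF \<phi>(1), symmetric]
        by (simp add: \<phi>(2)[symmetric] \<sigma>(4))
    qed
  qed (use \<sigma> c \<delta> mod_homD[OF \<phi>(1)] \<phi> in \<open>auto simp: is_cochain_def\<close>)
qed

end

context generated_ext
begin

lemma left_module_pullback:
  assumes X: "(i, E, p) \<in> extensions R M N" and Y: "(i', E', p') \<in> extensions R M N"
  shows "left_module R (pullback E p E' p')"
proof -
  note D = extensionsD[OF X] and D' = extensionsD[OF Y]
  interpret E: left_module R E by (rule D(1))
  interpret E': left_module R E' by (rule D'(1))
  have z: "p \<zero>\<^bsub>E\<^esub> = \<zero>\<^bsub>M\<^esub>" "p' \<zero>\<^bsub>E'\<^esub> = \<zero>\<^bsub>M\<^esub>"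
    using mod_hom_additive(1)[OF D(1) M D(3)] mod_hom_additive(1)[OF D'(1) M D'(3)] by auto
  have neg: "p (\<ominus>\<^bsub>E\<^esub> x) = \<ominus>\<^bsub>M\<^esub> p x" "p' (\<ominus>\<^bsub>E'\<^esub> y) = \<ominus>\<^bsub>M\<^esub> p' y"
    if "x \<in> carrier E" "y \<in> carrier E'" for x y
    using additive_mapD(2)[OF E.M.abelian_group_axioms M.M.abelian_group_axioms _ mod_homD(2)[OF D(3)]]
      additive_mapD(2)[OF E'.M.abelian_group_axioms M.M.abelian_group_axioms _ mod_homD(2)[OF D'(3)]]
      that mod_homD(1)[OF D(3)] mod_homD(1)[OF D'(3)] by auto
  have "abelian_group (pullback E p E' p')"
  proof (rule abelian_groupI)
    fix x assume x: "x \<in> carrier (pullback E p E' p')"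
    then show "\<exists>y\<in>carrier (pullback E p E' p').
        y \<oplus>\<^bsub>pullback E p E' p'\<^esub> x = \<zero>\<^bsub>pullback E p E' p'\<^esub>"
      by (intro bexI[of _ "(\<ominus>\<^bsub>E\<^esub> fst x, \<ominus>\<^bsub>E'\<^esub> snd x)"])
        (auto simp: pullback_def E.M.l_neg E'.M.l_neg neg)
  qed (use z in \<open>auto simp: pullback_def mod_homD(2)[OF D(3)] mod_homD(2)[OF D'(3)]
        E.M.a_ac E'.M.a_ac\<close>)
  then show ?thesis
    unfolding left_module_def left_module_axioms_def
    using E.smult_closed E'.smult_closed E.smult_one E'.smult_one M.R.ring_axioms
    by (auto simp: pullback_def mod_homD(3)[OF D(3)] mod_homD(3)[OF D'(3)] E.smult_l_distr E'.smult_l_distr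
        E.smult_r_distr E'.smult_r_distr E.smult_assoc E'.smult_assoc)
qed

definition cochain_add :: "('g \<Rightarrow> 'm \<Rightarrow> 'n) \<Rightarrow> ('g \<Rightarrow> 'm \<Rightarrow> 'n) \<Rightarrow> 'g \<Rightarrow> 'm \<Rightarrow> 'n" where
  "cochain_add \<delta> \<delta>' = (\<lambda>\<gamma> m. \<delta> \<gamma> m \<oplus>\<^bsub>N\<^esub> \<delta>' \<gamma> m)"

definition cochain_smult :: "'r \<Rightarrow> ('g \<Rightarrow> 'm \<Rightarrow> 'n) \<Rightarrow> 'g \<Rightarrow> 'm \<Rightarrow> 'n" where
  "cochain_smult c \<delta> = (\<lambda>\<gamma> m. c \<odot>\<^bsub>N\<^esub> \<delta> \<gamma> m)"

definition ext_class :: "('g \<Rightarrow> 'm \<Rightarrow> 'n) \<Rightarrow> ('r, 'm, 'n, 'e) ext set" where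
  "ext_class \<delta> = {X. has_cocycle X \<delta>}"

lemma has_cocycle_extension: "has_cocycle X \<delta> \<Longrightarrow> X \<in> extensions R M N"
  by (auto simp: has_cocycle_def)

text \<open>
  Hence equivalence classes of extensions are the sets of all extensions with a given cocycle, and the
  operations on classes can be computed on cocycles.
\<close>

lemma ext_equiv_class:
  assumes "is_cochain \<delta>" "has_cocycle X \<delta>"
  shows "ext_equiv R M N `` {X} = ext_class \<delta>"
  using has_cocycle_transport[OF assms(2,1)] has_cocycle_equiv[OF assms(2)]
  by (auto simp: ext_class_def)

text \<open>
  The map on the pull-back is determined by its two coordinates: the common image in \<open>M\<close>, and the sum of
  the two retractions, whose defect is the sum of the two cocycles.
\<close>

lemma baer_sum_if_cocycles:
  assumes "has_cocycle X \<delta>" "has_cocycle Y \<delta>'" "has_cocycle Z (cochain_add \<delta> \<delta>')"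
    and \<delta>: "is_cochain \<delta>" "is_cochain \<delta>'"
  shows "is_baer_sum R N X Y Z"
proof -
  obtain i1 E1 p1 i2 E2 p2 i E p where XYZ: "X = (i1, E1, p1)" "Y = (i2, E2, p2)" "Z = (i, E, p)"
    by (metis prod_cases3)
  note X = has_cocycleD[OF assms(1)[unfolded XYZ]] and Y = has_cocycleD[OF assms(2)[unfolded XYZ]]
    and Z = has_cocycleD[OF assms(3)[unfolded XYZ]]
  obtain \<rho>1 where r1: "\<rho>1 \<in> carrier E1 \<rightarrow> carrier N"
    "\<And>x y. x \<in> carrier E1 \<Longrightarrow> y \<in> carrier E1 \<Longrightarrow> \<rho>1 (x \<oplus>\<^bsub>E1\<^esub> y) = \<rho>1 x \<oplus>\<^bsub>N\<^esub> \<rho>1 y"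
    "\<And>n. n \<in> carrier N \<Longrightarrow> \<rho>1 (i1 n) = n"
    "\<And>\<gamma> e. \<gamma> \<in> \<Gamma> \<Longrightarrow> e \<in> carrier E1 \<Longrightarrow> \<rho>1 (gen \<gamma> \<odot>\<^bsub>E1\<^esub> e) = gen \<gamma> \<odot>\<^bsub>N\<^esub> \<rho>1 e \<oplus>\<^bsub>N\<^esub> \<delta> \<gamma> (p1 e)"
    using X(2) by blast
  obtain \<rho>2 where r2: "\<rho>2 \<in> carrier E2 \<rightarrow> carrier N"
    "\<And>x y. x \<in> carrier E2 \<Longrightarrow> y \<in> carrier E2 \<Longrightarrow> \<rho>2 (x \<oplus>\<^bsub>E2\<^esub> y) = \<rho>2 x \<oplus>\<^bsub>N\<^esub> \<rho>2 y"
    "\<And>n. n \<in> carrier N \<Longrightarrow> \<rho>2 (i2 n) = n"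
    "\<And>\<gamma> e. \<gamma> \<in> \<Gamma> \<Longrightarrow> e \<in> carrier E2 \<Longrightarrow> \<rho>2 (gen \<gamma> \<odot>\<^bsub>E2\<^esub> e) = gen \<gamma> \<odot>\<^bsub>N\<^esub> \<rho>2 e \<oplus>\<^bsub>N\<^esub> \<delta>' \<gamma> (p2 e)"
    using Y(2) by blast
  obtain \<rho> where r: "\<rho> \<in> carrier E \<rightarrow> carrier N"
    "\<And>x y. x \<in> carrier E \<Longrightarrow> y \<in> carrier E \<Longrightarrow> \<rho> (x \<oplus>\<^bsub>E\<^esub> y) = \<rho> x \<oplus>\<^bsub>N\<^esub> \<rho> y"
    "\<And>n. n \<in> carrier N \<Longrightarrow> \<rho> (i n) = n"
    "\<And>\<gamma> e. \<gamma> \<in> \<Gamma> \<Longrightarrow> e \<in> carrier E \<Longrightarrow>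
      \<rho> (gen \<gamma> \<odot>\<^bsub>E\<^esub> e) = gen \<gamma> \<odot>\<^bsub>N\<^esub> \<rho> e \<oplus>\<^bsub>N\<^esub> cochain_add \<delta> \<delta>' \<gamma> (p e)"
    using Z(2) by blast
  note D1 = extensionsD[OF X(1)] and D2 = extensionsD[OF Y(1)] and D = extensionsD[OF Z(1)]
  let ?P = "pullback E1 p1 E2 p2"
  have P: "left_module R ?P" by (rule left_module_pullback[OF X(1) Y(1)])
  have c1: "\<rho>1 x \<in> carrier N" if "x \<in> carrier E1" for x using r1(1) that by auto
  have c2: "\<rho>2 x \<in> carrier N" if "x \<in> carrier E2" for x using r2(1) that by auto
  have dc: "\<delta> \<gamma> m \<in> carrier N" "\<delta>' \<gamma> m \<in> carrier N" if "\<gamma> \<in> \<Gamma>" "m \<in> carrier M" for \<gamma> m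
    using \<delta> that by (auto simp: is_cochain_def)
  have "\<exists>\<phi>\<in>mod_hom R ?P E. \<forall>x\<in>carrier ?P. p (\<phi> x) = p1 (fst x) \<and> \<rho> (\<phi> x) = \<rho>1 (fst x) \<oplus>\<^bsub>N\<^esub> \<rho>2 (snd x)"
  proof (rule lift_to_extension[OF Z(1) r P, of "\<lambda>x. p1 (fst x)" "\<lambda>x. \<rho>1 (fst x) \<oplus>\<^bsub>N\<^esub> \<rho>2 (snd x)"])
    show "(\<lambda>x. p1 (fst x)) \<in> mod_hom R ?P M"
      using mod_homD[OF D1(3)] mod_homD(1)[OF D2(3)] by (auto simp: mod_hom_def pullback_def)
    show "(\<lambda>x. \<rho>1 (fst x) \<oplus>\<^bsub>N\<^esub> \<rho>2 (snd x)) \<in> carrier ?P \<rightarrow> carrier N"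
      using c1 c2 by (auto simp: pullback_def)
    show "\<rho>1 (fst (x \<oplus>\<^bsub>?P\<^esub> y)) \<oplus>\<^bsub>N\<^esub> \<rho>2 (snd (x \<oplus>\<^bsub>?P\<^esub> y)) =
       \<rho>1 (fst x) \<oplus>\<^bsub>N\<^esub> \<rho>2 (snd x) \<oplus>\<^bsub>N\<^esub> (\<rho>1 (fst y) \<oplus>\<^bsub>N\<^esub> \<rho>2 (snd y))"
      if "x \<in> carrier ?P" "y \<in> carrier ?P" for x y
      using that c1 c2 by (auto simp: pullback_def r1(2) r2(2) N.M.a_ac)
    show "\<rho>1 (fst (gen \<gamma> \<odot>\<^bsub>?P\<^esub> x)) \<oplus>\<^bsub>N\<^esub> \<rho>2 (snd (gen \<gamma> \<odot>\<^bsub>?P\<^esub> x)) =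
       gen \<gamma> \<odot>\<^bsub>N\<^esub> (\<rho>1 (fst x) \<oplus>\<^bsub>N\<^esub> \<rho>2 (snd x)) \<oplus>\<^bsub>N\<^esub> cochain_add \<delta> \<delta>' \<gamma> (p1 (fst x))"
      if "\<gamma> \<in> \<Gamma>" "x \<in> carrier ?P" for \<gamma> x
      using that c1 c2 gen_closed[OF that(1)] dc D1(9) D2(9) N.smult_closed
      by (auto simp: pullback_def r1(4) r2(4) N.M.a_ac cochain_add_def N.smult_r_distr)
  qed
  then obtain \<phi> where \<phi>: "\<phi> \<in> mod_hom R ?P E" "\<And>x. x \<in> carrier ?P \<Longrightarrow> p (\<phi> x) = p1 (fst x)"
    "\<And>x. x \<in> carrier ?P \<Longrightarrow> \<rho> (\<phi> x) = \<rho>1 (fst x) \<oplus>\<^bsub>N\<^esub> \<rho>2 (snd x)"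
    by blast
  have "\<phi> (i1 n1, i2 n2) = i (n1 \<oplus>\<^bsub>N\<^esub> n2)" if n: "n1 \<in> carrier N" "n2 \<in> carrier N" for n1 n2
  proof -
    have x: "(i1 n1, i2 n2) \<in> carrier ?P"
      using D1(7,8)[OF n(1)] D2(7,8)[OF n(2)] by (simp add: pullback_def)
    have "\<exists>!e. e \<in> carrier E \<and> p e = \<zero>\<^bsub>M\<^esub> \<and> \<rho> e = n1 \<oplus>\<^bsub>N\<^esub> n2"
      by (rule coordinates_bij[OF Z(1) r(1-3)]) (use n in auto)
    moreover have "p (\<phi> (i1 n1, i2 n2)) = \<zero>\<^bsub>M\<^esub>" "\<rho> (\<phi> (i1 n1, i2 n2)) = n1 \<oplus>\<^bsub>N\<^esub> n2"
      using \<phi>(2,3)[OF x] D1(7)[OF n(1)] r1(3) r2(3) n by simp_all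
    moreover have "n1 \<oplus>\<^bsub>N\<^esub> n2 \<in> carrier N" using n by simp
    ultimately show ?thesis using D(7,8) r(3) mod_homD(1)[OF \<phi>(1) x] by auto
  qed
  then show ?thesis
    using \<phi>(1,2) by (auto simp: is_baer_sum_def XYZ intro!: bexI[of _ \<phi>])
qed

text \<open>
  Conversely, a pair of sections gives a section of the pull-back, which the defining map of the Baer sum
  carries to a section of \<open>Z\<close>.
\<close>

lemma cocycle_of_baer_sum:
  assumes "has_cocycle X \<delta>" "has_cocycle Y \<delta>'" "Z \<in> extensions R M N" "is_baer_sum R N X Y Z"
    and \<delta>: "is_cochain \<delta>" "is_cochain \<delta>'"
  shows "has_cocycle Z (cochain_add \<delta> \<delta>')"
proof -
  obtain i1 E1 p1 i2 E2 p2 i E p where XYZ: "X = (i1, E1, p1)" "Y = (i2, E2, p2)" "Z = (i, E, p)"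
    by (metis prod_cases3)
  note X = has_cocycleD(1)[OF assms(1)[unfolded XYZ]] and Y = has_cocycleD(1)[OF assms(2)[unfolded XYZ]]
    and Z = assms(3)[unfolded XYZ]
  note D1 = extensionsD[OF X] and D2 = extensionsD[OF Y] and D = extensionsD[OF Z]
  let ?P = "pullback E1 p1 E2 p2"
  interpret P: left_module R ?P by (rule left_module_pullback[OF X Y])
  interpret E1: left_module R E1 by (rule D1(1))
  interpret E2: left_module R E2 by (rule D2(1))
  interpret E: left_module R E by (rule D(1))
  obtain \<phi> where \<phi>: "\<phi> \<in> mod_hom R ?P E"
    "\<And>n1 n2. n1 \<in> carrier N \<Longrightarrow> n2 \<in> carrier N \<Longrightarrow> \<phi> (i1 n1, i2 n2) = i (n1 \<oplus>\<^bsub>N\<^esub> n2)"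
    "\<And>e1 e2. (e1, e2) \<in> carrier ?P \<Longrightarrow> p (\<phi> (e1, e2)) = p1 e1"
    using assms(4) unfolding is_baer_sum_def XYZ by fastforce
  have dc: "\<delta> \<gamma> m \<in> carrier N" "\<delta>' \<gamma> m \<in> carrier N" if "\<gamma> \<in> \<Gamma>" "m \<in> carrier M" for \<gamma> m
    using \<delta> that by (auto simp: is_cochain_def)
  obtain \<sigma>1 where s1: "\<sigma>1 \<in> carrier M \<rightarrow> carrier E1"
    "\<And>x y. x \<in> carrier M \<Longrightarrow> y \<in> carrier M \<Longrightarrow> \<sigma>1 (x \<oplus>\<^bsub>M\<^esub> y) = \<sigma>1 x \<oplus>\<^bsub>E1\<^esub> \<sigma>1 y"
    "\<And>m. m \<in> carrier M \<Longrightarrow> p1 (\<sigma>1 m) = m"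
    "\<And>\<gamma> m. \<gamma> \<in> \<Gamma> \<Longrightarrow> m \<in> carrier M \<Longrightarrow> \<delta> \<gamma> m \<in> carrier N \<Longrightarrow>
      gen \<gamma> \<odot>\<^bsub>E1\<^esub> \<sigma>1 m = \<sigma>1 (gen \<gamma> \<odot>\<^bsub>M\<^esub> m) \<oplus>\<^bsub>E1\<^esub> i1 (\<delta> \<gamma> m)"
    using has_cocycle_sectionD[OF assms(1)[unfolded XYZ]] by blast
  obtain \<sigma>2 where s2: "\<sigma>2 \<in> carrier M \<rightarrow> carrier E2"
    "\<And>x y. x \<in> carrier M \<Longrightarrow> y \<in> carrier M \<Longrightarrow> \<sigma>2 (x \<oplus>\<^bsub>M\<^esub> y) = \<sigma>2 x \<oplus>\<^bsub>E2\<^esub> \<sigma>2 y"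
    "\<And>m. m \<in> carrier M \<Longrightarrow> p2 (\<sigma>2 m) = m"
    "\<And>\<gamma> m. \<gamma> \<in> \<Gamma> \<Longrightarrow> m \<in> carrier M \<Longrightarrow> \<delta>' \<gamma> m \<in> carrier N \<Longrightarrow>
      gen \<gamma> \<odot>\<^bsub>E2\<^esub> \<sigma>2 m = \<sigma>2 (gen \<gamma> \<odot>\<^bsub>M\<^esub> m) \<oplus>\<^bsub>E2\<^esub> i2 (\<delta>' \<gamma> m)"
    using has_cocycle_sectionD[OF assms(2)[unfolded XYZ]] by blast
  have c1: "\<sigma>1 m \<in> carrier E1" if "m \<in> carrier M" for m using s1(1) that by auto
  have c2: "\<sigma>2 m \<in> carrier E2" if "m \<in> carrier M" for m using s2(1) that by auto
  have P: "(\<sigma>1 m, \<sigma>2 m) \<in> carrier ?P" if "m \<in> carrier M" for m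
    using that c1 c2 s1(3) s2(3) by (simp add: pullback_def)
  have iP: "(i1 n, i2 n') \<in> carrier ?P" if "n \<in> carrier N" "n' \<in> carrier N" for n n'
    using D1(7,8)[OF that(1)] D2(7,8)[OF that(2)] by (simp add: pullback_def)
  have add: "(e1 \<oplus>\<^bsub>E1\<^esub> f1, e2 \<oplus>\<^bsub>E2\<^esub> f2) = (e1, e2) \<oplus>\<^bsub>?P\<^esub> (f1, f2)" for e1 e2 f1 f2
    by (simp add: pullback_def)
  have sm: "(r \<odot>\<^bsub>E1\<^esub> e1, r \<odot>\<^bsub>E2\<^esub> e2) = r \<odot>\<^bsub>?P\<^esub> (e1, e2)" for r e1 e2
    by (simp add: pullback_def)
  show ?thesis
    unfolding XYZ
  proof (rule has_cocycle_sectionI[OF Z, of "\<lambda>m. \<phi> (\<sigma>1 m, \<sigma>2 m)"])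
    show "(\<lambda>m. \<phi> (\<sigma>1 m, \<sigma>2 m)) \<in> carrier M \<rightarrow> carrier E"
      using P mod_homD(1)[OF \<phi>(1)] by blast
    show "\<phi> (\<sigma>1 (x \<oplus>\<^bsub>M\<^esub> y), \<sigma>2 (x \<oplus>\<^bsub>M\<^esub> y)) = \<phi> (\<sigma>1 x, \<sigma>2 x) \<oplus>\<^bsub>E\<^esub> \<phi> (\<sigma>1 y, \<sigma>2 y)"
      if "x \<in> carrier M" "y \<in> carrier M" for x y
      using that P by (simp add: s1(2) s2(2) add mod_homD(2)[OF \<phi>(1)])
    show "p (\<phi> (\<sigma>1 m, \<sigma>2 m)) = m" if "m \<in> carrier M" for m
      using \<phi>(3)[OF P[OF that]] s1(3)[OF that] by simp
    show "cochain_add \<delta> \<delta>' \<gamma> m \<in> carrier N" if "\<gamma> \<in> \<Gamma>" "m \<in> carrier M" for \<gamma> m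
      using dc[OF that] by (simp add: cochain_add_def)
    show "gen \<gamma> \<odot>\<^bsub>E\<^esub> \<phi> (\<sigma>1 m, \<sigma>2 m) = \<phi> (\<sigma>1 (gen \<gamma> \<odot>\<^bsub>M\<^esub> m), \<sigma>2 (gen \<gamma> \<odot>\<^bsub>M\<^esub> m)) \<oplus>\<^bsub>E\<^esub>
        i (cochain_add \<delta> \<delta>' \<gamma> m)" if "\<gamma> \<in> \<Gamma>" "m \<in> carrier M" for \<gamma> m
    proof -
      note g = gen_closed[OF that(1)]
      have "gen \<gamma> \<odot>\<^bsub>E\<^esub> \<phi> (\<sigma>1 m, \<sigma>2 m) = \<phi> (gen \<gamma> \<odot>\<^bsub>E1\<^esub> \<sigma>1 m, gen \<gamma> \<odot>\<^bsub>E2\<^esub> \<sigma>2 m)"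
        using mod_homD(3)[OF \<phi>(1) g P[OF that(2)]] by (simp add: sm)
      also have "\<dots> = \<phi> ((\<sigma>1 (gen \<gamma> \<odot>\<^bsub>M\<^esub> m), \<sigma>2 (gen \<gamma> \<odot>\<^bsub>M\<^esub> m)) \<oplus>\<^bsub>?P\<^esub> (i1 (\<delta> \<gamma> m), i2 (\<delta>' \<gamma> m)))"
        using that dc[OF that] by (simp add: s1(4) s2(4) add)
      also have "\<dots> = \<phi> (\<sigma>1 (gen \<gamma> \<odot>\<^bsub>M\<^esub> m), \<sigma>2 (gen \<gamma> \<odot>\<^bsub>M\<^esub> m)) \<oplus>\<^bsub>E\<^esub> i (cochain_add \<delta> \<delta>' \<gamma> m)"
        using P[OF M.smult_closed[OF g that(2)]] iP[OF dc[OF that]] \<phi>(2)[OF dc[OF that]]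
        by (simp add: mod_homD(2)[OF \<phi>(1)] cochain_add_def)
      finally show ?thesis .
    qed
  qed
qed

lemma baer_sum_classes:
  fixes X Y :: "('r, 'm, 'n, 'e) ext"
  assumes "has_cocycle X \<delta>" "has_cocycle Y \<delta>'" "is_cochain \<delta>" "is_cochain \<delta>'"
  shows "{Z \<in> extensions R M N. \<exists>X\<in>ext_class \<delta> :: ('r, 'm, 'n, 'e) ext set. \<exists>Y\<in>ext_class \<delta>'. is_baer_sum R N X Y Z} =
    ext_class (cochain_add \<delta> \<delta>')"
  (is "?L = ?R")
proof
  show "?L \<subseteq> ?R"
    using cocycle_of_baer_sum[OF _ _ _ _ assms(3,4)] unfolding ext_class_def by blast
  show "?R \<subseteq> ?L"
  proof
    fix Z assume "Z \<in> ?R"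
    then have Z: "has_cocycle Z (cochain_add \<delta> \<delta>')" by (simp add: ext_class_def)
    show "Z \<in> ?L"
      using baer_sum_if_cocycles[OF assms(1,2) Z assms(3,4)] assms(1,2) has_cocycle_extension[OF Z]
      unfolding ext_class_def by blast
  qed
qed

lemma scalar_mult_if_cocycles:
  assumes "has_cocycle X \<delta>" "has_cocycle Z (cochain_smult (s c) \<delta>)" and \<delta>: "is_cochain \<delta>"
    and s: "s c \<in> carrier R" and central: "\<And>r. r \<in> carrier R \<Longrightarrow> s c \<otimes>\<^bsub>R\<^esub> r = r \<otimes>\<^bsub>R\<^esub> s c"
  shows "is_scalar_mult R s N c X Z"
proof -
  obtain i1 E1 p1 i E p where XZ: "X = (i1, E1, p1)" "Z = (i, E, p)"
    by (metis prod_cases3)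
  note X = has_cocycleD[OF assms(1)[unfolded XZ]] and Z = has_cocycleD[OF assms(2)[unfolded XZ]]
  obtain \<rho>1 where r1: "\<rho>1 \<in> carrier E1 \<rightarrow> carrier N"
    "\<And>x y. x \<in> carrier E1 \<Longrightarrow> y \<in> carrier E1 \<Longrightarrow> \<rho>1 (x \<oplus>\<^bsub>E1\<^esub> y) = \<rho>1 x \<oplus>\<^bsub>N\<^esub> \<rho>1 y"
    "\<And>n. n \<in> carrier N \<Longrightarrow> \<rho>1 (i1 n) = n"
    "\<And>\<gamma> e. \<gamma> \<in> \<Gamma> \<Longrightarrow> e \<in> carrier E1 \<Longrightarrow> \<rho>1 (gen \<gamma> \<odot>\<^bsub>E1\<^esub> e) = gen \<gamma> \<odot>\<^bsub>N\<^esub> \<rho>1 e \<oplus>\<^bsub>N\<^esub> \<delta> \<gamma> (p1 e)"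
    using X(2) by blast
  obtain \<rho> where r: "\<rho> \<in> carrier E \<rightarrow> carrier N"
    "\<And>x y. x \<in> carrier E \<Longrightarrow> y \<in> carrier E \<Longrightarrow> \<rho> (x \<oplus>\<^bsub>E\<^esub> y) = \<rho> x \<oplus>\<^bsub>N\<^esub> \<rho> y"
    "\<And>n. n \<in> carrier N \<Longrightarrow> \<rho> (i n) = n"
    "\<And>\<gamma> e. \<gamma> \<in> \<Gamma> \<Longrightarrow> e \<in> carrier E \<Longrightarrow>
      \<rho> (gen \<gamma> \<odot>\<^bsub>E\<^esub> e) = gen \<gamma> \<odot>\<^bsub>N\<^esub> \<rho> e \<oplus>\<^bsub>N\<^esub> cochain_smult (s c) \<delta> \<gamma> (p e)"
    using Z(2) by blast
  note D1 = extensionsD[OF X(1)] and D = extensionsD[OF Z(1)]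
  have c1: "\<rho>1 x \<in> carrier N" if "x \<in> carrier E1" for x using r1(1) that by auto
  have dc: "\<delta> \<gamma> m \<in> carrier N" if "\<gamma> \<in> \<Gamma>" "m \<in> carrier M" for \<gamma> m
    using \<delta> that by (auto simp: is_cochain_def)
  have "\<exists>\<phi>\<in>mod_hom R E1 E. \<forall>x\<in>carrier E1. p (\<phi> x) = p1 x \<and> \<rho> (\<phi> x) = s c \<odot>\<^bsub>N\<^esub> \<rho>1 x"
  proof (rule lift_to_extension[OF Z(1) r D1(1,3), of "\<lambda>x. s c \<odot>\<^bsub>N\<^esub> \<rho>1 x"])
    show "(\<lambda>x. s c \<odot>\<^bsub>N\<^esub> \<rho>1 x) \<in> carrier E1 \<rightarrow> carrier N"
      using c1 s N.smult_closed by auto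
    show "s c \<odot>\<^bsub>N\<^esub> \<rho>1 (x \<oplus>\<^bsub>E1\<^esub> y) = s c \<odot>\<^bsub>N\<^esub> \<rho>1 x \<oplus>\<^bsub>N\<^esub> s c \<odot>\<^bsub>N\<^esub> \<rho>1 y"
      if "x \<in> carrier E1" "y \<in> carrier E1" for x y
      using that c1 s by (simp add: r1(2) N.smult_r_distr)
    show "s c \<odot>\<^bsub>N\<^esub> \<rho>1 (gen \<gamma> \<odot>\<^bsub>E1\<^esub> x) =
       gen \<gamma> \<odot>\<^bsub>N\<^esub> (s c \<odot>\<^bsub>N\<^esub> \<rho>1 x) \<oplus>\<^bsub>N\<^esub> cochain_smult (s c) \<delta> \<gamma> (p1 x)"
      if "\<gamma> \<in> \<Gamma>" "x \<in> carrier E1" for \<gamma> x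
      using that c1 gen_closed[OF that(1)] dc D1(9) s N.smult_closed
      by (simp add: r1(4) cochain_smult_def N.smult_r_distr central flip: N.smult_assoc)
  qed
  then obtain \<phi> where \<phi>: "\<phi> \<in> mod_hom R E1 E" "\<And>x. x \<in> carrier E1 \<Longrightarrow> p (\<phi> x) = p1 x"
    "\<And>x. x \<in> carrier E1 \<Longrightarrow> \<rho> (\<phi> x) = s c \<odot>\<^bsub>N\<^esub> \<rho>1 x"
    by blast
  have "\<phi> (i1 n) = i (s c \<odot>\<^bsub>N\<^esub> n)" if n: "n \<in> carrier N" for n
  proof -
    have sn: "s c \<odot>\<^bsub>N\<^esub> n \<in> carrier N" by (rule N.smult_closed[OF s n])
    have "\<exists>!e. e \<in> carrier E \<and> p e = \<zero>\<^bsub>M\<^esub> \<and> \<rho> e = s c \<odot>\<^bsub>N\<^esub> n"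
      by (rule coordinates_bij[OF Z(1) r(1-3)]) (use sn in auto)
    moreover have "p (\<phi> (i1 n)) = \<zero>\<^bsub>M\<^esub>" "\<rho> (\<phi> (i1 n)) = s c \<odot>\<^bsub>N\<^esub> n"
      using \<phi>(2,3)[OF D1(8)[OF n]] D1(7)[OF n] r1(3)[OF n] by simp_all
    ultimately show ?thesis
      using D(7,8)[OF sn] r(3)[OF sn] mod_homD(1)[OF \<phi>(1) D1(8)[OF n]] by auto
  qed
  then show ?thesis
    using \<phi>(1,2) by (auto simp: is_scalar_mult_def XZ intro!: bexI[of _ \<phi>])
qed

lemma cocycle_of_scalar_mult:
  assumes "has_cocycle X \<delta>" "Z \<in> extensions R M N" "is_scalar_mult R s N c X Z"
    and \<delta>: "is_cochain \<delta>" and s: "s c \<in> carrier R"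
  shows "has_cocycle Z (cochain_smult (s c) \<delta>)"
proof -
  obtain i1 E1 p1 i E p where XZ: "X = (i1, E1, p1)" "Z = (i, E, p)"
    by (metis prod_cases3)
  note X = has_cocycleD(1)[OF assms(1)[unfolded XZ]] and Z = assms(2)[unfolded XZ]
  note D1 = extensionsD[OF X] and D = extensionsD[OF Z]
  obtain \<phi> where \<phi>: "\<phi> \<in> mod_hom R E1 E"
    "\<And>n. n \<in> carrier N \<Longrightarrow> \<phi> (i1 n) = i (s c \<odot>\<^bsub>N\<^esub> n)"
    "\<And>e. e \<in> carrier E1 \<Longrightarrow> p (\<phi> e) = p1 e"
    using assms(3) by (auto simp: is_scalar_mult_def XZ)
  have dc: "\<delta> \<gamma> m \<in> carrier N" if "\<gamma> \<in> \<Gamma>" "m \<in> carrier M" for \<gamma> m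
    using \<delta> that by (auto simp: is_cochain_def)
  obtain \<sigma> where \<sigma>: "\<sigma> \<in> carrier M \<rightarrow> carrier E1"
    "\<And>x y. x \<in> carrier M \<Longrightarrow> y \<in> carrier M \<Longrightarrow> \<sigma> (x \<oplus>\<^bsub>M\<^esub> y) = \<sigma> x \<oplus>\<^bsub>E1\<^esub> \<sigma> y"
    "\<And>m. m \<in> carrier M \<Longrightarrow> p1 (\<sigma> m) = m"
    "\<And>\<gamma> m. \<gamma> \<in> \<Gamma> \<Longrightarrow> m \<in> carrier M \<Longrightarrow> \<delta> \<gamma> m \<in> carrier N \<Longrightarrow>
      gen \<gamma> \<odot>\<^bsub>E1\<^esub> \<sigma> m = \<sigma> (gen \<gamma> \<odot>\<^bsub>M\<^esub> m) \<oplus>\<^bsub>E1\<^esub> i1 (\<delta> \<gamma> m)"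
    using has_cocycle_sectionD[OF assms(1)[unfolded XZ]] by blast
  have c: "\<sigma> m \<in> carrier E1" if "m \<in> carrier M" for m using \<sigma>(1) that by auto
  show ?thesis
    unfolding XZ
  proof (rule has_cocycle_sectionI[OF Z, of "\<phi> \<circ> \<sigma>"])
    show "gen \<gamma> \<odot>\<^bsub>E\<^esub> (\<phi> \<circ> \<sigma>) m = (\<phi> \<circ> \<sigma>) (gen \<gamma> \<odot>\<^bsub>M\<^esub> m) \<oplus>\<^bsub>E\<^esub> i (cochain_smult (s c) \<delta> \<gamma> m)"
      if "\<gamma> \<in> \<Gamma>" "m \<in> carrier M" for \<gamma> m
      using that dc[OF that] c gen_closed M.smult_closed D1(8) mod_homD(2,3)[OF \<phi>(1), symmetric]
      by (simp add: \<phi>(2)[symmetric] \<sigma>(4) cochain_smult_def)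
  qed (use \<sigma> c dc s N.smult_closed mod_homD[OF \<phi>(1)] \<phi> in \<open>auto simp: cochain_smult_def\<close>)
qed

lemma scalar_mult_class:
  fixes X :: "('r, 'm, 'n, 'e) ext"
  assumes "has_cocycle X \<delta>" "is_cochain \<delta>"
    and "s c \<in> carrier R" "\<And>r. r \<in> carrier R \<Longrightarrow> s c \<otimes>\<^bsub>R\<^esub> r = r \<otimes>\<^bsub>R\<^esub> s c"
  shows "{Z \<in> extensions R M N. \<exists>X\<in>ext_class \<delta> :: ('r, 'm, 'n, 'e) ext set. is_scalar_mult R s N c X Z} =
    ext_class (cochain_smult (s c) \<delta>)"
  (is "?L = ?R")
proof
  show "?L \<subseteq> ?R"
    using cocycle_of_scalar_mult[where s = s and c = c, OF _ _ _ assms(2,3)] unfolding ext_class_def by blast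
  show "?R \<subseteq> ?L"
  proof
    fix Z assume "Z \<in> ?R"
    then have Z: "has_cocycle Z (cochain_smult (s c) \<delta>)" by (simp add: ext_class_def)
    show "Z \<in> ?L"
      using scalar_mult_if_cocycles[where s = s and c = c, OF assms(1) Z assms(2,3,4)] assms(1) has_cocycle_extension[OF Z]
      unfolding ext_class_def by blast
  qed
qed

text \<open>
  A linear section is an additive section with defect zero.
\<close>

lemma split_ext_class: "{X \<in> extensions R M N. split_ext R M X} = ext_class (\<lambda>_ _. \<zero>\<^bsub>N\<^esub>)"
proof -
  have "split_ext R M (i, E, p) \<longleftrightarrow> has_cocycle (i, E, p) (\<lambda>_ _. \<zero>\<^bsub>N\<^esub>)"
    if X: "(i, E, p) \<in> extensions R M N" for i p and E :: "('r, 'd) module"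
  proof -
    note D = extensionsD[OF X]
    interpret E: left_module R E by (rule D(1))
    have i0: "i \<zero>\<^bsub>N\<^esub> = \<zero>\<^bsub>E\<^esub>" by (rule mod_hom_additive(1)[OF N D(1,2)])
    show ?thesis
    proof
      assume "split_ext R M (i, E, p)"
      then obtain \<sigma> where \<sigma>: "\<sigma> \<in> mod_hom R M E" "\<And>x. x \<in> carrier M \<Longrightarrow> p (\<sigma> x) = x"
        by (auto simp: split_ext_def)
      show "has_cocycle (i, E, p) (\<lambda>_ _. \<zero>\<^bsub>N\<^esub>)"
        by (rule has_cocycle_sectionI[OF X, of \<sigma>])
          (use mod_homD[OF \<sigma>(1)] \<sigma>(2) i0 gen_closed M.smult_closed E.smult_closed in auto)
    next
      assume *: "has_cocycle (i, E, p) (\<lambda>_ _. \<zero>\<^bsub>N\<^esub>)"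
      obtain \<sigma> where \<sigma>: "\<sigma> \<in> carrier M \<rightarrow> carrier E"
        "\<And>x y. x \<in> carrier M \<Longrightarrow> y \<in> carrier M \<Longrightarrow> \<sigma> (x \<oplus>\<^bsub>M\<^esub> y) = \<sigma> x \<oplus>\<^bsub>E\<^esub> \<sigma> y"
        "\<And>m. m \<in> carrier M \<Longrightarrow> p (\<sigma> m) = m"
        "\<And>\<gamma> m. \<gamma> \<in> \<Gamma> \<Longrightarrow> m \<in> carrier M \<Longrightarrow> \<zero>\<^bsub>N\<^esub> \<in> carrier N \<Longrightarrow>
          gen \<gamma> \<odot>\<^bsub>E\<^esub> \<sigma> m = \<sigma> (gen \<gamma> \<odot>\<^bsub>M\<^esub> m) \<oplus>\<^bsub>E\<^esub> i \<zero>\<^bsub>N\<^esub>"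
        using has_cocycle_sectionD[OF *] by blast
      have c: "\<sigma> m \<in> carrier E" if "m \<in> carrier M" for m using \<sigma>(1) that by auto
      have "\<sigma> \<in> mod_hom R M E"
        by (rule mod_hom_by_generators[OF M D(1) \<sigma>(1,2)])
          (use \<sigma>(4) i0 c gen_closed M.smult_closed in auto)
      then show "split_ext R M (i, E, p)" using \<sigma>(3) by (auto simp: split_ext_def)
    qed
  qed
  then have "X \<in> extensions R M N \<Longrightarrow> split_ext R M X \<longleftrightarrow> has_cocycle X (\<lambda>_ _. \<zero>\<^bsub>N\<^esub>)"
    for X :: "('r, 'm, 'n, 'd) ext"
    by (cases X) blast
  then show ?thesis using has_cocycle_extension unfolding ext_class_def by blast
qed

text \<open>
  Changing the retraction by an additive map \<open>h : M \<rightarrow> N\<close> changes the cocycle by the coboundary of \<open>h\<close>.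
\<close>

lemma has_cocycle_cohomologous:
  assumes "has_cocycle X \<delta>" "is_cochain \<delta>" "is_cochain \<delta>'"
    and h: "h \<in> carrier M \<rightarrow> carrier N"
    and h_add: "\<And>x y. x \<in> carrier M \<Longrightarrow> y \<in> carrier M \<Longrightarrow> h (x \<oplus>\<^bsub>M\<^esub> y) = h x \<oplus>\<^bsub>N\<^esub> h y"
    and eq: "\<And>\<gamma> m. \<gamma> \<in> \<Gamma> \<Longrightarrow> m \<in> carrier M \<Longrightarrow>
      \<delta>' \<gamma> m \<oplus>\<^bsub>N\<^esub> h (gen \<gamma> \<odot>\<^bsub>M\<^esub> m) = \<delta> \<gamma> m \<oplus>\<^bsub>N\<^esub> gen \<gamma> \<odot>\<^bsub>N\<^esub> h m"
  shows "has_cocycle X \<delta>'"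
proof -
  obtain i E p where X: "X = (i, E, p)" by (metis prod_cases3)
  note ext = has_cocycleD(1)[OF assms(1)[unfolded X]]
  note D = extensionsD[OF ext]
  interpret E: left_module R E by (rule D(1))
  have dc: "\<delta> \<gamma> m \<in> carrier N" "\<delta>' \<gamma> m \<in> carrier N" if "\<gamma> \<in> \<Gamma>" "m \<in> carrier M" for \<gamma> m
    using assms(2,3) that by (auto simp: is_cochain_def)
  obtain \<sigma> where \<sigma>: "\<sigma> \<in> carrier M \<rightarrow> carrier E"
    "\<And>x y. x \<in> carrier M \<Longrightarrow> y \<in> carrier M \<Longrightarrow> \<sigma> (x \<oplus>\<^bsub>M\<^esub> y) = \<sigma> x \<oplus>\<^bsub>E\<^esub> \<sigma> y"
    "\<And>m. m \<in> carrier M \<Longrightarrow> p (\<sigma> m) = m"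
    "\<And>\<gamma> m. \<gamma> \<in> \<Gamma> \<Longrightarrow> m \<in> carrier M \<Longrightarrow> \<delta> \<gamma> m \<in> carrier N \<Longrightarrow>
      gen \<gamma> \<odot>\<^bsub>E\<^esub> \<sigma> m = \<sigma> (gen \<gamma> \<odot>\<^bsub>M\<^esub> m) \<oplus>\<^bsub>E\<^esub> i (\<delta> \<gamma> m)"
    using has_cocycle_sectionD[OF assms(1)[unfolded X]] by blast
  have c: "\<sigma> m \<in> carrier E" "h m \<in> carrier N" if "m \<in> carrier M" for m using \<sigma>(1) h that by auto
  note i_add = mod_homD(2)[OF D(2)] and i_sm = mod_homD(3)[OF D(2)]
  show ?thesis
    unfolding X
  proof (rule has_cocycle_sectionI[OF ext, of "\<lambda>m. \<sigma> m \<oplus>\<^bsub>E\<^esub> i (h m)"])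
    show "gen \<gamma> \<odot>\<^bsub>E\<^esub> (\<sigma> m \<oplus>\<^bsub>E\<^esub> i (h m)) =
        \<sigma> (gen \<gamma> \<odot>\<^bsub>M\<^esub> m) \<oplus>\<^bsub>E\<^esub> i (h (gen \<gamma> \<odot>\<^bsub>M\<^esub> m)) \<oplus>\<^bsub>E\<^esub> i (\<delta>' \<gamma> m)"
      if "\<gamma> \<in> \<Gamma>" "m \<in> carrier M" for \<gamma> m
    proof -
      note g = gen_closed[OF that(1)]
      have gm: "gen \<gamma> \<odot>\<^bsub>M\<^esub> m \<in> carrier M" by (rule M.smult_closed[OF g that(2)])
      have "gen \<gamma> \<odot>\<^bsub>E\<^esub> (\<sigma> m \<oplus>\<^bsub>E\<^esub> i (h m)) =
          \<sigma> (gen \<gamma> \<odot>\<^bsub>M\<^esub> m) \<oplus>\<^bsub>E\<^esub> i (\<delta> \<gamma> m) \<oplus>\<^bsub>E\<^esub> i (gen \<gamma> \<odot>\<^bsub>N\<^esub> h m)"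
        using that g c D(8) dc[OF that] by (simp add: E.smult_r_distr \<sigma>(4) i_sm)
      also have "\<dots> = \<sigma> (gen \<gamma> \<odot>\<^bsub>M\<^esub> m) \<oplus>\<^bsub>E\<^esub> i (\<delta> \<gamma> m \<oplus>\<^bsub>N\<^esub> gen \<gamma> \<odot>\<^bsub>N\<^esub> h m)"
        using that g gm c D(8) dc[OF that] N.smult_closed by (simp add: i_add E.M.a_assoc)
      also have "\<dots> = \<sigma> (gen \<gamma> \<odot>\<^bsub>M\<^esub> m) \<oplus>\<^bsub>E\<^esub> i (\<delta>' \<gamma> m \<oplus>\<^bsub>N\<^esub> h (gen \<gamma> \<odot>\<^bsub>M\<^esub> m))"
        using eq[OF that] by simp
      also have "\<dots> = \<sigma> (gen \<gamma> \<odot>\<^bsub>M\<^esub> m) \<oplus>\<^bsub>E\<^esub> i (h (gen \<gamma> \<odot>\<^bsub>M\<^esub> m)) \<oplus>\<^bsub>E\<^esub> i (\<delta>' \<gamma> m)"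
        using gm c D(8) dc[OF that] by (simp add: i_add E.M.a_ac)
      finally show ?thesis .
    qed
    show "p (\<sigma> m \<oplus>\<^bsub>E\<^esub> i (h m)) = m" if "m \<in> carrier M" for m
      using that c D(7,8) \<sigma>(3) by (simp add: mod_homD(2)[OF D(3)])
    show "\<sigma> (x \<oplus>\<^bsub>M\<^esub> y) \<oplus>\<^bsub>E\<^esub> i (h (x \<oplus>\<^bsub>M\<^esub> y)) = \<sigma> x \<oplus>\<^bsub>E\<^esub> i (h x) \<oplus>\<^bsub>E\<^esub> (\<sigma> y \<oplus>\<^bsub>E\<^esub> i (h y))"
      if "x \<in> carrier M" "y \<in> carrier M" for x y
      using that c D(8) by (simp add: \<sigma>(2) h_add i_add E.M.a_ac)
  qed (use c dc D(8) in auto)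
qed

text \<open>
  Two retractions of the same inclusion differ by an additive map which factors through \<open>M\<close>.
\<close>

lemma cohomologous_if_has_cocycle:
  assumes "has_cocycle X \<delta>" "has_cocycle X \<delta>'" "is_cochain \<delta>" "is_cochain \<delta>'"
  obtains h where "h \<in> carrier M \<rightarrow> carrier N"
    "\<And>x y. x \<in> carrier M \<Longrightarrow> y \<in> carrier M \<Longrightarrow> h (x \<oplus>\<^bsub>M\<^esub> y) = h x \<oplus>\<^bsub>N\<^esub> h y"
    "\<And>\<gamma> m. \<gamma> \<in> \<Gamma> \<Longrightarrow> m \<in> carrier M \<Longrightarrow>
      \<delta>' \<gamma> m \<oplus>\<^bsub>N\<^esub> h (gen \<gamma> \<odot>\<^bsub>M\<^esub> m) = \<delta> \<gamma> m \<oplus>\<^bsub>N\<^esub> gen \<gamma> \<odot>\<^bsub>N\<^esub> h m"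
proof -
  obtain i E p where X: "X = (i, E, p)" by (metis prod_cases3)
  note ext = has_cocycleD(1)[OF assms(1)[unfolded X]]
  note D = extensionsD[OF ext]
  interpret E: left_module R E by (rule D(1))
  have dc: "\<delta> \<gamma> m \<in> carrier N" "\<delta>' \<gamma> m \<in> carrier N" if "\<gamma> \<in> \<Gamma>" "m \<in> carrier M" for \<gamma> m
    using assms(3,4) that by (auto simp: is_cochain_def)
  obtain \<rho> where r: "\<rho> \<in> carrier E \<rightarrow> carrier N"
    "\<And>x y. x \<in> carrier E \<Longrightarrow> y \<in> carrier E \<Longrightarrow> \<rho> (x \<oplus>\<^bsub>E\<^esub> y) = \<rho> x \<oplus>\<^bsub>N\<^esub> \<rho> y"
    "\<And>n. n \<in> carrier N \<Longrightarrow> \<rho> (i n) = n"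
    "\<And>\<gamma> e. \<gamma> \<in> \<Gamma> \<Longrightarrow> e \<in> carrier E \<Longrightarrow> \<rho> (gen \<gamma> \<odot>\<^bsub>E\<^esub> e) = gen \<gamma> \<odot>\<^bsub>N\<^esub> \<rho> e \<oplus>\<^bsub>N\<^esub> \<delta> \<gamma> (p e)"
    using has_cocycleD(2)[OF assms(1)[unfolded X]] by blast
  obtain \<sigma> where \<sigma>: "\<sigma> \<in> carrier M \<rightarrow> carrier E"
    "\<And>x y. x \<in> carrier M \<Longrightarrow> y \<in> carrier M \<Longrightarrow> \<sigma> (x \<oplus>\<^bsub>M\<^esub> y) = \<sigma> x \<oplus>\<^bsub>E\<^esub> \<sigma> y"
    "\<And>m. m \<in> carrier M \<Longrightarrow> p (\<sigma> m) = m"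
    "\<And>\<gamma> m. \<gamma> \<in> \<Gamma> \<Longrightarrow> m \<in> carrier M \<Longrightarrow> \<delta>' \<gamma> m \<in> carrier N \<Longrightarrow>
      gen \<gamma> \<odot>\<^bsub>E\<^esub> \<sigma> m = \<sigma> (gen \<gamma> \<odot>\<^bsub>M\<^esub> m) \<oplus>\<^bsub>E\<^esub> i (\<delta>' \<gamma> m)"
    using has_cocycle_sectionD[OF assms(2)[unfolded X]] by blast
  have c: "\<sigma> m \<in> carrier E" if "m \<in> carrier M" for m using \<sigma>(1) that by auto
  have rc: "\<rho> e \<in> carrier N" if "e \<in> carrier E" for e using r(1) that by auto
  show ?thesis
  proof (rule that[of "\<lambda>m. \<rho> (\<sigma> m)"])
    show "(\<lambda>m. \<rho> (\<sigma> m)) \<in> carrier M \<rightarrow> carrier N" using c rc by auto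
    show "\<rho> (\<sigma> (x \<oplus>\<^bsub>M\<^esub> y)) = \<rho> (\<sigma> x) \<oplus>\<^bsub>N\<^esub> \<rho> (\<sigma> y)" if "x \<in> carrier M" "y \<in> carrier M" for x y
      using that c by (simp add: \<sigma>(2) r(2))
    show "\<delta>' \<gamma> m \<oplus>\<^bsub>N\<^esub> \<rho> (\<sigma> (gen \<gamma> \<odot>\<^bsub>M\<^esub> m)) = \<delta> \<gamma> m \<oplus>\<^bsub>N\<^esub> gen \<gamma> \<odot>\<^bsub>N\<^esub> \<rho> (\<sigma> m)"
      if "\<gamma> \<in> \<Gamma>" "m \<in> carrier M" for \<gamma> m
    proof -
      note g = gen_closed[OF that(1)]
      have gm: "gen \<gamma> \<odot>\<^bsub>M\<^esub> m \<in> carrier M" by (rule M.smult_closed[OF g that(2)])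
      have "\<rho> (gen \<gamma> \<odot>\<^bsub>E\<^esub> \<sigma> m) = gen \<gamma> \<odot>\<^bsub>N\<^esub> \<rho> (\<sigma> m) \<oplus>\<^bsub>N\<^esub> \<delta> \<gamma> m"
        using r(4)[OF that(1) c[OF that(2)]] \<sigma>(3)[OF that(2)] by simp
      moreover have "\<rho> (gen \<gamma> \<odot>\<^bsub>E\<^esub> \<sigma> m) = \<rho> (\<sigma> (gen \<gamma> \<odot>\<^bsub>M\<^esub> m)) \<oplus>\<^bsub>N\<^esub> \<delta>' \<gamma> m"
        using \<sigma>(4)[OF that dc(2)[OF that]] c[OF gm] D(8)[OF dc(2)[OF that]] r(2,3) dc(2)[OF that] by simp
      ultimately show ?thesis
        using rc c gm that dc[OF that] N.smult_closed[OF g] by (metis N.M.a_comm)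
    qed
  qed
qed

end

section \<open>The path algebra and its representations\<close>

text \<open>
  The elements \<open>c \<pi>\<close> for a scalar \<open>c\<close> and a path \<open>\<pi>\<close>; they span the path algebra additively.
\<close>

definition mono :: "'k::field \<Rightarrow> ('v, 'a) path \<Rightarrow> ('v, 'a) path \<Rightarrow> 'k" where
  "mono c \<pi> = (\<lambda>\<rho>. if \<rho> = \<pi> then c else 0)"

lemma path_elt_eq_mono: "path_elt \<pi> = mono 1 \<pi>"
  by (simp add: path_elt_def mono_def)

lemma carrier_path_algebra:
  "F \<in> carrier (path_algebra Q) \<longleftrightarrow> finite {\<pi>. F \<pi> \<noteq> 0} \<and> (\<forall>\<pi>. F \<pi> \<noteq> 0 \<longrightarrow> \<pi> \<in> paths Q)"
  by (auto simp: path_algebra_def)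

lemma path_algebra_simps:
  "F \<oplus>\<^bsub>path_algebra Q\<^esub> G = (\<lambda>\<pi>. F \<pi> + G \<pi>)"
  "F \<otimes>\<^bsub>path_algebra Q\<^esub> G = path_mult Q F G"
  "\<zero>\<^bsub>path_algebra Q\<^esub> = (\<lambda>_. 0)"
  "\<one>\<^bsub>path_algebra Q\<^esub> = (\<lambda>(x, p). if x \<in> verts Q \<and> p = [] then 1 else 0)"
  by (auto simp: path_algebra_def)

lemma mono_carrier: "\<pi> \<in> paths Q \<Longrightarrow> mono c \<pi> \<in> carrier (path_algebra Q)"
  by (auto simp: carrier_path_algebra mono_def intro: finite_subset[of _ "{\<pi>}"])

lemma path_algebra_induct [consumes 1, case_names zero step]:
  assumes "F \<in> carrier (path_algebra Q)"
    and zero: "P (\<lambda>_. 0)"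
    and step: "\<And>c \<pi> G. \<pi> \<in> paths Q \<Longrightarrow> G \<in> carrier (path_algebra Q) \<Longrightarrow> P G \<Longrightarrow> P (\<lambda>\<rho>. mono c \<pi> \<rho> + G \<rho>)"
  shows "P F"
proof -
  have "P F" if "finite S" "{\<pi>. F \<pi> \<noteq> 0} \<subseteq> S" "S \<subseteq> paths Q" for S F
    using that
  proof (induct S arbitrary: F rule: finite_induct)
    case empty
    then have "F = (\<lambda>_. 0)" by auto
    then show ?case using zero by simp
  next
    case (insert \<pi> S)
    define G where "G = F(\<pi> := 0)"
    have sub: "{\<pi>. G \<pi> \<noteq> 0} \<subseteq> S" using insert.prems insert.hyps by (auto simp: G_def)
    have "P G" using insert.hyps(3)[OF sub] insert.prems by simp
    moreover have "G \<in> carrier (path_algebra Q)"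
      using sub insert.prems insert.hyps(1) by (auto simp: carrier_path_algebra dest: finite_subset)
    moreover have "F = (\<lambda>\<rho>. mono (F \<pi>) \<pi> \<rho> + G \<rho>)" by (auto simp: mono_def G_def)
    ultimately show ?case using step[of \<pi> G "F \<pi>"] insert.prems by simp
  qed
  from this[of "{\<pi>. F \<pi> \<noteq> 0}" F] show ?thesis
    using assms(1) unfolding carrier_path_algebra by blast
qed

abbreviation awlast_in :: "('v, 'a) pre_digraph \<Rightarrow> ('v, 'a) path \<Rightarrow> 'v" where
  "awlast_in Q \<pi> \<equiv> pre_digraph.awlast Q (fst \<pi>) (snd \<pi>)"

lemma awlast_simps:
  "pre_digraph.awlast Q x [] = x"
  "pre_digraph.awlast Q x (a # p) = pre_digraph.awlast Q (head Q a) p"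
  by (auto simp: pre_digraph.awalk_verts.simps)
    (cases p; simp add: pre_digraph.awalk_verts.simps)

lemma awlast_snoc: "pre_digraph.awlast Q x (p @ [a]) = head Q a"
  by (induct p arbitrary: x) (auto simp: awlast_simps)

lemma mult_mono_mono:
  "path_mult Q (mono c \<rho>) (mono d \<pi>) =
    (if fst \<rho> = awlast_in Q \<pi> then mono (c * d) (fst \<pi>, snd \<pi> @ snd \<rho>) else (\<lambda>_. 0))"
proof
  fix \<tau> :: "('a, 'b) path"
  obtain x p where \<tau>: "\<tau> = (x, p)" by (cases \<tau>)
  have "path_mult Q (mono c \<rho>) (mono d \<pi>) \<tau> =
      (\<Sum>i\<le>length p. if i = length (snd \<pi>) then
         (if fst \<rho> = awlast_in Q \<pi> \<and> \<tau> = (fst \<pi>, snd \<pi> @ snd \<rho>) then c * d else 0) else 0)"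
    unfolding \<tau> path_mult_def prod.case
  proof (rule sum.cong[OF refl])
    fix i assume i: "i \<in> {..length p}"
    have "mono c \<rho> (pre_digraph.awlast Q x (take i p), drop i p) * mono d \<pi> (x, take i p) =
      (if (pre_digraph.awlast Q x (take i p), drop i p) = \<rho> \<and> (x, take i p) = \<pi> then c * d else 0)"
      by (simp add: mono_def)
    also have "(pre_digraph.awlast Q x (take i p), drop i p) = \<rho> \<and> (x, take i p) = \<pi> \<longleftrightarrow>
       i = length (snd \<pi>) \<and> fst \<rho> = awlast_in Q \<pi> \<and> (x, p) = (fst \<pi>, snd \<pi> @ snd \<rho>)"
      (is "?A \<longleftrightarrow> ?B")
    proof
      assume ?A then show ?B using i by (auto simp: min_def)
    next
      assume ?B then show ?A by (cases \<rho>; cases \<pi>) auto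
    qed
    finally show "mono c \<rho> (pre_digraph.awlast Q x (take i p), drop i p) * mono d \<pi> (x, take i p) =
      (if i = length (snd \<pi>) then
         (if fst \<rho> = awlast_in Q \<pi> \<and> (x, p) = (fst \<pi>, snd \<pi> @ snd \<rho>) then c * d else 0) else 0)"
      by simp
  qed
  also have "\<dots> = (if fst \<rho> = awlast_in Q \<pi> \<and> \<tau> = (fst \<pi>, snd \<pi> @ snd \<rho>) then c * d else 0)"
    by (auto simp: \<tau>)
  also have "\<dots> = (if fst \<rho> = awlast_in Q \<pi> then mono (c * d) (fst \<pi>, snd \<pi> @ snd \<rho>) else (\<lambda>_. 0)) \<tau>"
    by (simp add: mono_def)
  finally show "path_mult Q (mono c \<rho>) (mono d \<pi>) \<tau> = \<dots>" .
qed

lemma paths_iff: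
  "(x, p) \<in> paths Q \<longleftrightarrow> x \<in> verts Q \<and> set p \<subseteq> arcs Q \<and> pre_digraph.cas Q x p (pre_digraph.awlast Q x p)"
proof -
  have "pre_digraph.cas Q x p y \<Longrightarrow> y = pre_digraph.awlast Q x p" for y
    by (induct p arbitrary: x) (auto simp: pre_digraph.cas.simps awlast_simps)
  then show ?thesis by (auto simp: paths_def pre_digraph.awalk_def)
qed

lemma paths_Nil: "(x, []) \<in> paths Q \<longleftrightarrow> x \<in> verts Q"
  by (auto simp: paths_iff pre_digraph.cas.simps awlast_simps)

lemma cas_snoc:
  "pre_digraph.cas Q x (p @ [a]) y \<longleftrightarrow> pre_digraph.cas Q x p (tail Q a) \<and> y = head Q a"
  by (induct p arbitrary: x) (auto simp: pre_digraph.cas.simps)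

lemma cas_awlast: "pre_digraph.cas Q x p y \<longleftrightarrow> pre_digraph.cas Q x p (pre_digraph.awlast Q x p) \<and> y = pre_digraph.awlast Q x p"
  by (induct p arbitrary: x) (auto simp: pre_digraph.cas.simps awlast_simps)

lemma paths_snoc:
  "(x, p @ [a]) \<in> paths Q \<longleftrightarrow> (x, p) \<in> paths Q \<and> a \<in> arcs Q \<and> tail Q a = pre_digraph.awlast Q x p"
  using cas_awlast[of Q x p "tail Q a"] by (auto simp: paths_iff cas_snoc awlast_snoc)

subsection \<open>Representations of the quiver\<close>

text \<open>
  The data \<open>d\<close>, \<open>vt\<close>, \<open>mat\<close> describe a representation of the quiver as soon as each arrow maps the
  space at its tail to the space at its head.
\<close>

locale quiver_rep =
  fixes Q :: "('v, 'a) pre_digraph" and d :: nat and vt :: "nat \<Rightarrow> 'v"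
    and mat :: "'a \<Rightarrow> nat \<Rightarrow> nat \<Rightarrow> 'k::field"
  assumes wf: "wf_digraph Q"
    and finite_verts: "finite (verts Q)"
    and vt: "\<And>i. i < d \<Longrightarrow> vt i \<in> verts Q"
    and mat: "\<And>a i j. a \<in> arcs Q \<Longrightarrow> i < d \<Longrightarrow> j < d \<Longrightarrow> mat a i j \<noteq> 0 \<Longrightarrow> vt i = tail Q a \<and> vt j = head Q a"
begin

abbreviation KQ :: "(('v, 'a) path \<Rightarrow> 'k) ring" where "KQ \<equiv> path_algebra Q"

definition space :: "(nat \<Rightarrow> 'k) set" where "space = {f. \<forall>i\<ge>d. f i = 0}"

abbreviation aact where "aact \<equiv> arrow_act d mat"
abbreviation pact where "pact \<equiv> path_act d vt mat"

definition act :: "(('v, 'a) path \<Rightarrow> 'k) \<Rightarrow> (nat \<Rightarrow> 'k) \<Rightarrow> nat \<Rightarrow> 'k" where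
  "act F f = (\<lambda>j. \<Sum>\<pi>\<in>{\<pi>. F \<pi> \<noteq> 0}. F \<pi> * pact \<pi> f j)"

lemma act_superset:
  assumes "finite S" "{\<pi>. F \<pi> \<noteq> 0} \<subseteq> S"
  shows "act F f j = (\<Sum>\<pi>\<in>S. F \<pi> * pact \<pi> f j)"
  unfolding act_def by (rule sum.mono_neutral_left) (use assms in auto)

lemma act_mono: "act (mono c \<pi>) f = (\<lambda>j. c * pact \<pi> f j)"
  by (rule ext, subst act_superset[of "{\<pi>}"]) (auto simp: mono_def)

lemma act_zero: "act (\<lambda>_. 0) f = (\<lambda>_. 0)"
  by (simp add: act_def)

lemma act_add:
  assumes "F \<in> carrier KQ" "G \<in> carrier KQ"
  shows "act (\<lambda>\<pi>. F \<pi> + G \<pi>) f = (\<lambda>j. act F f j + act G f j)"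
proof
  fix j
  let ?S = "{\<pi>. F \<pi> \<noteq> 0} \<union> {\<pi>. G \<pi> \<noteq> 0}"
  have S: "finite ?S" using assms by (simp add: carrier_path_algebra)
  show "act (\<lambda>\<pi>. F \<pi> + G \<pi>) f j = act F f j + act G f j"
    by (subst (1 2 3) act_superset[OF S]) (auto simp: sum.distrib algebra_simps)
qed

lemma aact_space: "aact a f \<in> space"
  by (simp add: arrow_act_def space_def)

lemma pact_space: "f \<in> space \<Longrightarrow> pact \<pi> f \<in> space"
proof -
  have "g \<in> space \<Longrightarrow> fold aact p g \<in> space" for p g
    by (induct p arbitrary: g) (auto simp: aact_space)
  then show "f \<in> space \<Longrightarrow> pact \<pi> f \<in> space"
    by (cases \<pi>) (auto simp: path_act_def space_def)
qed

lemma act_space: "f \<in> space \<Longrightarrow> act F f \<in> space"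
  using pact_space[of f] by (simp add: act_def space_def)

lemma aact_lin: "aact a (\<lambda>i. c * f i + g i) = (\<lambda>i. c * aact a f i + aact a g i)"
  by (auto simp: arrow_act_def sum.distrib sum_distrib_left algebra_simps)

lemma pact_lin: "pact \<pi> (\<lambda>i. c * f i + g i) = (\<lambda>i. c * pact \<pi> f i + pact \<pi> g i)"
proof -
  have "fold aact p (\<lambda>i. c * f i + g i) = (\<lambda>i. c * fold aact p f i + fold aact p g i)" for p f g
    by (induct p arbitrary: f g) (auto simp: aact_lin)
  moreover have "(\<lambda>i. if vt i = x then c * f i + g i else 0) =
      (\<lambda>i. c * (if vt i = x then f i else 0) + (if vt i = x then g i else 0))" for x
    by auto
  ultimately show ?thesis by (cases \<pi>) (simp add: path_act_def)
qed

lemma act_lin: "act F (\<lambda>i. c * f i + g i) = (\<lambda>i. c * act F f i + act F g i)"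
  unfolding act_def pact_lin by (simp add: sum.distrib sum_distrib_left algebra_simps)

lemma pact_zero: "pact \<pi> (\<lambda>_. 0) = (\<lambda>_. 0)"
  using pact_lin[of \<pi> "-1" "\<lambda>_. 0" "\<lambda>_. 0"] by (auto simp: fun_eq_iff)

lemma pact_snoc: "pact (x, p @ [a]) f = aact a (pact (x, p) f)"
  by (simp add: path_act_def)

lemma pact_Nil: "pact (x, []) f = (\<lambda>i. if vt i = x then f i else 0)"
  by (simp add: path_act_def)

lemma aact_supp:
  assumes "a \<in> arcs Q" "aact a f j \<noteq> 0"
  shows "vt j = head Q a"
proof -
  have "j < d" "(\<Sum>i<d. mat a i j * f i) \<noteq> 0" using assms(2) by (auto simp: arrow_act_def split: if_splits)
  then obtain i where "i < d" "mat a i j * f i \<noteq> 0" by (meson lessThan_iff sum.neutral)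
  then show ?thesis using mat[OF assms(1)] \<open>j < d\<close> by auto
qed

lemma aact_restrict:
  assumes "a \<in> arcs Q"
  shows "aact a (\<lambda>i. if vt i = tail Q a then f i else 0) = aact a f"
proof
  fix j
  have "mat a i j * (if vt i = tail Q a then f i else 0) = mat a i j * f i" if "i < d" "j < d" for i
    using mat[OF assms that] by auto
  then have "(\<Sum>i<d. mat a i j * (if vt i = tail Q a then f i else 0)) = (\<Sum>i<d. mat a i j * f i)" if "j < d"
    using that by (intro sum.cong) auto
  then show "aact a (\<lambda>i. if vt i = tail Q a then f i else 0) j = aact a f j"
    by (simp add: arrow_act_def)
qed

lemma pact_supp:
  assumes "\<pi> \<in> paths Q" "pact \<pi> f j \<noteq> 0"
  shows "vt j = awlast_in Q \<pi>"
proof -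
  obtain x p where \<pi>: "\<pi> = (x, p)" by (cases \<pi>)
  show ?thesis
  proof (cases p rule: rev_exhaust)
    case Nil
    then show ?thesis using assms(2) by (auto simp: \<pi> path_act_def awlast_simps split: if_splits)
  next
    case (snoc q a)
    then have "a \<in> arcs Q" using assms(1) by (simp add: \<pi> paths_snoc)
    then show ?thesis using assms(2) aact_supp by (simp add: \<pi> snoc pact_snoc awlast_snoc)
  qed
qed

lemma pact_pact:
  assumes \<pi>: "\<pi> \<in> paths Q"
  shows "pact \<rho> (pact \<pi> f) = (if fst \<rho> = awlast_in Q \<pi> then pact (fst \<pi>, snd \<pi> @ snd \<rho>) f else (\<lambda>_. 0))"
proof -
  obtain x p y q where [simp]: "\<pi> = (x, p)" "\<rho> = (y, q)" by (metis prod.exhaust)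
  have "(\<lambda>i. if vt i = y then pact (x, p) f i else 0) = (if y = awlast_in Q \<pi> then pact (x, p) f else (\<lambda>_. 0))"
    using pact_supp[OF \<pi>, of f] by (auto simp: fun_eq_iff)
  moreover have "fold aact q (\<lambda>_. 0) = (\<lambda>_. 0)"
    by (induct q) (auto simp: arrow_act_def cong: if_cong)
  moreover have "pact \<rho> g = fold aact q (\<lambda>i. if vt i = y then g i else 0)" for g
    by (simp add: path_act_def)
  moreover have "pact (x, p @ q) f = fold aact q (pact (x, p) f)"
    by (simp add: path_act_def)
  ultimately show ?thesis by simp
qed

text \<open>
  By bilinearity it suffices to compare the action of two paths, where incompatible paths give zero on
  both sides.
\<close>

lemma act_mult:
  assumes F: "F \<in> carrier KQ" and G: "G \<in> carrier KQ" and KQ: "ring KQ"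
  shows "act (path_mult Q F G) f = act F (act G f)"
proof -
  interpret PA: ring KQ by (rule KQ)
  have pm: "path_mult Q A B = A \<otimes>\<^bsub>KQ\<^esub> B" for A B by (simp add: path_algebra_simps)
  have dist_l: "path_mult Q (\<lambda>\<rho>. A \<rho> + B \<rho>) C = (\<lambda>\<rho>. path_mult Q A C \<rho> + path_mult Q B C \<rho>)"
    if "A \<in> carrier KQ" "B \<in> carrier KQ" "C \<in> carrier KQ" for A B C
    using PA.l_distr[OF that] by (simp add: path_algebra_simps)
  have dist_r: "path_mult Q C (\<lambda>\<rho>. A \<rho> + B \<rho>) = (\<lambda>\<rho>. path_mult Q C A \<rho> + path_mult Q C B \<rho>)"
    if "A \<in> carrier KQ" "B \<in> carrier KQ" "C \<in> carrier KQ" for A B C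
    using PA.r_distr[OF that] by (simp add: path_algebra_simps)
  have closed: "path_mult Q A B \<in> carrier KQ" if "A \<in> carrier KQ" "B \<in> carrier KQ" for A B
    using PA.m_closed[OF that] by (simp add: pm)
  have zero_l: "path_mult Q (\<lambda>_. 0) C = (\<lambda>_. 0)" "path_mult Q C (\<lambda>_. 0) = (\<lambda>_. 0)" for C :: "('v, 'a) path \<Rightarrow> 'k"
    by (auto simp: path_mult_def)
  have act_0: "act A (\<lambda>_. 0) = (\<lambda>_. 0)" for A by (simp add: act_def pact_zero)
  show ?thesis
    using F
  proof (induct F rule: path_algebra_induct)
    case zero
    then show ?case by (simp add: zero_l act_zero)
  next
    case (step c \<rho> F)
    have "act (path_mult Q (mono c \<rho>) G) f = act (mono c \<rho>) (act G f)"
      using G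
    proof (induct G rule: path_algebra_induct)
      case zero
      then show ?case by (simp add: zero_l act_zero act_0)
    next
      case (step e \<pi> G)
      have "act (path_mult Q (mono c \<rho>) (mono e \<pi>)) f = act (mono c \<rho>) (act (mono e \<pi>) f)"
        using pact_pact[OF step(1), of \<rho> f] pact_lin[of \<rho> e "pact \<pi> f" "\<lambda>_. 0"]
        by (auto simp: mult_mono_mono act_mono act_zero pact_zero fun_eq_iff)
      then show ?case
        using step act_lin[of "mono c \<rho>" 1 "act (mono e \<pi>) f" "act G f"] \<open>\<rho> \<in> paths Q\<close>
        by (simp add: dist_r mono_carrier closed act_add)
    qed
    then show ?case
      using step G by (simp add: dist_l mono_carrier closed act_add)
  qed
qed


text \<open>
  The elements acting as zero on all vectors form an ideal, so only the generators need to be tested.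
\<close>

lemma ideal_acts_zero:
  assumes I: "ideal I KQ" "I = Idl\<^bsub>KQ\<^esub> (path_elt ` P)" and P: "P \<subseteq> {\<pi> \<in> paths Q. length (snd \<pi>) = 2}"
    and rel: "\<And>a b f. a \<in> arcs Q \<Longrightarrow> b \<in> arcs Q \<Longrightarrow> head Q a = tail Q b \<Longrightarrow> zero_rel Q I b a \<Longrightarrow>
      aact b (aact a f) = (\<lambda>_. 0)"
    and F: "F \<in> I"
  shows "act F f = (\<lambda>_. 0)"
proof -
  interpret I: ideal I KQ by (rule I(1))
  have KQ: "ring KQ" by (rule I.ring_axioms)
  define K where "K = {F \<in> carrier KQ. \<forall>f. act F f = (\<lambda>_. 0)}"
  have act_0: "act A (\<lambda>_. 0) = (\<lambda>_. 0)" for A by (simp add: act_def pact_zero)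
  have pm: "A \<otimes>\<^bsub>KQ\<^esub> B = path_mult Q A B" for A B by (simp add: path_algebra_simps)
  have act_tensor: "act (A \<otimes>\<^bsub>KQ\<^esub> B) f = act A (act B f)" if "A \<in> carrier KQ" "B \<in> carrier KQ" for A B f
    using act_mult[OF that KQ] by (simp add: pm)
  have add: "act (A \<oplus>\<^bsub>KQ\<^esub> B) f = (\<lambda>j. act A f j + act B f j)" if "A \<in> carrier KQ" "B \<in> carrier KQ" for A B f
    using act_add[OF that] by (simp add: path_algebra_simps)
  have "ideal K KQ"
  proof (rule idealI[OF KQ])
    show "subgroup K (add_monoid KQ)"
    proof
      show "K \<subseteq> carrier (add_monoid KQ)" by (auto simp: K_def)
      show "A \<otimes>\<^bsub>add_monoid KQ\<^esub> B \<in> K" if "A \<in> K" "B \<in> K" for A B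
        using that by (auto simp: K_def add)
      show "\<one>\<^bsub>add_monoid KQ\<^esub> \<in> K"
        using I.zero_closed act_zero by (auto simp: K_def path_algebra_simps)
      show "inv\<^bsub>add_monoid KQ\<^esub> A \<in> K" if "A \<in> K" for A
      proof -
        have A: "A \<in> carrier KQ" "\<ominus>\<^bsub>KQ\<^esub> A \<in> carrier KQ" using that by (auto simp: K_def)
        have "act (\<ominus>\<^bsub>KQ\<^esub> A) f = (\<lambda>_. 0)" for f
          using add[OF A, of f] that I.r_neg[OF A(1)] act_zero[of f]
          by (simp add: K_def path_algebra_simps)
        then show ?thesis using A(2) by (simp add: K_def a_inv_def)
      qed
    qed
  qed (auto simp: K_def act_tensor act_0)
  moreover have "path_elt ` P \<subseteq> K"
  proof
    fix F :: "('v, 'a) path \<Rightarrow> 'k" assume "F \<in> path_elt ` P"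
    then obtain x p where \<pi>: "(x, p) \<in> P" "F = mono 1 (x, p)"
      by (auto simp: path_elt_eq_mono)
    then obtain a b where p: "p = [a, b]" using P by (auto simp: numeral_2_eq_2 length_Suc_conv)
    have path: "(x, p) \<in> paths Q" using \<pi> P by auto
    then have ab: "a \<in> arcs Q" "b \<in> arcs Q" "x = tail Q a" "head Q a = tail Q b"
      using paths_snoc[of x "[a]" b Q] paths_snoc[of x "[]" a Q] by (auto simp: p awlast_simps)
    have "path_elt ` P \<subseteq> carrier KQ" using P by (auto simp: path_elt_eq_mono intro!: mono_carrier)
    then have "path_elt ` P \<subseteq> I" unfolding I(2) by (rule I.genideal_self)
    then have "zero_rel Q I b a" using \<pi> by (auto simp: zero_rel_def p ab(3) path_elt_eq_mono)
    then have "pact (x, [a, b]) f = (\<lambda>_. 0)" for f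
      using rel[OF ab(1,2,4)] by (simp add: path_act_def)
    then show "F \<in> K" using mono_carrier[OF path] by (simp add: K_def \<pi>(2) act_mono p)
  qed
  ultimately have "I \<subseteq> K" unfolding I(2) by (rule I.genideal_minimal)
  then show ?thesis using F by (auto simp: K_def)
qed

end

text \<open>
  Scalars, vertices and arrows generate the algebra as a ring. Scalars are included because the modules
  are considered over the ring alone, without a separate vector space structure.
\<close>

datatype ('k, 'v, 'a) generator = Scal 'k | Vert 'v | Arr 'a

locale gentle_quiver =
  fixes Q :: "('v, 'a) pre_digraph" and I :: "(('v, 'a) path \<Rightarrow> 'k::field) set"
  assumes gentle: "gentle Q I"
begin

abbreviation PA :: "(('v, 'a) path \<Rightarrow> 'k) ring" where "PA \<equiv> path_algebra Q"
abbreviation \<Lambda> where "\<Lambda> \<equiv> gentle_alg Q I"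

sublocale fin_digraph Q
  using gentle by (simp add: gentle_def)

sublocale I: ideal I PA
  using gentle by (simp add: gentle_def admissible_ideal_def)

lemma PA_ring: "ring PA" by (rule I.ring_axioms)

lemma \<Lambda>_ring: "ring \<Lambda>" by (rule I.quotient_is_ring)

abbreviation cl where "cl F \<equiv> I +>\<^bsub>PA\<^esub> F"

lemma cl_hom:
  assumes "F \<in> carrier PA" "G \<in> carrier PA"
  shows "cl F \<oplus>\<^bsub>\<Lambda>\<^esub> cl G = cl (F \<oplus>\<^bsub>PA\<^esub> G)" "cl F \<otimes>\<^bsub>\<Lambda>\<^esub> cl G = cl (F \<otimes>\<^bsub>PA\<^esub> G)"
    "\<one>\<^bsub>\<Lambda>\<^esub> = cl \<one>\<^bsub>PA\<^esub>" "cl F \<in> carrier \<Lambda>"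
  using I.rcos_ring_hom assms by (auto simp: ring_hom_def)

lemma \<Lambda>_carrierE:
  assumes "X \<in> carrier \<Lambda>"
  obtains F where "F \<in> carrier PA" "X = cl F"
  using assms by (auto simp: FactRing_def A_RCOSETS_def')

definition unit_mult :: "'k \<Rightarrow> ('v, 'a) path \<Rightarrow> 'k" where
  "unit_mult c = (\<lambda>\<pi>. c * \<one>\<^bsub>PA\<^esub> \<pi>)"

lemma unit_mult_eq: "unit_mult c = (\<lambda>(x, p). if x \<in> verts Q \<and> p = [] then c else 0)"
  by (auto simp: unit_mult_def path_algebra_simps)

lemma unit_mult_carrier: "unit_mult c \<in> carrier PA"
proof -
  have "{\<pi>. unit_mult c \<pi> \<noteq> 0} \<subseteq> (\<lambda>x. (x, [])) ` verts Q"
    by (auto simp: unit_mult_eq split: if_splits)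
  then show ?thesis
    by (auto simp: carrier_path_algebra unit_mult_eq paths_Nil split: if_splits dest: finite_subset)
qed

lemma unit_mult_mult:
  assumes "F \<in> carrier PA"
  shows "unit_mult c \<otimes>\<^bsub>PA\<^esub> F = (\<lambda>\<pi>. c * F \<pi>)" "F \<otimes>\<^bsub>PA\<^esub> unit_mult c = (\<lambda>\<pi>. c * F \<pi>)"
proof -
  have "unit_mult c \<otimes>\<^bsub>PA\<^esub> F = (\<lambda>\<pi>. c * (\<one>\<^bsub>PA\<^esub> \<otimes>\<^bsub>PA\<^esub> F) \<pi>)"
    by (auto simp: path_algebra_simps(2) path_mult_def unit_mult_def sum_distrib_left mult.assoc)
  then show "unit_mult c \<otimes>\<^bsub>PA\<^esub> F = (\<lambda>\<pi>. c * F \<pi>)" using assms by simp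
  have "F \<otimes>\<^bsub>PA\<^esub> unit_mult c = (\<lambda>\<pi>. c * (F \<otimes>\<^bsub>PA\<^esub> \<one>\<^bsub>PA\<^esub>) \<pi>)"
    by (auto simp: path_algebra_simps(2) path_mult_def unit_mult_def sum_distrib_left mult_ac)
  then show "F \<otimes>\<^bsub>PA\<^esub> unit_mult c = (\<lambda>\<pi>. c * F \<pi>)" using assms by simp
qed

lemma scal_eq: "scal Q I c = cl (unit_mult c)"
  by (simp add: scal_def unit_mult_def)

lemma scal_carrier: "scal Q I c \<in> carrier \<Lambda>"
  using cl_hom(4) unit_mult_carrier by (auto simp: scal_eq)

lemma scal_central:
  assumes "r \<in> carrier \<Lambda>"
  shows "scal Q I c \<otimes>\<^bsub>\<Lambda>\<^esub> r = r \<otimes>\<^bsub>\<Lambda>\<^esub> scal Q I c"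
proof -
  obtain F where F: "F \<in> carrier PA" "r = cl F" by (rule \<Lambda>_carrierE[OF assms])
  then show ?thesis
    using unit_mult_mult[of F c] cl_hom(2)[OF unit_mult_carrier F(1)] cl_hom(2)[OF F(1) unit_mult_carrier]
    by (simp add: scal_eq)
qed

primrec gen :: "('k, 'v, 'a) generator \<Rightarrow> (('v, 'a) path \<Rightarrow> 'k) set" where
  "gen (Scal c) = scal Q I c"
| "gen (Vert x) = cl (path_elt (x, []))"
| "gen (Arr a) = cl (path_elt (tail Q a, [a]))"

definition gens :: "('k, 'v, 'a) generator set" where
  "gens = range Scal \<union> Vert ` verts Q \<union> Arr ` arcs Q"

lemma arc_path: "a \<in> arcs Q \<Longrightarrow> (tail Q a, [a]) \<in> paths Q"
  using paths_snoc[of "tail Q a" "[]" a Q] by (simp add: paths_Nil awlast_simps)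

lemma gen_closed: "\<gamma> \<in> gens \<Longrightarrow> gen \<gamma> \<in> carrier \<Lambda>"
  by (auto simp: gens_def path_elt_eq_mono arc_path paths_Nil
      intro!: cl_hom(4) scal_carrier mono_carrier)

lemma gen_induct:
  assumes "r \<in> carrier \<Lambda>" and gen: "\<And>\<gamma>. \<gamma> \<in> gens \<Longrightarrow> P (gen \<gamma>)"
    and add: "\<And>r s. r \<in> carrier \<Lambda> \<Longrightarrow> s \<in> carrier \<Lambda> \<Longrightarrow> P r \<Longrightarrow> P s \<Longrightarrow> P (r \<oplus>\<^bsub>\<Lambda>\<^esub> s)"
    and mult: "\<And>r s. r \<in> carrier \<Lambda> \<Longrightarrow> s \<in> carrier \<Lambda> \<Longrightarrow> P r \<Longrightarrow> P s \<Longrightarrow> P (r \<otimes>\<^bsub>\<Lambda>\<^esub> s)"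
  shows "P r"
proof -
  have 1: "P (cl (mono c (x, p)))" if "(x, p) \<in> paths Q" for c x p
    using that
  proof (induct p rule: rev_induct)
    case Nil
    have m: "mono 1 (x, []) \<in> carrier PA" by (rule mono_carrier[OF Nil])
    have "mono c (x, []) = unit_mult c \<otimes>\<^bsub>PA\<^esub> mono 1 (x, [])"
      using unit_mult_mult(1)[OF m, of c] by (simp add: mono_def fun_eq_iff)
    then have "cl (mono c (x, [])) = gen (Scal c) \<otimes>\<^bsub>\<Lambda>\<^esub> gen (Vert x)"
      using cl_hom(2)[OF unit_mult_carrier m] by (simp add: scal_eq path_elt_eq_mono)
    moreover have "Scal c \<in> gens" "Vert x \<in> gens" using Nil by (auto simp: gens_def paths_Nil)
    ultimately show ?case using mult[OF gen_closed gen_closed gen gen] by metis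
  next
    case (snoc a p)
    then have a: "(x, p) \<in> paths Q" "a \<in> arcs Q" "tail Q a = awlast_in Q (x, p)"
      by (auto simp: paths_snoc)
    have m: "mono 1 (tail Q a, [a]) \<in> carrier PA" "mono c (x, p) \<in> carrier PA"
      using a mono_carrier arc_path by blast+
    have "mono c (x, p @ [a]) = mono 1 (tail Q a, [a]) \<otimes>\<^bsub>PA\<^esub> mono c (x, p)"
      using a(3) by (simp add: path_algebra_simps mult_mono_mono)
    then have "cl (mono c (x, p @ [a])) = gen (Arr a) \<otimes>\<^bsub>\<Lambda>\<^esub> cl (mono c (x, p))"
      using cl_hom(2)[OF m] by (simp add: path_elt_eq_mono)
    moreover have "Arr a \<in> gens" using a by (auto simp: gens_def)
    ultimately show ?case using mult[OF gen_closed cl_hom(4)[OF m(2) m(2)] gen snoc(1)[OF a(1)]] by metis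
  qed
  obtain F where F: "F \<in> carrier PA" "r = cl F" by (rule \<Lambda>_carrierE[OF assms(1)])
  have "P (cl F)"
    using F(1)
  proof (induct F rule: path_algebra_induct)
    case zero
    have "cl (\<lambda>_. 0) = gen (Scal 0)" by (simp add: scal_def)
    then show ?case using gen[of "Scal 0"] by (auto simp: gens_def)
  next
    case (step c \<pi> G)
    have m: "mono c \<pi> \<in> carrier PA" by (rule mono_carrier[OF step(1)])
    have "cl (\<lambda>\<rho>. mono c \<pi> \<rho> + G \<rho>) = cl (mono c \<pi>) \<oplus>\<^bsub>\<Lambda>\<^esub> cl G"
      using cl_hom(1)[OF m step(2)] by (simp add: path_algebra_simps)
    moreover have "P (cl (mono c \<pi>))" using 1 step(1) by (cases \<pi>) auto
    ultimately show ?case using add[OF cl_hom(4)[OF m m] cl_hom(4)[OF step(2) step(2)]] step(3) by metis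
  qed
  then show ?thesis by (simp add: F)
qed

end

text \<open>
  A representation of the quiver in which the zero relations of length two hold; as these generate the
  ideal, it is a module over the gentle algebra.
\<close>

locale gentle_rep = gentle_quiver Q I + quiver_rep Q d vt mat
  for Q :: "('v, 'a) pre_digraph" and I :: "(('v, 'a) path \<Rightarrow> 'k::field) set"
    and d :: nat and vt :: "nat \<Rightarrow> 'v" and mat :: "'a \<Rightarrow> nat \<Rightarrow> nat \<Rightarrow> 'k" +
  assumes relations: "\<And>a b f. a \<in> arcs Q \<Longrightarrow> b \<in> arcs Q \<Longrightarrow> head Q a = tail Q b \<Longrightarrow> zero_rel Q I b a \<Longrightarrow>
      arrow_act d mat b (arrow_act d mat a f) = (\<lambda>_. 0)"
begin

abbreviation QM where "QM \<equiv> quiver_module Q I d vt mat"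

lemma QM_simps:
  "carrier QM = space" "\<zero>\<^bsub>QM\<^esub> = (\<lambda>_. 0)" "f \<oplus>\<^bsub>QM\<^esub> g = (\<lambda>i. f i + g i)"
  by (auto simp: quiver_module_def space_def)

lemma act_I:
  assumes "F \<in> I"
  shows "act F f = (\<lambda>_. 0)"
proof -
  obtain P where P: "P \<subseteq> {\<pi> \<in> paths Q. length (snd \<pi>) = 2}" "I = Idl\<^bsub>PA\<^esub> (path_elt ` P)"
    using gentle by (auto simp: gentle_def)
  show ?thesis by (rule ideal_acts_zero[OF I.ideal_axioms P(2,1) relations assms])
qed

lemma smult_cl:
  assumes F: "F \<in> carrier PA"
  shows "cl F \<odot>\<^bsub>QM\<^esub> f = act F f"
proof -
  have "F \<in> cl F" using F I.a_rcos_self by blast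
  then have some: "(SOME G. G \<in> cl F) \<in> cl F" by (rule someI[of "\<lambda>G. G \<in> cl F"])
  define H where "H = (SOME G. G \<in> cl F)"
  obtain i where i: "i \<in> I" "H = i \<oplus>\<^bsub>PA\<^esub> F"
    using some unfolding H_def[symmetric] by (auto simp: a_r_coset_def')
  have "cl F \<odot>\<^bsub>QM\<^esub> f = act (i \<oplus>\<^bsub>PA\<^esub> F) f"
    unfolding i(2)[symmetric] H_def by (simp add: quiver_module_def act_def Let_def)
  also have "\<dots> = act F f"
    using act_add[of i F f] i(1) F act_I by (simp add: path_algebra_simps)
  finally show ?thesis .
qed

lemma act_unit_mult:
  assumes "f \<in> space"
  shows "act (unit_mult c) f = (\<lambda>i. c * f i)"
proof
  fix j
  have "act (unit_mult c) f j = (\<Sum>\<pi>\<in>(\<lambda>x. (x, [])) ` verts Q. unit_mult c \<pi> * pact \<pi> f j)"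
    by (rule act_superset) (auto simp: unit_mult_eq split: if_splits)
  also have "\<dots> = (\<Sum>x\<in>verts Q. unit_mult c (x, []) * pact (x, []) f j)"
    by (subst sum.reindex) (auto simp: inj_on_def)
  also have "\<dots> = (\<Sum>x\<in>verts Q. if x = vt j then c * f j else 0)"
    by (intro sum.cong) (auto simp: unit_mult_eq pact_Nil)
  also have "\<dots> = c * f j"
  proof (cases "j < d")
    case True
    then show ?thesis using vt[OF True] by simp
  next
    case False
    then show ?thesis using assms by (simp add: space_def)
  qed
  finally show "act (unit_mult c) f j = c * f j" .
qed

lemma left_module_QM: "left_module \<Lambda> QM"
proof -
  have "abelian_group QM"
  proof (rule abelian_groupI)
    fix f assume "f \<in> carrier QM"
    then show "\<exists>g\<in>carrier QM. g \<oplus>\<^bsub>QM\<^esub> f = \<zero>\<^bsub>QM\<^esub>"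
      by (intro bexI[of _ "\<lambda>i. - f i"]) (auto simp: QM_simps space_def)
  qed (auto simp: QM_simps space_def add.assoc add.commute)
  moreover have "left_module_axioms \<Lambda> QM"
  proof
    fix r s f g
    assume r: "r \<in> carrier \<Lambda>" and f: "f \<in> carrier QM"
    obtain F where F: "F \<in> carrier PA" "r = cl F" by (rule \<Lambda>_carrierE[OF r])
    show "r \<odot>\<^bsub>QM\<^esub> f \<in> carrier QM"
      using f F by (simp add: smult_cl QM_simps act_space)
    show "r \<odot>\<^bsub>QM\<^esub> (f \<oplus>\<^bsub>QM\<^esub> g) = r \<odot>\<^bsub>QM\<^esub> f \<oplus>\<^bsub>QM\<^esub> r \<odot>\<^bsub>QM\<^esub> g"
      using F act_lin[of F 1 f g] by (simp add: smult_cl QM_simps)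
    assume s: "s \<in> carrier \<Lambda>"
    obtain G where G: "G \<in> carrier PA" "s = cl G" by (rule \<Lambda>_carrierE[OF s])
    show "(r \<oplus>\<^bsub>\<Lambda>\<^esub> s) \<odot>\<^bsub>QM\<^esub> f = r \<odot>\<^bsub>QM\<^esub> f \<oplus>\<^bsub>QM\<^esub> s \<odot>\<^bsub>QM\<^esub> f"
      using F G act_add[OF F(1) G(1)] I.a_closed[OF F(1) G(1)]
      by (simp add: cl_hom(1) smult_cl QM_simps path_algebra_simps)
    show "(r \<otimes>\<^bsub>\<Lambda>\<^esub> s) \<odot>\<^bsub>QM\<^esub> f = r \<odot>\<^bsub>QM\<^esub> (s \<odot>\<^bsub>QM\<^esub> f)"
      using F G act_mult[OF F(1) G(1) PA_ring] I.m_closed[OF F(1) G(1)]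
      by (simp add: cl_hom(2) smult_cl path_algebra_simps)
  next
    fix f assume f: "f \<in> carrier QM"
    have "\<one>\<^bsub>PA\<^esub> = unit_mult 1" by (simp add: unit_mult_def)
    then show "\<one>\<^bsub>\<Lambda>\<^esub> \<odot>\<^bsub>QM\<^esub> f = f"
      using f cl_hom(3)[OF unit_mult_carrier unit_mult_carrier] act_unit_mult[of f 1]
      by (simp add: smult_cl unit_mult_carrier QM_simps)
  qed
  ultimately show ?thesis
    by (intro left_module.intro \<Lambda>_ring)
qed

lemma smult_gen:
  assumes "f \<in> space"
  shows "gen (Scal c) \<odot>\<^bsub>QM\<^esub> f = (\<lambda>i. c * f i)"
    and "x \<in> verts Q \<Longrightarrow> gen (Vert x) \<odot>\<^bsub>QM\<^esub> f = (\<lambda>i. if vt i = x then f i else 0)"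
    and "a \<in> arcs Q \<Longrightarrow> gen (Arr a) \<odot>\<^bsub>QM\<^esub> f = arrow_act d mat a f"
proof -
  show "gen (Scal c) \<odot>\<^bsub>QM\<^esub> f = (\<lambda>i. c * f i)"
    using assms by (simp add: scal_eq smult_cl unit_mult_carrier act_unit_mult)
  show "gen (Vert x) \<odot>\<^bsub>QM\<^esub> f = (\<lambda>i. if vt i = x then f i else 0)" if "x \<in> verts Q"
    using that by (simp add: path_elt_eq_mono smult_cl mono_carrier paths_Nil act_mono pact_Nil)
  show "gen (Arr a) \<odot>\<^bsub>QM\<^esub> f = arrow_act d mat a f" if "a \<in> arcs Q"
    using that aact_restrict[OF that, of f]
    by (simp add: path_elt_eq_mono smult_cl mono_carrier arc_path act_mono path_act_def)
qed

end

section \<open>Sides of half-edges\<close>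

lemma card_le_2D:
  assumes "finite S" "card S \<le> 2" "x \<in> S" "y \<in> S" "z \<in> S"
  shows "x = y \<or> y = z \<or> x = z"
proof (rule ccontr)
  assume "\<not> ?thesis"
  then have "card {x, y, z} = 3" by simp
  moreover have "card {x, y, z} \<le> card S" by (rule card_mono) (use assms in auto)
  ultimately show False using assms(2) by simp
qed

lemma lsrc_linv [simp]: "lsrc Q (linv l) = ltgt Q l" "ltgt Q (linv l) = lsrc Q l"
  "letter_arc (linv l) = letter_arc l" "linv (linv l) = l"
  by (cases l; simp)+

context gentle_quiver
begin

text \<open>
  Half-edges at a vertex are given by letters starting there. Two of them are related if no string can
  enter along one and leave along the other.
\<close>

definition sim :: "'a letter \<Rightarrow> 'a letter \<Rightarrow> bool" where
  "sim l l' \<longleftrightarrow> l = l' \<or> (\<exists>c a. zero_rel Q I c a \<and> (l = Dir c \<and> l' = Inv a \<or> l = Inv a \<and> l' = Dir c))"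

lemma zero_rel_unique:
  assumes "a \<in> arcs Q" "b \<in> arcs Q" "b' \<in> arcs Q"
  shows "head Q a = tail Q b \<Longrightarrow> head Q a = tail Q b' \<Longrightarrow> zero_rel Q I b a = zero_rel Q I b' a \<Longrightarrow> b = b'"
    and "head Q b = tail Q a \<Longrightarrow> head Q b' = tail Q a \<Longrightarrow> zero_rel Q I a b = zero_rel Q I a b' \<Longrightarrow> b = b'"
proof -
  have eq: "x = y" if "card S \<le> 1" "S \<subseteq> arcs Q" "x \<in> S" "y \<in> S" for S and x y :: 'a
    using that card_le_Suc0_iff_eq[of S] finite_subset[OF that(2) finite_arcs] by auto
  note g = gentle[unfolded gentle_def]
  have c: "card {b \<in> arcs Q. head Q a = tail Q b \<and> \<not> zero_rel Q I b a} \<le> 1"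
    "card {c \<in> arcs Q. head Q c = tail Q a \<and> \<not> zero_rel Q I a c} \<le> 1"
    "card {b \<in> arcs Q. head Q a = tail Q b \<and> zero_rel Q I b a} \<le> 1"
    "card {c \<in> arcs Q. head Q c = tail Q a \<and> zero_rel Q I a c} \<le> 1"
    using g assms(1) by blast+
  show "b = b'" if "head Q a = tail Q b" "head Q a = tail Q b'" "zero_rel Q I b a = zero_rel Q I b' a"
    using eq[OF c(1), of b b'] eq[OF c(3), of b b'] that assms by auto
  show "b = b'" if "head Q b = tail Q a" "head Q b' = tail Q a" "zero_rel Q I a b = zero_rel Q I a b'"
    using eq[OF c(2), of b b'] eq[OF c(4), of b b'] that assms by auto
qed

lemma two_arcs:
  assumes "a \<in> arcs Q" "b \<in> arcs Q" "c \<in> arcs Q"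
  shows "tail Q a = tail Q b \<Longrightarrow> tail Q b = tail Q c \<Longrightarrow> a = b \<or> b = c \<or> a = c"
    and "head Q a = head Q b \<Longrightarrow> head Q b = head Q c \<Longrightarrow> a = b \<or> b = c \<or> a = c"
proof -
  have v: "tail Q a \<in> verts Q" "head Q a \<in> verts Q" using assms by auto
  note g = gentle[unfolded gentle_def]
  have c: "card {b \<in> arcs Q. tail Q b = tail Q a} \<le> 2" "card {b \<in> arcs Q. head Q b = head Q a} \<le> 2"
    using g v by blast+
  show "a = b \<or> b = c \<or> a = c" if "tail Q a = tail Q b" "tail Q b = tail Q c"
    by (rule card_le_2D[OF _ c(1)]) (use assms that finite_arcs in auto)
  show "a = b \<or> b = c \<or> a = c" if "head Q a = head Q b" "head Q b = head Q c"
    by (rule card_le_2D[OF _ c(2)]) (use assms that finite_arcs in auto)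
qed

lemma sim_sym: "sim l l' \<longleftrightarrow> sim l' l"
  by (auto simp: sim_def)

lemma sim_trans:
  assumes "letter_arc l \<in> arcs Q" "letter_arc l' \<in> arcs Q" "letter_arc k \<in> arcs Q"
    and "lsrc Q l = lsrc Q l'" "lsrc Q l' = lsrc Q k" "sim l l'" "sim l' k"
  shows "sim l k"
  using assms zero_rel_unique[of "letter_arc l'" "letter_arc l" "letter_arc k"]
  by (cases l; cases l'; cases k) (auto simp: sim_def)

text \<open>
  Three pairwise unrelated half-edges would violate the bounds on the number of arrows, or of arrows with
  nonzero composition, at a vertex.
\<close>

lemma sim_two_classes:
  assumes "letter_arc l \<in> arcs Q" "letter_arc l' \<in> arcs Q" "letter_arc k \<in> arcs Q"
    and "lsrc Q l = lsrc Q l'" "lsrc Q l' = lsrc Q k" "\<not> sim l l'"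
  shows "sim l k \<or> sim l' k"
proof (rule ccontr)
  assume neg: "\<not> (sim l k \<or> sim l' k)"
  have z1: False if "a \<in> arcs Q" "c \<in> arcs Q" "c' \<in> arcs Q" "head Q a = tail Q c" "head Q a = tail Q c'"
    "\<not> zero_rel Q I c a" "\<not> zero_rel Q I c' a" "c \<noteq> c'" for a c c'
    using zero_rel_unique(1)[OF that(1-5)] that(6-8) by blast
  have z2: False if "c \<in> arcs Q" "a \<in> arcs Q" "a' \<in> arcs Q" "head Q a = tail Q c" "head Q a' = tail Q c"
    "\<not> zero_rel Q I c a" "\<not> zero_rel Q I c a'" "a \<noteq> a'" for c a a'
    using zero_rel_unique(2)[OF that(1-5)] that(6-8) by blast
  show False
  proof (cases l)
    case l: (Dir x)
    show False
    proof (cases l')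
      case l': (Dir y)
      show False
        using z1[of _ x y] two_arcs(1)[of x y] assms neg by (cases k) (auto simp: sim_def l l')
    next
      case l': (Inv y)
      show False
        using z1[of y x] z2[of x y] assms neg by (cases k) (auto simp: sim_def l l')
    qed
  next
    case l: (Inv x)
    show False
    proof (cases l')
      case l': (Dir y)
      show False
        using z1[of x y] z2[of y x] assms neg by (cases k) (auto simp: sim_def l l')
    next
      case l': (Inv y)
      show False
        using z2[of _ x y] two_arcs(2)[of x y] assms neg by (cases k) (auto simp: sim_def l l')
    qed
  qed
qed

text \<open>
  By the gentle axioms the half-edges at a vertex fall into at most two classes, one for each of the
  two ways in which a string can pass through; \<open>side\<close> names these classes.
\<close>

definition side :: "'a letter \<Rightarrow> bool" where
  "side l \<longleftrightarrow> sim l (SOME r. letter_arc r \<in> arcs Q \<and> lsrc Q r = lsrc Q l)"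

lemma side_eq_iff_sim:
  assumes "letter_arc l \<in> arcs Q" "letter_arc l' \<in> arcs Q" "lsrc Q l = lsrc Q l'"
  shows "side l = side l' \<longleftrightarrow> sim l l'"
proof -
  define r where "r = (SOME r. letter_arc r \<in> arcs Q \<and> lsrc Q r = lsrc Q l)"
  have r: "letter_arc r \<in> arcs Q \<and> lsrc Q r = lsrc Q l"
    unfolding r_def by (rule someI[of _ l]) (use assms in auto)
  have s: "side l = sim l r" "side l' = sim l' r" by (simp_all add: side_def r_def assms(3))
  show ?thesis
  proof
    assume "side l = side l'"
    then show "sim l l'"
      unfolding s using sim_trans[of l r l'] sim_two_classes[of l r l'] sim_sym r assms by metis
  next
    assume "sim l l'"
    then show "side l = side l'"
      unfolding s using sim_trans[of l l' r] sim_trans[of l' l r] sim_sym r assms by metis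
  qed
qed

lemma side_simps:
  assumes "a \<in> arcs Q" "c \<in> arcs Q"
  shows "tail Q a = tail Q c \<Longrightarrow> side (Dir a) = side (Dir c) \<longleftrightarrow> a = c"
    and "head Q a = head Q c \<Longrightarrow> side (Inv a) = side (Inv c) \<longleftrightarrow> a = c"
    and "head Q a = tail Q c \<Longrightarrow> side (Dir c) = side (Inv a) \<longleftrightarrow> zero_rel Q I c a"
    and "head Q a = tail Q c \<Longrightarrow> side (Inv a) = side (Dir c) \<longleftrightarrow> zero_rel Q I c a"
  using assms side_eq_iff_sim[of "Dir a" "Dir c"] side_eq_iff_sim[of "Inv a" "Inv c"]
    side_eq_iff_sim[of "Dir c" "Inv a"]
  by (auto simp: sim_def)

definition step :: "'a letter \<Rightarrow> 'a letter \<Rightarrow> bool" where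
  "step l l' \<longleftrightarrow> lsrc Q l' = ltgt Q l \<and> side (linv l) \<noteq> side l'"

section \<open>Words as diagrams on the integers\<close>

text \<open>
  A word with places in the integers, possibly infinite in both directions. The letter at place
  \<open>j\<close> joins the vertices at places \<open>j\<close> and \<open>j + 1\<close>.
\<close>

definition walk :: "(int \<Rightarrow> 'a letter option) \<Rightarrow> bool" where
  "walk \<omega> \<longleftrightarrow> (\<forall>j l. \<omega> j = Some l \<longrightarrow> letter_arc l \<in> arcs Q) \<and>
     (\<forall>j l l'. \<omega> j = Some l \<longrightarrow> \<omega> (j + 1) = Some l' \<longrightarrow> step l l')"

lemma walkD:
  assumes "walk \<omega>"
  shows "\<omega> j = Some l \<Longrightarrow> letter_arc l \<in> arcs Q"
    and "\<omega> j = Some l \<Longrightarrow> \<omega> (j + 1) = Some l' \<Longrightarrow> lsrc Q l' = ltgt Q l \<and> side (linv l) \<noteq> side l'"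
    and "\<omega> (j - 1) = Some l \<Longrightarrow> \<omega> j = Some l' \<Longrightarrow> lsrc Q l' = ltgt Q l \<and> side (linv l) \<noteq> side l'"
proof -
  show "letter_arc l \<in> arcs Q" if "\<omega> j = Some l" using assms that unfolding walk_def by blast
  show *: "lsrc Q l' = ltgt Q l \<and> side (linv l) \<noteq> side l'" if "\<omega> j = Some l" "\<omega> (j + 1) = Some l'" for j
    using assms that unfolding walk_def step_def by blast
  show "lsrc Q l' = ltgt Q l \<and> side (linv l) \<noteq> side l'" if "\<omega> (j - 1) = Some l" "\<omega> j = Some l'"
    using *[of "j - 1"] that by simp
qed

end

text \<open>
  The action of the arrow \<open>a\<close> on functions on the places of a diagram, all letters having weight one.
\<close>

definition lact :: "(int \<Rightarrow> 'a letter option) \<Rightarrow> 'a \<Rightarrow> (int \<Rightarrow> 'k::field) \<Rightarrow> int \<Rightarrow> 'k" where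
  "lact \<omega> a g = (\<lambda>j. (if \<omega> (j - 1) = Some (Dir a) then g (j - 1) else 0) +
                      (if \<omega> j = Some (Inv a) then g (j + 1) else 0))"

text \<open>
  If \<open>ba \<in> I\<close>, then \<open>b\<close> and the inverse of \<open>a\<close> are on the same side, so that \<open>a\<close> and \<open>b\<close> are never consecutive
  letters of a walk.
\<close>

lemma (in gentle_quiver) lact_relation:
  assumes "walk \<omega>" "zero_rel Q I b a" "a \<in> arcs Q" "b \<in> arcs Q" "head Q a = tail Q b"
  shows "lact \<omega> b (lact \<omega> a g) = (\<lambda>_. 0)"
proof
  fix j
  have s: "side (Dir b) = side (Inv a)" using side_simps(3)[OF assms(3,4,5)] assms(2) by simp
  have "\<not> (\<omega> (j - 1) = Some (Dir b) \<and> \<omega> (j - 1 - 1) = Some (Dir a))"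
    using walkD(3)[OF assms(1), of "j - 1" "Dir a" "Dir b"] s by auto
  moreover have "\<not> (\<omega> j = Some (Inv b) \<and> \<omega> (j + 1) = Some (Inv a))"
    using walkD(2)[OF assms(1), of j "Inv b" "Inv a"] s by auto
  ultimately show "lact \<omega> b (lact \<omega> a g) j = 0" by (auto simp: lact_def)
qed

definition zext :: "(nat \<Rightarrow> 'k::field) \<Rightarrow> int \<Rightarrow> 'k" where
  "zext f j = (if 0 \<le> j then f (nat j) else 0)"

definition word_diagram :: "'a letter list \<Rightarrow> int \<Rightarrow> 'a letter option" where
  "word_diagram ls j = (if 0 \<le> j \<and> j < int (length ls) then Some (ls ! nat j) else None)"

lemma arrow_act_letter_mat:
  assumes "length ls \<le> d" "\<And>t. t < length ls \<Longrightarrow> nxt t < d" "j < d"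
  shows "arrow_act d (letter_mat ls nxt wt) a f j =
    (\<Sum>t<length ls. (if ls ! t = Dir a \<and> j = nxt t then wt t * f t else 0) +
                    (if ls ! t = Inv a \<and> j = t then wt t * f (nxt t) else 0))"
proof -
  have "arrow_act d (letter_mat ls nxt wt) a f j =
      (\<Sum>i<d. \<Sum>t<length ls. (if ls ! t = Dir a \<and> i = t \<and> j = nxt t \<or> ls ! t = Inv a \<and> i = nxt t \<and> j = t
                     then wt t else 0) * f i)"
    using assms(3) by (simp add: arrow_act_def letter_mat_def sum_distrib_right)
  also have "\<dots> = (\<Sum>t<length ls. \<Sum>i<d. (if i = t then if ls ! t = Dir a \<and> j = nxt t then wt t * f t else 0 else 0) +
      (if i = nxt t then if ls ! t = Inv a \<and> j = t then wt t * f (nxt t) else 0 else 0))"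
    by (subst sum.swap) (auto intro!: sum.cong)
  also have "\<dots> = (\<Sum>t<length ls. (if ls ! t = Dir a \<and> j = nxt t then wt t * f t else 0) +
                    (if ls ! t = Inv a \<and> j = t then wt t * f (nxt t) else 0))"
    using assms(1,2) by (intro sum.cong) (auto simp: sum.distrib)
  finally show ?thesis .
qed

lemma string_arrow_act:
  assumes "j \<le> length ls"
  shows "arrow_act (Suc (length ls)) (letter_mat ls Suc (\<lambda>_. 1)) a f j = lact (word_diagram ls) a (zext f) (int j)"
proof -
  have "arrow_act (Suc (length ls)) (letter_mat ls Suc (\<lambda>_. 1)) a f j =
    (\<Sum>t<length ls. (if ls ! t = Dir a \<and> j = Suc t then f t else 0) +
                    (if ls ! t = Inv a \<and> j = t then f (Suc t) else 0))"
    using assms by (subst arrow_act_letter_mat) (auto intro!: sum.cong)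
  also have "\<dots> = (\<Sum>t<length ls. if t = j - 1 then (if 0 < j \<and> ls ! (j - 1) = Dir a then f (j - 1) else 0) else 0) +
      (\<Sum>t<length ls. if t = j then (if ls ! j = Inv a then f (Suc j) else 0) else 0)"
    unfolding sum.distrib by (intro arg_cong2[where f = "(+)"] sum.cong) auto
  also have "\<dots> = (if 0 < j \<and> ls ! (j - 1) = Dir a then f (j - 1) else 0) +
      (if j < length ls \<and> ls ! j = Inv a then f (Suc j) else 0)"
    unfolding sum.delta[OF finite_lessThan] using assms by auto
  also have "\<dots> = lact (word_diagram ls) a (zext f) (int j)"
    using assms by (auto simp: lact_def zext_def word_diagram_def nat_diff_distrib nat_add_distrib)
  finally show ?thesis .
qed

context gentle_quiver
begin

definition good_word :: "('v, 'a) word \<Rightarrow> bool" where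
  "good_word w \<longleftrightarrow> fst w \<in> verts Q \<and> (snd w \<noteq> [] \<longrightarrow> fst w = lsrc Q (hd (snd w))) \<and>
     walk (word_diagram (snd w))"

lemma walk_word_diagram_iff:
  "walk (word_diagram ls) \<longleftrightarrow> letter_arc ` set ls \<subseteq> arcs Q \<and>
    (\<forall>i. Suc i < length ls \<longrightarrow> step (ls ! i) (ls ! Suc i))"
proof
  assume w: "walk (word_diagram ls)"
  have "letter_arc (ls ! i) \<in> arcs Q" if "i < length ls" for i
    using walkD(1)[OF w, of "int i"] that by (simp add: word_diagram_def)
  moreover have "step (ls ! i) (ls ! Suc i)" if "Suc i < length ls" for i
    using walkD(2)[OF w, of "int i" "ls ! i" "ls ! Suc i"] that
    by (simp add: word_diagram_def step_def nat_add_distrib)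
  ultimately show "letter_arc ` set ls \<subseteq> arcs Q \<and> (\<forall>i. Suc i < length ls \<longrightarrow> step (ls ! i) (ls ! Suc i))"
    by (auto simp: in_set_conv_nth)
next
  assume *: "letter_arc ` set ls \<subseteq> arcs Q \<and> (\<forall>i. Suc i < length ls \<longrightarrow> step (ls ! i) (ls ! Suc i))"
  have "step l l'" if "word_diagram ls j = Some l" "word_diagram ls (j + 1) = Some l'" for j l l'
    using that *[THEN conjunct2, rule_format, of "nat j"]
    by (auto simp: word_diagram_def nat_add_distrib split: if_splits)
  moreover have "letter_arc l \<in> arcs Q" if "word_diagram ls j = Some l" for j l
    using that * by (auto simp: word_diagram_def split: if_splits)
  ultimately show "walk (word_diagram ls)" by (auto simp: walk_def)
qed

lemma word_vert_lsrc:
  assumes "good_word w" "t < length (snd w)"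
  shows "word_vert Q w t = lsrc Q (snd w ! t)"
proof (cases t)
  case 0
  then show ?thesis using assms by (auto simp: word_vert_def good_word_def hd_conv_nth)
next
  case (Suc i)
  then show ?thesis
    using assms unfolding good_word_def walk_word_diagram_iff by (simp add: word_vert_def step_def)
qed

lemma word_vert_ltgt: "word_vert Q w (Suc t) = ltgt Q (snd w ! t)"
  by (simp add: word_vert_def)

lemma lsrc_verts: "letter_arc l \<in> arcs Q \<Longrightarrow> lsrc Q l \<in> verts Q" "letter_arc l \<in> arcs Q \<Longrightarrow> ltgt Q l \<in> verts Q"
  by (cases l; simp)+

lemma letter_mat_nonzeroE:
  assumes "letter_mat ls nxt wt a i j \<noteq> 0"
  obtains t where "t < length ls" "ls ! t = Dir a \<and> i = t \<and> j = nxt t \<or> ls ! t = Inv a \<and> i = nxt t \<and> j = t"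
proof -
  have "\<exists>t<length ls. (if ls ! t = Dir a \<and> i = t \<and> j = nxt t \<or> ls ! t = Inv a \<and> i = nxt t \<and> j = t
       then wt t else 0) \<noteq> 0"
  proof (rule ccontr)
    assume "\<not> ?thesis"
    then have "letter_mat ls nxt wt a i j = 0"
      unfolding letter_mat_def by (intro sum.neutral) blast
    then show False using assms by simp
  qed
  then show ?thesis using that by (metis (mono_tags))
qed

lemma string_rep:
  assumes w: "good_word w"
  shows "gentle_rep Q I (Suc (length (snd w))) (word_vert Q w) (letter_mat (snd w) Suc (\<lambda>_. 1))"
proof
  let ?ls = "snd w"
  let ?d = "Suc (length ?ls)" and ?mat = "letter_mat ?ls Suc (\<lambda>_. 1 :: 'k)"
  note walk = w[unfolded good_word_def, THEN conjunct2, THEN conjunct2]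
  show "word_vert Q w i \<in> verts Q" if "i < ?d" for i
  proof (cases i)
    case 0
    then show ?thesis using w by (simp add: word_vert_def good_word_def)
  next
    case (Suc t)
    then show ?thesis
      using that walk lsrc_verts(2)[of "?ls ! t"] nth_mem[of t ?ls]
      unfolding walk_word_diagram_iff by (simp add: word_vert_ltgt image_subset_iff)
  qed
  show "word_vert Q w i = tail Q a \<and> word_vert Q w j = head Q a" if "?mat a i j \<noteq> 0" for a i j
    using that by (rule letter_mat_nonzeroE) (auto simp: word_vert_lsrc[OF w] word_vert_ltgt)
  show "arrow_act ?d ?mat b (arrow_act ?d ?mat a f) = (\<lambda>_. 0)"
    if "a \<in> arcs Q" "b \<in> arcs Q" "head Q a = tail Q b" "zero_rel Q I b a" for a b f
  proof
    fix j
    have e: "lact (word_diagram ?ls) b (zext (arrow_act ?d ?mat a f)) i =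
        lact (word_diagram ?ls) b (lact (word_diagram ?ls) a (zext f)) i" for i
    proof -
      have "zext (arrow_act ?d ?mat a f) k = lact (word_diagram ?ls) a (zext f) k"
        if "0 \<le> k" "k \<le> int (length ?ls)" for k
        using that string_arrow_act[of "nat k" ?ls a f] by (simp add: zext_def)
      then show ?thesis by (simp add: lact_def[of _ b] word_diagram_def)
    qed
    show "arrow_act ?d ?mat b (arrow_act ?d ?mat a f) j = 0"
    proof (cases "j \<le> length ?ls")
      case True
      then show ?thesis
        using lact_relation[OF walk that(4,1,2,3), of "zext f"] by (simp add: string_arrow_act e)
    qed (simp add: arrow_act_def)
  qed
qed auto

end

context gentle_quiver
begin

text \<open>
  A direct path without zero relations acts on its string module by sending the first basis vector to
  the last one. Since the ideal acts as zero, the path does not belong to it.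
\<close>

lemma direct_path_notin_I:
  assumes "p \<noteq> []" and arcs: "set p \<subseteq> arcs Q"
    and step: "\<And>i. Suc i < length p \<Longrightarrow> head Q (p ! i) = tail Q (p ! Suc i) \<and> \<not> zero_rel Q I (p ! Suc i) (p ! i)"
  shows "path_elt (tail Q (hd p), p) \<notin> I"
proof
  assume mem: "path_elt (tail Q (hd p), p) \<in> I"
  define ls where "ls = map Dir p"
  define w where "w = word_of Q ls"
  have arc: "p ! i \<in> arcs Q" if "i < length p" for i using arcs that by auto
  have w: "good_word w"
    unfolding good_word_def walk_word_diagram_iff
  proof (intro conjI allI impI)
    show "fst w \<in> verts Q" using assms(1) arc[of 0] by (simp add: w_def word_of_def ls_def hd_map hd_conv_nth)
    show "letter_arc ` set (snd w) \<subseteq> arcs Q" using arcs by (auto simp: w_def word_of_def ls_def)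
    show "step (snd w ! i) (snd w ! Suc i)" if "Suc i < length (snd w)" for i
    proof -
      have i: "Suc i < length p" using that by (simp add: w_def word_of_def ls_def)
      then show ?thesis
        using step[OF i] side_simps(4)[OF arc arc, of i "Suc i"] by (simp add: w_def word_of_def ls_def step_def)
    qed
  qed (simp add: w_def word_of_def)
  interpret w: gentle_rep Q I "Suc (length (snd w))" "word_vert Q w" "letter_mat (snd w) Suc (\<lambda>_. 1 :: 'k)"
    by (rule string_rep[OF w])
  define e :: "nat \<Rightarrow> nat \<Rightarrow> 'k" where "e k = (\<lambda>i. if i = k then 1 else 0)" for k
  have snd_w: "snd w = ls" by (simp add: w_def word_of_def)
  have aact: "w.aact (p ! k) (e k) = e (Suc k)" if k: "k < length p" for k
  proof
    fix j
    show "w.aact (p ! k) (e k) j = e (Suc k) j"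
    proof (cases "j \<le> length ls")
      case True
      have "w.aact (p ! k) (e k) j = lact (word_diagram ls) (p ! k) (zext (e k)) (int j)"
        using string_arrow_act[OF True] by (simp add: snd_w)
      also have "\<dots> = e (Suc k) j"
        using k by (auto simp: lact_def word_diagram_def ls_def zext_def e_def)
      finally show ?thesis .
    next
      case False
      then show ?thesis using k by (simp add: arrow_act_def e_def snd_w ls_def)
    qed
  qed
  have "fold w.aact (take k p) (e 0) = e k" if "k \<le> length p" for k
    using that by (induct k) (auto simp: take_Suc_conv_app_nth aact)
  from this[of "length p"] have "fold w.aact p (e 0) = e (length p)" by simp
  moreover have "(\<lambda>i. if word_vert Q w i = tail Q (hd p) then e 0 i else 0) = e 0"
    using assms(1) by (auto simp: e_def word_vert_def w_def word_of_def ls_def hd_map)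
  ultimately have 1: "w.pact (tail Q (hd p), p) (e 0) = e (length p)" by (simp add: path_act_def)
  have 2: "w.pact (tail Q (hd p), p) (e 0) = (\<lambda>_. 0)"
    using w.act_I[OF mem, of "e 0"] by (simp add: path_elt_eq_mono w.act_mono)
  have "e (length p) (length p) = 0" by (rule fun_cong[OF trans[OF 1[symmetric] 2]])
  then show False by (simp add: e_def)
qed

lemma sublist_pair:
  assumes "Suc i < length ls"
  shows "sublist [ls ! i, ls ! Suc i] ls"
proof -
  have "ls = take i ls @ [ls ! i, ls ! Suc i] @ drop (Suc (Suc i)) ls"
    using id_take_nth_drop[of i ls] Cons_nth_drop_Suc[of "Suc i" ls] assms by simp
  then show ?thesis unfolding sublist_def by blast
qed

lemma sublist_nth:
  assumes "sublist xs ls"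
  obtains k where "k + length xs \<le> length ls" "\<And>i. i < length xs \<Longrightarrow> xs ! i = ls ! (k + i)"
proof -
  obtain ps ss where "ls = ps @ xs @ ss" using assms by (auto simp: sublist_def)
  then show ?thesis using that[of "length ps"] by (simp add: nth_append)
qed

text \<open>
  Since \<open>I\<close> is generated by paths of length two, being a string is a condition on consecutive letters.
\<close>

lemma is_string_iff: "is_string Q I w \<longleftrightarrow> good_word w"
proof -
  obtain x ls where w: "w = (x, ls)" by (cases w)
  let ?arcs = "letter_arc ` set ls \<subseteq> arcs Q"
  have arc: "letter_arc (ls ! i) \<in> arcs Q" if ?arcs "i < length ls" for i
    using that by (meson image_subset_iff nth_mem)
  have "((\<forall>i. Suc i < length ls \<longrightarrow> lsrc Q (ls ! Suc i) = ltgt Q (ls ! i) \<and> ls ! Suc i \<noteq> linv (ls ! i)) \<and>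
       (\<forall>p. p \<noteq> [] \<and> sublist (map Dir p) ls \<longrightarrow> path_elt (tail Q (hd p), p) \<notin> I) \<and>
       (\<forall>p. p \<noteq> [] \<and> sublist (map Inv (rev p)) ls \<longrightarrow> path_elt (tail Q (hd p), p) \<notin> I)) \<longleftrightarrow>
    (\<forall>i. Suc i < length ls \<longrightarrow> step (ls ! i) (ls ! Suc i))" (is "?L \<longleftrightarrow> ?R") if A: ?arcs
  proof
    assume L: ?L
    show ?R
    proof (intro allI impI)
      fix i assume i: "Suc i < length ls"
      have v: "lsrc Q (ls ! Suc i) = ltgt Q (ls ! i)" "ls ! Suc i \<noteq> linv (ls ! i)" using L i by auto
      have "\<not> sim (linv (ls ! i)) (ls ! Suc i)"
      proof
        assume "sim (linv (ls ! i)) (ls ! Suc i)"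
        then obtain c a where ca: "zero_rel Q I c a"
          "linv (ls ! i) = Dir c \<and> ls ! Suc i = Inv a \<or> linv (ls ! i) = Inv a \<and> ls ! Suc i = Dir c"
          using v(2) by (auto simp: sim_def)
        then have "[ls ! i, ls ! Suc i] = map Inv (rev [a, c]) \<or> [ls ! i, ls ! Suc i] = map Dir [a, c]"
          by (cases "ls ! i") auto
        then have "sublist (map Inv (rev [a, c])) ls \<or> sublist (map Dir [a, c]) ls"
          using sublist_pair[OF i] by metis
        moreover have "sublist (map Inv (rev [a, c])) ls \<Longrightarrow> path_elt (tail Q (hd [a, c]), [a, c]) \<notin> I"
          "sublist (map Dir [a, c]) ls \<Longrightarrow> path_elt (tail Q (hd [a, c]), [a, c]) \<notin> I"
          using L by blast+
        ultimately have "path_elt (tail Q a, [a, c]) \<notin> I" by auto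
        then show False using ca(1) by (simp add: zero_rel_def)
      qed
      then show "step (ls ! i) (ls ! Suc i)"
        using v side_eq_iff_sim[of "linv (ls ! i)" "ls ! Suc i"] arc[OF A] i by (simp add: step_def)
    qed
  next
    assume R: ?R
    have "ls ! Suc i \<noteq> linv (ls ! i)" if "Suc i < length ls" for i using R that by (auto simp: step_def)
    moreover have "path_elt (tail Q (hd p), p) \<notin> I" if p: "p \<noteq> []" "sublist (map Dir p) ls" for p
    proof (rule direct_path_notin_I[OF p(1)])
      obtain k where k: "k + length p \<le> length ls" "\<And>i. i < length p \<Longrightarrow> Dir (p ! i) = ls ! (k + i)"
        by (rule sublist_nth[OF p(2)]) auto
      have pa: "p ! i \<in> arcs Q" if "i < length p" for i
        using arc[OF A, of "k + i"] k(1) k(2)[OF that, symmetric] that by simp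
      then show "set p \<subseteq> arcs Q" by (auto simp: in_set_conv_nth)
      show "head Q (p ! i) = tail Q (p ! Suc i) \<and> \<not> zero_rel Q I (p ! Suc i) (p ! i)" if i: "Suc i < length p" for i
      proof -
        have "step (Dir (p ! i)) (Dir (p ! Suc i))"
          using R[rule_format, of "k + i"] k(1) k(2)[of i] k(2)[of "Suc i"] i by simp
        then show ?thesis
          using side_simps(4)[OF pa pa, of i "Suc i"] i by (simp add: step_def)
      qed
    qed
    moreover have "path_elt (tail Q (hd p), p) \<notin> I" if p: "p \<noteq> []" "sublist (map Inv (rev p)) ls" for p
    proof (rule direct_path_notin_I[OF p(1)])
      obtain k where k: "k + length p \<le> length ls" "\<And>i. i < length p \<Longrightarrow> Inv (rev p ! i) = ls ! (k + i)"
        by (rule sublist_nth[OF p(2)]) auto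
      have k': "Inv (p ! i) = ls ! (k + (length p - 1 - i))" if "i < length p" for i
        using k(2)[of "length p - 1 - i"] that by (simp add: rev_nth)
      have pa: "p ! i \<in> arcs Q" if "i < length p" for i
      proof -
        have "k + (length p - 1 - i) < length ls" using k(1) that by simp
        then show ?thesis using arc[OF A, of "k + (length p - 1 - i)"] k'[OF that, symmetric] by simp
      qed
      then show "set p \<subseteq> arcs Q" by (auto simp: in_set_conv_nth)
      show "head Q (p ! i) = tail Q (p ! Suc i) \<and> \<not> zero_rel Q I (p ! Suc i) (p ! i)" if i: "Suc i < length p" for i
      proof -
        have j: "Suc (k + (length p - 1 - Suc i)) = k + (length p - 1 - i)" using i by simp
        have "Suc (k + (length p - 1 - Suc i)) < length ls" using k(1) i by simp
        then have "step (Inv (p ! Suc i)) (Inv (p ! i))"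
          using R[rule_format, of "k + (length p - 1 - Suc i)"] k'[of i] k'[of "Suc i"] i unfolding j by simp
        then show ?thesis
          using side_simps(3)[OF pa pa, of i "Suc i"] i by (auto simp: step_def)
      qed
    qed
    ultimately show ?L using R by (auto simp: step_def)
  qed
  then show ?thesis
    unfolding is_string_def good_word_def walk_word_diagram_iff w Let_def by auto
qed

end

section \<open>Coordinates for band modules\<close>

locale band_setup = gentle_quiver Q I
  for Q :: "('v, 'a) pre_digraph" and I :: "(('v, 'a) path \<Rightarrow> 'k::field) set" +
  fixes b :: "'a letter list" and t\<^sub>0 :: nat and \<mu> :: 'k
  assumes band: "is_band Q I b" and \<mu>: "\<mu> \<noteq> 0" and t\<^sub>0: "t\<^sub>0 < length b" and dir: "\<exists>a. b ! t\<^sub>0 = Dir a"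
begin

abbreviation n where "n \<equiv> length b"
abbreviation \<beta> where "\<beta> \<equiv> inf_word b"
abbreviation \<beta>\<omega> where "\<beta>\<omega> \<equiv> (\<lambda>j. Some (inf_word b j))"
abbreviation band_nxt where "band_nxt \<equiv> (\<lambda>t. Suc t mod length b)"
abbreviation band_wt where "band_wt \<equiv> (\<lambda>t. if t = t\<^sub>0 then \<mu> else 1)"
abbreviation band_mat where "band_mat \<equiv> letter_mat b band_nxt band_wt"

lemma n_pos: "0 < n" by (rule order_le_less_trans[OF le0 t\<^sub>0])

lemma inf_word_periodic: "\<beta> (j + int n) = \<beta> j" "\<beta> (j - int n) = \<beta> j"
  by (simp_all add: inf_word_def)

lemma walk_band: "walk \<beta>\<omega>"
proof -
  have b: "b \<noteq> []" "good_word (word_of Q b)" "good_word (word_of Q [last b, hd b])"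
    using band by (auto simp: is_band_def is_string_iff)
  have arcs: "letter_arc ` set b \<subseteq> arcs Q" and st: "\<And>i. Suc i < n \<Longrightarrow> step (b ! i) (b ! Suc i)"
    using b(2) by (auto simp: good_word_def walk_word_diagram_iff word_of_def)
  have wrap: "step (last b) (hd b)"
    using b(3) unfolding good_word_def walk_word_diagram_iff word_of_def by (auto dest: spec[of _ 0])
  have "letter_arc (\<beta> j) \<in> arcs Q" for j
    using arcs n_pos by (simp add: inf_word_def image_subset_iff nat_less_iff)
  moreover have "step (\<beta> j) (\<beta> (j + 1))" for j
  proof (cases "j mod int n + 1 < int n")
    case True
    have "(j + 1) mod int n = j mod int n + 1"
      using True n_pos mod_add_left_eq[of j "int n" 1] by simp
    moreover define k where "k = nat (j mod int n)"
    moreover have k: "int k = j mod int n" using n_pos by (simp add: k_def)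
    moreover have "Suc k < n" "nat (j mod int n + 1) = Suc k" using True k by linarith+
    ultimately show ?thesis using st[of k] by (simp add: inf_word_def)
  next
    case False
    then have e: "j mod int n = int n - 1" using n_pos pos_mod_bound[of "int n" j] by linarith
    then have "(j + 1) mod int n = 0" using mod_add_left_eq[of j "int n" 1] by simp
    moreover have "nat (int n - 1) = n - 1" using n_pos by simp
    ultimately show ?thesis
      using wrap b(1) by (simp add: inf_word_def e last_conv_nth hd_conv_nth)
  qed
  ultimately show ?thesis by (auto simp: walk_def)
qed

text \<open>
  Over the integers the module becomes unweighted: \<open>place_weight j\<close> is the scalar of the basis vector
  \<open>z\<^sub>j\<close> in the universal cover, chosen such that all letters act by one.
\<close>

definition place_weight :: "int \<Rightarrow> 'k" where
  "place_weight j = \<mu> powi (- ((j + (int n - 1 - int t\<^sub>0)) div int n))"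

text \<open>
  The functions on the integers which come from elements of the band module: translation by a period is
  multiplication by the inverse of \<open>\<mu>\<close>.
\<close>

definition quasi_periodic :: "(int \<Rightarrow> 'k) \<Rightarrow> bool" where
  "quasi_periodic g \<longleftrightarrow> (\<forall>j. g (j + int n) = g j / \<mu>)"

definition band_coords :: "(nat \<Rightarrow> 'k) \<Rightarrow> int \<Rightarrow> 'k" where
  "band_coords f j = f (nat (j mod int n)) * place_weight j"

definition band_vector :: "(int \<Rightarrow> 'k) \<Rightarrow> nat \<Rightarrow> 'k" where
  "band_vector g = (\<lambda>i. if i < n then g (int i) / place_weight (int i) else 0)"

lemma place_weight_nonzero: "place_weight j \<noteq> 0"
  using \<mu> by (simp add: place_weight_def)

lemma place_weight_period: "place_weight (j + int n) = place_weight j / \<mu>"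
proof -
  have "(j + int n + (int n - 1 - int t\<^sub>0)) div int n = (j + (int n - 1 - int t\<^sub>0)) div int n + 1"
    using n_pos div_add_self2[of "int n" "j + (int n - 1 - int t\<^sub>0)"] by (simp add: algebra_simps)
  moreover have "\<mu> powi (- (k + 1)) = \<mu> powi (- k) / \<mu>" for k
    using power_int_diff[of \<mu> "- k" 1] \<mu> by simp
  ultimately show ?thesis by (simp add: place_weight_def)
qed

lemma place_weight_step:
  "place_weight (j - 1) = place_weight j * (if (j - 1) mod int n = int t\<^sub>0 then \<mu> else 1)"
proof -
  define x where "x = j + (int n - 1 - int t\<^sub>0)"
  have "(j - 1) mod int n = int t\<^sub>0 \<longleftrightarrow> int n dvd x"
  proof -
    have "(j - 1) mod int n = int t\<^sub>0 \<longleftrightarrow> (j - 1) mod int n = int t\<^sub>0 mod int n"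
      using t\<^sub>0 by simp
    also have "\<dots> \<longleftrightarrow> int n dvd (j - 1 - int t\<^sub>0)" by (rule mod_eq_dvd_iff)
    also have "\<dots> \<longleftrightarrow> int n dvd (j - 1 - int t\<^sub>0 + int n)" by simp
    finally show ?thesis by (simp add: x_def algebra_simps)
  qed
  moreover have "(x - 1) div int n = x div int n - (if int n dvd x then 1 else 0)"
  proof (rule int_div_pos_eq)
    show "x - 1 = int n * (x div int n - (if int n dvd x then 1 else 0)) + (if int n dvd x then int n - 1 else x mod int n - 1)"
      using mult_div_mod_eq[of "int n" x] by (auto simp: algebra_simps dvd_eq_mod_eq_0)
    have "1 \<le> x mod int n" if "\<not> int n dvd x"
    proof -
      have "0 \<le> x mod int n" "x mod int n \<noteq> 0" using n_pos that by (auto simp: dvd_eq_mod_eq_0)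
      then show ?thesis by linarith
    qed
    then show "0 \<le> (if int n dvd x then int n - 1 else x mod int n - 1)" using n_pos by auto
    show "(if int n dvd x then int n - 1 else x mod int n - 1) < int n"
      using n_pos pos_mod_bound[of "int n" x]
      by (cases "int n dvd x"; simp only: if_True if_False; linarith)
  qed
  moreover have "\<mu> powi (1 - k) = \<mu> powi (- k) * \<mu>" for k
    using power_int_add[of \<mu> "- k" 1] \<mu> by simp
  moreover have "place_weight j = \<mu> powi (- (x div int n))" by (simp add: place_weight_def x_def)
  moreover have "place_weight (j - 1) = \<mu> powi (- ((x - 1) div int n))"
    unfolding place_weight_def x_def by (simp add: algebra_simps)
  ultimately show ?thesis by simp
qed

lemma band_weight_eq: "band_weight b t\<^sub>0 \<mu> j = place_weight (int j)"
proof -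
  have "int ((j + (n - 1 - t\<^sub>0)) div n) = (int j + (int n - 1 - int t\<^sub>0)) div int n"
    unfolding zdiv_int using t\<^sub>0 by (intro arg_cong2[where f = "(div)"]) linarith+
  then show ?thesis
    using \<mu> by (simp add: band_weight_def place_weight_def power_int_minus power_int_inverse flip: power_int_of_nat)
qed

lemma quasi_periodic_band_coords: "quasi_periodic (band_coords f)"
  by (simp add: quasi_periodic_def band_coords_def place_weight_period)

lemma quasi_periodicD:
  assumes "quasi_periodic g"
  shows "g (j + int n) = g j / \<mu>" "g (j - int n) = g j * \<mu>"
  using assms[unfolded quasi_periodic_def, rule_format, of j]
    assms[unfolded quasi_periodic_def, rule_format, of "j - int n"] \<mu> by auto

lemma quasi_periodic_eqI:
  assumes "quasi_periodic g" "quasi_periodic h" "\<And>j. c \<le> j \<Longrightarrow> j < c + int n \<Longrightarrow> g j = h j"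
  shows "g = h"
proof
  fix j
  have shift: "g (i + int k * int n) = h (i + int k * int n) \<longleftrightarrow> g i = h i" for i k
  proof (induct k)
    case (Suc k)
    have e: "i + int (Suc k) * int n = i + int k * int n + int n" by (simp add: algebra_simps)
    show ?case
      unfolding e quasi_periodicD(1)[OF assms(1)] quasi_periodicD(1)[OF assms(2)] using Suc \<mu> by simp
  qed simp
  define i where "i = c + (j - c) mod int n"
  define q where "q = (j - c) div int n"
  have j: "j = i + q * int n" by (simp add: i_def q_def)
  have i: "g i = h i" using assms(3)[of i] n_pos by (simp add: i_def)
  show "g j = h j"
  proof (cases "0 \<le> q")
    case True
    then show ?thesis using shift[of i "nat q"] i j by simp
  next
    case False
    then have "i = j + int (nat (- q)) * int n" using j by (simp add: algebra_simps)
    then show ?thesis using shift[of j "nat (- q)"] i by simp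
  qed
qed

lemma band_coords_vector: "quasi_periodic g \<Longrightarrow> band_coords (band_vector g) = g"
  by (rule quasi_periodic_eqI[of _ _ 0])
    (use place_weight_nonzero in \<open>auto simp: quasi_periodic_band_coords band_coords_def band_vector_def\<close>)

lemma band_vector_coords: "\<forall>i\<ge>n. f i = 0 \<Longrightarrow> band_vector (band_coords f) = f"
  using place_weight_nonzero by (auto simp: band_coords_def band_vector_def fun_eq_iff)

lemma band_arrow_act:
  "band_coords (arrow_act n band_mat a f) j = lact \<beta>\<omega> a (band_coords f) j"
proof -
  define i where "i = nat (j mod int n)"
  define k where "k = nat ((j - 1) mod int n)"
  have i: "i < n" "int i = j mod int n" and k: "k < n" "int k = (j - 1) mod int n"
    using n_pos by (simp_all add: i_def k_def nat_less_iff)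
  have nxt_k: "i = band_nxt t \<longleftrightarrow> t = k" if "t < n" for t
  proof -
    have "i = band_nxt t \<longleftrightarrow> j mod int n = (int t + 1) mod int n"
      unfolding i(2)[symmetric] by (metis of_nat_Suc of_nat_eq_iff zmod_int add.commute)
    also have "\<dots> \<longleftrightarrow> int n dvd j - (int t + 1)" by (rule mod_eq_dvd_iff)
    also have "\<dots> \<longleftrightarrow> int n dvd (j - 1) - int t" by (simp add: algebra_simps)
    also have "\<dots> \<longleftrightarrow> (j - 1) mod int n = int t mod int n" by (rule mod_eq_dvd_iff[symmetric])
    also have "\<dots> \<longleftrightarrow> t = k" using that k by auto
    finally show ?thesis .
  qed
  have nxt_i: "int (band_nxt i) = (j + 1) mod int n"
    using i(2) by (metis mod_add_left_eq of_nat_Suc zmod_int add.commute)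
  have "arrow_act n band_mat a f i =
     (\<Sum>t<n. (if b ! t = Dir a \<and> i = band_nxt t then band_wt t * f t else 0) +
             (if b ! t = Inv a \<and> i = t then band_wt t * f (band_nxt t) else 0))"
    by (rule arrow_act_letter_mat) (use i(1) n_pos in auto)
  also have "\<dots> = (\<Sum>t<n. if t = k then (if b ! k = Dir a then band_wt k * f k else 0) else 0) +
     (\<Sum>t<n. if t = i then (if b ! i = Inv a then band_wt i * f (band_nxt i) else 0) else 0)"
    unfolding sum.distrib using nxt_k by (intro arg_cong2[where f = "(+)"] sum.cong) auto
  also have "\<dots> = (if b ! k = Dir a then band_wt k * f k else 0) + (if b ! i = Inv a then f (band_nxt i) else 0)"
    unfolding sum.delta[OF finite_lessThan] using i(1) k(1) dir by auto
  finally have e: "arrow_act n band_mat a f i =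
    (if b ! k = Dir a then band_wt k * f k else 0) + (if b ! i = Inv a then f (band_nxt i) else 0)" .
  have "b ! i = Inv a \<Longrightarrow> place_weight (j + 1) = place_weight j"
    using place_weight_step[of "j + 1"] dir i by auto
  moreover have "nat ((j + 1) mod int n) = band_nxt i" using nxt_i by simp
  moreover have "(j - 1) mod int n = int t\<^sub>0 \<longleftrightarrow> k = t\<^sub>0" using k by auto
  ultimately show ?thesis
    using e place_weight_step[of j]
    by (simp add: band_coords_def lact_def inf_word_def algebra_simps flip: i_def k_def)
qed

lemma band_rep: "gentle_rep Q I n (\<lambda>i. lsrc Q (b ! i)) band_mat"
proof
  have st: "lsrc Q (b ! band_nxt t) = ltgt Q (b ! t)" if "t < n" for t
    using walkD(2)[OF walk_band, of "int t"] that
    by (auto simp: inf_word_def nat_mod_distrib nat_add_distrib)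
  show "lsrc Q (b ! i) \<in> verts Q" if "i < n" for i
    using lsrc_verts(1) walkD(1)[OF walk_band, of "int i"] that by (simp add: inf_word_def)
  show "lsrc Q (b ! i) = tail Q a \<and> lsrc Q (b ! j) = head Q a" if "band_mat a i j \<noteq> 0" for a i j
    using that by (rule letter_mat_nonzeroE) (auto simp: st)
  show "arrow_act n band_mat d (arrow_act n band_mat a f) = (\<lambda>_. 0)"
    if "a \<in> arcs Q" "d \<in> arcs Q" "head Q a = tail Q d" "zero_rel Q I d a" for a d f
  proof -
    define F where "F = arrow_act n band_mat d (arrow_act n band_mat a f)"
    have z: "band_coords F = (\<lambda>_. 0)"
    proof
      fix j
      have "band_coords F j = lact \<beta>\<omega> d (lact \<beta>\<omega> a (band_coords f)) j"
        unfolding F_def band_arrow_act by (simp add: band_arrow_act[abs_def])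
      then show "band_coords F j = 0"
        using lact_relation[OF walk_band that(4,1,2,3), of "band_coords f"] by simp
    qed
    have "\<forall>i\<ge>n. F i = 0" by (simp add: F_def arrow_act_def)
    from band_vector_coords[OF this] have "F = (\<lambda>_. 0)" unfolding z by (auto simp: band_vector_def)
    then show ?thesis by (simp add: F_def)
  qed
qed auto

end

section \<open>Cocycles between a string and a band\<close>

text \<open>
  The transpose of \<open>lact\<close>; precomposition with \<open>a\<close> acts in this way on the rows of a matrix whose rows are
  indexed by the places of the diagram.
\<close>

definition ract :: "(int \<Rightarrow> 'a letter option) \<Rightarrow> 'a \<Rightarrow> (int \<Rightarrow> 'k::field) \<Rightarrow> int \<Rightarrow> 'k" where
  "ract \<omega> a g = (\<lambda>s. (if \<omega> s = Some (Dir a) then g (s + 1) else 0) +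
                      (if \<omega> (s - 1) = Some (Inv a) then g (s - 1) else 0))"

locale string_band = band_setup Q I b t\<^sub>0 \<mu>
  for Q :: "('v, 'a) pre_digraph" and I :: "(('v, 'a) path \<Rightarrow> 'k::field) set"
    and b :: "'a letter list" and t\<^sub>0 :: nat and \<mu> :: 'k +
  fixes w :: "('v, 'a) word"
  assumes w: "good_word w"
begin

definition len :: int where "len = int (length (snd w))"
definition \<omega> :: "int \<Rightarrow> 'a letter option" where "\<omega> = word_diagram (snd w)"
definition vert :: "int \<Rightarrow> 'v" where "vert s = word_vert Q w (nat s)"

lemma walk_\<omega>: "walk \<omega>"
  using w by (simp add: good_word_def \<omega>_def)

lemma \<omega>_range: "\<omega> s = Some l \<Longrightarrow> 0 \<le> s \<and> s < len"
  by (auto simp: \<omega>_def word_diagram_def len_def split: if_splits)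

lemma \<omega>_vert: "\<omega> s = Some l \<Longrightarrow> vert s = lsrc Q l" "\<omega> s = Some l \<Longrightarrow> vert (s + 1) = ltgt Q l"
  using word_vert_lsrc[OF w, of "nat s"] word_vert_ltgt[of w "nat s"]
  by (auto simp: \<omega>_def word_diagram_def vert_def nat_add_distrib split: if_splits)

lemma band_vert: "lsrc Q (\<beta> (j + 1)) = ltgt Q (\<beta> j)" "lsrc Q (\<beta> j) = ltgt Q (\<beta> (j - 1))"
  using walkD(2)[OF walk_band, of j] walkD(3)[OF walk_band, of j] by auto

lemma band_side: "side (linv (\<beta> (j - 1))) \<longleftrightarrow> \<not> side (\<beta> j)"
  using walkD(3)[OF walk_band, of j] by auto

lemma band_arc: "letter_arc (\<beta> j) \<in> arcs Q"
  using walkD(1)[OF walk_band] by auto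

lemma \<omega>_arc: "\<omega> s = Some l \<Longrightarrow> letter_arc l \<in> arcs Q"
  using walkD(1)[OF walk_\<omega>] by auto

text \<open>
  Throughout, \<open>s\<close> is a place of the string and \<open>j\<close> a place of the bi-infinite word of the band.
\<close>

definition same_vert :: "int \<Rightarrow> int \<Rightarrow> bool" where
  "same_vert s j \<longleftrightarrow> 0 \<le> s \<and> s \<le> len \<and> vert s = lsrc Q (\<beta> j)"

text \<open>
  The number \<open>f a s j\<close> is the coefficient at place \<open>j\<close> of the image of the basis vector \<open>z\<^sub>s\<close> under the defect of
  the arrow \<open>a\<close>. Thus \<open>s\<close> lies over the tail and \<open>j\<close> over the head of \<open>a\<close>. Scalars and vertices have defect zero.
\<close>

definition cochain :: "('a \<Rightarrow> int \<Rightarrow> int \<Rightarrow> 'k) \<Rightarrow> bool" where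
  "cochain f \<longleftrightarrow> (\<forall>a s. quasi_periodic (f a s)) \<and>
     (\<forall>a s j. f a s j \<noteq> 0 \<longrightarrow> a \<in> arcs Q \<and> 0 \<le> s \<and> s \<le> len \<and> vert s = tail Q a \<and> lsrc Q (\<beta> j) = head Q a)"

text \<open>
  This is the derivative of the relation \<open>ca = 0\<close>: applied to a vector of the middle term, it becomes
  \<open>c \<delta>\<^sub>a + \<delta>\<^sub>c a = 0\<close>.
\<close>

definition cocycle :: "('a \<Rightarrow> int \<Rightarrow> int \<Rightarrow> 'k) \<Rightarrow> bool" where
  "cocycle f \<longleftrightarrow> cochain f \<and>
     (\<forall>a\<in>arcs Q. \<forall>c\<in>arcs Q. head Q a = tail Q c \<longrightarrow> zero_rel Q I c a \<longrightarrow>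
        (\<forall>s j. lact \<beta>\<omega> c (f a s) j + ract \<omega> a (\<lambda>s. f c s j) s = 0))"

definition hom_matrix :: "(int \<Rightarrow> int \<Rightarrow> 'k) \<Rightarrow> bool" where
  "hom_matrix h \<longleftrightarrow> (\<forall>s. quasi_periodic (h s)) \<and> (\<forall>s j. h s j \<noteq> 0 \<longrightarrow> same_vert s j)"

definition coboundary :: "(int \<Rightarrow> int \<Rightarrow> 'k) \<Rightarrow> 'a \<Rightarrow> int \<Rightarrow> int \<Rightarrow> 'k" where
  "coboundary h a s j = lact \<beta>\<omega> a (h s) j - ract \<omega> a (\<lambda>s. h s j) s"

lemma cochainD: "cochain f \<Longrightarrow> f a s j \<noteq> 0 \<Longrightarrow>
    a \<in> arcs Q \<and> 0 \<le> s \<and> s \<le> len \<and> vert s = tail Q a \<and> lsrc Q (\<beta> j) = head Q a"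
  "cochain f \<Longrightarrow> f a s (j + int n) = f a s j / \<mu>"
  unfolding cochain_def quasi_periodic_def by blast+

lemma ract_relation:
  assumes "zero_rel Q I c a" "a \<in> arcs Q" "c \<in> arcs Q" "head Q a = tail Q c"
  shows "ract \<omega> a (ract \<omega> c g) = (\<lambda>_. 0)"
proof
  fix s
  have sd: "side (Dir c) = side (Inv a)" using side_simps(3)[OF assms(2,3,4)] assms(1) by simp
  have "\<not> (\<omega> s = Some (Dir a) \<and> \<omega> (s + 1) = Some (Dir c))"
    using walkD(2)[OF walk_\<omega>, of s "Dir a" "Dir c"] sd by auto
  moreover have "\<not> (\<omega> (s - 1) = Some (Inv a) \<and> \<omega> (s - 1 - 1) = Some (Inv c))"
    using walkD(3)[OF walk_\<omega>, of "s - 1" "Inv c" "Inv a"] sd by auto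
  ultimately show "ract \<omega> a (ract \<omega> c g) s = 0" by (auto simp: ract_def)
qed

lemma lact_quasi_periodic: "quasi_periodic g \<Longrightarrow> quasi_periodic (lact \<beta>\<omega> a g)"
proof -
  assume g: "quasi_periodic g"
  have e: "j + int n - 1 = j - 1 + int n" "j + int n + 1 = j + 1 + int n" for j by simp_all
  show ?thesis
    unfolding quasi_periodic_def lact_def e inf_word_periodic quasi_periodicD(1)[OF g]
    by (simp add: add_divide_distrib)
qed

lemma cocycle_coboundary:
  assumes h: "hom_matrix h"
  shows "cocycle (coboundary h)"
  unfolding cocycle_def cochain_def
proof (intro conjI allI impI ballI)
  have qp: "quasi_periodic (h s)" for s using h by (simp add: hom_matrix_def)
  show "quasi_periodic (coboundary h a s)" for a s
    using quasi_periodicD(1)[OF lact_quasi_periodic[OF qp]] quasi_periodicD(1)[OF qp]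
    by (simp add: quasi_periodic_def coboundary_def ract_def add_divide_distrib diff_divide_distrib)
  have supp: "h s j \<noteq> 0 \<Longrightarrow> same_vert s j" for s j using h by (simp add: hom_matrix_def)
  fix a s j assume "coboundary h a s j \<noteq> 0"
  then have "\<beta> (j - 1) = Dir a \<and> h s (j - 1) \<noteq> 0 \<or> \<beta> j = Inv a \<and> h s (j + 1) \<noteq> 0 \<or>
    \<omega> s = Some (Dir a) \<and> h (s + 1) j \<noteq> 0 \<or> \<omega> (s - 1) = Some (Inv a) \<and> h (s - 1) j \<noteq> 0"
    by (rule contrapos_np) (auto simp: coboundary_def lact_def ract_def)
  then consider "\<beta> (j - 1) = Dir a" "h s (j - 1) \<noteq> 0" | "\<beta> j = Inv a" "h s (j + 1) \<noteq> 0"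
    | "\<omega> s = Some (Dir a)" "h (s + 1) j \<noteq> 0" | "\<omega> (s - 1) = Some (Inv a)" "h (s - 1) j \<noteq> 0"
    by blast
  then have "a \<in> arcs Q \<and> 0 \<le> s \<and> s \<le> len \<and> vert s = tail Q a \<and> lsrc Q (\<beta> j) = head Q a"
  proof cases
    case 1
    then show ?thesis using supp[OF 1(2)] band_arc[of "j - 1"] band_vert(2)[of j] by (simp add: same_vert_def)
  next
    case 2
    then show ?thesis using supp[OF 2(2)] band_arc[of j] band_vert(1)[of j] by (simp add: same_vert_def)
  next
    case 3
    then show ?thesis
      using supp[OF 3(2)] \<omega>_arc[OF 3(1)] \<omega>_vert[OF 3(1)] \<omega>_range[OF 3(1)] by (simp add: same_vert_def)
  next
    case 4
    then show ?thesis
      using supp[OF 4(2)] \<omega>_arc[OF 4(1)] \<omega>_vert[OF 4(1)] \<omega>_range[OF 4(1)] by (simp add: same_vert_def)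
  qed
  then show "a \<in> arcs Q" "0 \<le> s" "s \<le> len" "vert s = tail Q a" "lsrc Q (\<beta> j) = head Q a" by auto
next
  fix a c s j
  assume ac: "a \<in> arcs Q" "c \<in> arcs Q" "head Q a = tail Q c" "zero_rel Q I c a"
  have "lact \<beta>\<omega> c (coboundary h a s) j =
      lact \<beta>\<omega> c (lact \<beta>\<omega> a (h s)) j - lact \<beta>\<omega> c (\<lambda>j. ract \<omega> a (\<lambda>s. h s j) s) j"
    by (simp add: lact_def[of _ c] coboundary_def)
  moreover have "ract \<omega> a (\<lambda>s. coboundary h c s j) s =
      ract \<omega> a (\<lambda>s. lact \<beta>\<omega> c (h s) j) s - ract \<omega> a (ract \<omega> c (\<lambda>s. h s j)) s"
    by (simp add: ract_def[of _ a] coboundary_def)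
  moreover have "lact \<beta>\<omega> c (\<lambda>j. ract \<omega> a (\<lambda>s. h s j) s) j = ract \<omega> a (\<lambda>s. lact \<beta>\<omega> c (h s) j) s"
    by (simp add: lact_def ract_def)
  ultimately show "lact \<beta>\<omega> c (coboundary h a s) j + ract \<omega> a (\<lambda>s. coboundary h c s j) s = 0"
    using lact_relation[OF walk_band ac(4,1,2,3), of "h s"] ract_relation[OF ac(4,1,2,3), of "\<lambda>s. h s j"]
    by simp
qed

lemma cocycle_lin:
  assumes "cocycle f" "cocycle g"
  shows "cocycle (\<lambda>a s j. f a s j + c * g a s j)"
  unfolding cocycle_def cochain_def
proof (intro conjI allI impI ballI)
  have fg: "cochain f" "cochain g" using assms by (auto simp: cocycle_def)
  show "quasi_periodic (\<lambda>j. f a s j + c * g a s j)" for a s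
    using cochainD(2)[OF fg(1)] cochainD(2)[OF fg(2)] by (simp add: quasi_periodic_def add_divide_distrib)
  fix a s j assume "f a s j + c * g a s j \<noteq> 0"
  then have "f a s j \<noteq> 0 \<or> g a s j \<noteq> 0" by auto
  then show "a \<in> arcs Q" "0 \<le> s" "s \<le> len" "vert s = tail Q a" "lsrc Q (\<beta> j) = head Q a"
    using cochainD(1)[OF fg(1)] cochainD(1)[OF fg(2)] by blast+
next
  fix a d s j
  assume ad: "a \<in> arcs Q" "d \<in> arcs Q" "head Q a = tail Q d" "zero_rel Q I d a"
  have 1: "lact \<beta>\<omega> d (f a s) j + ract \<omega> a (\<lambda>s. f d s j) s = 0" "lact \<beta>\<omega> d (g a s) j + ract \<omega> a (\<lambda>s. g d s j) s = 0"
    using assms ad by (auto simp: cocycle_def)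
  have "lact \<beta>\<omega> d (\<lambda>j. f a s j + c * g a s j) j + ract \<omega> a (\<lambda>s. f d s j + c * g d s j) s =
    (lact \<beta>\<omega> d (f a s) j + ract \<omega> a (\<lambda>s. f d s j) s) + c * (lact \<beta>\<omega> d (g a s) j + ract \<omega> a (\<lambda>s. g d s j) s)"
    by (simp add: lact_def ract_def algebra_simps)
  then show "lact \<beta>\<omega> d (\<lambda>j. f a s j + c * g a s j) j + ract \<omega> a (\<lambda>s. f d s j + c * g d s j) s = 0"
    unfolding 1 by simp
qed

text \<open>
  If the arrow \<open>a\<close> of an entry is not itself the letter by which the band enters place \<open>j\<close>, then on the
  side of \<open>a\<close> the band leaves this place by an arrow \<open>c\<close> with \<open>ca \<in> I\<close>. The cocycle condition for \<open>ca\<close>, read at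
  the neighbouring place, then expresses the entry through entries at \<open>c\<close>, which are among those assumed
  to vanish.
\<close>

lemma cocycle_zeroI:
  assumes g: "cocycle g"
    and left: "\<And>s j c. same_vert s j \<Longrightarrow> \<beta> (j - 1) = Inv c \<Longrightarrow> g c s (j - 1) = 0"
    and right: "\<And>s j d. same_vert s j \<Longrightarrow> \<beta> j = Dir d \<Longrightarrow> g d s (j + 1) = 0"
  shows "g a s j = 0"
proof (rule ccontr)
  assume nz: "g a s j \<noteq> 0"
  have gc: "cochain g" using g by (simp add: cocycle_def)
  note D = cochainD(1)[OF gc nz]
  have "\<beta> (j - 1) \<noteq> Dir a"
  proof
    assume e: "\<beta> (j - 1) = Dir a"
    then have "same_vert s (j - 1)" using D by (simp add: same_vert_def)
    then show False using right[of s "j - 1" a] e nz by simp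
  qed
  moreover have "\<beta> j \<noteq> Inv a"
  proof
    assume e: "\<beta> j = Inv a"
    then have "same_vert s (j + 1)" using D band_vert(1)[of j] by (simp add: same_vert_def)
    then show False using left[of s "j + 1" a] e nz by simp
  qed
  ultimately have ne: "linv (\<beta> (j - 1)) \<noteq> Inv a" "\<beta> j \<noteq> Inv a" by (cases "\<beta> (j - 1)"; simp)+
  \<comment> \<open>the half-edge of the band on the side of \<open>a\<close> leads out of the vertex by some \<open>c\<close> with \<open>ca \<in> I\<close>\<close>
  have v: "lsrc Q (\<beta> j) = head Q a" "ltgt Q (\<beta> (j - 1)) = head Q a" using D band_vert(2)[of j] by auto
  have zr: "\<exists>c. l = Dir c \<and> zero_rel Q I c a \<and> c \<in> arcs Q \<and> tail Q c = head Q a"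
    if "side l = side (Inv a)" "l \<noteq> Inv a" "lsrc Q l = head Q a" "letter_arc l \<in> arcs Q" for l
    using that D side_simps(2,3)[of a "letter_arc l"] by (cases l) auto
  have rel: "lact \<beta>\<omega> c (g a s) i + ract \<omega> a (\<lambda>s. g c s i) s = 0"
    if "zero_rel Q I c a" "c \<in> arcs Q" "tail Q c = head Q a" for c i
    using g that D by (simp add: cocycle_def)
  show False
  proof (cases "side (\<beta> j) = side (Inv a)")
    case True
    then obtain c where c: "\<beta> j = Dir c" "zero_rel Q I c a" "c \<in> arcs Q" "tail Q c = head Q a"
      using zr[OF _ ne(2) v(1)] band_arc by auto
    have z: "g c s' (j + 1) = 0" if "vert s' = head Q a" "0 \<le> s'" "s' \<le> len" for s'
      using right[of s' j c] that c v by (simp add: same_vert_def)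
    have "ract \<omega> a (\<lambda>s. g c s (j + 1)) s = 0"
      using z[of "s + 1"] z[of "s - 1"] \<omega>_range[of s] \<omega>_range[of "s - 1"] \<omega>_vert(2)[of s] \<omega>_vert(1)[of "s - 1"]
      by (auto simp: ract_def)
    moreover have "\<beta> (j + 1) \<noteq> Inv c" using band_side[of "j + 1"] c(1) by auto
    then have "lact \<beta>\<omega> c (g a s) (j + 1) = g a s j" using c(1) by (simp add: lact_def)
    ultimately show False using rel[OF c(2-4), of "j + 1"] nz by simp
  next
    case False
    then have "side (linv (\<beta> (j - 1))) = side (Inv a)" using band_side[of j] by auto
    then obtain c where c: "linv (\<beta> (j - 1)) = Dir c" "zero_rel Q I c a" "c \<in> arcs Q" "tail Q c = head Q a"
      using zr[OF _ ne(1)] v(2) band_arc[of "j - 1"] by auto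
    have c1: "\<beta> (j - 1) = Inv c" using c(1) by (cases "\<beta> (j - 1)") auto
    have z: "g c s' (j - 1) = 0" if "vert s' = head Q a" "0 \<le> s'" "s' \<le> len" for s'
      using left[of s' j c] that c1 v by (simp add: same_vert_def)
    have "ract \<omega> a (\<lambda>s. g c s (j - 1)) s = 0"
      using z[of "s + 1"] z[of "s - 1"] \<omega>_range[of s] \<omega>_range[of "s - 1"] \<omega>_vert(2)[of s] \<omega>_vert(1)[of "s - 1"]
      by (auto simp: ract_def)
    moreover have "\<beta> (j - 1 - 1) \<noteq> Dir c" using band_side[of "j - 1"] c1 by auto
    then have "lact \<beta>\<omega> c (g a s) (j - 1) = g a s j" using c1 by (simp add: lact_def)
    ultimately show False using rel[OF c(2-4), of "j - 1"] nz by simp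
  qed
qed

section \<open>Aligned places and overlaps\<close>

text \<open>
  The string and the band pass through their common vertex in the same direction. If they pass in
  opposite directions, the inverse of the string is aligned with the band.
\<close>

definition aligned :: "int \<Rightarrow> int \<Rightarrow> bool" where
  "aligned s j \<longleftrightarrow> same_vert s j \<and> (\<forall>l. \<omega> s = Some l \<longrightarrow> side l = side (\<beta> j)) \<and>
     (\<forall>l. \<omega> (s - 1) = Some l \<longrightarrow> side (linv l) = side (linv (\<beta> (j - 1))))"

lemma aligned_same_vert: "aligned s j \<Longrightarrow> same_vert s j"
  by (simp add: aligned_def)

lemma aligned_left:
  assumes "aligned s j" "\<omega> (s - 1) = Some (\<beta> (j - 1))"
  shows "aligned (s - 1) (j - 1)"
proof -
  have "side (linv l) = side (linv (\<beta> (j - 1 - 1)))" if "\<omega> (s - 1 - 1) = Some l" for l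
    using walkD(3)[OF walk_\<omega> that assms(2)] band_side[of "j - 1"] by auto
  then show ?thesis
    using assms \<omega>_range[OF assms(2)] \<omega>_vert(1)[OF assms(2)] by (auto simp: aligned_def same_vert_def)
qed

lemma aligned_right:
  assumes "aligned s j" "\<omega> s = Some (\<beta> j)"
  shows "aligned (s + 1) (j + 1)"
proof -
  have "side l = side (\<beta> (j + 1))" if "\<omega> (s + 1) = Some l" for l
    using walkD(2)[OF walk_\<omega> assms(2) that] band_side[of "j + 1"] by auto
  then show ?thesis
    using assms \<omega>_range[OF assms(2)] \<omega>_vert(2)[OF assms(2)] band_vert(1)[of j]
    by (auto simp: aligned_def same_vert_def)
qed

lemma same_vert_period: "same_vert s (j + int n) \<longleftrightarrow> same_vert s j"
  by (simp add: same_vert_def inf_word_periodic)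

lemma aligned_period: "aligned s (j + int n) \<longleftrightarrow> aligned s j"
proof -
  have "j + int n - 1 = j - 1 + int n" by simp
  then show ?thesis by (simp only: aligned_def same_vert_period inf_word_periodic)
qed

text \<open>
  From a pair of places move to the left as long as both words have the same letter. The condition says
  that the band then continues with an inverse letter, as to the left of an overlap.
\<close>

function left_open :: "int \<Rightarrow> int \<Rightarrow> bool" where
  "left_open s j = (if \<omega> (s - 1) = Some (\<beta> (j - 1)) then left_open (s - 1) (j - 1)
     else (\<exists>c. \<beta> (j - 1) = Inv c))"
  by auto
termination by (relation "measure (\<lambda>(s, j). nat s)") (auto dest: \<omega>_range)

text \<open>
  Along a common subword of the string and the band, the equations \<open>coboundary h = f\<close> at the arrows leaving the
  band form a two-term recursion for \<open>h\<close>. Its solution is obtained by summation from the left end or from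
  the right end of the common subword.
\<close>

function left_sum :: "('a \<Rightarrow> int \<Rightarrow> int \<Rightarrow> 'k) \<Rightarrow> int \<Rightarrow> int \<Rightarrow> 'k" where
  "left_sum f s j = (if \<omega> (s - 1) = Some (\<beta> (j - 1)) then left_sum f (s - 1) (j - 1) else 0) +
     (case \<beta> (j - 1) of Inv c \<Rightarrow> f c s (j - 1)
      | Dir a \<Rightarrow> if \<omega> (s - 1) = Some (Dir a) then - f a (s - 1) j else 0)"
  by auto
termination by (relation "measure (\<lambda>(f, s, j). nat s)") (auto dest: \<omega>_range)

function right_sum :: "('a \<Rightarrow> int \<Rightarrow> int \<Rightarrow> 'k) \<Rightarrow> int \<Rightarrow> int \<Rightarrow> 'k" where
  "right_sum f s j = (if \<omega> s = Some (\<beta> j) then right_sum f (s + 1) (j + 1) else 0) +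
     (case \<beta> j of Dir d \<Rightarrow> f d s (j + 1)
      | Inv a \<Rightarrow> if \<omega> s = Some (Inv a) then - f a (s + 1) j else 0)"
  by auto
termination by (relation "measure (\<lambda>(f, s, j). nat (len - s))") (auto dest: \<omega>_range)

declare left_open.simps [simp del] left_sum.simps [simp del] right_sum.simps [simp del]

lemma left_open_period: "left_open s (j + int n) \<longleftrightarrow> left_open s j"
proof (induct s j rule: left_open.induct)
  case (1 s j)
  have e: "j + int n - 1 = j - 1 + int n" by simp
  show ?case
    unfolding left_open.simps[of s "j + int n"] left_open.simps[of s j] e inf_word_periodic using 1 by simp
qed

lemma left_sum_period:
  assumes f: "cochain f"
  shows "left_sum f s (j + int n) = left_sum f s j / \<mu>"
proof (induct "nat s" arbitrary: s j rule: less_induct)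
  case (less s j)
  have e: "j + int n - 1 = j - 1 + int n" by simp
  have "\<omega> (s - 1) = Some (\<beta> (j - 1)) \<Longrightarrow> left_sum f (s - 1) (j - 1 + int n) = left_sum f (s - 1) (j - 1) / \<mu>"
    using less[of "s - 1" "j - 1"] \<omega>_range[of "s - 1"] by simp
  then show ?case
    unfolding left_sum.simps[of f s "j + int n"] left_sum.simps[of f s j] e inf_word_periodic
    using cochainD(2)[OF f] by (auto simp: add_divide_distrib diff_divide_distrib split: letter.split)
qed

lemma right_sum_period:
  assumes f: "cochain f"
  shows "right_sum f s (j + int n) = right_sum f s j / \<mu>"
proof (induct "nat (len - s)" arbitrary: s j rule: less_induct)
  case (less s j)
  have e: "j + int n + 1 = j + 1 + int n" by simp
  have "\<omega> s = Some (\<beta> j) \<Longrightarrow> right_sum f (s + 1) (j + 1 + int n) = right_sum f (s + 1) (j + 1) / \<mu>"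
    using less[of "s + 1" "j + 1"] \<omega>_range[of s] by simp
  then show ?case
    unfolding right_sum.simps[of f s "j + int n"] right_sum.simps[of f s j] e inf_word_periodic
    using cochainD(2)[OF f] by (auto simp: add_divide_distrib diff_divide_distrib split: letter.split)
qed

text \<open>
  If the common subword is open to the left, then there is an equation at its left end, which has to be
  the start of the summation. Otherwise only the right end can impose an equation.
\<close>

definition solution :: "('a \<Rightarrow> int \<Rightarrow> int \<Rightarrow> 'k) \<Rightarrow> int \<Rightarrow> int \<Rightarrow> 'k" where
  "solution f s j = (if left_open s j then left_sum f s j else right_sum f s j)"

lemma coboundary_left:
  assumes "aligned s j" "\<beta> (j - 1) = Inv c"
  shows "coboundary h c s (j - 1) = h s j - (if \<omega> (s - 1) = Some (Inv c) then h (s - 1) (j - 1) else 0)"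
proof -
  have "\<beta> (j - 1 - 1) \<noteq> Dir c" using band_side[of "j - 1"] assms(2) by auto
  moreover have "\<omega> s \<noteq> Some (Dir c)"
    using assms band_side[of j] by (auto simp: aligned_def)
  ultimately show ?thesis using assms(2) by (simp add: coboundary_def lact_def ract_def)
qed

lemma coboundary_right:
  assumes "aligned s j" "\<beta> j = Dir d"
  shows "coboundary h d s (j + 1) = h s j - (if \<omega> s = Some (Dir d) then h (s + 1) (j + 1) else 0)"
proof -
  have "\<beta> (j + 1) \<noteq> Inv d" using band_side[of "j + 1"] assms(2) by auto
  moreover have "\<omega> (s - 1) \<noteq> Some (Inv d)"
    using assms band_side[of j] by (auto simp: aligned_def)
  ultimately show ?thesis using assms(2) by (simp add: coboundary_def lact_def ract_def)
qed

lemma solution_left: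
  assumes "aligned s j" "\<beta> (j - 1) = Inv c" and h: "\<And>s j. aligned s j \<Longrightarrow> h s j = solution f s j"
  shows "coboundary h c s (j - 1) = f c s (j - 1)"
proof (cases "\<omega> (s - 1) = Some (\<beta> (j - 1))")
  case True
  note al = aligned_left[OF assms(1) True]
  have "left_open s j = left_open (s - 1) (j - 1)" using left_open.simps[of s j] True by simp
  then show ?thesis
    using coboundary_left[OF assms(1,2), of h] h[OF assms(1)] h[OF al] True assms(2)
      left_sum.simps[of f s j] right_sum.simps[of f "s - 1" "j - 1"]
    by (simp add: solution_def)
next
  case False
  then have "left_open s j" using left_open.simps[of s j] assms(2) by simp
  then show ?thesis
    using coboundary_left[OF assms(1,2), of h] h[OF assms(1)] False assms(2) left_sum.simps[of f s j]
    by (simp add: solution_def)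
qed

text \<open>
  Here both ends of the common subword impose an equation, so that the recursion has one equation too
  many: the one at the arrow \<open>\<beta> j\<close> remains unsolved.
\<close>

definition right_end :: "int \<Rightarrow> int \<Rightarrow> bool" where
  "right_end s j \<longleftrightarrow> aligned s j \<and> left_open s j \<and> (\<exists>d. \<beta> j = Dir d) \<and> \<omega> s \<noteq> Some (\<beta> j)"

lemma solution_right:
  assumes "aligned s j" "\<beta> j = Dir d" "\<not> right_end s j"
    and h: "\<And>s j. aligned s j \<Longrightarrow> h s j = solution f s j"
  shows "coboundary h d s (j + 1) = f d s (j + 1)"
proof (cases "\<omega> s = Some (\<beta> j)")
  case True
  note al = aligned_right[OF assms(1) True]
  have "left_open (s + 1) (j + 1) = left_open s j" using left_open.simps[of "s + 1" "j + 1"] True by simp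
  then show ?thesis
    using coboundary_right[OF assms(1,2), of h] h[OF assms(1)] h[OF al] True assms(2)
      left_sum.simps[of f "s + 1" "j + 1"] right_sum.simps[of f s j]
    by (simp add: solution_def)
next
  case False
  then have "\<not> left_open s j" using assms by (auto simp: right_end_def)
  then show ?thesis
    using coboundary_right[OF assms(1,2), of h] h[OF assms(1)] False assms(2) right_sum.simps[of f s j]
    by (simp add: solution_def)
qed

text \<open>
  The equation at the left end of the overlap says that the first value of \<open>h\<close> is zero, and each further
  equation that two consecutive values agree.
\<close>

lemma coboundary_zero_along_overlap:
  assumes left: "\<And>s j c. aligned s j \<Longrightarrow> \<beta> (j - 1) = Inv c \<Longrightarrow> coboundary h c s (j - 1) = 0"
    and right: "\<And>s j d. aligned s j \<Longrightarrow> \<beta> j = Dir d \<Longrightarrow> \<omega> s = Some (\<beta> j) \<Longrightarrow> coboundary h d s (j + 1) = 0"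
    and "aligned s j" "left_open s j"
  shows "h s j = 0"
  using assms(3,4)
proof (induct "nat s" arbitrary: s j rule: less_induct)
  case (less s j)
  show ?case
  proof (cases "\<omega> (s - 1) = Some (\<beta> (j - 1))")
    case True
    note al = aligned_left[OF less(2) True]
    have "left_open (s - 1) (j - 1)" using left_open.simps[of s j] less(3) True by simp
    then have z: "h (s - 1) (j - 1) = 0"
      using less(1)[of "s - 1" "j - 1"] al \<omega>_range[OF True] by simp
    show ?thesis
    proof (cases "\<beta> (j - 1)")
      case (Dir d)
      then show ?thesis
        using coboundary_right[OF al, of d h] right[OF al, of d] True z by simp
    next
      case (Inv c)
      then show ?thesis
        using coboundary_left[OF less(2), of c h] left[OF less(2), of c] True z by simp
    qed
  next
    case False
    then obtain c where c: "\<beta> (j - 1) = Inv c" using left_open.simps[of s j] less(3) by auto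
    then show ?thesis using coboundary_left[OF less(2), of c h] left[OF less(2) c] False by simp
  qed
qed

end

context string_band
begin

subsection \<open>Right ends are the overlaps\<close>

definition end_s :: "'a overlap \<Rightarrow> int" where
  "end_s ov = int (ov_start ov) + int (length (ov_m ov))"

definition end_j :: "'a overlap \<Rightarrow> int" where
  "end_j ov = int (ov_pos ov) + int (length (ov_m ov))"

lemma overlapsD:
  assumes "ov \<in> overlaps Q I w b"
  shows "\<omega> (int (ov_start ov) - 1) = map_option Dir (ov_A ov)"
    "i < length (ov_m ov) \<Longrightarrow> \<omega> (int (ov_start ov) + int i) = Some (ov_m ov ! i)"
    "\<omega> (end_s ov) = map_option Inv (ov_B ov)"
    "\<beta> (int (ov_pos ov) - 1) = Inv (ov_C ov)"
    "i < length (ov_m ov) \<Longrightarrow> \<beta> (int (ov_pos ov) + int i) = ov_m ov ! i"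
    "\<beta> (end_j ov) = Dir (ov_D ov)"
    "same_vert (int (ov_start ov)) (int (ov_pos ov))"
    "ov_m ov = [] \<Longrightarrow> ov_A ov = Some a \<Longrightarrow> zero_rel Q I (ov_C ov) a"
    "ov_m ov = [] \<Longrightarrow> ov_B ov = Some c \<Longrightarrow> zero_rel Q I (ov_D ov) c"
    "int (ov_start ov) + int (length (ov_m ov)) \<le> len"
proof -
  have ls: "snd w = ov_vR ov @ dir_opt (ov_A ov) @ ov_m ov @ inv_opt (ov_B ov) @ ov_vL ov"
    and A: "ov_A ov = None \<longrightarrow> ov_vR ov = []" and B: "ov_B ov = None \<longrightarrow> ov_vL ov = []"
    and o: "overlap_conditions Q I (ov_A ov) (ov_B ov) (Some (ov_C ov)) (Some (ov_D ov)) (ov_m ov)"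
    and pos: "ov_pos ov < n" and v: "word_vert Q w (ov_start ov) = lsrc Q (b ! ov_pos ov)"
    using assms by (auto simp: overlaps_def)
  show "\<omega> (int (ov_start ov) - 1) = map_option Dir (ov_A ov)"
    using A by (cases "ov_A ov") (auto simp: \<omega>_def word_diagram_def ls dir_opt_def ov_start_def nth_append nat_diff_distrib)
  show "\<omega> (int (ov_start ov) + int i) = Some (ov_m ov ! i)" if "i < length (ov_m ov)"
    using that by (auto simp: \<omega>_def word_diagram_def ls dir_opt_def ov_start_def nth_append nat_add_distrib split: option.splits)
  show "\<omega> (end_s ov) = map_option Inv (ov_B ov)"
    using B by (cases "ov_B ov") (auto simp: \<omega>_def word_diagram_def ls dir_opt_def inv_opt_def end_s_def ov_start_def nth_append nat_add_distrib
        split: option.splits)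
  show "\<beta> (int (ov_pos ov) - 1) = Inv (ov_C ov)" "\<beta> (end_j ov) = Dir (ov_D ov)"
    "i < length (ov_m ov) \<Longrightarrow> \<beta> (int (ov_pos ov) + int i) = ov_m ov ! i"
    using assms by (auto simp: overlaps_def end_j_def)
  show le: "int (ov_start ov) + int (length (ov_m ov)) \<le> len"
    by (auto simp: len_def ls ov_start_def)
  then show "same_vert (int (ov_start ov)) (int (ov_pos ov))"
    using v pos by (simp add: same_vert_def vert_def inf_word_def)
  show "zero_rel Q I (ov_C ov) a" if "ov_m ov = []" "ov_A ov = Some a"
    using o that by (auto simp: overlap_conditions_def)
  show "zero_rel Q I (ov_D ov) c" if "ov_m ov = []" "ov_B ov = Some c"
    using o that by (auto simp: overlap_conditions_def)
qed

lemma aligned_along: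
  assumes "aligned s j" "left_open s j" "\<And>i. i < k \<Longrightarrow> \<omega> (s + int i) = Some (\<beta> (j + int i))"
  shows "aligned (s + int k) (j + int k) \<and> left_open (s + int k) (j + int k)"
  using assms(3)
proof (induct k)
  case 0
  then show ?case using assms by simp
next
  case (Suc k)
  then have IH: "aligned (s + int k) (j + int k)" "left_open (s + int k) (j + int k)"
    and m: "\<omega> (s + int k) = Some (\<beta> (j + int k))" by auto
  have e: "s + int (Suc k) = s + int k + 1" "j + int (Suc k) = j + int k + 1" by auto
  show ?case
    unfolding e using aligned_right[OF IH(1) m] left_open.simps[of "s + int k + 1" "j + int k + 1"] m IH(2) by simp
qed

text \<open>
  If \<open>m\<close> is nontrivial, a common letter determines the sides. For trivial \<open>m\<close> this is what the relations
  \<open>CA\<close> and \<open>DB\<close> in the ideal express.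
\<close>

lemma overlap_aligned:
  assumes ov: "ov \<in> overlaps Q I w b"
  shows "aligned (int (ov_start ov)) (int (ov_pos ov))"
  unfolding aligned_def
proof (intro conjI allI impI)
  note O = overlapsD[OF ov]
  let ?s = "int (ov_start ov)" and ?j = "int (ov_pos ov)"
  show sv: "same_vert ?s ?j" by (rule O(7))
  show r: "side l = side (\<beta> ?j)" if l: "\<omega> ?s = Some l" for l
  proof (cases "ov_m ov")
    case Nil
    then have "\<omega> ?s = map_option Inv (ov_B ov)" "\<beta> ?j = Dir (ov_D ov)" using O(3,6) by (auto simp: end_s_def end_j_def)
    then obtain c where c: "ov_B ov = Some c" "l = Inv c" using l by (cases "ov_B ov") auto
    then have "zero_rel Q I (ov_D ov) c" using O(9) Nil by simp
    moreover have "lsrc Q l = lsrc Q (\<beta> ?j)" using sv \<omega>_vert(1)[OF l] by (simp add: same_vert_def)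
    ultimately show ?thesis
      using side_simps(4)[of c "ov_D ov"] \<omega>_arc[OF l] band_arc[of ?j] c \<open>\<beta> ?j = Dir (ov_D ov)\<close> by simp
  next
    case Cons
    then show ?thesis using O(2)[of 0] O(5)[of 0] l by simp
  qed
  show "side (linv l) = side (linv (\<beta> (?j - 1)))" if l: "\<omega> (?s - 1) = Some l" for l
  proof -
    obtain a where a: "ov_A ov = Some a" "l = Dir a" using l O(1) by (cases "ov_A ov") auto
    show ?thesis
    proof (cases "ov_m ov")
      case Nil
      then have "zero_rel Q I (ov_C ov) a" using O(8) a by simp
      moreover have "ltgt Q l = ltgt Q (\<beta> (?j - 1))"
        using sv \<omega>_vert(2)[OF l] band_vert(2)[of ?j] by (simp add: same_vert_def)
      ultimately show ?thesis
        using side_simps(4)[of a "ov_C ov"] \<omega>_arc[OF l] band_arc[of "?j - 1"] a O(4) by simp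
    next
      case (Cons x xs)
      then have x: "\<omega> ?s = Some x" using O(2)[of 0] by simp
      then show ?thesis using walkD(3)[OF walk_\<omega> l x] r[OF x] band_side[of ?j] by auto
    qed
  qed
qed

lemma overlap_right_end:
  assumes ov: "ov \<in> overlaps Q I w b"
  shows "right_end (end_s ov) (end_j ov)"
proof -
  note O = overlapsD[OF ov]
  have "left_open (int (ov_start ov)) (int (ov_pos ov))"
    unfolding left_open.simps[of "int (ov_start ov)" "int (ov_pos ov)"] using O(1,4) by auto
  then have "aligned (end_s ov) (end_j ov) \<and> left_open (end_s ov) (end_j ov)"
    unfolding end_s_def end_j_def using aligned_along[OF overlap_aligned[OF ov]] O(2,5) by simp
  then show ?thesis using O(3,6) by (auto simp: right_end_def)
qed

lemma left_open_start:
  assumes "aligned s j" "left_open s j"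
  shows "\<exists>k c. int k \<le> s \<and> (\<forall>i<k. \<omega> (s - int k + int i) = Some (\<beta> (j - int k + int i))) \<and>
    aligned (s - int k) (j - int k) \<and> \<beta> (j - int k - 1) = Inv c \<and> \<omega> (s - int k - 1) \<noteq> Some (Inv c)"
  using assms
proof (induct "nat s" arbitrary: s j rule: less_induct)
  case (less s j)
  show ?case
  proof (cases "\<omega> (s - 1) = Some (\<beta> (j - 1))")
    case True
    note al = aligned_left[OF less(2) True] and rng = \<omega>_range[OF True]
    have "left_open (s - 1) (j - 1)" using left_open.simps[of s j] less(3) True by simp
    then obtain k c where k: "int k \<le> s - 1"
      "\<forall>i<k. \<omega> (s - 1 - int k + int i) = Some (\<beta> (j - 1 - int k + int i))"
      "aligned (s - 1 - int k) (j - 1 - int k)" "\<beta> (j - 1 - int k - 1) = Inv c" "\<omega> (s - 1 - int k - 1) \<noteq> Some (Inv c)"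
      using less(1)[of "s - 1" "j - 1"] al rng by auto
    have e: "s - int (Suc k) = s - 1 - int k" "j - int (Suc k) = j - 1 - int k" by auto
    have "\<omega> (s - 1 - int k + int i) = Some (\<beta> (j - 1 - int k + int i))" if "i < Suc k" for i
      using that k(2) True by (cases "i = k") auto
    then show ?thesis
      using k by (intro exI[of _ "Suc k"] exI[of _ c]) (unfold e, auto)
  next
    case False
    then obtain c where "\<beta> (j - 1) = Inv c" using left_open.simps[of s j] less(3) by auto
    then show ?thesis
      using False less(2) by (intro exI[of _ 0] exI[of _ c]) (auto simp: aligned_def same_vert_def)
  qed
qed

lemma unmatched_right:
  assumes "aligned s j" "\<beta> j = Dir d" "\<omega> s = Some l" "l \<noteq> Dir d"
  obtains c where "l = Inv c" "zero_rel Q I d c"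
proof (cases l)
  case (Dir x)
  then show ?thesis
    using assms side_simps(1)[of x d] \<omega>_arc[OF assms(3)] band_arc[of j] \<omega>_vert(1)[OF assms(3)]
    by (auto simp: aligned_def same_vert_def)
next
  case (Inv x)
  then show ?thesis
    using assms side_simps(4)[of x d] \<omega>_arc[OF assms(3)] band_arc[of j] \<omega>_vert(1)[OF assms(3)] that
    by (auto simp: aligned_def same_vert_def)
qed

lemma unmatched_left:
  assumes "aligned s j" "\<beta> (j - 1) = Inv c" "\<omega> (s - 1) = Some l" "l \<noteq> Inv c"
  obtains a where "l = Dir a" "zero_rel Q I c a"
proof (cases l)
  case (Dir x)
  then show ?thesis
    using assms side_simps(4)[of x c] \<omega>_arc[OF assms(3)] band_arc[of "j - 1"] \<omega>_vert(2)[OF assms(3)]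
      band_vert(2)[of j] that
    by (auto simp: aligned_def same_vert_def)
next
  case (Inv x)
  then show ?thesis
    using assms side_simps(1)[of x c] \<omega>_arc[OF assms(3)] band_arc[of "j - 1"] \<omega>_vert(2)[OF assms(3)]
      band_vert(2)[of j]
    by (auto simp: aligned_def same_vert_def)
qed

text \<open>
  The common subword ending at a right end is \<open>m\<close>. By the choice of sides, the next letter of the string
  on either side can only be \<open>A\<close> or the inverse of \<open>B\<close>, or there is none.
\<close>

lemma right_end_overlap:
  assumes "right_end s j"
  obtains ov where "ov \<in> overlaps Q I w b" "end_s ov = s" "(end_j ov - j) mod int n = 0"
proof -
  obtain d where al: "aligned s j" and lo: "left_open s j" and d: "\<beta> j = Dir d" "\<omega> s \<noteq> Some (Dir d)"
    using assms by (auto simp: right_end_def)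
  obtain k c where k: "int k \<le> s" "\<And>i. i < k \<Longrightarrow> \<omega> (s - int k + int i) = Some (\<beta> (j - int k + int i))"
    "aligned (s - int k) (j - int k)" "\<beta> (j - int k - 1) = Inv c" "\<omega> (s - int k - 1) \<noteq> Some (Inv c)"
    using left_open_start[OF al lo] by auto
  define st where "st = nat (s - int k)"
  define ls where "ls = snd w"
  have s: "s = int st + int k" using k(1) by (simp add: st_def)
  have sl: "st + k \<le> length ls"
    using al s by (simp add: aligned_def same_vert_def len_def ls_def)
  have \<omega>n: "\<omega> (int i) = (if i < length ls then Some (ls ! i) else None)" for i
    by (simp add: \<omega>_def word_diagram_def ls_def)
  define A where "A = (if st = 0 then None else Some (letter_arc (ls ! (st - 1))))"
  define B where "B = (if st + k = length ls then None else Some (letter_arc (ls ! (st + k))))"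
  define vR where "vR = take (st - 1) ls"
  define vL where "vL = drop (Suc (st + k)) ls"
  define m where "m = take k (drop st ls)"
  define pos where "pos = nat ((j - int k) mod int n)"
  define ov where "ov = \<lparr>ov_vR = vR, ov_A = A, ov_m = m, ov_B = B, ov_vL = vL, ov_C = c, ov_D = d, ov_pos = pos\<rparr>"
  have posi: "int pos = (j - int k) mod int n" and pos_n: "pos < n"
    using n_pos by (simp_all add: pos_def nat_less_iff)
  have per: "\<beta> (int pos + i) = \<beta> (j - int k + i)" for i
    by (simp add: inf_word_def posi mod_add_left_eq)
  have lenm: "length m = k" using sl by (simp add: m_def)
  have A1: "take st ls = vR @ dir_opt A" and A2: "A = Some a \<Longrightarrow> zero_rel Q I c a" for a
  proof -
    consider "st = 0" | "0 < st" by auto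
    then have "take st ls = vR @ dir_opt A \<and> (\<forall>a. A = Some a \<longrightarrow> zero_rel Q I c a)"
    proof cases
      case 1
      then show ?thesis by (simp add: A_def vR_def dir_opt_def)
    next
      case 2
      have e: "s - int k - 1 = int (st - 1)" using s 2 by simp
      have l: "\<omega> (s - int k - 1) = Some (ls ! (st - 1))" using sl 2 unfolding e \<omega>n by simp
      then have "ls ! (st - 1) \<noteq> Inv c" using k(5) by simp
      then obtain x where x: "ls ! (st - 1) = Dir x" "zero_rel Q I c x"
        using unmatched_left[OF k(3,4) l] by blast
      have "take st ls = take (st - 1) ls @ [ls ! (st - 1)]"
        using take_Suc_conv_app_nth[of "st - 1" ls] 2 sl by simp
      then show ?thesis using x 2 by (simp add: A_def vR_def dir_opt_def)
    qed
    then show "take st ls = vR @ dir_opt A" "A = Some a \<Longrightarrow> zero_rel Q I c a" by auto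
  qed
  have B1: "drop (st + k) ls = inv_opt B @ vL" and B2: "B = Some a \<Longrightarrow> zero_rel Q I d a" for a
  proof -
    consider "st + k = length ls" | "st + k < length ls" using sl by linarith
    then have "drop (st + k) ls = inv_opt B @ vL \<and> (\<forall>a. B = Some a \<longrightarrow> zero_rel Q I d a)"
    proof cases
      case 1
      then show ?thesis by (simp add: B_def vL_def inv_opt_def)
    next
      case 2
      have l: "\<omega> s = Some (ls ! (st + k))" using 2 \<omega>n[of "st + k"] by (simp add: s)
      then have "ls ! (st + k) \<noteq> Dir d" using d(2) by simp
      then obtain x where x: "ls ! (st + k) = Inv x" "zero_rel Q I d x"
        using unmatched_right[OF al d(1) l] by blast
      have "drop (st + k) ls = ls ! (st + k) # drop (Suc (st + k)) ls" using 2 by (simp add: Cons_nth_drop_Suc)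
      then show ?thesis using x 2 by (simp add: B_def vL_def inv_opt_def)
    qed
    then show "drop (st + k) ls = inv_opt B @ vL" "B = Some a \<Longrightarrow> zero_rel Q I d a" by auto
  qed
  have dec: "ls = vR @ dir_opt A @ m @ inv_opt B @ vL"
  proof -
    have "ls = take st ls @ take k (drop st ls) @ drop (st + k) ls"
      using append_take_drop_id[of st ls] append_take_drop_id[of k "drop st ls"]
      by (simp add: add.commute)
    then show ?thesis using A1 B1 by (simp add: m_def)
  qed
  have start: "ov_start ov = st"
    using arg_cong[OF A1, of length] sl by (simp add: ov_start_def ov_def)
  have "ov \<in> overlaps Q I w b"
    unfolding overlaps_def mem_Collect_eq
  proof (intro conjI allI impI)
    show "snd w = ov_vR ov @ dir_opt (ov_A ov) @ ov_m ov @ inv_opt (ov_B ov) @ ov_vL ov"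
      using dec by (simp add: ov_def ls_def)
    show "ov_vR ov = []" if "ov_A ov = None" using that by (auto simp: ov_def A_def vR_def split: if_splits)
    show "ov_vL ov = []" if "ov_B ov = None" using that by (auto simp: ov_def B_def vL_def split: if_splits)
    show "ov_pos ov < length b" using pos_n by (simp add: ov_def)
    show "inf_word b (int (ov_pos ov) - 1) = Inv (ov_C ov)"
      using per[of "-1"] k(4) by (simp add: ov_def)
    show "inf_word b (int (ov_pos ov) + int i) = ov_m ov ! i" if i: "i < length (ov_m ov)" for i
    proof -
      have ik: "i < k" using i lenm by (simp add: ov_def)
      have "\<omega> (int (st + i)) = Some (\<beta> (j - int k + int i))" using k(2)[OF ik] by (simp add: s)
      then have "ls ! (st + i) = \<beta> (j - int k + int i)" unfolding \<omega>n by (simp split: if_splits)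
      then show ?thesis using per[of "int i"] ik sl by (simp add: ov_def m_def)
    qed
    show "inf_word b (int (ov_pos ov) + int (length (ov_m ov))) = Dir (ov_D ov)"
      using per[of "int k"] d(1) lenm by (simp add: ov_def)
    show "word_vert Q w (ov_start ov) = lsrc Q (b ! ov_pos ov)"
      using k(3) per[of 0] s pos_n unfolding start
      by (simp add: aligned_def same_vert_def vert_def ov_def inf_word_def)
    show "overlap_conditions Q I (ov_A ov) (ov_B ov) (Some (ov_C ov)) (Some (ov_D ov)) (ov_m ov)"
      using A2 B2 by (simp add: overlap_conditions_def ov_def)
  qed
  moreover have "end_s ov = int st + int k" unfolding end_s_def start using lenm by (simp add: ov_def)
  moreover have "(end_j ov - j) mod int n = 0"
  proof -
    have "int pos - (j - int k) = int n * (- ((j - int k) div int n))"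
      unfolding posi mult_minus_right using mult_div_mod_eq[of "int n" "j - int k"] by linarith
    moreover have "end_j ov - j = int pos - (j - int k)" using lenm by (simp add: end_j_def ov_def)
    ultimately have "end_j ov - j = int n * (- ((j - int k) div int n))" by linarith
    then show ?thesis by (simp only: mod_mult_self1_is_0)
  qed
  ultimately show ?thesis using that[of ov] s by simp
qed

lemma inf_word_cong: "(i - j) mod int n = 0 \<Longrightarrow> \<beta> (i + k) = \<beta> (j + k)"
proof -
  assume "(i - j) mod int n = 0"
  then have "i mod int n = j mod int n" by (simp add: mod_eq_dvd_iff mod_0_imp_dvd)
  then have "(i + k) mod int n = (j + k) mod int n"
    using mod_add_left_eq[of i "int n" k] mod_add_left_eq[of j "int n" k] by simp
  then show ?thesis by (simp add: inf_word_def)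
qed

text \<open>
  Since \<open>m\<close> is a maximal common subword, it is determined by its right end.
\<close>

lemma overlap_determined_by_end:
  assumes ov: "ov \<in> overlaps Q I w b" and ov': "ov' \<in> overlaps Q I w b"
    and s: "end_s ov = end_s ov'" and j: "(end_j ov - end_j ov') mod int n = 0"
  shows "ov = ov'"
proof -
  note O = overlapsD[OF ov] and O' = overlapsD[OF ov']
  \<comment> \<open>a longer common part would cover the letter at which the shorter one is known to stop\<close>
  have no_longer: "\<not> length (ov_m x) < length (ov_m y)"
    if x: "x \<in> overlaps Q I w b" and y: "y \<in> overlaps Q I w b" and s: "end_s x = end_s y"
      and j: "(end_j y - end_j x) mod int n = 0" for x y
  proof
    assume less: "length (ov_m x) < length (ov_m y)"
    define i where "i = length (ov_m y) - length (ov_m x) - 1"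
    have i: "i < length (ov_m y)" using less by (simp add: i_def)
    have li: "int i = int (length (ov_m y)) - int (length (ov_m x)) - 1" using less by (simp add: i_def)
    have "int (ov_start y) + int i = int (ov_start x) - 1" using s li by (simp add: end_s_def)
    then have 1: "\<omega> (int (ov_start x) - 1) = Some (ov_m y ! i)" using overlapsD(2)[OF y i] by simp
    have "\<beta> (int (ov_pos x) - 1) = \<beta> (end_j x + (- int (length (ov_m x)) - 1))"
      by (simp add: end_j_def)
    also have "\<dots> = \<beta> (end_j y + (- int (length (ov_m x)) - 1))"
      using inf_word_cong[OF j] by simp
    also have "end_j y + (- int (length (ov_m x)) - 1) = int (ov_pos y) + int i"
      using li by (simp add: end_j_def)
    finally have "ov_m y ! i = Inv (ov_C x)" using overlapsD(5)[OF y i] overlapsD(4)[OF x] by simp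
    then show False using 1 overlapsD(1)[OF x] by (cases "ov_A x") auto
  qed
  have j': "(end_j ov' - end_j ov) mod int n = 0"
    using j dvd_diff_commute[of "int n" "end_j ov" "end_j ov'"] by (simp add: dvd_eq_mod_eq_0)
  have lm: "length (ov_m ov) = length (ov_m ov')"
    using no_longer[OF ov ov' s j'] no_longer[OF ov' ov s[symmetric] j] by linarith
  have st: "ov_start ov = ov_start ov'" using s lm by (simp add: end_s_def)
  have p: "ov_pos ov < n" "ov_pos ov' < n" using ov ov' by (auto simp: overlaps_def)
  have "(int (ov_pos ov) - int (ov_pos ov')) mod int n = 0" using j lm by (simp add: end_j_def)
  then have "int (ov_pos ov) mod int n = int (ov_pos ov') mod int n"
    by (simp add: mod_eq_dvd_iff mod_0_imp_dvd)
  then have pos: "ov_pos ov = ov_pos ov'" using p by simp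
  have A: "ov_A ov = ov_A ov'"
    using O(1) O'(1) st by (cases "ov_A ov"; cases "ov_A ov'") auto
  have B: "ov_B ov = ov_B ov'"
    using O(3) O'(3) s by (cases "ov_B ov"; cases "ov_B ov'") auto
  have m: "ov_m ov = ov_m ov'"
    using O(5) O'(5) lm pos by (intro nth_equalityI) auto
  have C: "ov_C ov = ov_C ov'" using O(4) O'(4) pos by simp
  have D: "ov_D ov = ov_D ov'" using O(6) O'(6) inf_word_cong[OF j, of 0] by simp
  have "snd w = ov_vR ov @ dir_opt (ov_A ov) @ ov_m ov @ inv_opt (ov_B ov) @ ov_vL ov"
    "snd w = ov_vR ov' @ dir_opt (ov_A ov') @ ov_m ov' @ inv_opt (ov_B ov') @ ov_vL ov'"
    using ov ov' by (auto simp: overlaps_def)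
  moreover have "length (ov_vR ov) = length (ov_vR ov')" using st A by (simp add: ov_start_def)
  ultimately have "ov_vR ov = ov_vR ov'" "ov_vL ov = ov_vL ov'" using A B m by auto
  then show ?thesis using A B C D m pos by (simp add: overlap.equality)
qed

end

section \<open>Both orientations of the string\<close>

text \<open>
  The string with both orientations. Facts about the inverse string carry the prefix \<open>rev\<close>; place \<open>s\<close> of the
  string is place \<open>len - s\<close> of its inverse.
\<close>

locale string_band_pair = string_band Q I b t\<^sub>0 \<mu> v
  for Q :: "('v, 'a) pre_digraph" and I :: "(('v, 'a) path \<Rightarrow> 'k::field) set"
    and b :: "'a letter list" and t\<^sub>0 :: nat and \<mu> :: 'k and v :: "('v, 'a) word"
begin

lemma word_inv_diagram:
  "word_diagram (snd (word_inv Q v)) s = map_option linv (\<omega> (len - 1 - s))"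
  by (auto simp: word_diagram_def \<omega>_def len_def word_inv_def rev_nth nat_diff_distrib
      intro!: arg_cong[where f = "\<lambda>i. linv (snd v ! i)"])

lemma good_word_inv: "good_word (word_inv Q v)"
proof -
  have ls: "snd (word_inv Q v) = map linv (rev (snd v))" by (simp add: word_inv_def)
  have "fst (word_inv Q v) \<in> verts Q"
  proof -
    interpret g: gentle_rep Q I "Suc (length (snd v))" "word_vert Q v" "letter_mat (snd v) Suc (\<lambda>_. 1 :: 'k)"
      by (rule string_rep[OF w])
    show ?thesis using g.vt by (simp add: word_inv_def)
  qed
  moreover have "fst (word_inv Q v) = lsrc Q (hd (snd (word_inv Q v)))" if "snd (word_inv Q v) \<noteq> []"
    using that by (cases "snd v" rule: rev_cases) (auto simp: word_inv_def word_vert_def)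
  moreover have "walk (word_diagram (snd (word_inv Q v)))"
    unfolding walk_def word_inv_diagram
  proof (intro conjI allI impI)
    fix j l assume "map_option linv (\<omega> (len - 1 - j)) = Some l"
    then show "letter_arc l \<in> arcs Q" using \<omega>_arc by auto
  next
    fix j l l' assume "map_option linv (\<omega> (len - 1 - j)) = Some l" "map_option linv (\<omega> (len - 1 - (j + 1))) = Some l'"
    then obtain k k' where k: "\<omega> (len - 1 - j) = Some k" "l = linv k" "\<omega> (len - 1 - j - 1) = Some k'" "l' = linv k'"
      by (auto simp: algebra_simps)
    then show "step l l'" using walkD(3)[OF walk_\<omega> k(3,1)] by (auto simp: step_def)
  qed
  ultimately show ?thesis by (simp add: good_word_def)
qed

sublocale rev: string_band Q I b t\<^sub>0 \<mu> "word_inv Q v"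
  by unfold_locales (rule good_word_inv)

lemma rev_len: "rev.len = len"
  unfolding rev.len_def len_def by (simp add: word_inv_def)

lemma rev_\<omega>: "rev.\<omega> s = map_option linv (\<omega> (len - 1 - s))"
  by (simp add: rev.\<omega>_def word_inv_diagram)

lemma rev_vert:
  assumes "0 \<le> s" "s \<le> len"
  shows "rev.vert s = vert (len - s)"
proof (cases "s = 0")
  case True
  then show ?thesis unfolding rev.vert_def vert_def len_def by (simp add: word_inv_def word_vert_def)
next
  case False
  have r: "0 \<le> len - s" "len - s < len" using assms False by auto
  then obtain l where l: "\<omega> (len - s) = Some l" by (simp add: \<omega>_def word_diagram_def len_def)
  have "rev.\<omega> (s - 1) = Some (linv l)" using l by (simp add: rev_\<omega>)
  from rev.\<omega>_vert(2)[OF this] show ?thesis using \<omega>_vert(1)[OF l] by simp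
qed

lemma rev_same_vert: "rev.same_vert s j \<longleftrightarrow> same_vert (len - s) j"
  using rev_vert[of s] by (auto simp: rev.same_vert_def same_vert_def rev_len)

definition flip :: "('a \<Rightarrow> int \<Rightarrow> int \<Rightarrow> 'k) \<Rightarrow> 'a \<Rightarrow> int \<Rightarrow> int \<Rightarrow> 'k" where
  "flip f = (\<lambda>a s j. f a (len - s) j)"

lemma linv_eq: "linv l = Dir a \<longleftrightarrow> l = Inv a" "linv l = Inv a \<longleftrightarrow> l = Dir a"
  by (cases l; simp)+

lemma rev_ract: "ract rev.\<omega> a g s = ract \<omega> a (\<lambda>s. g (len - s)) (len - s)"
proof -
  have e: "len - 1 - s = len - s - 1" "len - 1 - (s - 1) = len - s" "len - (len - s - 1) = s + 1"
    "len - (len - s + 1) = s - 1" by simp_all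
  show ?thesis by (simp add: ract_def rev_\<omega> e linv_eq)
qed

lemma rev_coboundary: "rev.coboundary h a s j = coboundary (\<lambda>s. h (len - s)) a (len - s) j"
  by (simp add: rev.coboundary_def coboundary_def rev_ract)

lemma rev_cocycle:
  assumes f: "cocycle f"
  shows "rev.cocycle (flip f)"
  unfolding rev.cocycle_def rev.cochain_def
proof (intro conjI allI impI ballI)
  have fc: "cochain f" using f by (simp add: cocycle_def)
  show "quasi_periodic (flip f a s)" for a s
    using fc by (simp add: flip_def cochain_def)
  fix a s j assume "flip f a s j \<noteq> 0"
  then have "a \<in> arcs Q \<and> 0 \<le> len - s \<and> len - s \<le> len \<and> vert (len - s) = tail Q a \<and> lsrc Q (\<beta> j) = head Q a"
    using cochainD(1)[OF fc, of a "len - s" j] unfolding flip_def by blast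
  then show "a \<in> arcs Q" "0 \<le> s" "s \<le> rev.len" "rev.vert s = tail Q a" "lsrc Q (\<beta> j) = head Q a"
    using rev_vert[of s] by (auto simp: rev_len)
next
  fix a c s j
  assume "a \<in> arcs Q" "c \<in> arcs Q" "head Q a = tail Q c" "zero_rel Q I c a"
  then have "lact \<beta>\<omega> c (f a (len - s)) j + ract \<omega> a (\<lambda>s. f c s j) (len - s) = 0"
    using f by (simp add: cocycle_def)
  then show "lact \<beta>\<omega> c (flip f a s) j + ract rev.\<omega> a (\<lambda>s. flip f c s j) s = 0"
    unfolding rev_ract by (simp add: flip_def)
qed

text \<open>
  The band passes from one side of the vertex to the other, and the string does the same or the opposite.
\<close>

lemma aligned_either:
  assumes "same_vert s j"
  shows "aligned s j \<or> rev.aligned (len - s) j"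
proof -
  have lr: "side (linv l) \<noteq> side l'" if "\<omega> (s - 1) = Some l" "\<omega> s = Some l'" for l l'
    using walkD(3)[OF walk_\<omega> that] by simp
  have r: "rev.aligned (len - s) j" if
    "\<And>l. \<omega> s = Some l \<Longrightarrow> side l \<noteq> side (\<beta> j)" "\<And>l. \<omega> (s - 1) = Some l \<Longrightarrow> side (linv l) = side (\<beta> j)"
  proof -
    have e: "len - 1 - (len - s) = s - 1" "len - 1 - (len - s - 1) = s" by simp_all
    show ?thesis
      using assms that band_side[of j] unfolding rev.aligned_def rev_same_vert rev_\<omega> e by auto
  qed
  have a: "aligned s j" if
    "\<And>l. \<omega> s = Some l \<Longrightarrow> side l = side (\<beta> j)" "\<And>l. \<omega> (s - 1) = Some l \<Longrightarrow> side (linv l) \<noteq> side (\<beta> j)"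
    using assms that band_side[of j] unfolding aligned_def by auto
  show ?thesis
  proof (cases "\<omega> s")
    case None
    then show ?thesis using a r by (cases "\<omega> (s - 1)") auto
  next
    case (Some l')
    then show ?thesis using a r lr by (cases "side l' = side (\<beta> j)") auto
  qed
qed

lemma aligned_not_both:
  assumes "aligned s j" "rev.aligned (len - s) j"
  shows "snd v = []"
proof (rule ccontr)
  assume "snd v \<noteq> []"
  then have "0 < len" by (simp add: len_def)
  then have "s < len \<or> 0 < s" by linarith
  moreover have "0 \<le> s" "s \<le> len" using assms(1) by (auto simp: aligned_def same_vert_def)
  ultimately have "(\<exists>l. \<omega> s = Some l) \<or> (\<exists>l. \<omega> (s - 1) = Some l)"
    by (auto simp: \<omega>_def word_diagram_def len_def)
  moreover have e: "len - 1 - (len - s) = s - 1" "len - 1 - (len - s - 1) = s" by simp_all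
  ultimately show False
    using assms band_side[of j] unfolding aligned_def rev.aligned_def rev_\<omega> e by auto
qed

text \<open>For a trivial string both orientations coincide, and only one of them may be counted.\<close>

definition is_end :: "int \<Rightarrow> int \<Rightarrow> bool" where
  "is_end s j \<longleftrightarrow> right_end s j \<or> snd v \<noteq> [] \<and> rev.right_end (len - s) j"

text \<open>
  The recursions for the two orientations concern disjoint sets of pairs of places unless the string is
  trivial, so their solutions can be combined to a single matrix \<open>h\<close>.
\<close>

lemma cocycle_reduce:
  assumes f: "cocycle f"
  obtains h where "hom_matrix h"
    "\<And>s j c. same_vert s j \<Longrightarrow> \<beta> (j - 1) = Inv c \<Longrightarrow> coboundary h c s (j - 1) = f c s (j - 1)"
    "\<And>s j d. same_vert s j \<Longrightarrow> \<beta> j = Dir d \<Longrightarrow> \<not> is_end s j \<Longrightarrow> coboundary h d s (j + 1) = f d s (j + 1)"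
proof -
  have fc: "cochain f" using f by (simp add: cocycle_def)
  have rc: "rev.cochain (flip f)" using rev_cocycle[OF f] by (simp add: rev.cocycle_def)
  define h where "h s j = (if aligned s j then solution f s j
    else if rev.aligned (len - s) j then rev.solution (flip f) (len - s) j else 0)" for s j
  have h1: "h s j = solution f s j" if "aligned s j" for s j using that by (simp add: h_def)
  have h2: "h (len - s) j = rev.solution (flip f) s j" if "rev.aligned s j" "snd v \<noteq> []" for s j
    using that aligned_not_both[of "len - s" j] by (auto simp: h_def)
  have "hom_matrix h"
    unfolding hom_matrix_def
  proof (intro conjI allI impI)
    show "quasi_periodic (h s)" for s
      unfolding quasi_periodic_def h_def aligned_period rev.aligned_period solution_def rev.solution_def
        left_open_period rev.left_open_period left_sum_period[OF fc] right_sum_period[OF fc]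
        rev.left_sum_period[OF rc] rev.right_sum_period[OF rc]
      by simp
    show "same_vert s j" if "h s j \<noteq> 0" for s j
      using that aligned_same_vert[of s j] rev.aligned_same_vert[of "len - s" j] rev_same_vert[of "len - s" j]
      by (auto simp: h_def split: if_splits)
  qed
  moreover have triv: "aligned s j" if "same_vert s j" "snd v = []" for s j
    using that by (auto simp: aligned_def \<omega>_def word_diagram_def)
  moreover have "coboundary h c s (j - 1) = f c s (j - 1)" if sj: "same_vert s j" "\<beta> (j - 1) = Inv c" for s j c
  proof (cases "aligned s j")
    case True
    then show ?thesis using solution_left[OF True sj(2)] h1 by blast
  next
    case False
    then have al: "rev.aligned (len - s) j" "snd v \<noteq> []" using aligned_either sj triv by blast+
    have "rev.coboundary (\<lambda>s. h (len - s)) c (len - s) (j - 1) = flip f c (len - s) (j - 1)"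
      by (rule rev.solution_left[OF al(1) sj(2)]) (use h2 al in blast)
    then show ?thesis by (simp add: rev_coboundary flip_def)
  qed
  moreover have "coboundary h d s (j + 1) = f d s (j + 1)"
    if sj: "same_vert s j" "\<beta> j = Dir d" "\<not> is_end s j" for s j d
  proof (cases "aligned s j")
    case True
    then show ?thesis using solution_right[OF True sj(2)] h1 sj(3) by (auto simp: is_end_def)
  next
    case False
    then have al: "rev.aligned (len - s) j" "snd v \<noteq> []" using aligned_either sj triv by blast+
    have "rev.coboundary (\<lambda>s. h (len - s)) d (len - s) (j + 1) = flip f d (len - s) (j + 1)"
      by (rule rev.solution_right[OF al(1) sj(2)]) (use h2 al sj in \<open>auto simp: is_end_def\<close>)
    then show ?thesis by (simp add: rev_coboundary flip_def)
  qed
  ultimately show ?thesis using that by blast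
qed

text \<open>
  This is why the numbers at the right ends are independent: a coboundary with no other entries at the
  arrows leaving the band comes from a matrix which vanishes along all overlaps.
\<close>

lemma coboundary_zero_at_ends:
  assumes left: "\<And>s j c. same_vert s j \<Longrightarrow> \<beta> (j - 1) = Inv c \<Longrightarrow> coboundary h c s (j - 1) = 0"
    and right: "\<And>s j d. same_vert s j \<Longrightarrow> \<beta> j = Dir d \<Longrightarrow> \<not> is_end s j \<Longrightarrow> coboundary h d s (j + 1) = 0"
    and "is_end s j" "\<beta> j = Dir d"
  shows "coboundary h d s (j + 1) = 0"
proof (cases "right_end s j")
  case True
  have ne: "\<not> is_end s j" if "aligned s j" "\<omega> s = Some (\<beta> j)" for s j
    using that aligned_not_both[of s j] by (auto simp: is_end_def right_end_def rev.right_end_def)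
  have al: "aligned s j" "left_open s j" "\<omega> s \<noteq> Some (Dir d)" using True assms(4) by (auto simp: right_end_def)
  have "h s j = 0"
    by (rule coboundary_zero_along_overlap[OF _ _ al(1,2)])
      (use left right ne aligned_same_vert in blast)+
  then show ?thesis using coboundary_right[OF al(1) assms(4), of h] al(3) by simp
next
  case False
  then have re: "rev.right_end (len - s) j" "snd v \<noteq> []" using assms(3) by (auto simp: is_end_def)
  have ne: "\<not> is_end (len - s) j" if "rev.aligned s j" "rev.\<omega> s = Some (\<beta> j)" for s j
    using that aligned_not_both[of "len - s" j] re(2) by (auto simp: is_end_def right_end_def rev.right_end_def)
  have sv: "same_vert (len - s) j" if "rev.aligned s j" for s j
    using rev.aligned_same_vert[OF that] by (simp add: rev_same_vert)
  have al: "rev.aligned (len - s) j" "rev.left_open (len - s) j" "rev.\<omega> (len - s) \<noteq> Some (Dir d)"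
    using re(1) assms(4) by (auto simp: rev.right_end_def)
  have "(\<lambda>s. h (len - s)) (len - s) j = 0"
    by (rule rev.coboundary_zero_along_overlap[OF _ _ al(1,2)])
      (use left right ne sv in \<open>auto simp: rev_coboundary\<close>)
  then show ?thesis
    using rev.coboundary_right[OF al(1) assms(4), of "\<lambda>s. h (len - s)"] al(3) by (simp add: rev_coboundary)
qed

end

section \<open>Extensions of string modules by band modules\<close>

context band_setup
begin

sublocale N: gentle_rep Q I n "\<lambda>i. lsrc Q (b ! i)" band_mat
  by (rule band_rep)

abbreviation Nb where "Nb \<equiv> band_module Q I b t\<^sub>0 \<mu>"

lemma Nb_eq: "Nb = N.QM"
  by (rule band_module_def)

lemma Nb_simps:
  "x \<in> carrier Nb \<longleftrightarrow> x \<in> N.space" "\<zero>\<^bsub>Nb\<^esub> = (\<lambda>_. 0)" "x \<oplus>\<^bsub>Nb\<^esub> y = (\<lambda>i. x i + y i)"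
  by (simp_all add: Nb_eq N.QM_simps)

lemma left_module_Nb: "left_module \<Lambda> Nb"
  unfolding Nb_eq by (rule N.left_module_QM)

lemma band_vector_space: "band_vector g \<in> N.space"
  by (simp add: band_vector_def N.space_def)

lemma N_eqI:
  assumes "x \<in> N.space" "y \<in> N.space" "band_coords x = band_coords y"
  shows "x = y"
proof -
  have "x = band_vector (band_coords x)"
    using assms(1) by (intro band_vector_coords[symmetric]) (simp add: N.space_def)
  also have "\<dots> = band_vector (band_coords y)" by (rule arg_cong[OF assms(3)])
  also have "\<dots> = y" using assms(2) by (intro band_vector_coords) (simp add: N.space_def)
  finally show ?thesis .
qed

lemma band_coords_simps:
  "band_coords (\<lambda>i. x i + y i) = (\<lambda>j. band_coords x j + band_coords y j)"
  "band_coords (\<lambda>i. c * x i) = (\<lambda>j. c * band_coords x j)"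
  "band_coords (\<lambda>_. 0) = (\<lambda>_. 0)"
  by (auto simp: band_coords_def algebra_simps)

lemma lsrc_inf_word: "lsrc Q (b ! nat (j mod int n)) = lsrc Q (\<beta> j)"
  by (simp add: inf_word_def)

lemma band_coords_gen:
  assumes "x \<in> N.space"
  shows "band_coords (gen (Scal c) \<odot>\<^bsub>Nb\<^esub> x) = (\<lambda>j. c * band_coords x j)"
    and "y \<in> verts Q \<Longrightarrow> band_coords (gen (Vert y) \<odot>\<^bsub>Nb\<^esub> x) = (\<lambda>j. if lsrc Q (\<beta> j) = y then band_coords x j else 0)"
    and "a \<in> arcs Q \<Longrightarrow> band_coords (gen (Arr a) \<odot>\<^bsub>Nb\<^esub> x) = lact \<beta>\<omega> a (band_coords x)"
proof -
  show "band_coords (gen (Scal c) \<odot>\<^bsub>Nb\<^esub> x) = (\<lambda>j. c * band_coords x j)"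
    unfolding Nb_eq N.smult_gen(1)[OF assms] by (rule band_coords_simps(2))
  show "band_coords (gen (Vert y) \<odot>\<^bsub>Nb\<^esub> x) = (\<lambda>j. if lsrc Q (\<beta> j) = y then band_coords x j else 0)" if "y \<in> verts Q"
    unfolding Nb_eq N.smult_gen(2)[OF assms that] by (auto simp: band_coords_def lsrc_inf_word)
  show "band_coords (gen (Arr a) \<odot>\<^bsub>Nb\<^esub> x) = lact \<beta>\<omega> a (band_coords x)" if "a \<in> arcs Q"
    unfolding Nb_eq N.smult_gen(3)[OF assms that] by (rule ext) (rule band_arrow_act)
qed

end

lemma sum_lessThan_add: "(\<Sum>i<m + k. g i) = (\<Sum>i<m. g i) + (\<Sum>i<k. g (m + i))"
  for g :: "nat \<Rightarrow> 'b::comm_monoid_add"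
  by (induct k) (auto simp: add.assoc)

definition unit_vec :: "nat \<Rightarrow> nat \<Rightarrow> 'k::field" where
  "unit_vec s = (\<lambda>i. if i = s then 1 else 0)"

text \<open>
  An additive and homogeneous map on a coordinate space is given by its values on the unit vectors; here
  in the form needed for vectors stored as functions with bounded support.
\<close>

lemma linear_map_matrix:
  fixes D :: "(nat \<Rightarrow> 'k::field) \<Rightarrow> nat \<Rightarrow> 'k"
  assumes add: "\<And>x y. \<forall>i\<ge>d. x i = 0 \<Longrightarrow> \<forall>i\<ge>d. y i = 0 \<Longrightarrow> D (\<lambda>i. x i + y i) = (\<lambda>i. D x i + D y i)"
    and scal: "\<And>c x. \<forall>i\<ge>d. x i = 0 \<Longrightarrow> D (\<lambda>i. c * x i) = (\<lambda>i. c * D x i)"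
    and m: "\<forall>i\<ge>d. m i = 0"
  shows "D m = (\<lambda>i. \<Sum>s<d. m s * D (unit_vec s) i)"
proof -
  have trunc: "D (\<lambda>i. if i < k then m i else 0) = (\<lambda>i. \<Sum>s<k. m s * D (unit_vec s) i)" if "k \<le> d" for k
    using that
  proof (induct k)
    case 0
    then show ?case using scal[of "\<lambda>_. 0" 0] by simp
  next
    case (Suc k)
    have "(\<lambda>i. if i < Suc k then m i else 0) = (\<lambda>i. (if i < k then m i else 0) + m k * unit_vec k i)"
      by (auto simp: unit_vec_def fun_eq_iff less_Suc_eq)
    moreover have "\<forall>i\<ge>d. m k * unit_vec k i = 0" "\<forall>i\<ge>d. unit_vec k i = (0::'k)" using Suc(2) by (auto simp: unit_vec_def)
    ultimately show ?case
      using add[of "\<lambda>i. if i < k then m i else 0" "\<lambda>i. m k * unit_vec k i"] scal[of "unit_vec k" "m k"] Suc by simp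
  qed
  have "(\<lambda>i. if i < d then m i else 0) = m" using m by auto
  then show ?thesis using trunc[of d] by simp
qed

context string_band
begin

sublocale M: gentle_rep Q I "Suc (length (snd w))" "word_vert Q w" "letter_mat (snd w) Suc (\<lambda>_. 1)"
  by (rule string_rep[OF w])

abbreviation Mw where "Mw \<equiv> string_module Q I w"
abbreviation L where "L \<equiv> length (snd w)"

lemma Mw_eq: "Mw = M.QM"
  by (rule string_module_def)

lemma Mw_simps:
  "x \<in> carrier Mw \<longleftrightarrow> x \<in> M.space" "\<zero>\<^bsub>Mw\<^esub> = (\<lambda>_. 0)" "x \<oplus>\<^bsub>Mw\<^esub> y = (\<lambda>i. x i + y i)"
  by (simp_all add: Mw_eq M.QM_simps)

lemma left_module_Mw: "left_module \<Lambda> Mw"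
  unfolding Mw_eq by (rule M.left_module_QM)

lemma Mw_gen:
  assumes "m \<in> M.space"
  shows "gen (Scal c) \<odot>\<^bsub>Mw\<^esub> m = (\<lambda>i. c * m i)"
    and "y \<in> verts Q \<Longrightarrow> gen (Vert y) \<odot>\<^bsub>Mw\<^esub> m = (\<lambda>i. if word_vert Q w i = y then m i else 0)"
    and "a \<in> arcs Q \<Longrightarrow> gen (Arr a) \<odot>\<^bsub>Mw\<^esub> m = M.aact a m"
  unfolding Mw_eq using M.smult_gen[OF assms] by auto

sublocale X: generated_ext \<Lambda> Mw Nb gens gen
proof (rule generated_ext.intro)
  show "left_module \<Lambda> Mw" by (rule left_module_Mw)
  show "left_module \<Lambda> Nb" by (rule left_module_Nb)
  show "gen \<gamma> \<in> carrier \<Lambda>" if "\<gamma> \<in> gens" for \<gamma> by (rule gen_closed[OF that])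
  show "P r" if "r \<in> carrier \<Lambda>" "\<And>\<gamma>. \<gamma> \<in> gens \<Longrightarrow> P (gen \<gamma>)"
    "\<And>r s. r \<in> carrier \<Lambda> \<Longrightarrow> s \<in> carrier \<Lambda> \<Longrightarrow> P r \<Longrightarrow> P s \<Longrightarrow> P (r \<oplus>\<^bsub>\<Lambda>\<^esub> s)"
    "\<And>r s. r \<in> carrier \<Lambda> \<Longrightarrow> s \<in> carrier \<Lambda> \<Longrightarrow> P r \<Longrightarrow> P s \<Longrightarrow> P (r \<otimes>\<^bsub>\<Lambda>\<^esub> s)" for P r
    by (rule gen_induct[of r P, OF that])
qed

lemma aact_lact: "s \<le> L \<Longrightarrow> M.aact a m s = lact \<omega> a (zext m) (int s)"
  unfolding \<omega>_def by (rule string_arrow_act)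

lemma lact_ract_adjoint:
  "(\<Sum>s\<le>L. lact \<omega> a (zext m) (int s) * g (int s)) = (\<Sum>s\<le>L. m s * ract \<omega> a g (int s))"
proof -
  have 0: "\<omega> (- 1) = None" and L: "\<omega> (int L) = None" by (auto simp: \<omega>_def word_diagram_def)
  have "(\<Sum>s\<le>L. lact \<omega> a (zext m) (int s) * g (int s)) =
    (\<Sum>s\<le>L. if \<omega> (int s - 1) = Some (Dir a) then zext m (int s - 1) * g (int s) else 0) +
    (\<Sum>s\<le>L. if \<omega> (int s) = Some (Inv a) then zext m (int s + 1) * g (int s) else 0)"
    unfolding sum.distrib[symmetric] by (intro sum.cong) (auto simp: lact_def algebra_simps)
  also have "(\<Sum>s\<le>L. if \<omega> (int s - 1) = Some (Dir a) then zext m (int s - 1) * g (int s) else 0) =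
    (\<Sum>s<L. if \<omega> (int s) = Some (Dir a) then m s * g (int s + 1) else 0)"
    unfolding sum.atMost_shift using 0 by (auto simp: zext_def add.commute intro!: sum.cong)
  also have "\<dots> = (\<Sum>s\<le>L. if \<omega> (int s) = Some (Dir a) then m s * g (int s + 1) else 0)"
    using L by (simp add: lessThan_Suc_atMost[symmetric])
  also have "(\<Sum>s\<le>L. if \<omega> (int s) = Some (Inv a) then zext m (int s + 1) * g (int s) else 0) =
    (\<Sum>s<L. if \<omega> (int s) = Some (Inv a) then m (Suc s) * g (int s) else 0)"
    using L by (simp add: lessThan_Suc_atMost[symmetric] zext_def nat_add_distrib cong: if_cong)
  also have "\<dots> = (\<Sum>s\<le>L. if \<omega> (int s - 1) = Some (Inv a) then m s * g (int s - 1) else 0)"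
    unfolding sum.atMost_shift using 0 by (auto intro!: sum.cong)
  also have "(\<Sum>s\<le>L. if \<omega> (int s) = Some (Dir a) then m s * g (int s + 1) else 0) + \<dots> =
    (\<Sum>s\<le>L. m s * ract \<omega> a g (int s))"
    unfolding sum.distrib[symmetric] by (intro sum.cong) (auto simp: ract_def algebra_simps)
  finally show ?thesis .
qed

definition apply_matrix :: "(int \<Rightarrow> int \<Rightarrow> 'k) \<Rightarrow> (nat \<Rightarrow> 'k) \<Rightarrow> int \<Rightarrow> 'k" where
  "apply_matrix h m = (\<lambda>j. \<Sum>s\<le>L. m s * h (int s) j)"

lemma apply_matrix_simps:
  "apply_matrix h (\<lambda>i. x i + y i) = (\<lambda>j. apply_matrix h x j + apply_matrix h y j)"
  "apply_matrix h (\<lambda>i. c * x i) = (\<lambda>j. c * apply_matrix h x j)"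
  by (auto simp: apply_matrix_def sum.distrib sum_distrib_left algebra_simps)

lemma apply_matrix_unit_vec:
  assumes "s \<le> L"
  shows "apply_matrix h (unit_vec s) = h (int s)"
proof
  fix j
  have "apply_matrix h (unit_vec s) j = (\<Sum>t\<le>L. if t = s then h (int t) j else 0)"
    unfolding apply_matrix_def by (intro sum.cong) (auto simp: unit_vec_def)
  then show "apply_matrix h (unit_vec s) j = h (int s) j" using assms by simp
qed

lemma apply_matrix_quasi_periodic:
  "(\<And>s. quasi_periodic (h s)) \<Longrightarrow> quasi_periodic (apply_matrix h m)"
  by (simp add: quasi_periodic_def apply_matrix_def sum_divide_distrib)

lemma apply_matrix_aact:
  "apply_matrix h (M.aact a m) j = (\<Sum>s\<le>L. m s * ract \<omega> a (\<lambda>s. h s j) (int s))"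
  unfolding lact_ract_adjoint[symmetric] by (simp add: apply_matrix_def aact_lact)

lemma lact_apply_matrix: "lact \<beta>\<omega> a (apply_matrix h m) j = (\<Sum>s\<le>L. m s * lact \<beta>\<omega> a (h (int s)) j)"
  by (simp add: lact_def apply_matrix_def sum.distrib algebra_simps)

text \<open>
  The passage from matrices to the defects of retractions.
\<close>

definition cochain_map :: "('a \<Rightarrow> int \<Rightarrow> int \<Rightarrow> 'k) \<Rightarrow> ('k, 'v, 'a) generator \<Rightarrow> (nat \<Rightarrow> 'k) \<Rightarrow> nat \<Rightarrow> 'k" where
  "cochain_map f \<gamma> m = (case \<gamma> of Arr a \<Rightarrow> band_vector (apply_matrix (f a) m) | _ \<Rightarrow> (\<lambda>_. 0))"

lemma cochain_map_space: "cochain_map f \<gamma> m \<in> N.space"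
  using band_vector_space by (cases \<gamma>) (auto simp: cochain_map_def N.space_def)

lemma is_cochain_cochain_map: "X.is_cochain (cochain_map f)"
  by (simp add: X.is_cochain_def Nb_simps cochain_map_space)

lemma cochain_map_coords:
  assumes "cochain f"
  shows "band_coords (cochain_map f (Arr a) m) = apply_matrix (f a) m"
  unfolding cochain_map_def generator.case
  by (rule band_coords_vector, rule apply_matrix_quasi_periodic) (use assms in \<open>simp add: cochain_def\<close>)

lemma unit_vec_space: "s \<le> L \<Longrightarrow> unit_vec s \<in> M.space"
  by (auto simp: unit_vec_def M.space_def)

subsection \<open>Realising cocycles\<close>

text \<open>
  The extension of a cocycle has the direct sum as underlying space: the coordinates below \<open>n\<close> belong
  to the band module, the others to the string module. The arrows act by block triangular matrices with
  the cocycle as off-diagonal block.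
\<close>

definition ext_vt :: "nat \<Rightarrow> 'v" where
  "ext_vt i = (if i < n then lsrc Q (b ! i) else word_vert Q w (i - n))"

definition ext_mat :: "('a \<Rightarrow> int \<Rightarrow> int \<Rightarrow> 'k) \<Rightarrow> 'a \<Rightarrow> nat \<Rightarrow> nat \<Rightarrow> 'k" where
  "ext_mat f a i j = (if i < n then (if j < n then band_mat a i j else 0)
     else if j < n then f a (int (i - n)) (int j) / place_weight (int j)
     else letter_mat (snd w) Suc (\<lambda>_. 1) a (i - n) (j - n))"

abbreviation ext_dim where "ext_dim \<equiv> Suc (n + L)"

definition N_part :: "(nat \<Rightarrow> 'k) \<Rightarrow> nat \<Rightarrow> 'k" where "N_part F = (\<lambda>i. if i < n then F i else 0)"
definition M_part :: "(nat \<Rightarrow> 'k) \<Rightarrow> nat \<Rightarrow> 'k" where "M_part F = (\<lambda>i. F (n + i))"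

lemma ext_arrow_act:
  "N_part (arrow_act ext_dim (ext_mat f) a F) =
     (\<lambda>i. N.aact a (N_part F) i + cochain_map f (Arr a) (M_part F) i)"
  "M_part (arrow_act ext_dim (ext_mat f) a F) = M.aact a (M_part F)"
proof -
  have e: "arrow_act ext_dim (ext_mat f) a F i =
      (\<Sum>k<n. ext_mat f a k i * F k) + (\<Sum>s<Suc L. ext_mat f a (n + s) i * F (n + s))" if "i < ext_dim" for i
    unfolding arrow_act_def add_Suc_right[symmetric] sum_lessThan_add using that by (simp only: add_Suc_right if_True)
  show "N_part (arrow_act ext_dim (ext_mat f) a F) =
     (\<lambda>i. N.aact a (N_part F) i + cochain_map f (Arr a) (M_part F) i)"
  proof
    fix i
    show "N_part (arrow_act ext_dim (ext_mat f) a F) i = N.aact a (N_part F) i + cochain_map f (Arr a) (M_part F) i"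
    proof (cases "i < n")
      case True
      have "(\<Sum>k<n. ext_mat f a k i * F k) = N.aact a (N_part F) i"
        using True by (simp add: arrow_act_def ext_mat_def N_part_def)
      moreover have "(\<Sum>s<Suc L. ext_mat f a (n + s) i * F (n + s)) = cochain_map f (Arr a) (M_part F) i"
        unfolding lessThan_Suc_atMost using True
        by (simp add: ext_mat_def M_part_def cochain_map_def band_vector_def apply_matrix_def sum_divide_distrib mult_ac)
      ultimately show ?thesis using True e[of i] by (simp add: N_part_def)
    next
      case False
      then show ?thesis by (simp add: N_part_def arrow_act_def cochain_map_def band_vector_def)
    qed
  qed
  show "M_part (arrow_act ext_dim (ext_mat f) a F) = M.aact a (M_part F)"
  proof
    fix t
    show "M_part (arrow_act ext_dim (ext_mat f) a F) t = M.aact a (M_part F) t"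
    proof (cases "t < Suc L")
      case True
      have "(\<Sum>k<n. ext_mat f a k (n + t) * F k) = 0" by (simp add: ext_mat_def)
      moreover have "(\<Sum>s<Suc L. ext_mat f a (n + s) (n + t) * F (n + s)) = M.aact a (M_part F) t"
        using True by (simp add: arrow_act_def ext_mat_def M_part_def del: sum.lessThan_Suc)
      ultimately show ?thesis using True e[of "n + t"] by (simp add: M_part_def)
    next
      case False
      then show ?thesis by (simp add: M_part_def arrow_act_def)
    qed
  qed
qed

lemma parts_eqI:
  assumes "N_part F = N_part G" "M_part F = M_part G"
  shows "F = G"
proof
  fix i
  show "F i = G i"
    using fun_cong[OF assms(1), of i] fun_cong[OF assms(2), of "i - n"]
    by (cases "i < n") (auto simp: N_part_def M_part_def)
qed

lemma cocycle_band_relation: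
  assumes f: "cocycle f" and ac: "a \<in> arcs Q" "c \<in> arcs Q" "head Q a = tail Q c" "zero_rel Q I c a"
  shows "lact \<beta>\<omega> c (apply_matrix (f a) m) j + apply_matrix (f c) (M.aact a m) j = 0"
proof -
  have "lact \<beta>\<omega> c (f a (int s)) j + ract \<omega> a (\<lambda>s. f c s j) (int s) = 0" for s
    using f ac by (simp add: cocycle_def)
  then have "m s * lact \<beta>\<omega> c (f a (int s)) j + m s * ract \<omega> a (\<lambda>s. f c s j) (int s) = 0" for s
    by (simp flip: distrib_left)
  then show ?thesis unfolding lact_apply_matrix apply_matrix_aact by (simp flip: sum.distrib)
qed

lemma ext_rep:
  assumes f: "cocycle f"
  shows "gentle_rep Q I ext_dim ext_vt (ext_mat f)"
proof
  have fc: "cochain f" using f by (simp add: cocycle_def)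
  show "ext_vt i \<in> verts Q" if "i < ext_dim" for i
    using that N.vt[of i] M.vt[of "i - n"] by (auto simp: ext_vt_def)
  show "ext_vt i = tail Q a \<and> ext_vt j = head Q a"
    if "a \<in> arcs Q" "i < ext_dim" "j < ext_dim" "ext_mat f a i j \<noteq> 0" for a i j
  proof (cases "i < n")
    case True
    then have "j < n" "band_mat a i j \<noteq> 0" using that(4) by (auto simp: ext_mat_def split: if_splits)
    then show ?thesis using N.mat[OF that(1) True] True by (simp add: ext_vt_def)
  next
    case i: False
    show ?thesis
    proof (cases "j < n")
      case True
      then have "f a (int (i - n)) (int j) \<noteq> 0" using that(4) i by (auto simp: ext_mat_def)
      moreover have "nat (int (i - n)) = i - n" by simp
      ultimately show ?thesis
        using cochainD(1)[OF fc, of a "int (i - n)" "int j"] i True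
        unfolding ext_vt_def vert_def inf_word_def by simp
    next
      case False
      then have "letter_mat (snd w) Suc (\<lambda>_. 1 :: 'k) a (i - n) (j - n) \<noteq> 0" using that(4) i by (simp add: ext_mat_def)
      then show ?thesis using M.mat[OF that(1), of "i - n" "j - n"] that(2,3) i False by (simp add: ext_vt_def)
    qed
  qed
  fix a c F
  assume ac: "a \<in> arcs Q" "c \<in> arcs Q" "head Q a = tail Q c" "zero_rel Q I c a"
  let ?E = "arrow_act ext_dim (ext_mat f)"
  have "N_part (?E c (?E a F)) = (\<lambda>i. N.aact c (N_part (?E a F)) i + cochain_map f (Arr c) (M.aact a (M_part F)) i)"
    by (simp add: ext_arrow_act)
  also have "\<dots> = (\<lambda>_. 0)"
  proof (rule N_eqI)
    show "(\<lambda>i. N.aact c (N_part (?E a F)) i + cochain_map f (Arr c) (M.aact a (M_part F)) i) \<in> N.space"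
      using N.aact_space cochain_map_space by (simp add: N.space_def)
    have "band_coords (\<lambda>i. N.aact c (N_part (?E a F)) i + cochain_map f (Arr c) (M.aact a (M_part F)) i) j = 0" for j
    proof -
      have 1: "band_coords (N_part (?E a F)) = (\<lambda>j. lact \<beta>\<omega> a (band_coords (N_part F)) j + apply_matrix (f a) (M_part F) j)"
        unfolding ext_arrow_act band_coords_simps cochain_map_coords[OF fc] by (simp add: band_arrow_act)
      have "lact \<beta>\<omega> c (\<lambda>j. lact \<beta>\<omega> a (band_coords (N_part F)) j + apply_matrix (f a) (M_part F) j) j =
        lact \<beta>\<omega> c (lact \<beta>\<omega> a (band_coords (N_part F))) j + lact \<beta>\<omega> c (apply_matrix (f a) (M_part F)) j"
        by (simp add: lact_def)
      then show ?thesis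
        unfolding band_coords_simps cochain_map_coords[OF fc] band_arrow_act 1
        using lact_relation[OF walk_band ac(4,1,2,3), of "band_coords (N_part F)"]
          cocycle_band_relation[OF f ac, of "M_part F" j] by simp
    qed
    then show "band_coords (\<lambda>i. N.aact c (N_part (?E a F)) i + cochain_map f (Arr c) (M.aact a (M_part F)) i) =
        band_coords (\<lambda>_. 0)" by (auto simp: band_coords_simps)
  qed (simp add: N.space_def)
  finally have 1: "N_part (?E c (?E a F)) = (\<lambda>_. 0)" .
  have 2: "M_part (?E c (?E a F)) = (\<lambda>_. 0)"
    unfolding ext_arrow_act by (rule M.relations[OF ac])
  have "N_part (\<lambda>_. 0) = (\<lambda>_. 0)" "M_part (\<lambda>_. 0) = (\<lambda>_. 0)" by (auto simp: N_part_def M_part_def)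
  with 1 2 show "?E c (?E a F) = (\<lambda>_. 0)" by - (rule parts_eqI, simp_all only:)
qed auto

definition cocycle_ext :: "('a \<Rightarrow> int \<Rightarrow> int \<Rightarrow> 'k) \<Rightarrow>
    ((('v, 'a) path \<Rightarrow> 'k) set, nat \<Rightarrow> 'k, nat \<Rightarrow> 'k, nat \<Rightarrow> 'k) ext" where
  "cocycle_ext f = ((\<lambda>x. x), quiver_module Q I ext_dim ext_vt (ext_mat f), M_part)"

lemma has_cocycle_cocycle_ext:
  assumes f: "cocycle f"
  shows "X.has_cocycle (cocycle_ext f) (cochain_map f)"
proof -
  interpret E: gentle_rep Q I ext_dim ext_vt "ext_mat f" by (rule ext_rep[OF f])
  have sp: "M_part F \<in> M.space" "N_part F \<in> N.space" if "F \<in> E.space" for F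
    using that by (auto simp: M_part_def N_part_def M.space_def N.space_def E.space_def)
  have NE: "x \<in> E.space" "N_part x = x" "M_part x = (\<lambda>_. 0)" if "x \<in> N.space" for x
    using that by (auto simp: E.space_def N.space_def N_part_def M_part_def)
  have N_gen: "N_part (gen \<gamma> \<odot>\<^bsub>E.QM\<^esub> F) = (\<lambda>i. (gen \<gamma> \<odot>\<^bsub>Nb\<^esub> N_part F) i + cochain_map f \<gamma> (M_part F) i)"
    and M_gen: "M_part (gen \<gamma> \<odot>\<^bsub>E.QM\<^esub> F) = gen \<gamma> \<odot>\<^bsub>Mw\<^esub> M_part F"
    if "\<gamma> \<in> gens" and F: "F \<in> E.space" for \<gamma> F
  proof -
    have "N_part (gen \<gamma> \<odot>\<^bsub>E.QM\<^esub> F) = (\<lambda>i. (gen \<gamma> \<odot>\<^bsub>Nb\<^esub> N_part F) i + cochain_map f \<gamma> (M_part F) i) \<and>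
      M_part (gen \<gamma> \<odot>\<^bsub>E.QM\<^esub> F) = gen \<gamma> \<odot>\<^bsub>Mw\<^esub> M_part F"
    proof (cases \<gamma>)
      case (Scal c)
      then show ?thesis
        unfolding Scal Nb_eq Mw_eq E.smult_gen(1)[OF F] N.smult_gen(1)[OF sp(2)[OF F]] M.smult_gen(1)[OF sp(1)[OF F]]
        by (auto simp: N_part_def M_part_def cochain_map_def)
    next
      case (Vert y)
      then have y: "y \<in> verts Q" using that(1) by (auto simp: gens_def)
      show ?thesis
        unfolding Vert Nb_eq Mw_eq E.smult_gen(2)[OF F y] N.smult_gen(2)[OF sp(2)[OF F] y] M.smult_gen(2)[OF sp(1)[OF F] y]
        by (auto simp: N_part_def M_part_def cochain_map_def ext_vt_def)
    next
      case (Arr a)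
      then have a: "a \<in> arcs Q" using that(1) by (auto simp: gens_def)
      show ?thesis
        unfolding Arr Nb_eq Mw_eq E.smult_gen(3)[OF F a] N.smult_gen(3)[OF sp(2)[OF F] a] M.smult_gen(3)[OF sp(1)[OF F] a]
        by (simp add: ext_arrow_act)
    qed
    then show "N_part (gen \<gamma> \<odot>\<^bsub>E.QM\<^esub> F) = (\<lambda>i. (gen \<gamma> \<odot>\<^bsub>Nb\<^esub> N_part F) i + cochain_map f \<gamma> (M_part F) i)"
      "M_part (gen \<gamma> \<odot>\<^bsub>E.QM\<^esub> F) = gen \<gamma> \<odot>\<^bsub>Mw\<^esub> M_part F" by auto
  qed
  have cm0: "cochain_map f \<gamma> (\<lambda>_. 0) = (\<lambda>_. 0)" for \<gamma>
    by (cases \<gamma>) (auto simp: cochain_map_def apply_matrix_def band_vector_def)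
  have zM: "gen \<gamma> \<odot>\<^bsub>Mw\<^esub> (\<lambda>_. 0) = (\<lambda>_. 0)" if "\<gamma> \<in> gens" for \<gamma>
  proof -
    have z: "(\<lambda>_. 0) \<in> M.space" by (simp add: M.space_def)
    show ?thesis
      using that Mw_gen[OF z] by (cases \<gamma>) (auto simp: gens_def arrow_act_def)
  qed
  have i: "(\<lambda>x. x) \<in> mod_hom \<Lambda> Nb E.QM"
  proof (rule X.mod_hom_by_generators[OF left_module_Nb E.left_module_QM])
    show "(\<lambda>x. x) \<in> carrier Nb \<rightarrow> carrier E.QM" using NE by (auto simp: Nb_simps E.QM_simps)
    show "gen \<gamma> \<odot>\<^bsub>Nb\<^esub> x = gen \<gamma> \<odot>\<^bsub>E.QM\<^esub> x" if "\<gamma> \<in> gens" "x \<in> carrier Nb" for \<gamma> x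
    proof -
      have x: "x \<in> N.space" using that by (simp add: Nb_simps)
      have gx: "gen \<gamma> \<odot>\<^bsub>Nb\<^esub> x \<in> N.space"
        using left_moduleD(3)[OF left_module_Nb gen_closed[OF that(1)] that(2)] by (simp add: Nb_simps)
      show ?thesis
        by (rule parts_eqI) (simp_all add: N_gen[OF that(1) NE(1)[OF x]] M_gen[OF that(1) NE(1)[OF x]] NE x gx cm0 zM that(1))
    qed
  qed (simp add: Nb_simps E.QM_simps)
  have p: "M_part \<in> mod_hom \<Lambda> E.QM Mw"
    by (rule X.mod_hom_by_generators[OF E.left_module_QM left_module_Mw])
      (auto simp: Mw_simps E.QM_simps sp M_gen, simp add: M_part_def)
  have surj: "M_part ` carrier E.QM = carrier Mw"
  proof
    show "carrier Mw \<subseteq> M_part ` carrier E.QM"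
    proof
      fix m assume m: "m \<in> carrier Mw"
      show "m \<in> M_part ` carrier E.QM"
        by (rule image_eqI[of _ _ "\<lambda>i. if i < n then 0 else m (i - n)"])
          (use m in \<open>auto simp: M_part_def E.QM_simps E.space_def Mw_simps M.space_def\<close>)
    qed
  qed (use mod_homD(1)[OF p] in blast)
  have ker: "(\<lambda>x. x) ` carrier Nb = {e \<in> carrier E.QM. M_part e = \<zero>\<^bsub>Mw\<^esub>}"
  proof -
    have "e \<in> N.space" if "e \<in> E.space" "M_part e = (\<lambda>_. 0)" for e
    proof -
      have "e i = 0" if "i \<ge> n" for i
        using fun_cong[OF \<open>M_part e = (\<lambda>_. 0)\<close>, of "i - n"] that by (simp add: M_part_def)
      then show ?thesis by (simp add: N.space_def)
    qed
    then show ?thesis using NE by (auto simp: Nb_simps E.QM_simps Mw_simps)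
  qed
  have "cocycle_ext f \<in> extensions \<Lambda> Mw Nb"
    unfolding cocycle_ext_def extensions_def
    using left_module_Nb left_module_Mw E.left_module_QM i p surj ker by auto
  moreover have "(\<exists>\<rho>\<in>carrier E.QM \<rightarrow> carrier Nb.
        (\<forall>x\<in>carrier E.QM. \<forall>y\<in>carrier E.QM. \<rho> (x \<oplus>\<^bsub>E.QM\<^esub> y) = \<rho> x \<oplus>\<^bsub>Nb\<^esub> \<rho> y) \<and>
        (\<forall>x\<in>carrier Nb. \<rho> x = x) \<and>
        (\<forall>\<gamma>\<in>gens. \<forall>e\<in>carrier E.QM. \<rho> (gen \<gamma> \<odot>\<^bsub>E.QM\<^esub> e) = gen \<gamma> \<odot>\<^bsub>Nb\<^esub> \<rho> e \<oplus>\<^bsub>Nb\<^esub> cochain_map f \<gamma> (M_part e)))"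
    by (rule bexI[of _ N_part])
      (use sp NE N_gen in \<open>auto simp: Nb_simps E.QM_simps\<close>, auto simp: N_part_def)
  ultimately show ?thesis by (simp add: X.has_cocycle_def cocycle_ext_def)
qed

end

subsection \<open>Reading off cocycles\<close>

lemma (in left_module) smult_zero_right: "r \<in> carrier R \<Longrightarrow> r \<odot>\<^bsub>M\<^esub> \<zero>\<^bsub>M\<^esub> = \<zero>\<^bsub>M\<^esub>"
  using additive_mapD(1)[of M M "\<lambda>x. r \<odot>\<^bsub>M\<^esub> x"] M.abelian_group_axioms smult_closed smult_r_distr by simp

lemma (in left_module) smult_finsum:
  assumes "finite A" "g \<in> A \<rightarrow> carrier M" "r \<in> carrier R"
  shows "r \<odot>\<^bsub>M\<^esub> finsum M g A = finsum M (\<lambda>i. r \<odot>\<^bsub>M\<^esub> g i) A"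
  using assms(1,2)
proof (induct A rule: finite_induct)
  case empty
  then show ?case using smult_zero_right assms(3) by simp
next
  case (insert x A)
  then have "g \<in> A \<rightarrow> carrier M" "g x \<in> carrier M" "(\<lambda>i. r \<odot>\<^bsub>M\<^esub> g i) \<in> A \<rightarrow> carrier M" "r \<odot>\<^bsub>M\<^esub> g x \<in> carrier M"
    using smult_closed[OF assms(3)] by auto
  then show ?case using insert assms(3) by (simp add: M.finsum_insert smult_r_distr)
qed

lemma mod_hom_finsum:
  assumes M: "left_module R M" and N: "left_module R N" and h: "h \<in> mod_hom R M N"
    and A: "finite A" "g \<in> A \<rightarrow> carrier M"
  shows "h (finsum M g A) = finsum N (\<lambda>i. h (g i)) A"
proof -
  interpret M: left_module R M by (rule M)
  interpret N: left_module R N by (rule N)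
  show ?thesis
    using A
  proof (induct A rule: finite_induct)
    case empty
    then show ?case using mod_hom_additive(1)[OF M N h] by simp
  next
    case (insert x A)
    then have "g \<in> A \<rightarrow> carrier M" "g x \<in> carrier M" "(\<lambda>i. h (g i)) \<in> A \<rightarrow> carrier N" "h (g x) \<in> carrier N"
      using mod_homD(1)[OF h] by auto
    then show ?case using insert by (simp add: M.M.finsum_insert N.M.finsum_insert mod_homD(2)[OF h])
  qed
qed

text \<open>
  A relation between three generators becomes a relation between their defects.
\<close>

lemma (in generated_ext) cocycle_mult:
  assumes "has_cocycle X \<delta>" and \<delta>: "is_cochain \<delta>" and g: "\<gamma> \<in> \<Gamma>" "\<gamma>' \<in> \<Gamma>" "\<gamma>'' \<in> \<Gamma>"
    and eq: "gen \<gamma> \<otimes>\<^bsub>R\<^esub> gen \<gamma>' = gen \<gamma>''" and m: "m \<in> carrier M"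
  shows "\<delta> \<gamma>'' m = gen \<gamma> \<odot>\<^bsub>N\<^esub> \<delta> \<gamma>' m \<oplus>\<^bsub>N\<^esub> \<delta> \<gamma> (gen \<gamma>' \<odot>\<^bsub>M\<^esub> m)"
proof -
  obtain i E p where X: "X = (i, E, p)" by (metis prod_cases3)
  note ext = has_cocycleD(1)[OF assms(1)[unfolded X]]
  note D = extensionsD[OF ext]
  interpret E: left_module R E by (rule D(1))
  obtain \<rho> where r: "\<rho> \<in> carrier E \<rightarrow> carrier N"
    "\<And>\<gamma> e. \<gamma> \<in> \<Gamma> \<Longrightarrow> e \<in> carrier E \<Longrightarrow> \<rho> (gen \<gamma> \<odot>\<^bsub>E\<^esub> e) = gen \<gamma> \<odot>\<^bsub>N\<^esub> \<rho> e \<oplus>\<^bsub>N\<^esub> \<delta> \<gamma> (p e)"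
    using has_cocycleD(2)[OF assms(1)[unfolded X]] by blast
  obtain e where e: "e \<in> carrier E" "p e = m" using D(5) m by (metis imageE)
  note c = gen_closed[OF g(1)] gen_closed[OF g(2)] gen_closed[OF g(3)]
  have re: "\<rho> e \<in> carrier N" using r(1) e by auto
  have gm: "gen \<gamma>' \<odot>\<^bsub>M\<^esub> m \<in> carrier M" by (rule M.smult_closed[OF c(2) m])
  have dc: "\<delta> \<gamma>' m \<in> carrier N" "\<delta> \<gamma>'' m \<in> carrier N" "\<delta> \<gamma> (gen \<gamma>' \<odot>\<^bsub>M\<^esub> m) \<in> carrier N"
    using \<delta> g m gm by (auto simp: is_cochain_def)
  have "gen \<gamma>'' \<odot>\<^bsub>N\<^esub> \<rho> e \<oplus>\<^bsub>N\<^esub> \<delta> \<gamma>'' m = \<rho> (gen \<gamma>'' \<odot>\<^bsub>E\<^esub> e)"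
    using r(2)[OF g(3) e(1)] e(2) by simp
  also have "\<dots> = \<rho> (gen \<gamma> \<odot>\<^bsub>E\<^esub> (gen \<gamma>' \<odot>\<^bsub>E\<^esub> e))"
    using E.smult_assoc[OF c(1,2) e(1)] eq by simp
  also have "\<dots> = gen \<gamma> \<odot>\<^bsub>N\<^esub> (gen \<gamma>' \<odot>\<^bsub>N\<^esub> \<rho> e \<oplus>\<^bsub>N\<^esub> \<delta> \<gamma>' m) \<oplus>\<^bsub>N\<^esub> \<delta> \<gamma> (gen \<gamma>' \<odot>\<^bsub>M\<^esub> m)"
    using r(2)[OF g(1) E.smult_closed[OF c(2) e(1)]] r(2)[OF g(2) e(1)] mod_homD(3)[OF D(3) c(2) e(1)] e(2) by simp
  also have "\<dots> = gen \<gamma>'' \<odot>\<^bsub>N\<^esub> \<rho> e \<oplus>\<^bsub>N\<^esub> (gen \<gamma> \<odot>\<^bsub>N\<^esub> \<delta> \<gamma>' m \<oplus>\<^bsub>N\<^esub> \<delta> \<gamma> (gen \<gamma>' \<odot>\<^bsub>M\<^esub> m))"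
    using N.smult_assoc[OF c(1,2) re] eq re dc c N.smult_closed
    by (simp add: N.smult_r_distr N.M.a_assoc)
  finally show ?thesis
    using N.smult_closed[OF c(3) re] N.smult_closed[OF c(1) dc(1)] dc by simp
qed

context gentle_quiver
begin

lemma unit_mult_ops:
  "unit_mult c \<oplus>\<^bsub>PA\<^esub> unit_mult d = unit_mult (c + d)" "unit_mult c \<otimes>\<^bsub>PA\<^esub> unit_mult d = unit_mult (c * d)"
proof -
  show "unit_mult c \<oplus>\<^bsub>PA\<^esub> unit_mult d = unit_mult (c + d)"
    by (simp add: path_algebra_simps(1) unit_mult_def algebra_simps)
  show "unit_mult c \<otimes>\<^bsub>PA\<^esub> unit_mult d = unit_mult (c * d)"
    unfolding unit_mult_mult(1)[OF unit_mult_carrier] by (simp add: unit_mult_def mult.assoc)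
qed

lemma scal_ops:
  "gen (Scal c) \<oplus>\<^bsub>\<Lambda>\<^esub> gen (Scal d) = gen (Scal (c + d))" "gen (Scal c) \<otimes>\<^bsub>\<Lambda>\<^esub> gen (Scal d) = gen (Scal (c * d))"
  using cl_hom(1,2)[OF unit_mult_carrier unit_mult_carrier, of c d] by (simp_all add: scal_eq unit_mult_ops)

lemma gens_simps: "Scal c \<in> gens" "Vert x \<in> gens \<longleftrightarrow> x \<in> verts Q" "Arr a \<in> gens \<longleftrightarrow> a \<in> arcs Q"
  by (auto simp: gens_def)

text \<open>
  These are the multiplication rules from which the cocycle conditions are read off: vertices restrict
  the support of the entries, and zero relations give the equation in the definition of a cocycle.
\<close>

lemma gen_mult:
  "a \<in> arcs Q \<Longrightarrow> gen (Arr a) \<otimes>\<^bsub>\<Lambda>\<^esub> gen (Vert (tail Q a)) = gen (Arr a)"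
  "a \<in> arcs Q \<Longrightarrow> gen (Vert (head Q a)) \<otimes>\<^bsub>\<Lambda>\<^esub> gen (Arr a) = gen (Arr a)"
  "x \<in> verts Q \<Longrightarrow> y \<in> verts Q \<Longrightarrow>
    gen (Vert x) \<otimes>\<^bsub>\<Lambda>\<^esub> gen (Vert y) = (if x = y then gen (Vert x) else gen (Scal 0))"
  "a \<in> arcs Q \<Longrightarrow> c \<in> arcs Q \<Longrightarrow> head Q a = tail Q c \<Longrightarrow> zero_rel Q I c a \<Longrightarrow>
    gen (Arr c) \<otimes>\<^bsub>\<Lambda>\<^esub> gen (Arr a) = gen (Scal 0)"
proof -
  have a: "mono 1 (tail Q a, [a]) \<in> carrier PA" if "a \<in> arcs Q" for a by (rule mono_carrier[OF arc_path[OF that]])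
  have v: "mono 1 (x, []) \<in> carrier PA" if "x \<in> verts Q" for x using that by (intro mono_carrier) (simp add: paths_Nil)
  have s0: "gen (Scal 0) = cl (\<lambda>_. 0)" by (simp add: scal_def)
  show "gen (Arr a) \<otimes>\<^bsub>\<Lambda>\<^esub> gen (Vert (tail Q a)) = gen (Arr a)" if "a \<in> arcs Q"
    using cl_hom(2)[OF a v, of a "tail Q a"] that
    by (simp add: path_elt_eq_mono path_algebra_simps mult_mono_mono awlast_simps)
  show "gen (Vert (head Q a)) \<otimes>\<^bsub>\<Lambda>\<^esub> gen (Arr a) = gen (Arr a)" if "a \<in> arcs Q"
    using cl_hom(2)[OF v a, of "head Q a" a] that
    by (simp add: path_elt_eq_mono path_algebra_simps mult_mono_mono awlast_simps)
  show "gen (Vert x) \<otimes>\<^bsub>\<Lambda>\<^esub> gen (Vert y) = (if x = y then gen (Vert x) else gen (Scal 0))"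
    if "x \<in> verts Q" "y \<in> verts Q"
    using cl_hom(2)[OF v v, of x y] that s0
    by (simp add: path_elt_eq_mono path_algebra_simps mult_mono_mono awlast_simps)
  show "gen (Arr c) \<otimes>\<^bsub>\<Lambda>\<^esub> gen (Arr a) = gen (Scal 0)"
    if "a \<in> arcs Q" "c \<in> arcs Q" "head Q a = tail Q c" "zero_rel Q I c a"
  proof -
    have "cl (mono 1 (tail Q a, [a, c])) = I"
      using that(4) by (intro I.a_rcos_const) (simp add: zero_rel_def path_elt_eq_mono)
    moreover have "cl (\<lambda>_. 0) = I"
      using I.a_rcos_const[OF additive_subgroup.zero_closed[OF I.additive_subgroup_axioms]]
      by (simp add: path_algebra_simps)
    ultimately show ?thesis
      using cl_hom(2)[OF a a, of c a] that s0
      by (simp add: path_elt_eq_mono path_algebra_simps mult_mono_mono awlast_simps)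
  qed
qed

lemma scal_zero_smult:
  assumes "left_module \<Lambda> E" "x \<in> carrier E"
  shows "gen (Scal 0) \<odot>\<^bsub>E\<^esub> x = \<zero>\<^bsub>E\<^esub>"
proof -
  interpret E: left_module \<Lambda> E by (rule assms(1))
  have c: "gen (Scal 0) \<in> carrier \<Lambda>" by (rule gen_closed[OF gens_simps(1)])
  have "gen (Scal 0) \<odot>\<^bsub>E\<^esub> x \<oplus>\<^bsub>E\<^esub> gen (Scal 0) \<odot>\<^bsub>E\<^esub> x = gen (Scal 0) \<odot>\<^bsub>E\<^esub> x"
    using E.smult_l_distr[OF c c assms(2)] scal_ops(1)[of 0 0] by simp
  then show ?thesis using E.smult_closed[OF c assms(2)] E.M.add.r_cancel_one by blast
qed

end

context string_band
begin

lemma word_vert_verts: "s \<le> L \<Longrightarrow> word_vert Q w s \<in> verts Q"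
  using M.vt[of s] by simp

lemma Mw_unit_vec:
  assumes "s \<le> L" "y \<in> verts Q"
  shows "gen (Vert y) \<odot>\<^bsub>Mw\<^esub> unit_vec s = (if word_vert Q w s = y then unit_vec s else (\<lambda>_. 0))"
  unfolding Mw_gen(2)[OF unit_vec_space[OF assms(1)] assms(2)] by (auto simp: unit_vec_def)

lemma apply_matrix_zero: "apply_matrix h (\<lambda>_. 0) = (\<lambda>_. 0)"
  by (simp add: apply_matrix_def)

text \<open>
  No separate verification of the cocycle condition is needed for a matrix which is known to be the
  defect of a retraction.
\<close>

lemma cocycle_of_has_cocycle:
  assumes X: "X.has_cocycle X (cochain_map f)"
    and range: "\<And>a s j. f a s j \<noteq> 0 \<Longrightarrow> a \<in> arcs Q \<and> 0 \<le> s \<and> s \<le> len"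
    and qp: "\<And>a s. quasi_periodic (f a s)"
  shows "cocycle f"
proof -
  have coords: "band_coords (cochain_map f (Arr a) m) = apply_matrix (f a) m" for a m
    unfolding cochain_map_def generator.case by (rule band_coords_vector, rule apply_matrix_quasi_periodic) (rule qp)
  note mult = X.cocycle_mult[OF X is_cochain_cochain_map]
  have uv: "unit_vec (nat s) \<in> carrier Mw" if "0 \<le> s" "s \<le> len" for s
    using that by (auto simp: Mw_simps len_def intro!: unit_vec_space)
  have am: "apply_matrix h (unit_vec (nat s)) = h s" if "0 \<le> s" "s \<le> len" for h s
    using that apply_matrix_unit_vec[of "nat s" h] by (simp add: len_def)
  have cv: "cochain_map f (Vert x) m = \<zero>\<^bsub>Nb\<^esub>" "cochain_map f (Scal c) m = \<zero>\<^bsub>Nb\<^esub>" for x c m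
    by (simp_all add: cochain_map_def Nb_simps)
  have cN: "cochain_map f \<gamma> m \<in> carrier Nb" for \<gamma> m by (simp add: Nb_simps cochain_map_space)
  have tail: "vert s = tail Q a" and head: "lsrc Q (\<beta> j) = head Q a" if nz: "f a s j \<noteq> 0" for a s j
  proof -
    note r = range[OF nz]
    have a: "a \<in> arcs Q" and s: "0 \<le> s" "s \<le> len" using r by auto
    have sL: "nat s \<le> L" using s by (simp add: len_def)
    have g: "Arr a \<in> gens" "Vert (tail Q a) \<in> gens" "Vert (head Q a) \<in> gens" using a by (auto simp: gens_simps)
    have "cochain_map f (Arr a) (unit_vec (nat s)) =
      gen (Arr a) \<odot>\<^bsub>Nb\<^esub> \<zero>\<^bsub>Nb\<^esub> \<oplus>\<^bsub>Nb\<^esub> cochain_map f (Arr a) (gen (Vert (tail Q a)) \<odot>\<^bsub>Mw\<^esub> unit_vec (nat s))"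
      by (rule mult[OF g(1,2,1) gen_mult(1)[OF a] uv[OF s], unfolded cv])
    also have "\<dots> = cochain_map f (Arr a) (if vert s = tail Q a then unit_vec (nat s) else (\<lambda>_. 0))"
      unfolding X.N.smult_zero_right[OF gen_closed[OF g(1)]] vert_def
      using Mw_unit_vec[OF sL, of "tail Q a"] cN a by simp
    finally have "apply_matrix (f a) (unit_vec (nat s)) = apply_matrix (f a) (if vert s = tail Q a then unit_vec (nat s) else (\<lambda>_. 0))"
      unfolding coords[symmetric] by (rule arg_cong)
    note e0 = fun_cong[OF this[unfolded am[OF s]], of j]
    show "vert s = tail Q a"
    proof (rule ccontr)
      assume "vert s \<noteq> tail Q a"
      with e0 have "f a s j = 0" by (simp only: if_False apply_matrix_zero)
      then show False using nz by simp
    qed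
    have "cochain_map f (Arr a) (unit_vec (nat s)) =
        gen (Vert (head Q a)) \<odot>\<^bsub>Nb\<^esub> cochain_map f (Arr a) (unit_vec (nat s)) \<oplus>\<^bsub>Nb\<^esub> \<zero>\<^bsub>Nb\<^esub>"
      by (rule mult[OF g(3,1,1) gen_mult(2)[OF a] uv[OF s], unfolded cv])
    also have "\<dots> = gen (Vert (head Q a)) \<odot>\<^bsub>Nb\<^esub> cochain_map f (Arr a) (unit_vec (nat s))"
      by (rule X.N.M.r_zero[OF X.N.smult_closed[OF gen_closed[OF g(3)] cN]])
    finally have e: "cochain_map f (Arr a) (unit_vec (nat s)) = gen (Vert (head Q a)) \<odot>\<^bsub>Nb\<^esub> cochain_map f (Arr a) (unit_vec (nat s))" .
    have hv: "head Q a \<in> verts Q" using a by simp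
    have "band_coords (cochain_map f (Arr a) (unit_vec (nat s))) j =
        (if lsrc Q (\<beta> j) = head Q a then band_coords (cochain_map f (Arr a) (unit_vec (nat s))) j else 0)"
      using fun_cong[OF trans[OF arg_cong[OF e, of band_coords] band_coords_gen(2)[OF cochain_map_space hv]], of j] .
    note e1 = this[unfolded coords am[OF s]]
    show "lsrc Q (\<beta> j) = head Q a"
    proof (rule ccontr)
      assume "lsrc Q (\<beta> j) \<noteq> head Q a"
      with e1 have "f a s j = 0" by (simp only: if_False)
      then show False using nz by simp
    qed
  qed
  have "lact \<beta>\<omega> c (f a s) j + ract \<omega> a (\<lambda>s. f c s j) s = 0"
    if ac: "a \<in> arcs Q" "c \<in> arcs Q" "head Q a = tail Q c" "zero_rel Q I c a" for a c s j
  proof (cases "0 \<le> s \<and> s \<le> len")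
    case True
    then have s: "0 \<le> s" "s \<le> len" by auto
    define z :: "nat \<Rightarrow> 'k" where "z = unit_vec (nat s)"
    have z: "z \<in> carrier Mw" "z \<in> M.space" using uv[OF s] by (auto simp: z_def Mw_simps)
    have g: "Arr a \<in> gens" "Arr c \<in> gens" using ac by (auto simp: gens_simps)
    have "\<zero>\<^bsub>Nb\<^esub> = gen (Arr c) \<odot>\<^bsub>Nb\<^esub> cochain_map f (Arr a) z \<oplus>\<^bsub>Nb\<^esub> cochain_map f (Arr c) (M.aact a z)"
      by (rule mult[OF g(2,1) gens_simps(1) gen_mult(4)[OF ac] z(1), unfolded cv Mw_gen(3)[OF z(2) ac(1)]])
    then have "(\<lambda>i. (gen (Arr c) \<odot>\<^bsub>Nb\<^esub> cochain_map f (Arr a) z) i + cochain_map f (Arr c) (M.aact a z) i) = (\<lambda>_. 0)"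
      unfolding Nb_simps by (rule sym)
    then have "band_coords (\<lambda>i. (gen (Arr c) \<odot>\<^bsub>Nb\<^esub> cochain_map f (Arr a) z) i + cochain_map f (Arr c) (M.aact a z) i) j = 0"
      by (simp only: band_coords_simps(3))
    then have "lact \<beta>\<omega> c (f a s) j + apply_matrix (f c) (M.aact a z) j = 0"
      unfolding band_coords_simps(1) band_coords_gen(3)[OF cochain_map_space ac(2)] coords z_def am[OF s] .
    moreover have "apply_matrix (f c) (M.aact a z) j = apply_matrix (\<lambda>s j. ract \<omega> a (\<lambda>s. f c s j) s) z j"
      unfolding apply_matrix_aact by (simp add: apply_matrix_def)
    ultimately show ?thesis using am[OF s] by (simp add: z_def)
  next
    case False
    then have "f a s j = 0" for j using range by blast
    moreover have "\<omega> s = None" "\<omega> (s - 1) = None" using \<omega>_range[of s] \<omega>_range[of "s - 1"] False by force+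
    ultimately show ?thesis by (simp add: lact_def ract_def)
  qed
  moreover have "cochain f" unfolding cochain_def using range qp tail head by blast
  ultimately show ?thesis unfolding cocycle_def by blast
qed

lemma linear_coords:
  assumes add: "\<And>x y. x \<in> M.space \<Longrightarrow> y \<in> M.space \<Longrightarrow> D (\<lambda>i. x i + y i) = (\<lambda>i. D x i + D y i)"
    and scal: "\<And>c x. x \<in> M.space \<Longrightarrow> D (\<lambda>i. c * x i) = (\<lambda>i. c * D x i)"
    and m: "m \<in> M.space"
  shows "band_coords (D m) = apply_matrix (\<lambda>s j. if 0 \<le> s \<and> s \<le> len then band_coords (D (unit_vec (nat s))) j else 0) m"
proof -
  have "D m = (\<lambda>i. \<Sum>s<Suc L. m s * D (unit_vec s) i)"
    by (rule linear_map_matrix) (use add scal m in \<open>auto simp: M.space_def\<close>)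
  then show ?thesis
    by (auto simp: band_coords_def apply_matrix_def len_def sum_distrib_right lessThan_Suc_atMost mult.assoc
        simp del: sum.lessThan_Suc intro!: sum.cong)
qed

lemma cochain_outside:
  assumes "cochain f" "\<not> (a \<in> arcs Q \<and> 0 \<le> s \<and> s \<le> len)"
  shows "f a s j = 0"
  using cochainD(1)[OF assms(1)] assms(2) by blast

text \<open>
  An additive map comparing two retractions commutes with scalars and vertices, because the defects there
  vanish. Hence it is given by a matrix supported on pairs of places with a common vertex.
\<close>

lemma cohomologous_coboundary:
  assumes X: "X.has_cocycle X (cochain_map f)" "X.has_cocycle X (cochain_map g)"
    and fg: "cochain f" "cochain g"
  obtains h where "hom_matrix h" "\<And>a s j. g a s j = f a s j + coboundary h a s j"
proof -
  obtain H where H: "H \<in> carrier Mw \<rightarrow> carrier Nb"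
    "\<And>x y. x \<in> carrier Mw \<Longrightarrow> y \<in> carrier Mw \<Longrightarrow> H (x \<oplus>\<^bsub>Mw\<^esub> y) = H x \<oplus>\<^bsub>Nb\<^esub> H y"
    "\<And>\<gamma> m. \<gamma> \<in> gens \<Longrightarrow> m \<in> carrier Mw \<Longrightarrow>
      cochain_map g \<gamma> m \<oplus>\<^bsub>Nb\<^esub> H (gen \<gamma> \<odot>\<^bsub>Mw\<^esub> m) = cochain_map f \<gamma> m \<oplus>\<^bsub>Nb\<^esub> gen \<gamma> \<odot>\<^bsub>Nb\<^esub> H m"
    using X.cohomologous_if_has_cocycle[OF X is_cochain_cochain_map is_cochain_cochain_map] by blast
  have HN: "H m \<in> N.space" if "m \<in> M.space" for m
    using H(1) that by (auto simp: Mw_simps Nb_simps Pi_iff)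
  have H_add: "H (\<lambda>i. x i + y i) = (\<lambda>i. H x i + H y i)" if "x \<in> M.space" "y \<in> M.space" for x y
    using H(2)[of x y] that by (simp add: Mw_simps Nb_simps)
  have H_scal: "H (\<lambda>i. c * x i) = (\<lambda>i. c * H x i)" if x: "x \<in> M.space" for c x
    using H(3)[OF gens_simps(1), of x c] x N.smult_gen(1)[OF HN[OF x]]
    unfolding Mw_gen(1)[OF x] by (simp add: Mw_simps Nb_simps Nb_eq[symmetric] cochain_map_def)
  define h where "h s j = (if 0 \<le> s \<and> s \<le> len then band_coords (H (unit_vec (nat s))) j else 0)" for s j
  have coords: "band_coords (H m) = apply_matrix h m" if "m \<in> M.space" for m
    unfolding h_def by (rule linear_coords[of H, OF H_add H_scal that])
  have hm: "hom_matrix h"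
    unfolding hom_matrix_def
  proof (intro conjI allI impI)
    show "quasi_periodic (h s)" for s
      by (cases "0 \<le> s \<and> s \<le> len")
        (auto simp: quasi_periodic_def h_def quasi_periodicD(1)[OF quasi_periodic_band_coords])
    fix s j assume nz: "h s j \<noteq> 0"
    then have s: "0 \<le> s" "s \<le> len" by (auto simp: h_def split: if_splits)
    have sL: "nat s \<le> L" using s by (simp add: len_def)
    have v: "vert s \<in> verts Q" using word_vert_verts[OF sL] by (simp add: vert_def)
    have u: "unit_vec (nat s) \<in> M.space" by (rule unit_vec_space[OF sL])
    have "H (unit_vec (nat s)) = gen (Vert (vert s)) \<odot>\<^bsub>Nb\<^esub> H (unit_vec (nat s))"
    proof -
      have gv: "gen (Vert (vert s)) \<odot>\<^bsub>Mw\<^esub> unit_vec (nat s) = unit_vec (nat s)"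
        using Mw_unit_vec[OF sL v] by (simp add: vert_def)
      have 0: "cochain_map f (Vert y) x = \<zero>\<^bsub>Nb\<^esub>" "cochain_map g (Vert y) x = \<zero>\<^bsub>Nb\<^esub>" for x y
        by (simp_all add: cochain_map_def Nb_simps)
      have "\<zero>\<^bsub>Nb\<^esub> \<oplus>\<^bsub>Nb\<^esub> H (unit_vec (nat s)) = \<zero>\<^bsub>Nb\<^esub> \<oplus>\<^bsub>Nb\<^esub> gen (Vert (vert s)) \<odot>\<^bsub>Nb\<^esub> H (unit_vec (nat s))"
        by (rule H(3)[OF gens_simps(2)[THEN iffD2, OF v] Mw_simps(1)[THEN iffD2, OF u], unfolded gv 0])
      from this[unfolded Nb_simps(2,3) add_0] show ?thesis .
    qed
    from fun_cong[OF trans[OF arg_cong[OF this, of band_coords] band_coords_gen(2)[OF HN[OF u] v]], of j]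
    have "band_coords (H (unit_vec (nat s))) j =
        (if lsrc Q (\<beta> j) = vert s then band_coords (H (unit_vec (nat s))) j else 0)" .
    then have "lsrc Q (\<beta> j) = vert s" using nz s by (cases "lsrc Q (\<beta> j) = vert s") (simp_all add: h_def)
    then show "same_vert s j" using s by (simp add: same_vert_def)
  qed
  have "g a s j = f a s j + coboundary h a s j" for a s j
  proof (cases "a \<in> arcs Q \<and> 0 \<le> s \<and> s \<le> len")
    case True
    then have a: "a \<in> arcs Q" and s: "0 \<le> s" "s \<le> len" by auto
    have sL: "nat s \<le> L" using s by (simp add: len_def)
    define z :: "nat \<Rightarrow> 'k" where "z = unit_vec (nat s)"
    have z: "z \<in> M.space" using unit_vec_space[OF sL] by (simp add: z_def)
    have am: "apply_matrix h z = h s" for h using apply_matrix_unit_vec[OF sL, of h] s by (simp add: z_def)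
    have az: "M.aact a z \<in> M.space" by (rule M.aact_space)
    have "(\<lambda>i. cochain_map g (Arr a) z i + H (M.aact a z) i) =
        (\<lambda>i. cochain_map f (Arr a) z i + (gen (Arr a) \<odot>\<^bsub>Nb\<^esub> H z) i)"
      using H(3)[of "Arr a" z] a z Mw_gen(3)[OF z a] by (simp add: gens_simps Mw_simps Nb_simps)
    then have "band_coords (\<lambda>i. cochain_map g (Arr a) z i + H (M.aact a z) i) j =
        band_coords (\<lambda>i. cochain_map f (Arr a) z i + (gen (Arr a) \<odot>\<^bsub>Nb\<^esub> H z) i) j" by simp
    then have "g a s j + apply_matrix h (M.aact a z) j = f a s j + lact \<beta>\<omega> a (h s) j"
      unfolding band_coords_simps cochain_map_coords[OF fg(1)] cochain_map_coords[OF fg(2)] coords[OF az]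
        band_coords_gen(3)[OF HN[OF z] a] coords[OF z] am .
    moreover have "apply_matrix h (M.aact a z) j = apply_matrix (\<lambda>s j. ract \<omega> a (\<lambda>s. h s j) s) z j"
      unfolding apply_matrix_aact by (simp add: apply_matrix_def)
    ultimately show ?thesis unfolding am by (simp add: coboundary_def algebra_simps)
  next
    case False
    have "cochain (coboundary h)" using cocycle_coboundary[OF hm] by (simp add: cocycle_def)
    then show ?thesis
      by (simp add: cochain_outside[OF fg(1) False] cochain_outside[OF fg(2) False]
          cochain_outside[of "coboundary h", OF _ False])
  qed
  then show ?thesis using that hm by blast
qed

lemma has_cocycle_add_coboundary:
  assumes X: "X.has_cocycle X (cochain_map f)" and f: "cochain f" and h: "hom_matrix h"
    and g: "\<And>a s j. g a s j = f a s j + coboundary h a s j"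
  shows "X.has_cocycle X (cochain_map g)"
proof -
  have qp: "quasi_periodic (h s)" for s using h by (simp add: hom_matrix_def)
  have cb: "cochain (coboundary h)" using cocycle_coboundary[OF h] by (simp add: cocycle_def)
  have gc: "cochain g"
    unfolding cochain_def
  proof (intro conjI allI impI)
    show "quasi_periodic (g a s)" for a s
      by (simp add: quasi_periodic_def g cochainD(2)[OF f] cochainD(2)[OF cb] add_divide_distrib)
    fix a s j assume "g a s j \<noteq> 0"
    then have "f a s j \<noteq> 0 \<or> coboundary h a s j \<noteq> 0" unfolding g by auto
    then show "a \<in> arcs Q" "0 \<le> s" "s \<le> len" "vert s = tail Q a" "lsrc Q (\<beta> j) = head Q a"
      using cochainD(1)[OF f] cochainD(1)[OF cb] by blast+
  qed
  define H where "H m = band_vector (apply_matrix h m)" for m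
  have HN: "H m \<in> N.space" for m by (simp add: H_def band_vector_space)
  have coords: "band_coords (H m) = apply_matrix h m" for m
    unfolding H_def by (rule band_coords_vector, rule apply_matrix_quasi_periodic, rule qp)
  show ?thesis
  proof (rule X.has_cocycle_cohomologous[OF X is_cochain_cochain_map is_cochain_cochain_map, of H])
    show "H \<in> carrier Mw \<rightarrow> carrier Nb" using HN by (simp add: Nb_simps)
    have sp: "(\<lambda>i. x i + y i) \<in> N.space" if "x \<in> N.space" "y \<in> N.space" for x y using that by (simp add: N.space_def)
    show "H (x \<oplus>\<^bsub>Mw\<^esub> y) = H x \<oplus>\<^bsub>Nb\<^esub> H y" for x y
      unfolding Mw_simps Nb_simps
      by (rule N_eqI[OF HN sp[OF HN HN]]) (simp add: band_coords_simps coords apply_matrix_simps)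
    show "cochain_map g \<gamma> m \<oplus>\<^bsub>Nb\<^esub> H (gen \<gamma> \<odot>\<^bsub>Mw\<^esub> m) = cochain_map f \<gamma> m \<oplus>\<^bsub>Nb\<^esub> gen \<gamma> \<odot>\<^bsub>Nb\<^esub> H m"
      if \<gamma>: "\<gamma> \<in> gens" and m: "m \<in> carrier Mw" for \<gamma> m
    proof -
      have ms: "m \<in> M.space" using m by (simp add: Mw_simps)
      have gH: "gen \<gamma> \<odot>\<^bsub>Nb\<^esub> H m \<in> N.space"
        using X.N.smult_closed[OF gen_closed[OF \<gamma>], of "H m"] HN by (simp add: Nb_simps)
      show ?thesis
        unfolding Nb_simps
      proof (rule N_eqI[OF sp[OF cochain_map_space HN] sp[OF cochain_map_space gH]], unfold band_coords_simps coords)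
        show "(\<lambda>j. band_coords (cochain_map g \<gamma> m) j + apply_matrix h (gen \<gamma> \<odot>\<^bsub>Mw\<^esub> m) j) =
          (\<lambda>j. band_coords (cochain_map f \<gamma> m) j + band_coords (gen \<gamma> \<odot>\<^bsub>Nb\<^esub> H m) j)"
        proof (cases \<gamma>)
          case (Scal c)
          have 0: "cochain_map f' (Scal c) m = (\<lambda>_. 0)" for f' by (simp only: cochain_map_def generator.case)
          show ?thesis
            unfolding Scal Mw_gen(1)[OF ms] band_coords_gen(1)[OF HN] 0 band_coords_simps(3) coords apply_matrix_simps(2)
            by (rule refl)
        next
          case (Vert y)
          then have y: "y \<in> verts Q" using \<gamma> by (simp only: gens_simps)
          have 0: "cochain_map f' (Vert y) m = (\<lambda>_. 0)" for f' by (simp only: cochain_map_def generator.case)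
          have "apply_matrix h (\<lambda>i. if word_vert Q w i = y then m i else 0) j =
              (if lsrc Q (\<beta> j) = y then apply_matrix h m j else 0)" for j
          proof -
            have "(if word_vert Q w s = y then m s else 0) * h (int s) j =
                (if lsrc Q (\<beta> j) = y then m s * h (int s) j else 0)" for s
            proof (cases "h (int s) j = 0")
              case False
              then have "same_vert (int s) j" using h unfolding hom_matrix_def by blast
              then have "word_vert Q w s = lsrc Q (\<beta> j)" unfolding same_vert_def vert_def nat_int by blast
              then show ?thesis by (simp only: mult_zero_left if_distrib[of "\<lambda>x. x * h (int s) j"] split: if_split)
            qed (simp only: mult_zero_right if_cancel)
            then show ?thesis unfolding apply_matrix_def
              by (cases "lsrc Q (\<beta> j) = y") (simp_all only: simp_thms if_True if_False sum.neutral_const)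
          qed
          note e = ext[of "apply_matrix h (\<lambda>i. if word_vert Q w i = y then m i else 0)", OF this]
          show ?thesis
            unfolding Vert Mw_gen(2)[OF ms y] band_coords_gen(2)[OF HN y] 0 band_coords_simps(3) coords e
            by (rule refl)
        next
          case (Arr a)
          then have a: "a \<in> arcs Q" using \<gamma> by (simp only: gens_simps)
          have "apply_matrix (g a) m j + apply_matrix h (M.aact a m) j = apply_matrix (f a) m j + lact \<beta>\<omega> a (apply_matrix h m) j" for j
          proof -
            have "m s * g a (int s) j + m s * ract \<omega> a (\<lambda>s. h s j) (int s) =
                m s * f a (int s) j + m s * lact \<beta>\<omega> a (h (int s)) j" for s
              unfolding g coboundary_def by (simp only: distrib_left right_diff_distrib add.assoc diff_add_cancel)
            then show ?thesis
              unfolding lact_apply_matrix apply_matrix_aact unfolding apply_matrix_def sum.distrib[symmetric] by (simp only:)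
          qed
          then show ?thesis
            unfolding Arr Mw_gen(3)[OF ms a] band_coords_gen(3)[OF HN a] cochain_map_coords[OF gc] cochain_map_coords[OF f] coords
            by (simp only:)
        qed
      qed
    qed
  qed
qed

end

subsection \<open>Every extension has a cocycle\<close>

context string_band
begin

lemma Mw_finsum:
  assumes "finite A" "g \<in> A \<rightarrow> carrier Mw"
  shows "finsum Mw g A = (\<lambda>i. \<Sum>s\<in>A. g s i)"
  using assms
proof (induct A rule: finite_induct)
  case empty
  show ?case by (simp add: Mw_simps)
next
  case (insert x A)
  have "g \<in> A \<rightarrow> carrier Mw" "g x \<in> carrier Mw" using insert(4) by auto
  note g = this
  have "finsum Mw g (insert x A) = g x \<oplus>\<^bsub>Mw\<^esub> finsum Mw g A"
    by (rule X.M.M.finsum_insert[OF insert(1,2) g])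
  also have "\<dots> = (\<lambda>i. g x i + (\<Sum>s\<in>A. g s i))" unfolding insert(3)[OF g(1)] Mw_simps(3) by (rule refl)
  also have "\<dots> = (\<lambda>i. \<Sum>s\<in>insert x A. g s i)" unfolding sum.insert[OF insert(1,2)] by (rule refl)
  finally show ?case .
qed

text \<open>
  Lift each basis vector \<open>z\<^sub>s\<close> to the middle term and project the lift to its vertex. The linear section with
  these values commutes with scalars and vertices, so only arrows contribute to its defect.
\<close>

lemma extension_has_cocycle:
  assumes X: "X \<in> extensions \<Lambda> Mw Nb"
  obtains f where "cocycle f" "X.has_cocycle X (cochain_map f)"
proof -
  obtain i E p where Xe: "X = (i, E, p)" by (rule prod_cases3[of X])
  note X' = X[unfolded Xe]
  note D = X.extensionsD[OF X']
  interpret E: left_module \<Lambda> E by (rule D(1))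
  have gS: "gen (Scal c) \<in> carrier \<Lambda>" for c by (rule gen_closed[OF gens_simps(1)])
  have gV: "gen (Vert x) \<in> carrier \<Lambda>" if "x \<in> verts Q" for x by (rule gen_closed[OF gens_simps(2)[THEN iffD2, OF that]])
  have gA: "gen (Arr a) \<in> carrier \<Lambda>" if "a \<in> arcs Q" for a by (rule gen_closed[OF gens_simps(3)[THEN iffD2, OF that]])
  have "\<forall>s\<in>{..L}. \<exists>x. x \<in> carrier E \<and> p x = unit_vec s"
  proof
    fix s assume "s \<in> {..L}"
    then have "unit_vec s \<in> p ` carrier E" unfolding D(5) Mw_simps(1) by (intro unit_vec_space) (simp only: atMost_iff)
    then obtain x where "unit_vec s = p x" "x \<in> carrier E" by (rule imageE)
    then show "\<exists>x. x \<in> carrier E \<and> p x = unit_vec s" by (intro exI[of _ x] conjI) (simp_all only:)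
  qed
  from bchoice[OF this] obtain l where l: "\<forall>s\<in>{..L}. l s \<in> carrier E \<and> p (l s) = unit_vec s" ..
  define e where "e s = gen (Vert (word_vert Q w s)) \<odot>\<^bsub>E\<^esub> l s" for s
  have eE: "e s \<in> carrier E" if "s \<le> L" for s
    unfolding e_def by (rule E.smult_closed[OF gV[OF word_vert_verts[OF that]]]) (use l that in auto)
  have pe: "p (e s) = unit_vec s" if s: "s \<le> L" for s
  proof -
    have ls: "l s \<in> carrier E" "p (l s) = unit_vec s" using l s by auto
    show ?thesis
      unfolding e_def mod_homD(3)[OF D(3) gV[OF word_vert_verts[OF s]] ls(1)] ls(2) Mw_unit_vec[OF s word_vert_verts[OF s]] by simp
  qed
  have eV: "gen (Vert y) \<odot>\<^bsub>E\<^esub> e s = (if word_vert Q w s = y then e s else \<zero>\<^bsub>E\<^esub>)" if s: "s \<le> L" and y: "y \<in> verts Q" for s y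
  proof -
    have ls: "l s \<in> carrier E" using l s by auto
    have "gen (Vert y) \<odot>\<^bsub>E\<^esub> e s = (gen (Vert y) \<otimes>\<^bsub>\<Lambda>\<^esub> gen (Vert (word_vert Q w s))) \<odot>\<^bsub>E\<^esub> l s"
      unfolding e_def by (rule E.smult_assoc[OF gV[OF y] gV[OF word_vert_verts[OF s]] ls, symmetric])
    then show ?thesis
      unfolding gen_mult(3)[OF y word_vert_verts[OF s]] using scal_zero_smult[OF D(1) ls] by (auto simp: e_def)
  qed
  define \<sigma> where "\<sigma> m = finsum E (\<lambda>s. gen (Scal (m s)) \<odot>\<^bsub>E\<^esub> e s) {..L}" for m
  have tE: "(\<lambda>s. gen (Scal (m s)) \<odot>\<^bsub>E\<^esub> e s) \<in> {..L} \<rightarrow> carrier E" for m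
    using E.smult_closed[OF gS] eE by simp
  have \<sigma>E: "\<sigma> m \<in> carrier E" for m unfolding \<sigma>_def by (rule E.M.finsum_closed[OF tE])
  have \<sigma>_add: "\<sigma> (\<lambda>i. x i + y i) = \<sigma> x \<oplus>\<^bsub>E\<^esub> \<sigma> y" for x y
  proof -
    have "\<sigma> (\<lambda>i. x i + y i) = finsum E (\<lambda>s. gen (Scal (x s)) \<odot>\<^bsub>E\<^esub> e s \<oplus>\<^bsub>E\<^esub> gen (Scal (y s)) \<odot>\<^bsub>E\<^esub> e s) {..L}"
      unfolding \<sigma>_def
    proof (rule E.M.finsum_cong')
      show "gen (Scal (x s + y s)) \<odot>\<^bsub>E\<^esub> e s = gen (Scal (x s)) \<odot>\<^bsub>E\<^esub> e s \<oplus>\<^bsub>E\<^esub> gen (Scal (y s)) \<odot>\<^bsub>E\<^esub> e s"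
        if "s \<in> {..L}" for s
        unfolding scal_ops(1)[symmetric] by (rule E.smult_l_distr[OF gS gS eE]) (use that in simp)
    qed (use tE[of x] tE[of y] in auto)
    also have "\<dots> = \<sigma> x \<oplus>\<^bsub>E\<^esub> \<sigma> y" unfolding \<sigma>_def by (rule E.M.finsum_addf[OF tE tE])
    finally show ?thesis .
  qed
  have p\<sigma>: "p (\<sigma> m) = m" if m: "m \<in> M.space" for m
  proof -
    have t: "p (gen (Scal (m s)) \<odot>\<^bsub>E\<^esub> e s) = (\<lambda>i. m s * unit_vec s i)" if s: "s \<le> L" for s
      unfolding mod_homD(3)[OF D(3) gS eE[OF s]] pe[OF s] by (rule Mw_gen(1)[OF unit_vec_space[OF s]])
    have "p (\<sigma> m) = finsum Mw (\<lambda>s. p (gen (Scal (m s)) \<odot>\<^bsub>E\<^esub> e s)) {..L}"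
      unfolding \<sigma>_def by (rule mod_hom_finsum[OF D(1) left_module_Mw D(3) _ tE]) simp
    also have "\<dots> = (\<lambda>i. \<Sum>s\<le>L. p (gen (Scal (m s)) \<odot>\<^bsub>E\<^esub> e s) i)"
      by (rule Mw_finsum) (use tE[of m] D(9) in auto)
    also have "\<dots> = (\<lambda>i. \<Sum>s\<le>L. m s * unit_vec s i)"
      using t by (intro ext sum.cong) auto
    also have "\<dots> = m"
    proof
      fix i
      have "(\<Sum>s\<le>L. m s * unit_vec s i) = (\<Sum>s\<le>L. if s = i then m s else 0)"
        by (intro sum.cong) (auto simp: unit_vec_def)
      also have "\<dots> = m i" using m by (auto simp: M.space_def)
      finally show "(\<Sum>s\<le>L. m s * unit_vec s i) = m i" .
    qed
    finally show ?thesis .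
  qed
  have \<sigma>_scal: "gen (Scal c) \<odot>\<^bsub>E\<^esub> \<sigma> m = \<sigma> (\<lambda>i. c * m i)" for c m
  proof -
    have "gen (Scal c) \<odot>\<^bsub>E\<^esub> \<sigma> m = finsum E (\<lambda>s. gen (Scal c) \<odot>\<^bsub>E\<^esub> (gen (Scal (m s)) \<odot>\<^bsub>E\<^esub> e s)) {..L}"
      unfolding \<sigma>_def by (rule E.smult_finsum[OF finite_atMost tE gS])
    also have "\<dots> = \<sigma> (\<lambda>i. c * m i)"
      unfolding \<sigma>_def
    proof (rule E.M.finsum_cong')
      show "gen (Scal c) \<odot>\<^bsub>E\<^esub> (gen (Scal (m s)) \<odot>\<^bsub>E\<^esub> e s) = gen (Scal (c * m s)) \<odot>\<^bsub>E\<^esub> e s" if "s \<in> {..L}" for s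
        unfolding scal_ops(2)[symmetric] by (rule E.smult_assoc[OF gS gS eE, symmetric]) (use that in simp)
    qed (use tE in auto)
    finally show ?thesis .
  qed
  have \<sigma>_vert: "gen (Vert y) \<odot>\<^bsub>E\<^esub> \<sigma> m = \<sigma> (\<lambda>i. if word_vert Q w i = y then m i else 0)" if y: "y \<in> verts Q" for y m
  proof -
    have "gen (Vert y) \<odot>\<^bsub>E\<^esub> \<sigma> m = finsum E (\<lambda>s. gen (Vert y) \<odot>\<^bsub>E\<^esub> (gen (Scal (m s)) \<odot>\<^bsub>E\<^esub> e s)) {..L}"
      unfolding \<sigma>_def by (rule E.smult_finsum[OF finite_atMost tE gV[OF y]])
    also have "\<dots> = \<sigma> (\<lambda>i. if word_vert Q w i = y then m i else 0)"
      unfolding \<sigma>_def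
    proof (rule E.M.finsum_cong')
      show "gen (Vert y) \<odot>\<^bsub>E\<^esub> (gen (Scal (m s)) \<odot>\<^bsub>E\<^esub> e s) =
          gen (Scal (if word_vert Q w s = y then m s else 0)) \<odot>\<^bsub>E\<^esub> e s" if "s \<in> {..L}" for s
      proof -
        have s: "s \<le> L" using that by simp
        have "gen (Scal (m s)) \<otimes>\<^bsub>\<Lambda>\<^esub> gen (Vert y) = gen (Vert y) \<otimes>\<^bsub>\<Lambda>\<^esub> gen (Scal (m s))"
          using scal_central[OF gV[OF y], of "m s"] by simp
        then have "gen (Vert y) \<odot>\<^bsub>E\<^esub> (gen (Scal (m s)) \<odot>\<^bsub>E\<^esub> e s) = gen (Scal (m s)) \<odot>\<^bsub>E\<^esub> (gen (Vert y) \<odot>\<^bsub>E\<^esub> e s)"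
          unfolding E.smult_assoc[OF gV[OF y] gS eE[OF s], symmetric] E.smult_assoc[OF gS gV[OF y] eE[OF s], symmetric] by (rule arg_cong[OF sym])
        then show ?thesis
          unfolding eV[OF s y] using E.smult_zero_right[OF gS] scal_zero_smult[OF D(1) eE[OF s]] by (cases "word_vert Q w s = y") (simp_all only: simp_thms if_True if_False)
      qed
    qed (use tE in auto)
    finally show ?thesis .
  qed
  \<comment> \<open>the defect of the section at \<open>a\<close>, an element of the image of \<open>i\<close>\<close>
  define diff where "diff a m = gen (Arr a) \<odot>\<^bsub>E\<^esub> \<sigma> m \<ominus>\<^bsub>E\<^esub> \<sigma> (M.aact a m)" for a m
  define Da where "Da a m = inv_into (carrier Nb) i (diff a m)" for a m
  have pPi: "p \<in> carrier E \<rightarrow> carrier Mw" using D(9) by (intro Pi_I)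
  have pneg: "p (\<ominus>\<^bsub>E\<^esub> x) = \<ominus>\<^bsub>Mw\<^esub> p x" if "x \<in> carrier E" for x
    by (rule additive_mapD(2)[OF E.M.abelian_group_axioms X.M.M.abelian_group_axioms pPi _ that]) (rule mod_homD(2)[OF D(3)])
  have diffE: "diff a m \<in> carrier E" if "a \<in> arcs Q" for a m
    unfolding diff_def by (rule E.M.minus_closed[OF E.smult_closed[OF gA[OF that] \<sigma>E] \<sigma>E])
  have Da: "Da a m \<in> carrier Nb" "i (Da a m) = diff a m" if a: "a \<in> arcs Q" and m: "m \<in> M.space" for a m
  proof -
    have "p (diff a m) = p (gen (Arr a) \<odot>\<^bsub>E\<^esub> \<sigma> m) \<oplus>\<^bsub>Mw\<^esub> p (\<ominus>\<^bsub>E\<^esub> \<sigma> (M.aact a m))"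
      unfolding diff_def a_minus_def
      by (rule mod_homD(2)[OF D(3) E.smult_closed[OF gA[OF a] \<sigma>E] E.M.a_inv_closed[OF \<sigma>E]])
    also have "\<dots> = M.aact a m \<oplus>\<^bsub>Mw\<^esub> \<ominus>\<^bsub>Mw\<^esub> M.aact a m"
      unfolding mod_homD(3)[OF D(3) gA[OF a] \<sigma>E] pneg[OF \<sigma>E] p\<sigma>[OF m]
        p\<sigma>[OF M.aact_space] Mw_gen(3)[OF m a] by (rule refl)
    also have "\<dots> = \<zero>\<^bsub>Mw\<^esub>" by (rule X.M.M.r_neg) (simp add: Mw_simps M.aact_space)
    finally have "diff a m \<in> i ` carrier Nb" unfolding D(6) using diffE[OF a] by blast
    then show "Da a m \<in> carrier Nb" "i (Da a m) = diff a m"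
      unfolding Da_def by (rule inv_into_into, rule f_inv_into_f)
  qed
  have sp: "(\<lambda>i. x i + y i) \<in> M.space" "(\<lambda>i. c * x i) \<in> M.space" if "x \<in> M.space" "y \<in> M.space" for x y c
    using that by (auto simp: M.space_def)
  have aact_lin: "M.aact a (\<lambda>i. x i + y i) = (\<lambda>i. M.aact a x i + M.aact a y i)"
    "M.aact a (\<lambda>i. c * x i) = (\<lambda>i. c * M.aact a x i)" for a x y c
    by (auto simp: arrow_act_def fun_eq_iff sum.distrib sum_distrib_left algebra_simps simp del: sum.lessThan_Suc)
  have Da_add: "Da a (\<lambda>i. x i + y i) = (\<lambda>i. Da a x i + Da a y i)"
    if a: "a \<in> arcs Q" and xy: "x \<in> M.space" "y \<in> M.space" for a x y
  proof -
    have c: "Da a (\<lambda>i. x i + y i) \<in> carrier Nb" "Da a x \<oplus>\<^bsub>Nb\<^esub> Da a y \<in> carrier Nb"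
      using Da(1)[OF a] sp xy X.N.M.a_closed by auto
    have "i (Da a (\<lambda>i. x i + y i)) = i (Da a x \<oplus>\<^bsub>Nb\<^esub> Da a y)"
      unfolding mod_homD(2)[OF D(2) Da(1)[OF a xy(1)] Da(1)[OF a xy(2)]] Da(2)[OF a xy(1)] Da(2)[OF a xy(2)] Da(2)[OF a sp(1)[OF xy]]
      unfolding diff_def aact_lin \<sigma>_add E.smult_r_distr[OF gA[OF a] \<sigma>E \<sigma>E]
      using E.smult_closed[OF gA[OF a] \<sigma>E] \<sigma>E by (simp add: a_minus_def E.M.minus_add E.M.a_ac)
    from inj_onD[OF D(4) this c] show ?thesis unfolding Nb_simps .
  qed
  have Da_scal: "Da a (\<lambda>i. c * x i) = (\<lambda>i. c * Da a x i)" if a: "a \<in> arcs Q" and x: "x \<in> M.space" for a c x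
  proof -
    have cc: "Da a (\<lambda>i. c * x i) \<in> carrier Nb" "gen (Scal c) \<odot>\<^bsub>Nb\<^esub> Da a x \<in> carrier Nb"
      using Da(1)[OF a] sp(2)[OF x x] x X.N.smult_closed[OF gS] by auto
    have "gen (Scal c) \<otimes>\<^bsub>\<Lambda>\<^esub> gen (Arr a) = gen (Arr a) \<otimes>\<^bsub>\<Lambda>\<^esub> gen (Scal c)"
      using scal_central[OF gA[OF a], of c] by simp
    then have com: "gen (Scal c) \<odot>\<^bsub>E\<^esub> (gen (Arr a) \<odot>\<^bsub>E\<^esub> \<sigma> x) = gen (Arr a) \<odot>\<^bsub>E\<^esub> (gen (Scal c) \<odot>\<^bsub>E\<^esub> \<sigma> x)"
      unfolding E.smult_assoc[OF gA[OF a] gS \<sigma>E, symmetric] E.smult_assoc[OF gS gA[OF a] \<sigma>E, symmetric] by (rule arg_cong)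
    have "i (gen (Scal c) \<odot>\<^bsub>Nb\<^esub> Da a x) = gen (Scal c) \<odot>\<^bsub>E\<^esub> diff a x"
      unfolding mod_homD(3)[OF D(2) gS Da(1)[OF a x]] Da(2)[OF a x] by (rule refl)
    also have "\<dots> = gen (Scal c) \<odot>\<^bsub>E\<^esub> (gen (Arr a) \<odot>\<^bsub>E\<^esub> \<sigma> x) \<oplus>\<^bsub>E\<^esub> gen (Scal c) \<odot>\<^bsub>E\<^esub> (\<ominus>\<^bsub>E\<^esub> \<sigma> (M.aact a x))"
      unfolding diff_def a_minus_def
      by (rule E.smult_r_distr[OF gS E.smult_closed[OF gA[OF a] \<sigma>E] E.M.a_inv_closed[OF \<sigma>E]])
    also have "gen (Scal c) \<odot>\<^bsub>E\<^esub> (\<ominus>\<^bsub>E\<^esub> \<sigma> (M.aact a x)) = \<ominus>\<^bsub>E\<^esub> (gen (Scal c) \<odot>\<^bsub>E\<^esub> \<sigma> (M.aact a x))"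
      by (rule additive_mapD(2)[OF E.M.abelian_group_axioms E.M.abelian_group_axioms _ _ \<sigma>E])
        (use E.smult_closed[OF gS] E.smult_r_distr[OF gS] in auto)
    finally have "i (gen (Scal c) \<odot>\<^bsub>Nb\<^esub> Da a x) = diff a (\<lambda>i. c * x i)"
      unfolding com \<sigma>_scal diff_def aact_lin a_minus_def .
    then have "i (Da a (\<lambda>i. c * x i)) = i (gen (Scal c) \<odot>\<^bsub>Nb\<^esub> Da a x)"
      unfolding Da(2)[OF a sp(2)[OF x x]] by (rule sym)
    have gc: "gen (Scal c) \<odot>\<^bsub>Nb\<^esub> Da a x = (\<lambda>i. c * Da a x i)"
      unfolding Nb_eq by (rule N.smult_gen(1)[OF Da(1)[OF a x, unfolded Nb_simps]])
    from inj_onD[OF D(4) \<open>i (Da a (\<lambda>i. c * x i)) = _\<close> cc] show ?thesis unfolding gc .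
  qed
  define f where "f a s j = (if a \<in> arcs Q \<and> 0 \<le> s \<and> s \<le> len then band_coords (Da a (unit_vec (nat s))) j else 0)" for a s j
  have cm: "cochain_map f (Arr a) m = Da a m" if a: "a \<in> arcs Q" and m: "m \<in> M.space" for a m
  proof -
    have fa: "f a = (\<lambda>s j. if 0 \<le> s \<and> s \<le> len then band_coords (Da a (unit_vec (nat s))) j else 0)"
      using a by (simp add: f_def fun_eq_iff)
    have "band_coords (Da a m) = apply_matrix (f a) m"
      unfolding fa by (rule linear_coords[of "Da a", OF Da_add[OF a] Da_scal[OF a] m])
    then have "cochain_map f (Arr a) m = band_vector (band_coords (Da a m))"
      unfolding cochain_map_def generator.case by simp
    also have "\<dots> = Da a m"
      by (rule band_vector_coords) (use Da(1)[OF a m] in \<open>simp add: Nb_simps N.space_def\<close>)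
    finally show ?thesis .
  qed
  have i0: "i (\<lambda>_. 0) = \<zero>\<^bsub>E\<^esub>" using mod_hom_additive(1)[OF left_module_Nb D(1) D(2)] by (simp add: Nb_simps)
  have hc: "X.has_cocycle X (cochain_map f)"
    unfolding Xe
  proof (rule X.has_cocycle_sectionI[OF X', of \<sigma>])
    show "\<sigma> \<in> carrier Mw \<rightarrow> carrier E" using \<sigma>E by simp
    show "\<sigma> (x \<oplus>\<^bsub>Mw\<^esub> y) = \<sigma> x \<oplus>\<^bsub>E\<^esub> \<sigma> y" for x y unfolding Mw_simps by (rule \<sigma>_add)
    show "p (\<sigma> m) = m" if "m \<in> carrier Mw" for m using p\<sigma> that by (simp add: Mw_simps)
    show "cochain_map f \<gamma> m \<in> carrier Nb" for \<gamma> m by (simp add: Nb_simps cochain_map_space)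
    show "gen \<gamma> \<odot>\<^bsub>E\<^esub> \<sigma> m = \<sigma> (gen \<gamma> \<odot>\<^bsub>Mw\<^esub> m) \<oplus>\<^bsub>E\<^esub> i (cochain_map f \<gamma> m)"
      if \<gamma>: "\<gamma> \<in> gens" and m: "m \<in> carrier Mw" for \<gamma> m
    proof -
      have ms: "m \<in> M.space" using m by (simp add: Mw_simps)
      show ?thesis
      proof (cases \<gamma>)
        case (Scal c)
        have 0: "cochain_map f (Scal c) m = (\<lambda>_. 0)" by (simp only: cochain_map_def generator.case)
        show ?thesis
          unfolding Scal \<sigma>_scal Mw_gen(1)[OF ms] 0 i0 by (rule E.M.r_zero[OF \<sigma>E, symmetric])
      next
        case (Vert y)
        then have y: "y \<in> verts Q" using \<gamma> by (simp only: gens_simps)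
        have 0: "cochain_map f (Vert y) m = (\<lambda>_. 0)" by (simp only: cochain_map_def generator.case)
        show ?thesis
          unfolding Vert \<sigma>_vert[OF y] Mw_gen(2)[OF ms y] 0 i0 by (rule E.M.r_zero[OF \<sigma>E, symmetric])
      next
        case (Arr a)
        then have a: "a \<in> arcs Q" using \<gamma> by (simp only: gens_simps)
        have c: "gen (Arr a) \<odot>\<^bsub>E\<^esub> \<sigma> m \<in> carrier E" by (rule E.smult_closed[OF gA[OF a] \<sigma>E])
        show ?thesis
          unfolding Arr Mw_gen(3)[OF ms a] cm[OF a ms] Da(2)[OF a ms] diff_def
          unfolding a_minus_def E.M.a_comm[OF c E.M.a_inv_closed[OF \<sigma>E]]
          by (rule E.M.r_neg2[OF \<sigma>E c, symmetric])
      qed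
    qed
  qed
  have "cocycle f"
  proof (rule cocycle_of_has_cocycle[OF hc])
    show "a \<in> arcs Q \<and> 0 \<le> s \<and> s \<le> len" if "f a s j \<noteq> 0" for a s j
      using that by (simp add: f_def split: if_splits)
    show "quasi_periodic (f a s)" for a s
      by (cases "a \<in> arcs Q \<and> 0 \<le> s \<and> s \<le> len")
        (auto simp: quasi_periodic_def f_def quasi_periodicD(1)[OF quasi_periodic_band_coords])
  qed
  then show ?thesis using that hc by blast
qed

end

section \<open>The cocycle of an overlap extension\<close>

context band_setup
begin

text \<open>
  The quasi-periodic function with prescribed values on the window of length \<open>n\<close> starting at \<open>c\<close>.
\<close>

definition extend :: "int \<Rightarrow> (int \<Rightarrow> 'k) \<Rightarrow> int \<Rightarrow> 'k" where
  "extend c g j = g (c + (j - c) mod int n) * place_weight j / place_weight (c + (j - c) mod int n)"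

lemma quasi_periodic_extend: "quasi_periodic (extend c g)"
proof -
  have "(j + int n - c) mod int n = (j - c) mod int n" for j
    using mod_add_self2[of "j - c" "int n"] by (simp add: algebra_simps)
  then show ?thesis by (simp add: quasi_periodic_def extend_def place_weight_period)
qed

lemma extend_window: "c \<le> j \<Longrightarrow> j < c + int n \<Longrightarrow> extend c g j = g j"
  using place_weight_nonzero by (simp add: extend_def)

lemma extend_eqI:
  assumes "quasi_periodic h" "\<And>j. c \<le> j \<Longrightarrow> j < c + int n \<Longrightarrow> h j = g j"
  shows "extend c g = h"
  by (rule quasi_periodic_eqI[OF quasi_periodic_extend assms(1), of c]) (simp add: extend_window assms(2))

end

text \<open>
  One overlap is fixed. The word \<open>u\<close> of the middle term follows the string up to the end of \<open>m\<close>, then the band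
  for one more period, and then the rest of the string.
\<close>

locale overlap_setup = string_band Q I b t\<^sub>0 \<mu> w
  for Q :: "('v, 'a) pre_digraph" and I :: "(('v, 'a) path \<Rightarrow> 'k::field) set"
    and b :: "'a letter list" and t\<^sub>0 :: nat and \<mu> :: 'k and w :: "('v, 'a) word" +
  fixes ov :: "'a overlap"
  assumes ov: "ov \<in> overlaps Q I w b"
begin

abbreviation st :: int where "st \<equiv> int (ov_start ov)"
abbreviation pos :: int where "pos \<equiv> int (ov_pos ov)"
abbreviation ml :: int where "ml \<equiv> int (length (ov_m ov))"
abbreviation s1 :: int where "s1 \<equiv> end_s ov"
abbreviation j1 :: int where "j1 \<equiv> end_j ov"
abbreviation u where "u \<equiv> ov_word Q b ov"

lemma ends: "s1 = st + ml" "j1 = pos + ml" "0 \<le> st" "0 \<le> ml" "0 \<le> pos" "s1 \<le> len" "0 < int n"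
  using overlapsD(10)[OF ov] n_pos by (simp_all add: end_s_def end_j_def)

lemma common: "st \<le> k \<Longrightarrow> k < s1 \<Longrightarrow> \<omega> k = Some (\<beta> (pos + (k - st)))"
  using overlapsD(2)[OF ov, of "nat (k - st)"] overlapsD(5)[OF ov, of "nat (k - st)"] ends by simp

lemma ends_\<omega>: "\<omega> (st - 1) = map_option Dir (ov_A ov)" "\<omega> s1 = map_option Inv (ov_B ov)"
  "\<beta> (pos - 1) = Inv (ov_C ov)" "\<beta> j1 = Dir (ov_D ov)"
  using overlapsD(1,3,4,6)[OF ov] .

lemma ends_\<beta>: "\<beta> (pos - 1 + int n) = Inv (ov_C ov)" "\<beta> (j1 + int n) = Dir (ov_D ov)"
  unfolding inf_word_periodic by (rule ends_\<omega>)+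

definition \<omega>u :: "int \<Rightarrow> 'a letter option" where
  "\<omega>u k = (if k < st then \<omega> k else if k < s1 + int n then Some (\<beta> (pos + (k - st))) else \<omega> (k - int n))"

lemma \<omega>u_left: "k < s1 \<Longrightarrow> \<omega>u k = \<omega> k"
  using common by (simp add: \<omega>u_def)

lemma \<omega>u_mid: "st \<le> k \<Longrightarrow> k < s1 + int n \<Longrightarrow> \<omega>u k = Some (\<beta> (pos + (k - st)))"
  by (simp add: \<omega>u_def)

text \<open>
  The word \<open>u\<close> contains two translates of \<open>m\<close>, so that its beginning up to the first copy and its end from the
  second copy on both are read in the string.
\<close>

lemma \<omega>u_right: "st + int n \<le> k \<Longrightarrow> \<omega>u k = \<omega> (k - int n)"
proof -
  assume k: "st + int n \<le> k"
  show ?thesis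
  proof (cases "k < s1 + int n")
    case True
    have e: "pos + (k - int n - st) + int n = pos + (k - st)" by simp
    have "\<beta> (pos + (k - int n - st)) = \<beta> (pos + (k - st))"
      using inf_word_periodic(1)[of "pos + (k - int n - st)"] unfolding e by (rule sym)
    then show ?thesis using common[of "k - int n"] k True ends by (simp add: \<omega>u_def)
  next
    case False
    then show ?thesis using k ends by (simp add: \<omega>u_def)
  qed
qed

lemma u_length: "length (snd u) = L + n" "snd u \<noteq> []"
proof -
  have ls: "snd w = ov_vR ov @ dir_opt (ov_A ov) @ ov_m ov @ inv_opt (ov_B ov) @ ov_vL ov"
    using ov by (simp add: overlaps_def)
  show l: "length (snd u) = L + n" by (simp add: ov_word_def word_of_def ov_y_def ls)
  show "snd u \<noteq> []" using l n_pos by (cases "snd u") auto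
qed

lemma u_diagram: "word_diagram (snd u) = \<omega>u"
proof
  fix k
  have ls: "snd w = ov_vR ov @ dir_opt (ov_A ov) @ ov_m ov @ inv_opt (ov_B ov) @ ov_vL ov"
    using ov by (simp add: overlaps_def)
  define P where "P = ov_vR ov @ dir_opt (ov_A ov)"
  define R where "R = inv_opt (ov_B ov) @ ov_vL ov"
  have w': "snd w = P @ ov_m ov @ R" and u': "snd u = P @ ov_y b ov @ R"
    by (simp_all add: ls P_def R_def ov_word_def word_of_def)
  have lP: "length P = ov_start ov" by (simp add: P_def ov_start_def)
  have ly: "length (ov_y b ov) = length (ov_m ov) + n" by (simp add: ov_y_def)
  consider "k < 0" | "0 \<le> k" "k < st" | "st \<le> k" "k < s1 + int n" | "s1 + int n \<le> k" by linarith
  then show "word_diagram (snd u) k = \<omega>u k"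
  proof cases
    case 1
    then show ?thesis using ends by (simp add: \<omega>u_def \<omega>_def word_diagram_def)
  next
    case 2
    then have "nat k < length P" unfolding lP by linarith
    then show ?thesis using 2 lP by (simp add: \<omega>u_def \<omega>_def word_diagram_def w' u' nth_append)
  next
    case 3
    define i where "i = nat (k - st)"
    have i: "k = int (ov_start ov + i)" "i < length (ov_m ov) + n" using 3 ends by (auto simp: i_def)
    have "snd u ! (ov_start ov + i) = ov_y b ov ! i"
      unfolding u' using lP ly i(2) by (simp add: nth_append)
    also have "\<dots> = \<beta> (pos + int i)" using i(2) by (simp add: ov_y_def)
    also have "\<dots> = \<beta> (pos + (k - st))" using i(1) by simp
    finally have "snd u ! nat k = \<beta> (pos + (k - st))" unfolding i(1) nat_int .
    moreover have "nat k < length (snd u)" unfolding u' using lP ly i by simp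
    ultimately show ?thesis using 3 \<omega>u_mid[OF 3] by (simp add: word_diagram_def nat_less_iff)
  next
    case 4
    define i where "i = nat (k - s1 - int n)"
    have i: "k = int (ov_start ov + length (ov_m ov) + n + i)" using 4 ends by (simp add: i_def)
    have k': "k - int n = int (ov_start ov + length (ov_m ov) + i)" using i by simp
    have "\<omega>u k = \<omega> (k - int n)" by (rule \<omega>u_right) (use 4 ends in linarith)
    also have "\<dots> = (if i < length R then Some (R ! i) else None)"
      unfolding k' \<omega>_def word_diagram_def w' using lP by (simp add: nth_append nat_add_distrib)
    also have "\<dots> = word_diagram (snd u) k"
      unfolding i word_diagram_def u' using lP ly by (simp add: nth_append nat_add_distrib)
    finally show ?thesis ..
  qed
qed

lemma aligned_ends: "aligned st pos" "aligned s1 j1"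
  using overlap_aligned[OF ov] overlap_right_end[OF ov] by (auto simp: right_end_def)

text \<open>
  At the two places where \<open>u\<close> changes between the string and the band both have the same sides, so the letters
  fit together.
\<close>

lemma good_u: "good_word u"
  unfolding good_word_def u_diagram
proof (intro conjI impI)
  have wk: "walk \<omega>u"
    unfolding walk_def
  proof (intro conjI allI impI)
    show "letter_arc l \<in> arcs Q" if "\<omega>u k = Some l" for k l
      using that \<omega>_arc band_arc by (auto simp: \<omega>u_def split: if_splits)
    fix k l l' assume l: "\<omega>u k = Some l" and l': "\<omega>u (k + 1) = Some l'"
    consider "k + 1 < st" | "k + 1 = st" | "st \<le> k" "k + 1 < s1 + int n" | "k + 1 = s1 + int n" | "s1 + int n \<le> k"
      by linarith
    then show "step l l'"
    proof cases
      case 1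
      then show ?thesis using l l' walkD(2)[OF walk_\<omega>, of k l l'] by (simp add: \<omega>u_def step_def)
    next
      case 2
      have k: "k = st - 1" using 2 by linarith
      have 1: "\<omega> (st - 1) = Some l" using l unfolding k by (simp add: \<omega>u_def)
      have 3: "l' = \<beta> pos" using l' ends unfolding 2 by (simp add: \<omega>u_def)
      have "side (linv l) = side (linv (\<beta> (pos - 1)))" using aligned_ends(1) 1 by (simp add: aligned_def)
      moreover have "lsrc Q (\<beta> pos) = ltgt Q l"
        using aligned_same_vert[OF aligned_ends(1)] \<omega>_vert(2)[OF 1] by (simp add: same_vert_def)
      ultimately show ?thesis using band_side[of pos] unfolding 3 step_def by simp
    next
      case 3
      then have "l = \<beta> (pos + (k - st))" "l' = \<beta> (pos + (k - st) + 1)"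
        using l l' \<omega>u_mid[of k] \<omega>u_mid[of "k + 1"] by (auto simp: algebra_simps)
      then show ?thesis using walkD(2)[OF walk_band, of "pos + (k - st)"] by (simp add: step_def)
    next
      case 4
      have k: "k = s1 + int n - 1" using 4 by linarith
      have e: "pos + (s1 + int n - 1 - st) = j1 - 1 + int n" using ends by simp
      have 1: "l = \<beta> (j1 - 1)"
        using l \<omega>u_mid[of k] ends inf_word_periodic(1)[of "j1 - 1"] unfolding k e by simp
      have 3: "\<omega> s1 = Some l'" using l' ends unfolding 4 by (simp add: \<omega>u_def)
      have "side l' = side (\<beta> j1)" using aligned_ends(2) 3 by (simp add: aligned_def)
      moreover have "lsrc Q l' = lsrc Q (\<beta> j1)"
        using aligned_same_vert[OF aligned_ends(2)] \<omega>_vert(1)[OF 3] by (simp add: same_vert_def)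
      ultimately show ?thesis using band_side[of j1] band_vert(2)[of j1] unfolding 1 step_def by simp
    next
      case 5
      have e: "k + 1 - int n = k - int n + 1" by simp
      have "\<omega> (k - int n) = Some l" "\<omega> (k - int n + 1) = Some l'"
        using 5 l l' ends unfolding e[symmetric] by (auto simp: \<omega>u_def)
      then show ?thesis using walkD(2)[OF walk_\<omega>] by (simp add: step_def)
    qed
  qed
  then show "walk \<omega>u" .
  obtain x xs where x: "snd u = x # xs" using u_length(2) by (cases "snd u") auto
  then have "\<omega>u 0 = Some x" unfolding u_diagram[symmetric] by (simp add: word_diagram_def)
  then have "letter_arc x \<in> arcs Q" by (rule walkD(1)[OF wk])
  moreover show fu: "fst u = lsrc Q (hd (snd u))" by (simp add: ov_word_def word_of_def)
  ultimately show "fst u \<in> verts Q" unfolding fu x by (simp add: lsrc_verts)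
qed

sublocale U: string_band Q I b t\<^sub>0 \<mu> u
  by unfold_locales (rule good_u)

lemma U_len: "U.len = len + int n"
  unfolding U.len_def len_def u_length by simp

lemma U_\<omega>: "U.\<omega> = \<omega>u"
  unfolding U.\<omega>_def by (rule u_diagram)

lemma \<omega>_Some: "0 \<le> s \<Longrightarrow> s < len \<Longrightarrow> \<exists>l. \<omega> s = Some l"
  by (simp add: \<omega>_def word_diagram_def len_def)

lemma U_vert_mid:
  assumes "st \<le> k" "k \<le> s1 + int n"
  shows "U.vert k = lsrc Q (\<beta> (pos + (k - st)))"
proof (cases "k < s1 + int n")
  case True
  show ?thesis by (rule U.\<omega>_vert(1)) (use True assms \<omega>u_mid in \<open>simp add: U_\<omega>\<close>)
next
  case False
  then have k: "k = s1 + int n - 1 + 1" using assms by simp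
  have e: "pos + (s1 + int n - 1 + 1 - st) - 1 = pos + (s1 + int n - 1 - st)" by simp
  have "U.vert (s1 + int n - 1 + 1) = ltgt Q (\<beta> (pos + (s1 + int n - 1 - st)))"
    by (rule U.\<omega>_vert(2), unfold U_\<omega>, rule \<omega>u_mid) (use ends in linarith)+
  then show ?thesis unfolding k band_vert(2)[of "pos + (s1 + int n - 1 + 1 - st)"] e .
qed

lemma U_vert_left:
  assumes "0 \<le> k" "k \<le> s1"
  shows "U.vert k = vert k"
proof (cases "k < s1")
  case True
  then obtain l where l: "\<omega> k = Some l" using \<omega>_Some[of k] assms ends by auto
  have "U.\<omega> k = Some l" unfolding U_\<omega> \<omega>u_left[OF True] by (rule l)
  then show ?thesis using U.\<omega>_vert(1) \<omega>_vert(1)[OF l] by simp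
next
  case False
  then have "k = s1" using assms by simp
  moreover have "pos + (s1 - st) = j1" using ends by simp
  ultimately show ?thesis
    using U_vert_mid[of s1] aligned_same_vert[OF aligned_ends(2)] ends by (simp add: same_vert_def)
qed

lemma U_vert_right:
  assumes "st \<le> k" "k \<le> len"
  shows "U.vert (k + int n) = vert k"
proof (cases "k = st")
  case True
  have "pos + (st + int n - st) = pos + int n" by simp
  then show ?thesis
    unfolding True using U_vert_mid[of "st + int n"] aligned_same_vert[OF aligned_ends(1)] ends inf_word_periodic(1)[of pos]
    by (simp add: same_vert_def)
next
  case False
  then have k: "st \<le> k - 1" "0 \<le> k - 1" "k - 1 < len" using assms ends by auto
  obtain l where l: "\<omega> (k - 1) = Some l" using \<omega>_Some k by blast
  have "U.\<omega> (k + int n - 1) = Some l"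
    unfolding U_\<omega> using \<omega>u_right[of "k + int n - 1"] k l by simp
  from U.\<omega>_vert(2)[OF this] show ?thesis using \<omega>_vert(2)[OF l] by simp
qed

end

context string_band
begin

lemma zext_aact: "0 \<le> k \<Longrightarrow> k \<le> len \<Longrightarrow> zext (M.aact a F) k = lact \<omega> a (zext F) k"
  using string_arrow_act[of "nat k" "snd w" a F] by (simp add: zext_def len_def \<omega>_def)

lemma M_eqI:
  assumes "x \<in> M.space" "y \<in> M.space" "\<And>k. 0 \<le> k \<Longrightarrow> k \<le> len \<Longrightarrow> zext x k = zext y k"
  shows "x = y"
proof
  fix i
  show "x i = y i"
    using assms(1,2) assms(3)[of "int i"] by (cases "i \<le> L") (simp_all add: M.space_def zext_def len_def)
qed

lemma zext_outside: "x \<in> M.space \<Longrightarrow> k < 0 \<or> len < k \<Longrightarrow> zext x k = 0"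
  by (auto simp: M.space_def zext_def len_def)

end

context overlap_setup
begin

abbreviation inj where "inj \<equiv> ov_inj b t\<^sub>0 \<mu> ov"
abbreviation proj where "proj \<equiv> ov_proj w b \<mu> ov"

lemma zext_inj:
  "zext (inj g) k = (if st \<le> k \<and> k \<le> s1 + int n then band_coords g (pos + (k - st)) else 0)"
proof (cases "st \<le> k \<and> k \<le> s1 + int n")
  case True
  define i where "i = nat (k - st)"
  have k: "k = int (ov_start ov + i)" and c: "pos + (k - st) = int (ov_pos ov + i)" using True by (auto simp: i_def)
  have "int i = k - st" using True by (simp add: i_def)
  then have i: "i \<le> length (ov_m ov) + n" using True ends by linarith
  have "zext (inj g) k = inj g (ov_start ov + i)" unfolding k zext_def nat_int by simp
  also have "\<dots> = place_weight (int (ov_pos ov + i)) * g ((ov_pos ov + i) mod n)"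
    unfolding ov_inj_def Let_def band_weight_eq using i by (simp del: of_nat_add)
  finally have "zext (inj g) k = place_weight (int (ov_pos ov + i)) * g ((ov_pos ov + i) mod n)" .
  moreover have "nat (int (ov_pos ov + i) mod int n) = (ov_pos ov + i) mod n"
    unfolding zmod_int[symmetric] by (rule nat_int)
  ultimately show ?thesis using True unfolding c band_coords_def by (simp del: of_nat_add)
next
  case False
  then have "\<not> (0 \<le> k \<and> ov_start ov \<le> nat k \<and> nat k \<le> ov_start ov + length (ov_m ov) + n)"
    using ends by (auto simp: le_nat_iff nat_le_iff)
  then show ?thesis using False by (auto simp: zext_def ov_inj_def)
qed

lemma inj_space: "inj g \<in> U.M.space"
proof -
  have "ov_start ov + length (ov_m ov) \<le> L" using ends by (simp add: len_def)
  then show ?thesis unfolding U.M.space_def unfolding mem_Collect_eq u_length(1) ov_inj_def by auto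
qed

lemma proj_space: "proj F \<in> M.space"
  by (simp add: M.space_def ov_proj_def)

lemma zext_proj:
  assumes "0 \<le> s" "s \<le> len"
  shows "zext (proj F) s = (if s \<le> s1 then zext F s else 0) - \<mu> * (if st \<le> s then zext F (s + int n) else 0)"
proof -
  define i where "i = nat s"
  have s: "s = int i" using assms by (simp add: i_def)
  have "i \<le> L" using assms(2) by (simp add: len_def s)
  then show ?thesis unfolding s using ends by (simp add: zext_def ov_proj_def nat_add_distrib)
qed

text \<open>
  The places of \<open>u\<close> after the first copy of \<open>m\<close>, up to the end of the second one, cover each place of the band
  once. The retraction reads a vector there and forgets the other coordinates.
\<close>

definition retract :: "(nat \<Rightarrow> 'k) \<Rightarrow> nat \<Rightarrow> 'k" where
  "retract F = band_vector (extend (j1 + 1) (\<lambda>j. zext F (st + (j - pos))))"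

lemma retract_coords: "band_coords (retract F) = extend (j1 + 1) (\<lambda>j. zext F (st + (j - pos)))"
  unfolding retract_def by (rule band_coords_vector[OF quasi_periodic_extend])

lemma retract_window:
  "j1 < j \<Longrightarrow> j \<le> j1 + int n \<Longrightarrow> band_coords (retract F) j = zext F (st + (j - pos))"
  "band_coords (retract F) j1 = \<mu> * zext F (s1 + int n)"
proof -
  show w: "band_coords (retract F) j = zext F (st + (j - pos))" if "j1 < j" "j \<le> j1 + int n" for j
    unfolding retract_coords by (rule extend_window) (use that in auto)
  have e: "st + (j1 + int n - pos) = s1 + int n" using ends by simp
  have "band_coords (retract F) j1 = band_coords (retract F) (j1 + int n) * \<mu>"
    using quasi_periodicD(2)[OF quasi_periodic_band_coords, of "retract F" "j1 + int n"] by simp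
  then show "band_coords (retract F) j1 = \<mu> * zext F (s1 + int n)"
    using w[of "j1 + int n"] ends unfolding e by simp
qed

text \<open>
  The retraction fails to commute with an arrow only at the two boundaries of the window from which it
  reads: on the left \<open>D\<close> enters the window from the end of the first copy of \<open>m\<close>, and on the right \<open>B\<close> enters
  it from behind the second copy. The factor \<open>1 / \<mu>\<close> compensates for the factor in \<open>ov_proj\<close>.
\<close>

definition ov_entry :: "'a \<Rightarrow> int \<Rightarrow> int \<Rightarrow> 'k" where
  "ov_entry a s j = (if s = s1 \<and> a = ov_D ov \<and> j = j1 + 1 then 1 else 0) -
     (if ov_B ov = Some a \<and> s = s1 + 1 \<and> j = j1 + int n then 1 / \<mu> else 0)"

definition ov_cochain :: "'a \<Rightarrow> int \<Rightarrow> int \<Rightarrow> 'k" where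
  "ov_cochain a s = extend (j1 + 1) (ov_entry a s)"

lemma apply_ov_cochain:
  assumes "j1 < j" "j \<le> j1 + int n"
  shows "apply_matrix (ov_cochain a) m j =
    (if a = ov_D ov \<and> j = j1 + 1 then zext m s1 else 0) - (if ov_B ov = Some a \<and> j = j1 + int n then zext m (s1 + 1) / \<mu> else 0)"
proof -
  have e: "ov_cochain a s j = ov_entry a s j" for s
    unfolding ov_cochain_def by (rule extend_window) (use assms in auto)
  have B: "s1 + 1 \<le> len" if "ov_B ov = Some a" using \<omega>_range[of s1] ends_\<omega>(2) that by auto
  have s: "int s = s1 \<longleftrightarrow> s = nat s1" "int s = s1 + 1 \<longleftrightarrow> s = nat (s1 + 1)" for s using ends by auto
  have n: "nat s1 \<le> L" "nat s1 \<noteq> nat (s1 + 1)" using ends by (simp_all add: len_def)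
  have "apply_matrix (ov_cochain a) m j =
     (\<Sum>s\<le>L. (if s = nat s1 then if a = ov_D ov \<and> j = j1 + 1 then m s else 0 else 0) -
       (if s = nat (s1 + 1) then if ov_B ov = Some a \<and> j = j1 + int n then m s / \<mu> else 0 else 0))"
    unfolding apply_matrix_def e ov_entry_def s using n(2) by (intro sum.cong) auto
  also have "\<dots> = (if a = ov_D ov \<and> j = j1 + 1 then m (nat s1) else 0) -
      (if ov_B ov = Some a \<and> j = j1 + int n then m (nat (s1 + 1)) / \<mu> else 0)"
    unfolding sum_subtractf sum.delta[OF finite_atMost] using n B by (auto simp: len_def)
  finally show ?thesis using ends by (simp add: zext_def)
qed

lemma retract_arrow:
  assumes "j1 < j" "j \<le> j1 + int n"
  shows "lact \<omega>u a (zext F) (st + (j - pos)) =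
    lact \<beta>\<omega> a (band_coords (retract F)) j + apply_matrix (ov_cochain a) (proj F) j"
proof -
  define k where "k = st + (j - pos)"
  have k: "s1 < k" "k \<le> s1 + int n" "pos + (k - st) = j" "pos + (k - 1 - st) = j - 1"
    "st + (j - 1 - pos) = k - 1" "st + (j + 1 - pos) = k + 1" using assms ends by (auto simp: k_def)
  have w1: "\<omega>u (k - 1) = Some (\<beta> (j - 1))" using \<omega>u_mid[of "k - 1"] k ends by simp
  have T1: "(if \<omega>u (k - 1) = Some (Dir a) then zext F (k - 1) else 0) =
    (if \<beta> (j - 1) = Dir a then band_coords (retract F) (j - 1) else 0) + (if a = ov_D ov \<and> j = j1 + 1 then zext (proj F) s1 else 0)"
  proof (cases "j = j1 + 1")
    case True
    have "k - 1 = s1" "j - 1 = j1" using True ends by (auto simp: k_def)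
    then show ?thesis
      using w1 ends_\<omega>(4) retract_window(2)[of F] zext_proj[of s1 F] ends True by auto
  next
    case False
    then show ?thesis using w1 retract_window(1)[of "j - 1" F] assms k(5) by auto
  qed
  have T2: "(if \<omega>u k = Some (Inv a) then zext F (k + 1) else 0) =
    (if \<beta> j = Inv a then band_coords (retract F) (j + 1) else 0) - (if ov_B ov = Some a \<and> j = j1 + int n then zext (proj F) (s1 + 1) / \<mu> else 0)"
  proof (cases "j = j1 + int n")
    case True
    have k': "k = s1 + int n" using True ends by (simp add: k_def)
    have wk: "\<omega>u k = map_option Inv (ov_B ov)" using \<omega>u_right[of k] ends ends_\<omega>(2) by (simp add: k')
    have bj: "\<beta> j = Dir (ov_D ov)" using ends_\<beta>(2) True by simp
    show ?thesis
    proof (cases "ov_B ov = Some a")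
      case B: True
      then have "s1 + 1 \<le> len" using \<omega>_range[of s1] ends_\<omega>(2) by auto
      then have "zext (proj F) (s1 + 1) = - (\<mu> * zext F (s1 + 1 + int n))" using zext_proj[of "s1 + 1" F] ends by simp
      moreover have e: "k + 1 = s1 + 1 + int n" by (simp add: k')
      ultimately show ?thesis unfolding e using wk bj B True \<mu> by simp
    next
      case False
      then show ?thesis using wk bj by auto
    qed
  next
    case False
    then have "\<omega>u k = Some (\<beta> j)" using \<omega>u_mid[of k] k ends assms by (simp add: k_def)
    then show ?thesis using False retract_window(1)[of "j + 1" F] assms k(6) by auto
  qed
  show ?thesis
    unfolding lact_def apply_ov_cochain[OF assms] using T1 T2 unfolding k_def[symmetric] by simp
qed

lemma inj_arrow:
  assumes "0 \<le> k" "k \<le> len + int n"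
  shows "lact \<omega>u a (zext (inj g)) k =
    (if st \<le> k \<and> k \<le> s1 + int n then lact \<beta>\<omega> a (band_coords g) (pos + (k - st)) else 0)"
proof -
  have T1: "(if \<omega>u (k - 1) = Some (Dir a) then zext (inj g) (k - 1) else 0) =
    (if st \<le> k \<and> k \<le> s1 + int n then if \<beta> (pos + (k - st) - 1) = Dir a then band_coords g (pos + (k - st) - 1) else 0 else 0)"
  proof -
    consider "k < st" | "k = st" | "st < k" "k \<le> s1 + int n" | "k = s1 + int n + 1" | "s1 + int n + 1 < k" by linarith
    then show ?thesis
    proof cases
      case 3
      have e: "pos + (k - 1 - st) = pos + (k - st) - 1" by simp
      have "\<omega>u (k - 1) = Some (\<beta> (pos + (k - 1 - st)))" by (rule \<omega>u_mid) (use 3 in linarith)+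
      moreover have "zext (inj g) (k - 1) = band_coords g (pos + (k - 1 - st))" unfolding zext_inj using 3 by simp
      ultimately show ?thesis unfolding e using 3 by simp
    next
      case 4
      have "\<omega>u (k - 1) = map_option Inv (ov_B ov)" using \<omega>u_right[of "s1 + int n"] ends ends_\<omega>(2) 4 by simp
      then show ?thesis using 4 by auto
    qed (use zext_inj[of g "k - 1"] ends_\<omega>(3) ends in auto)
  qed
  have T2: "(if \<omega>u k = Some (Inv a) then zext (inj g) (k + 1) else 0) =
    (if st \<le> k \<and> k \<le> s1 + int n then if \<beta> (pos + (k - st)) = Inv a then band_coords g (pos + (k - st) + 1) else 0 else 0)"
  proof -
    consider "k < st - 1" | "k = st - 1" | "st \<le> k" "k < s1 + int n" | "k = s1 + int n" | "s1 + int n < k" by linarith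
    then show ?thesis
    proof cases
      case 2
      then have "\<omega>u k = map_option Dir (ov_A ov)" using ends_\<omega>(1) by (simp add: \<omega>u_def)
      then show ?thesis using 2 by auto
    next
      case 3
      have e: "pos + (k + 1 - st) = pos + (k - st) + 1" by simp
      have "zext (inj g) (k + 1) = band_coords g (pos + (k + 1 - st))" unfolding zext_inj using 3 by simp
      then show ?thesis unfolding e using 3 \<omega>u_mid[OF 3] by simp
    next
      case 4
      have e: "pos + (k - st) = j1 + int n" using 4 ends by simp
      show ?thesis unfolding e using zext_inj[of g "k + 1"] ends_\<beta>(2) 4 by simp
    qed (use zext_inj[of g "k + 1"] in auto)
  qed
  show ?thesis unfolding lact_def T1 T2 by simp
qed

text \<open>
  The two summands of the projection are compared separately. They are the projections to the factor
  word ending with the first copy of \<open>m\<close> and to the one beginning with the second copy; the letters \<open>D\<close> and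
  \<open>C\<close> of \<open>u\<close>, which are next to these words, point away from them.
\<close>

lemma proj_arrow:
  assumes "0 \<le> s" "s \<le> len"
  shows "lact \<omega> a (zext (proj F)) s =
    (if s \<le> s1 then lact \<omega>u a (zext F) s else 0) - \<mu> * (if st \<le> s then lact \<omega>u a (zext F) (s + int n) else 0)"
proof -
  have T1: "(if \<omega> (s - 1) = Some (Dir a) then zext (proj F) (s - 1) else 0) =
     (if s \<le> s1 then if \<omega>u (s - 1) = Some (Dir a) then zext F (s - 1) else 0 else 0) -
     \<mu> * (if st \<le> s then if \<omega>u (s + int n - 1) = Some (Dir a) then zext F (s + int n - 1) else 0 else 0)"
  proof (cases "\<omega> (s - 1) = Some (Dir a)")
    case True
    then have r: "0 \<le> s - 1" "s - 1 \<le> len" using \<omega>_range by force+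
    have e: "s - 1 + int n = s + int n - 1" by simp
    note z = zext_proj[OF r, of F, unfolded e]
    have ne: "s - 1 \<noteq> s1" using True ends_\<omega>(2) by auto
    have 1: "\<omega>u (s - 1) = Some (Dir a)" if "s \<le> s1" using \<omega>u_left[of "s - 1"] that True by simp
    have 2: "\<omega>u (s + int n - 1) = Some (Dir a)" if "st < s" using \<omega>u_right[of "s + int n - 1"] that True by simp
    have 3: "\<omega>u (s + int n - 1) \<noteq> Some (Dir a)" if "s = st"
    proof -
      have e: "pos + (st + int n - 1 - st) = pos - 1 + int n" by simp
      have "\<omega>u (st + int n - 1) = Some (\<beta> (pos - 1 + int n))"
        using \<omega>u_mid[of "st + int n - 1"] ends unfolding e by simp
      then show ?thesis using ends_\<beta>(1) that by simp
    qed
    consider "s < st" | "s = st" | "st < s" by linarith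
    then show ?thesis
    proof cases
      case 1
      then show ?thesis using True z \<open>s \<le> s1 \<Longrightarrow> \<omega>u (s - 1) = Some (Dir a)\<close> ne ends by simp
    next
      case 2
      then show ?thesis using True z \<open>s \<le> s1 \<Longrightarrow> \<omega>u (s - 1) = Some (Dir a)\<close> 3 ne ends by simp
    next
      case 3
      then show ?thesis using True z \<open>s \<le> s1 \<Longrightarrow> \<omega>u (s - 1) = Some (Dir a)\<close> 2 ne by simp
    qed
  next
    case False
    have 1: "\<omega>u (s - 1) \<noteq> Some (Dir a)" if "s \<le> s1" using \<omega>u_left[of "s - 1"] that False by simp
    have 2: "\<omega>u (s + int n - 1) \<noteq> Some (Dir a)" if "st \<le> s"
    proof (cases "s = st")
      case True
      have e: "pos + (st + int n - 1 - st) = pos - 1 + int n" by simp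
      have "\<omega>u (st + int n - 1) = Some (\<beta> (pos - 1 + int n))"
        using \<omega>u_mid[of "st + int n - 1"] ends unfolding e by simp
      then show ?thesis using ends_\<beta>(1) True by simp
    next
      case F: False
      then show ?thesis using \<omega>u_right[of "s + int n - 1"] that False by simp
    qed
    show ?thesis using False 1 2 by simp
  qed
  have T2: "(if \<omega> s = Some (Inv a) then zext (proj F) (s + 1) else 0) =
     (if s \<le> s1 then if \<omega>u s = Some (Inv a) then zext F (s + 1) else 0 else 0) -
     \<mu> * (if st \<le> s then if \<omega>u (s + int n) = Some (Inv a) then zext F (s + int n + 1) else 0 else 0)"
  proof -
    have 2: "\<omega>u (s + int n) = \<omega> s" if "st \<le> s" using \<omega>u_right[of "s + int n"] that by simp
    have 3: "\<omega>u s = \<omega> s" if "s < s1" by (rule \<omega>u_left[OF that])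
    have 4: "\<omega>u s1 = Some (Dir (ov_D ov))" using \<omega>u_mid[of s1] ends ends_\<omega>(4) by simp
    show ?thesis
    proof (cases "\<omega> s = Some (Inv a)")
      case True
      then have r: "0 \<le> s + 1" "s + 1 \<le> len" using \<omega>_range by force+
      have e: "s + 1 + int n = s + int n + 1" by simp
      note z = zext_proj[OF r, of F, unfolded e]
      have ne: "s + 1 \<noteq> st"
      proof
        assume "s + 1 = st"
        then have "s = st - 1" by simp
        then show False using True ends_\<omega>(1) by auto
      qed
      consider "s < s1" | "s = s1" | "s1 < s" by linarith
      then show ?thesis
      proof cases
        case 1
        then show ?thesis using True z 2 3 ne by (cases "st \<le> s") auto
      next
        case c2: 2
        then show ?thesis using True z 2 4 ends by simp
      next
        case c3: 3
        then show ?thesis using True z 2 ends by simp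
      qed
    next
      case False
      then show ?thesis using 2 3 4 by (cases "s < s1"; cases "s = s1") auto
    qed
  qed
  show ?thesis unfolding lact_def T1 T2 by (simp add: algebra_simps)
qed

end

context overlap_setup
begin

lemma zext_vert: "zext (\<lambda>i. if word_vert Q u i = y then F i else 0) k = (if U.vert k = y then zext F k else 0)"
  by (simp add: zext_def U.vert_def)

lemma inj_hom: "inj \<in> mod_hom \<Lambda> Nb U.Mw"
proof (rule X.mod_hom_by_generators[OF left_module_Nb U.left_module_Mw])
  show "inj \<in> carrier Nb \<rightarrow> carrier U.Mw" using inj_space by (simp add: U.Mw_simps)
  show "inj (x \<oplus>\<^bsub>Nb\<^esub> y) = inj x \<oplus>\<^bsub>U.Mw\<^esub> inj y" for x y
    unfolding Nb_simps U.Mw_simps by (simp add: ov_inj_def Let_def fun_eq_iff algebra_simps)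
  show "inj (gen \<gamma> \<odot>\<^bsub>Nb\<^esub> x) = gen \<gamma> \<odot>\<^bsub>U.Mw\<^esub> inj x" if \<gamma>: "\<gamma> \<in> gens" and "x \<in> carrier Nb" for \<gamma> x
  proof -
    have x: "x \<in> N.space" using that(2) by (simp add: Nb_simps)
    note js = inj_space[of x]
    show ?thesis
    proof (cases \<gamma>)
      case (Scal c)
      have 1: "gen (Scal c) \<odot>\<^bsub>Nb\<^esub> x = (\<lambda>i. c * x i)" unfolding Nb_eq by (rule N.smult_gen(1)[OF x])
      show ?thesis
        unfolding Scal U.Mw_gen(1)[OF js] 1 by (simp add: ov_inj_def Let_def fun_eq_iff)
    next
      case (Vert y)
      then have y: "y \<in> verts Q" using \<gamma> by (simp only: gens_simps)
      have sp: "(\<lambda>i. if word_vert Q u i = y then inj x i else 0) \<in> U.M.space"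
        using js by (simp add: U.M.space_def)
      show ?thesis
        unfolding Vert U.Mw_gen(2)[OF js y]
        by (rule U.M_eqI[OF inj_space sp], unfold zext_vert zext_inj band_coords_gen(2)[OF x y]) (use U_vert_mid in auto)
    next
      case (Arr a)
      then have a: "a \<in> arcs Q" using \<gamma> by (simp only: gens_simps)
      show ?thesis
        unfolding Arr U.Mw_gen(3)[OF js a]
      proof (rule U.M_eqI[OF inj_space U.M.aact_space])
        fix k assume k: "0 \<le> k" "k \<le> U.len"
        then show "zext (inj (gen (Arr a) \<odot>\<^bsub>Nb\<^esub> x)) k = zext (U.M.aact a (inj x)) k"
          unfolding U.zext_aact[OF k] U_\<omega> zext_inj[of "gen (Arr a) \<odot>\<^bsub>Nb\<^esub> x"] band_coords_gen(3)[OF x a]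
          using inj_arrow[of k a x] by (simp only: U_len)
      qed
    qed
  qed
qed

lemma proj_hom: "proj \<in> mod_hom \<Lambda> U.Mw Mw"
proof (rule X.mod_hom_by_generators[OF U.left_module_Mw left_module_Mw])
  show "proj \<in> carrier U.Mw \<rightarrow> carrier Mw" using proj_space by (simp add: Mw_simps)
  show "proj (x \<oplus>\<^bsub>U.Mw\<^esub> y) = proj x \<oplus>\<^bsub>Mw\<^esub> proj y" for x y
    unfolding Mw_simps U.Mw_simps by (simp add: ov_proj_def fun_eq_iff algebra_simps)
  show "proj (gen \<gamma> \<odot>\<^bsub>U.Mw\<^esub> x) = gen \<gamma> \<odot>\<^bsub>Mw\<^esub> proj x" if \<gamma>: "\<gamma> \<in> gens" and "x \<in> carrier U.Mw" for \<gamma> x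
  proof -
    have x: "x \<in> U.M.space" using that(2) by (simp only: U.Mw_simps)
    note ps = proj_space[of x]
    show ?thesis
    proof (cases \<gamma>)
      case (Scal c)
      show ?thesis
        unfolding Scal U.Mw_gen(1)[OF x] Mw_gen(1)[OF ps] by (simp add: ov_proj_def fun_eq_iff algebra_simps)
    next
      case (Vert y)
      then have y: "y \<in> verts Q" using \<gamma> by (simp only: gens_simps)
      have sp: "(\<lambda>i. if word_vert Q w i = y then proj x i else 0) \<in> M.space" using ps by (simp add: M.space_def)
      have zv: "zext (\<lambda>i. if word_vert Q w i = y then proj x i else 0) s = (if vert s = y then zext (proj x) s else 0)" for s
        by (simp add: zext_def vert_def)
      show ?thesis
        unfolding Vert U.Mw_gen(2)[OF x y] Mw_gen(2)[OF ps y]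
      proof (rule M_eqI[OF proj_space sp])
        fix s assume s: "0 \<le> s" "s \<le> len"
        show "zext (proj (\<lambda>i. if word_vert Q u i = y then x i else 0)) s =
          zext (\<lambda>i. if word_vert Q w i = y then proj x i else 0) s"
          unfolding zv zext_proj[OF s] zext_vert using U_vert_left[OF s(1)] U_vert_right[OF _ s(2)] by auto
      qed
    next
      case (Arr a)
      then have a: "a \<in> arcs Q" using \<gamma> by (simp only: gens_simps)
      show ?thesis
        unfolding Arr U.Mw_gen(3)[OF x a] Mw_gen(3)[OF ps a]
      proof (rule M_eqI[OF proj_space M.aact_space])
        fix s assume s: "0 \<le> s" "s \<le> len"
        have e: "zext (U.M.aact a x) s = lact \<omega>u a (zext x) s"
          "zext (U.M.aact a x) (s + int n) = lact \<omega>u a (zext x) (s + int n)"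
          unfolding U_\<omega>[symmetric] by (rule U.zext_aact; use s U_len in simp)+
        show "zext (proj (U.M.aact a x)) s = zext (M.aact a (proj x)) s"
          unfolding zext_aact[OF s] proj_arrow[OF s] zext_proj[OF s] e by (rule refl)
      qed
    qed
  qed
qed

lemma retract_inj:
  assumes "g \<in> N.space"
  shows "retract (inj g) = g"
proof (rule N_eqI[OF _ assms])
  show "retract (inj g) \<in> N.space" unfolding retract_def by (rule band_vector_space)
  show "band_coords (retract (inj g)) = band_coords g"
    unfolding retract_coords
    by (rule extend_eqI[OF quasi_periodic_band_coords]) (use ends in \<open>simp add: zext_inj\<close>)
qed

lemma proj_inj: "proj (inj g) = (\<lambda>_. 0)"
proof (rule M_eqI[OF proj_space])
  show "(\<lambda>_. 0) \<in> M.space" by (simp add: M.space_def)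
  fix s assume s: "0 \<le> s" "s \<le> len"
  have e: "pos + (s + int n - st) = pos + (s - st) + int n" by simp
  have q: "band_coords g (pos + (s - st) + int n) = band_coords g (pos + (s - st)) / \<mu>"
    by (rule quasi_periodicD(1)[OF quasi_periodic_band_coords])
  show "zext (proj (inj g)) s = zext (\<lambda>_. 0) s"
    unfolding zext_proj[OF s] zext_inj e q using \<mu> ends by (auto simp: zext_def)
qed

text \<open>
  Vanishing of the projection means that the coordinates outside \<open>y\<close> are zero and that coordinates in the two
  copies of \<open>m\<close> differ by the factor \<open>\<mu>\<close>; such a vector is determined by one period.
\<close>

lemma kernel_proj:
  assumes F: "F \<in> U.M.space" and z: "proj F = (\<lambda>_. 0)"
  shows "inj (retract F) = F"
proof (rule U.M_eqI[OF inj_space F])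
  have R: "(if s \<le> s1 then zext F s else 0) = \<mu> * (if st \<le> s then zext F (s + int n) else 0)" if "0 \<le> s" "s \<le> len" for s
    using zext_proj[OF that, of F] unfolding z by (simp add: zext_def)
  have cl: "band_coords (retract F) (pos + (k - st)) = zext F k" if "st \<le> k" "k \<le> s1 + int n" for k
    using that
  proof (induct "nat (s1 + int n - k)" arbitrary: k rule: less_induct)
    case (less k)
    show ?case
    proof (cases "s1 < k")
      case True
      then show ?thesis using retract_window(1)[of "pos + (k - st)" F] less(2,3) ends by simp
    next
      case False
      have "band_coords (retract F) (pos + (k + int n - st)) = zext F (k + int n)"
      proof (rule less(1))
        show "nat (s1 + int n - (k + int n)) < nat (s1 + int n - k)"
          unfolding zless_nat_conj using False ends(7) by (intro conjI; linarith)
      qed (use False less(2) ends in linarith)+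
      moreover have e: "pos + (k + int n - st) = pos + (k - st) + int n" by simp
      moreover have "zext F k = \<mu> * zext F (k + int n)" using R[of k] False less(2) ends by simp
      ultimately show ?thesis
        using quasi_periodicD(1)[OF quasi_periodic_band_coords, of "retract F" "pos + (k - st)"] \<mu> unfolding e by (auto simp: field_simps)
    qed
  qed
  fix k assume k: "0 \<le> k" "k \<le> U.len"
  consider "k < st" | "st \<le> k" "k \<le> s1 + int n" | "s1 + int n < k" by linarith
  then show "zext (inj (retract F)) k = zext F k"
  proof cases
    case 1
    then show ?thesis unfolding zext_inj using R[of k] k ends by simp
  next
    case 2
    then show ?thesis unfolding zext_inj using cl by simp
  next
    case 3
    then show ?thesis unfolding zext_inj using R[of "k - int n"] k \<mu> ends U_len by simp
  qed
qed

text \<open>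
  On the part of \<open>m\<close> the preimage is a geometric sum, because there \<open>ov_proj\<close> subtracts a translate.
\<close>

lemma proj_surj:
  assumes x: "x \<in> M.space"
  shows "\<exists>F\<in>U.M.space. proj F = x"
proof
  \<comment> \<open>the sum runs over all translates of \<open>k\<close> up to \<open>s1\<close>; \<open>L\<close> bounds their number because \<open>n\<close> is positive\<close>
  define G where "G k = (\<Sum>q<Suc L. if k + int q * int n \<le> s1 then \<mu> ^ q * zext x (k + int q * int n) else 0)" for k
  have G_rec: "G k = zext x k + \<mu> * G (k + int n)" if k: "0 \<le> k" "k \<le> s1" for k
  proof -
    have e: "k + int n + int q * int n = k + int (Suc q) * int n" for q by (simp add: algebra_simps)
    have "1 \<le> int n" using ends(7) by linarith
    then have "int (Suc L) * 1 \<le> int (Suc L) * int n" by (rule mult_left_mono) simp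
    then have top: "\<not> k + int (Suc L) * int n \<le> s1" using k ends(6) unfolding len_def mult_1_right by linarith
    have "\<mu> * G (k + int n) = (\<Sum>q<Suc L. \<mu> * (if k + int (Suc q) * int n \<le> s1 then \<mu> ^ q * zext x (k + int (Suc q) * int n) else 0))"
      unfolding G_def e by (rule sum_distrib_left)
    also have "\<dots> = (\<Sum>q<Suc L. if k + int (Suc q) * int n \<le> s1 then \<mu> ^ Suc q * zext x (k + int (Suc q) * int n) else 0)"
      by (rule sum.cong) auto
    also have "\<dots> = (\<Sum>q<L. if k + int (Suc q) * int n \<le> s1 then \<mu> ^ Suc q * zext x (k + int (Suc q) * int n) else 0)"
      unfolding sum.lessThan_Suc using top by simp
    finally have 1: "\<mu> * G (k + int n) = (\<Sum>q<L. if k + int (Suc q) * int n \<le> s1 then \<mu> ^ Suc q * zext x (k + int (Suc q) * int n) else 0)" .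
    show ?thesis unfolding 1 unfolding G_def sum.lessThan_Suc_shift using k by simp
  qed
  define F where "F i = (if int i < st then x i else if int i \<le> s1 + int n then G (int i) else - zext x (int i - int n) / \<mu>)" for i
  have zF: "zext F k = (if k < st then zext x k else if k \<le> s1 + int n then G k else - zext x (k - int n) / \<mu>)" if "0 \<le> k" for k
    using that by (simp add: zext_def[of F] zext_def[of x k] F_def)
  show "F \<in> U.M.space"
    unfolding U.M.space_def mem_Collect_eq
  proof (intro allI impI)
    fix i assume "i \<ge> Suc (length (snd u))"
    then have i: "int i > len + int n" by (simp add: u_length len_def)
    then show "F i = 0" using zext_outside[OF x, of "int i - int n"] ends by (simp add: F_def)
  qed
  show "proj F = x"
  proof (rule M_eqI[OF proj_space x])
    fix s assume s: "0 \<le> s" "s \<le> len"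
    have z1: "zext F s = (if s < st then zext x s else if s \<le> s1 + int n then G s else - zext x (s - int n) / \<mu>)"
      by (rule zF[OF s(1)])
    have z2: "zext F (s + int n) = (if s + int n < st then zext x (s + int n) else if s \<le> s1 then G (s + int n) else - zext x s / \<mu>)"
      using zF[of "s + int n"] s by simp
    consider "s < st" | "st \<le> s" "s \<le> s1" | "s1 < s" by linarith
    then show "zext (proj F) s = zext x s"
    proof cases
      case 1
      then show ?thesis unfolding zext_proj[OF s] using z1 ends by simp
    next
      case 2
      then show ?thesis unfolding zext_proj[OF s] z1 z2 using G_rec[of s] s ends by simp
    next
      case 3
      then show ?thesis unfolding zext_proj[OF s] z1 z2 using \<mu> ends by simp
    qed
  qed
qed

lemma overlap_extension: "overlap_extension Q I w b t\<^sub>0 \<mu> ov \<in> extensions \<Lambda> Mw Nb"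
proof -
  have "proj ` carrier U.Mw = carrier Mw"
  proof
    show "carrier Mw \<subseteq> proj ` carrier U.Mw"
    proof
      fix x assume "x \<in> carrier Mw"
      then obtain F where "F \<in> U.M.space" "proj F = x" using proj_surj[of x] unfolding Mw_simps by blast
      then show "x \<in> proj ` carrier U.Mw" using U.Mw_simps(1)[of F] by blast
    qed
  qed (use mod_homD(1)[OF proj_hom] in blast)
  moreover have "inj ` carrier Nb = {e \<in> carrier U.Mw. proj e = \<zero>\<^bsub>Mw\<^esub>}"
  proof
    show "inj ` carrier Nb \<subseteq> {e \<in> carrier U.Mw. proj e = \<zero>\<^bsub>Mw\<^esub>}"
      unfolding Mw_simps(2) using proj_inj mod_homD(1)[OF inj_hom] by blast
    show "{e \<in> carrier U.Mw. proj e = \<zero>\<^bsub>Mw\<^esub>} \<subseteq> inj ` carrier Nb"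
    proof
      fix e assume "e \<in> {e \<in> carrier U.Mw. proj e = \<zero>\<^bsub>Mw\<^esub>}"
      then have "e \<in> U.M.space" "proj e = (\<lambda>_. 0)" unfolding Mw_simps(2) U.Mw_simps(1) by auto
      then have "inj (retract e) = e" by (rule kernel_proj)
      moreover have "retract e \<in> carrier Nb" unfolding retract_def Nb_simps(1) by (rule band_vector_space)
      ultimately show "e \<in> inj ` carrier Nb" by (metis imageI)
    qed
  qed
  moreover have "inj_on inj (carrier Nb)"
    by (rule inj_on_inverseI[of _ retract]) (use retract_inj in \<open>simp add: Nb_simps\<close>)
  ultimately show ?thesis
    unfolding overlap_extension_def extensions_def
    using left_module_Nb U.left_module_Mw left_module_Mw inj_hom proj_hom by blast
qed

lemma retract_gen:
  assumes \<gamma>: "\<gamma> \<in> gens" and F: "F \<in> U.M.space"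
  shows "retract (gen \<gamma> \<odot>\<^bsub>U.Mw\<^esub> F) = gen \<gamma> \<odot>\<^bsub>Nb\<^esub> retract F \<oplus>\<^bsub>Nb\<^esub> cochain_map ov_cochain \<gamma> (proj F)"
  unfolding Nb_simps(3)
proof (rule N_eqI, unfold band_coords_simps(1))
  have rN: "retract G \<in> N.space" for G unfolding retract_def by (rule band_vector_space)
  show "retract (gen \<gamma> \<odot>\<^bsub>U.Mw\<^esub> F) \<in> N.space" by (rule rN)
  have sN: "gen \<gamma> \<odot>\<^bsub>Nb\<^esub> retract F \<in> N.space"
    using left_moduleD(3)[OF left_module_Nb gen_closed[OF \<gamma>], of "retract F"] rN unfolding Nb_simps by blast
  then show "(\<lambda>i. (gen \<gamma> \<odot>\<^bsub>Nb\<^esub> retract F) i + cochain_map ov_cochain \<gamma> (proj F) i) \<in> N.space"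
    using cochain_map_space[of ov_cochain \<gamma> "proj F"] by (simp add: N.space_def)
  let ?R = "\<lambda>j. band_coords (gen \<gamma> \<odot>\<^bsub>Nb\<^esub> retract F) j + band_coords (cochain_map ov_cochain \<gamma> (proj F)) j"
  have qp: "quasi_periodic ?R"
    by (simp add: quasi_periodic_def quasi_periodicD(1)[OF quasi_periodic_band_coords] add_divide_distrib)
  show "band_coords (retract (gen \<gamma> \<odot>\<^bsub>U.Mw\<^esub> F)) = ?R"
    unfolding retract_coords
  proof (rule extend_eqI[OF qp])
    fix j assume "j1 + 1 \<le> j" "j < j1 + 1 + int n"
    then have j: "j1 < j" "j \<le> j1 + int n" by auto
    have w: "band_coords (retract F) j = zext F (st + (j - pos))" by (rule retract_window(1)[OF j])
    have r: "0 \<le> st + (j - pos)" "st \<le> st + (j - pos)" "st + (j - pos) \<le> s1 + int n" using j ends by auto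
    show "?R j = zext (gen \<gamma> \<odot>\<^bsub>U.Mw\<^esub> F) (st + (j - pos))"
    proof (cases \<gamma>)
      case (Scal c)
      have 0: "cochain_map ov_cochain (Scal c) m = (\<lambda>_. 0)" for m by (simp only: cochain_map_def generator.case)
      show ?thesis
        unfolding Scal 0 U.Mw_gen(1)[OF F] band_coords_gen(1)[OF rN] band_coords_simps(3) w by (simp add: zext_def)
    next
      case (Vert y)
      then have y: "y \<in> verts Q" using \<gamma> by (simp only: gens_simps)
      have 0: "cochain_map ov_cochain (Vert y) m = (\<lambda>_. 0)" for m by (simp only: cochain_map_def generator.case)
      have "U.vert (st + (j - pos)) = lsrc Q (\<beta> j)" using U_vert_mid[OF r(2,3)] by simp
      then show ?thesis
        unfolding Vert 0 U.Mw_gen(2)[OF F y] band_coords_gen(2)[OF rN y] band_coords_simps(3) w zext_vert by simp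
    next
      case (Arr a)
      then have a: "a \<in> arcs Q" using \<gamma> by (simp only: gens_simps)
      have qpc: "quasi_periodic (ov_cochain a s)" for a s unfolding ov_cochain_def by (rule quasi_periodic_extend)
      have c: "band_coords (cochain_map ov_cochain (Arr a) m) = apply_matrix (ov_cochain a) m" for m
        unfolding cochain_map_def generator.case by (rule band_coords_vector, rule apply_matrix_quasi_periodic, rule qpc)
      have "zext (U.M.aact a F) (st + (j - pos)) = lact \<omega>u a (zext F) (st + (j - pos))"
        unfolding U_\<omega>[symmetric] by (rule U.zext_aact) (use r ends U_len in simp_all)
      then show ?thesis
        unfolding Arr U.Mw_gen(3)[OF F a] band_coords_gen(3)[OF rN a] c retract_arrow[OF j] by (rule sym)
    qed
  qed
qed

lemma overlap_has_cocycle: "X.has_cocycle (overlap_extension Q I w b t\<^sub>0 \<mu> ov) (cochain_map ov_cochain)"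
  unfolding X.has_cocycle_def overlap_extension_def split_conv
proof (intro conjI bexI[of _ retract] ballI)
  show "(inj, U.Mw, proj) \<in> extensions \<Lambda> Mw Nb" using overlap_extension by (simp only: overlap_extension_def)
  show "retract (x \<oplus>\<^bsub>U.Mw\<^esub> y) = retract x \<oplus>\<^bsub>Nb\<^esub> retract y" for x y
    unfolding Nb_simps U.Mw_simps
  proof (rule N_eqI)
    show "band_coords (retract (\<lambda>i. x i + y i)) = band_coords (\<lambda>i. retract x i + retract y i)"
      unfolding band_coords_simps retract_coords extend_def by (auto simp: zext_def add_divide_distrib distrib_right)
  qed (use band_vector_space in \<open>simp_all add: retract_def N.space_def\<close>)
  show "retract (inj g) = g" if "g \<in> carrier Nb" for g using retract_inj that by (simp add: Nb_simps)
  show "retract (gen \<gamma> \<odot>\<^bsub>U.Mw\<^esub> F) = gen \<gamma> \<odot>\<^bsub>Nb\<^esub> retract F \<oplus>\<^bsub>Nb\<^esub> cochain_map ov_cochain \<gamma> (proj F)"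
    if "\<gamma> \<in> gens" "F \<in> carrier U.Mw" for \<gamma> F
    using retract_gen that unfolding U.Mw_simps by blast
  show "retract \<in> carrier U.Mw \<rightarrow> carrier Nb" using band_vector_space by (simp add: retract_def Nb_simps)
qed

lemma ov_cochain_nonzero:
  assumes "ov_cochain a s j \<noteq> 0"
  shows "s = s1 \<and> a = ov_D ov \<and> (j - (j1 + 1)) mod int n = 0 \<or>
    ov_B ov = Some a \<and> s = s1 + 1 \<and> (j - j1) mod int n = 0"
proof -
  define i where "i = j1 + 1 + (j - (j1 + 1)) mod int n"
  have "ov_entry a s i \<noteq> 0" using assms by (auto simp: ov_cochain_def extend_def i_def)
  then have "s = s1 \<and> a = ov_D ov \<and> i = j1 + 1 \<or> ov_B ov = Some a \<and> s = s1 + 1 \<and> i = j1 + int n"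
    by (auto simp: ov_entry_def split: if_splits)
  moreover have "(j - j1) mod int n = 0" if "i = j1 + int n"
  proof -
    have "(j - j1) mod int n = ((j - (j1 + 1)) mod int n + 1) mod int n" by (simp add: mod_add_left_eq)
    also have "(j - (j1 + 1)) mod int n + 1 = int n" using that by (simp add: i_def)
    finally show ?thesis by simp
  qed
  ultimately show ?thesis by (auto simp: i_def)
qed

lemma cocycle_ov_cochain: "cocycle ov_cochain"
proof (rule cocycle_of_has_cocycle[OF overlap_has_cocycle])
  show "quasi_periodic (ov_cochain a s)" for a s unfolding ov_cochain_def by (rule quasi_periodic_extend)
  show "a \<in> arcs Q \<and> 0 \<le> s \<and> s \<le> len" if "ov_cochain a s j \<noteq> 0" for a s j
    using ov_cochain_nonzero[OF that] band_arc[of j1] \<omega>_arc[of s1 "Inv a"] \<omega>_range[of s1 "Inv a"] ends ends_\<omega> by auto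
qed

text \<open>
  Among the entries at arrows leaving the band, only the one at the right end of the overlap survives.
\<close>

lemma ov_cochain_entries:
  "\<beta> (j - 1) = Inv c \<Longrightarrow> ov_cochain c s (j - 1) = 0"
  "\<beta> j = Dir d \<Longrightarrow> ov_cochain d s (j + 1) \<noteq> 0 \<longleftrightarrow> s = s1 \<and> (j - j1) mod int n = 0"
proof -
  show "ov_cochain c s (j - 1) = 0" if b: "\<beta> (j - 1) = Inv c"
  proof (rule ccontr)
    assume "ov_cochain c s (j - 1) \<noteq> 0"
    then consider "c = ov_D ov" "(j - 1 - (j1 + 1)) mod int n = 0" | "(j - 1 - j1) mod int n = 0"
      using ov_cochain_nonzero by blast
    then show False
    proof cases
      case 1
      have "\<beta> (j - 1) = \<beta> (j1 + 1)" using inf_word_cong[OF 1(2), of 0] by simp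
      then show False using b 1(1) band_side[of "j1 + 1"] ends_\<omega>(4) by simp
    next
      case 2
      have "\<beta> (j - 1) = \<beta> j1" using inf_word_cong[OF 2, of 0] by simp
      then show False using b ends_\<omega>(4) by simp
    qed
  qed
  show "ov_cochain d s (j + 1) \<noteq> 0 \<longleftrightarrow> s = s1 \<and> (j - j1) mod int n = 0" if b: "\<beta> j = Dir d"
  proof
    assume "ov_cochain d s (j + 1) \<noteq> 0"
    from ov_cochain_nonzero[OF this] show "s = s1 \<and> (j - j1) mod int n = 0"
    proof
      assume B: "ov_B ov = Some d \<and> s = s1 + 1 \<and> (j + 1 - j1) mod int n = 0"
      have "\<beta> j = \<beta> (j1 - 1)" using inf_word_cong[of "j + 1" j1 "-1"] B by simp
      then have "\<beta> (j1 - 1) = Dir d" using b by simp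
      then have "side (Inv d) \<noteq> side (\<beta> j1)" using band_side[of j1] by simp
      moreover have "side (Inv d) = side (\<beta> j1)"
        using aligned_ends(2) ends_\<omega>(2) B by (simp add: aligned_def)
      ultimately show ?thesis by simp
    qed simp
  next
    assume s: "s = s1 \<and> (j - j1) mod int n = 0"
    have "\<beta> j = \<beta> j1" using inf_word_cong[of j j1 0] s by simp
    then have d: "d = ov_D ov" using b ends_\<omega>(4) by simp
    have e: "(j + 1 - (j1 + 1)) mod int n = 0" using s by simp
    have "ov_entry d s (j1 + 1) = 1" using s d by (simp add: ov_entry_def)
    then show "ov_cochain d s (j + 1) \<noteq> 0" unfolding ov_cochain_def extend_def e using place_weight_nonzero by simp
  qed
qed

end

context string_band
begin

lemma aligned_cong: "(i - j) mod int n = 0 \<Longrightarrow> aligned s i \<longleftrightarrow> aligned s j"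
  using inf_word_cong[of i j 0] inf_word_cong[of i j "-1"] by (simp add: aligned_def same_vert_def)

end

context string_band_pair
begin

lemma word_inv_trivial: "snd v = [] \<Longrightarrow> word_inv Q v = v"
  by (cases v) (simp add: word_inv_def word_vert_def)

text \<open>
  The middle of a nontrivial palindrome under inversion would be a letter equal to its inverse, or a
  letter followed by its inverse.
\<close>

lemma word_inv_neq:
  assumes "snd v \<noteq> []"
  shows "word_inv Q v \<noteq> v"
proof
  assume "word_inv Q v = v"
  then have r: "\<omega> s = map_option linv (\<omega> (len - 1 - s))" for s
    using word_inv_diagram[of s] by (simp add: \<omega>_def)
  have pos: "0 < len" using assms by (simp add: len_def)
  define k where "k = len div 2"
  have som: "\<exists>l. \<omega> s = Some l" if "0 \<le> s" "s < len" for s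
    using that by (simp add: \<omega>_def word_diagram_def len_def)
  have ll: "linv l \<noteq> l" for l :: "'a letter" by (cases l) auto
  consider "len = 2 * k" | "len = 2 * k + 1" unfolding k_def by linarith
  then show False
  proof cases
    case 1
    then obtain l where l: "\<omega> (k - 1) = Some l" using som[of "k - 1"] pos by auto
    have e: "len - 1 - k = k - 1" using 1 by simp
    have "\<omega> k = Some (linv l)" using r[of k, unfolded e l] by (simp only: option.map)
    from walkD(3)[OF walk_\<omega> l this] show False by simp
  next
    case 2
    then obtain l where l: "\<omega> k = Some l" using som[of k] pos by auto
    have e: "len - 1 - k = k" using 2 by simp
    from r[of k, unfolded e l] have "l = linv l" by (simp only: option.map option.inject)
    then show False by (rule notE[OF ll[of l] sym])
  qed
qed

definition datum_cochain :: "('v, 'a) word \<times> 'a overlap \<Rightarrow> 'a \<Rightarrow> int \<Rightarrow> int \<Rightarrow> 'k" where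
  "datum_cochain d = (if fst d = v then overlap_setup.ov_cochain b t\<^sub>0 \<mu> (snd d) else flip (overlap_setup.ov_cochain b t\<^sub>0 \<mu> (snd d)))"

text \<open>
  The place of the given string \<open>v\<close> at the right end of the overlap, also for data which involve its inverse.
\<close>

definition datum_s :: "('v, 'a) word \<times> 'a overlap \<Rightarrow> int" where
  "datum_s d = (if fst d = v then end_s (snd d) else len - end_s (snd d))"

definition datum_j :: "('v, 'a) word \<times> 'a overlap \<Rightarrow> int" where
  "datum_j d = end_j (snd d)"

abbreviation data where "data \<equiv> overlap_data Q I v b"

lemma data_cases:
  assumes "d \<in> data"
  obtains ov where "d = (v, ov)" "ov \<in> overlaps Q I v b"
    | ov where "d = (word_inv Q v, ov)" "ov \<in> overlaps Q I (word_inv Q v) b" "word_inv Q v \<noteq> v" "snd v \<noteq> []"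
proof -
  obtain w' ov where d: "d = (w', ov)" "w' = v \<or> w' = word_inv Q v" "ov \<in> overlaps Q I w' b"
    using assms unfolding overlap_data_def by blast
  show ?thesis
  proof (cases "w' = v")
    case True
    then show ?thesis using that(1) d by blast
  next
    case False
    then have "w' = word_inv Q v" "snd v \<noteq> []" using d(2) word_inv_trivial by auto
    then show ?thesis using that(2) d False by blast
  qed
qed

lemma overlap_setup_rev: "ov \<in> overlaps Q I (word_inv Q v) b \<Longrightarrow> overlap_setup Q I b t\<^sub>0 \<mu> (word_inv Q v) ov"
  by unfold_locales

lemma overlap_setup_v: "ov \<in> overlaps Q I v b \<Longrightarrow> overlap_setup Q I b t\<^sub>0 \<mu> v ov"
  by unfold_locales

lemma rev_L: "length (snd (word_inv Q v)) = L"
  by (simp add: word_inv_def)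

lemma zext_reverse: "0 \<le> s \<Longrightarrow> s \<le> len \<Longrightarrow> zext (reverse_iso v m) s = zext m (len - s)"
  by (auto simp: zext_def reverse_iso_def len_def nat_diff_distrib)

lemma reverse_space: "reverse_iso v m \<in> M.space"
  by (simp add: M.space_def reverse_iso_def)

lemma reverse_hom: "reverse_iso v \<in> mod_hom \<Lambda> rev.Mw Mw"
proof (rule X.mod_hom_by_generators[OF rev.left_module_Mw left_module_Mw])
  show "reverse_iso v \<in> carrier rev.Mw \<rightarrow> carrier Mw" using reverse_space by (simp add: Mw_simps)
  show "reverse_iso v (x \<oplus>\<^bsub>rev.Mw\<^esub> y) = reverse_iso v x \<oplus>\<^bsub>Mw\<^esub> reverse_iso v y" for x y
    unfolding Mw_simps rev.Mw_simps by (simp add: reverse_iso_def fun_eq_iff)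
  show "reverse_iso v (gen \<gamma> \<odot>\<^bsub>rev.Mw\<^esub> x) = gen \<gamma> \<odot>\<^bsub>Mw\<^esub> reverse_iso v x"
    if \<gamma>: "\<gamma> \<in> gens" and "x \<in> carrier rev.Mw" for \<gamma> x
  proof -
    have x: "x \<in> rev.M.space" using that(2) by (simp only: rev.Mw_simps)
    note ps = reverse_space[of x]
    show ?thesis
    proof (cases \<gamma>)
      case (Scal c)
      show ?thesis
        unfolding Scal rev.Mw_gen(1)[OF x] Mw_gen(1)[OF ps] by (simp add: reverse_iso_def fun_eq_iff)
    next
      case (Vert y)
      then have y: "y \<in> verts Q" using \<gamma> by (simp only: gens_simps)
      have sp: "(\<lambda>i. if word_vert Q v i = y then reverse_iso v x i else 0) \<in> M.space" using ps by (simp add: M.space_def)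
      show ?thesis
        unfolding Vert rev.Mw_gen(2)[OF x y] Mw_gen(2)[OF ps y]
      proof (rule M_eqI[OF reverse_space sp])
        fix s assume s: "0 \<le> s" "s \<le> len"
        have z1: "zext (\<lambda>i. if word_vert Q v i = y then reverse_iso v x i else 0) s = (if vert s = y then zext (reverse_iso v x) s else 0)"
          by (simp add: zext_def vert_def)
        have z2: "zext (\<lambda>i. if word_vert Q (word_inv Q v) i = y then x i else 0) (len - s) = (if rev.vert (len - s) = y then zext x (len - s) else 0)"
          by (simp add: zext_def rev.vert_def)
        have "rev.vert (len - s) = vert s" using rev_vert[of "len - s"] s by simp
        then show "zext (reverse_iso v (\<lambda>i. if word_vert Q (word_inv Q v) i = y then x i else 0)) s =
          zext (\<lambda>i. if word_vert Q v i = y then reverse_iso v x i else 0) s"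
          unfolding z1 zext_reverse[OF s] z2 by simp
      qed
    next
      case (Arr a)
      then have a: "a \<in> arcs Q" using \<gamma> by (simp only: gens_simps)
      show ?thesis
        unfolding Arr rev.Mw_gen(3)[OF x a] Mw_gen(3)[OF ps a]
      proof (rule M_eqI[OF reverse_space M.aact_space])
        fix s assume s: "0 \<le> s" "s \<le> len"
        have e: "zext (rev.M.aact a x) (len - s) = lact rev.\<omega> a (zext x) (len - s)"
          by (rule rev.zext_aact) (use s rev_len in simp_all)
        have i: "len - 1 - (len - s - 1) = s" "len - 1 - (len - s) = s - 1" "len - s + 1 = len - (s - 1)" "len - s - 1 = len - (s + 1)"
          "len - 1 - (len - (s + 1)) = s"
          by simp_all
        have z1: "zext (reverse_iso v x) (s + 1) = zext x (len - (s + 1))" if "\<omega> s = Some l" for l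
          by (rule zext_reverse) (use \<omega>_range[OF that] in simp_all)
        have z2: "zext (reverse_iso v x) (s - 1) = zext x (len - (s - 1))" if "\<omega> (s - 1) = Some l" for l
          by (rule zext_reverse) (use \<omega>_range[OF that] in simp_all)
        have w: "rev.\<omega> (len - s - 1) = map_option linv (\<omega> s)" "rev.\<omega> (len - s) = map_option linv (\<omega> (s - 1))"
          unfolding rev_\<omega> i by (rule refl)+
        show "zext (reverse_iso v (rev.M.aact a x)) s = zext (M.aact a (reverse_iso v x)) s"
          unfolding zext_aact[OF s] zext_reverse[OF s] e unfolding lact_def w
          using z1 z2 by (auto simp: linv_eq i)
      qed
    qed
  qed
qed

lemma reverse_cochain_map:
  assumes "m \<in> rev.M.space"
  shows "cochain_map (flip f) \<gamma> (reverse_iso v m) = rev.cochain_map f \<gamma> m"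
proof (cases \<gamma>)
  case (Arr a)
  have "apply_matrix (flip f a) (reverse_iso v m) = rev.apply_matrix (f a) m"
  proof
    fix j
    have "(\<Sum>s\<le>L. reverse_iso v m s * flip f a (int s) j) = (\<Sum>s\<le>L. m s * f a (int s) j)"
      by (rule sum.reindex_bij_witness[of _ "\<lambda>s. L - s" "\<lambda>s. L - s"])
        (auto simp: reverse_iso_def flip_def len_def of_nat_diff)
    then show "apply_matrix (flip f a) (reverse_iso v m) j = rev.apply_matrix (f a) m j"
      unfolding apply_matrix_def rev.apply_matrix_def rev_L .
  qed
  then show ?thesis unfolding Arr cochain_map_def rev.cochain_map_def generator.case by (rule arg_cong)
qed (simp_all add: cochain_map_def rev.cochain_map_def)

text \<open>
  The retraction remains the same; only the coordinates on the string module are renumbered.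
\<close>

lemma reverse_has_cocycle:
  assumes "rev.X.has_cocycle (i, E, p) (rev.cochain_map f)"
  shows "X.has_cocycle (i, E, reverse_iso v \<circ> p) (cochain_map (flip f))"
proof -
  note C = rev.X.has_cocycleD[OF assms]
  note D = rev.X.extensionsD[OF C(1)]
  have rr: "reverse_iso v (reverse_iso v m) = m" if "m \<in> M.space" for m
    using that by (auto simp: reverse_iso_def M.space_def fun_eq_iff)
  have sp: "rev.M.space = M.space" unfolding M.space_def rev.M.space_def rev_L ..
  have hom: "reverse_iso v \<circ> p \<in> mod_hom \<Lambda> E Mw"
    using D(3) reverse_hom by (auto simp: mod_hom_def Pi_iff)
  have "(reverse_iso v \<circ> p) ` carrier E = carrier Mw"
  proof -
    have "(reverse_iso v \<circ> p) ` carrier E = reverse_iso v ` carrier rev.Mw"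
      unfolding image_comp[symmetric] D(5) ..
    also have "\<dots> = carrier Mw"
    proof
      show "reverse_iso v ` carrier rev.Mw \<subseteq> carrier Mw" using mod_homD(1)[OF reverse_hom] by blast
      show "carrier Mw \<subseteq> reverse_iso v ` carrier rev.Mw"
      proof
        fix x assume "x \<in> carrier Mw"
        then have x: "x \<in> M.space" by (simp only: Mw_simps)
        show "x \<in> reverse_iso v ` carrier rev.Mw"
          by (rule image_eqI, rule rr[OF x, symmetric]) (use reverse_space sp in \<open>simp only: rev.Mw_simps\<close>)
      qed
    qed
    finally show ?thesis .
  qed
  moreover have "reverse_iso v m = (\<lambda>_. 0) \<longleftrightarrow> m = (\<lambda>_. 0)" if "m \<in> M.space" for m
  proof
    have z: "reverse_iso v (\<lambda>_. 0) = (\<lambda>_. 0)" by (auto simp: reverse_iso_def)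
    show "m = (\<lambda>_. 0)" if "reverse_iso v m = (\<lambda>_. 0)" using rr[OF \<open>m \<in> M.space\<close>] unfolding that z by (rule sym)
    show "reverse_iso v m = (\<lambda>_. 0)" if "m = (\<lambda>_. 0)" unfolding that by (rule z)
  qed
  then have "(reverse_iso v \<circ> p) e = \<zero>\<^bsub>Mw\<^esub> \<longleftrightarrow> p e = \<zero>\<^bsub>rev.Mw\<^esub>" if "e \<in> carrier E" for e
    using D(9)[OF that] unfolding Mw_simps(2) rev.Mw_simps(1,2) sp o_apply by simp
  then have "i ` carrier Nb = {e \<in> carrier E. (reverse_iso v \<circ> p) e = \<zero>\<^bsub>Mw\<^esub>}"
    unfolding D(6) by (intro Collect_cong conj_cong refl) simp
  ultimately have e1: "(i, E, reverse_iso v \<circ> p) \<in> extensions \<Lambda> Mw Nb"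
    unfolding extensions_def mem_Collect_eq split_conv using D(1-4) hom left_module_Nb left_module_Mw by (intro conjI)
  obtain \<rho> where \<rho>: "\<rho> \<in> carrier E \<rightarrow> carrier Nb"
    "\<forall>x\<in>carrier E. \<forall>y\<in>carrier E. \<rho> (x \<oplus>\<^bsub>E\<^esub> y) = \<rho> x \<oplus>\<^bsub>Nb\<^esub> \<rho> y"
    "\<forall>n\<in>carrier Nb. \<rho> (i n) = n"
    "\<forall>\<gamma>\<in>gens. \<forall>e\<in>carrier E. \<rho> (gen \<gamma> \<odot>\<^bsub>E\<^esub> e) = gen \<gamma> \<odot>\<^bsub>Nb\<^esub> \<rho> e \<oplus>\<^bsub>Nb\<^esub> rev.cochain_map f \<gamma> (p e)"
    using C(2) by blast
  have e2: "\<forall>\<gamma>\<in>gens. \<forall>e\<in>carrier E. \<rho> (gen \<gamma> \<odot>\<^bsub>E\<^esub> e) = gen \<gamma> \<odot>\<^bsub>Nb\<^esub> \<rho> e \<oplus>\<^bsub>Nb\<^esub> cochain_map (flip f) \<gamma> ((reverse_iso v \<circ> p) e)"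
  proof (intro ballI)
    fix \<gamma> e assume g: "\<gamma> \<in> gens" "e \<in> carrier E"
    have "p e \<in> rev.M.space" using D(9)[OF g(2)] by (simp only: rev.Mw_simps)
    then show "\<rho> (gen \<gamma> \<odot>\<^bsub>E\<^esub> e) = gen \<gamma> \<odot>\<^bsub>Nb\<^esub> \<rho> e \<oplus>\<^bsub>Nb\<^esub> cochain_map (flip f) \<gamma> ((reverse_iso v \<circ> p) e)"
      using \<rho>(4) g by (simp only: o_apply reverse_cochain_map)
  qed
  show ?thesis
    unfolding X.has_cocycle_def split_conv by (intro conjI bexI[OF _ \<rho>(1)] e1 e2 \<rho>(2,3))
qed

lemma datum_has_cocycle:
  assumes "d \<in> data"
  shows "X.has_cocycle (datum_ext Q I v b t\<^sub>0 \<mu> d) (cochain_map (datum_cochain d))"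
  using assms
proof (cases rule: data_cases)
  case (1 ov)
  interpret O: overlap_setup Q I b t\<^sub>0 \<mu> v ov by (rule overlap_setup_v[OF 1(2)])
  show ?thesis
    using O.overlap_has_cocycle by (simp add: 1(1) datum_ext_def datum_cochain_def overlap_extension_def)
next
  case (2 ov)
  interpret O: overlap_setup Q I b t\<^sub>0 \<mu> "word_inv Q v" ov by (rule overlap_setup_rev[OF 2(2)])
  show ?thesis
    using reverse_has_cocycle[OF O.overlap_has_cocycle[unfolded overlap_extension_def]] 2(3)
    by (simp add: 2(1) datum_ext_def datum_cochain_def overlap_extension_def)
qed

text \<open>
  The cocycles of the overlap extensions behave like unit vectors with respect to the right ends.
\<close>

lemma datum_entries:
  assumes "d \<in> data"
  shows "\<beta> (j - 1) = Inv c \<Longrightarrow> datum_cochain d c s (j - 1) = 0"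
    and "\<beta> j = Dir e \<Longrightarrow> datum_cochain d e s (j + 1) \<noteq> 0 \<longleftrightarrow> s = datum_s d \<and> (j - datum_j d) mod int n = 0"
    and "is_end (datum_s d) (datum_j d)"
    and "\<exists>e. \<beta> (datum_j d) = Dir e"
    and "cocycle (datum_cochain d)"
proof -
  have "(\<beta> (j - 1) = Inv c \<longrightarrow> datum_cochain d c s (j - 1) = 0) \<and>
    (\<beta> j = Dir e \<longrightarrow> (datum_cochain d e s (j + 1) \<noteq> 0 \<longleftrightarrow> s = datum_s d \<and> (j - datum_j d) mod int n = 0)) \<and>
    is_end (datum_s d) (datum_j d) \<and> (\<exists>e. \<beta> (datum_j d) = Dir e) \<and> cocycle (datum_cochain d)" for j c s e
    using assms
  proof (cases rule: data_cases)
    case (1 ov)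
    interpret O: overlap_setup Q I b t\<^sub>0 \<mu> v ov by (rule overlap_setup_v[OF 1(2)])
    show ?thesis
      using O.ov_cochain_entries[of j c s] O.ov_cochain_entries(2)[of j e s] O.cocycle_ov_cochain overlap_right_end[OF 1(2)] O.ends_\<omega>(4)
      by (simp add: 1(1) datum_cochain_def datum_s_def datum_j_def is_end_def)
  next
    case (2 ov)
    interpret O: overlap_setup Q I b t\<^sub>0 \<mu> "word_inv Q v" ov by (rule overlap_setup_rev[OF 2(2)])
    have "cocycle (flip (overlap_setup.ov_cochain b t\<^sub>0 \<mu> ov))"
    proof (rule cocycle_of_has_cocycle[OF reverse_has_cocycle[OF O.overlap_has_cocycle[unfolded overlap_extension_def]]])
      have oc: "rev.cochain (overlap_setup.ov_cochain b t\<^sub>0 \<mu> ov)" using O.cocycle_ov_cochain by (simp add: rev.cocycle_def)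
      show "quasi_periodic (flip (overlap_setup.ov_cochain b t\<^sub>0 \<mu> ov) a s)" for a s
        using oc by (simp add: flip_def rev.cochain_def)
      show "a \<in> arcs Q \<and> 0 \<le> s \<and> s \<le> len" if "flip (overlap_setup.ov_cochain b t\<^sub>0 \<mu> ov) a s j \<noteq> 0" for a s j
        using rev.cochainD(1)[OF oc that[unfolded flip_def]] by (simp add: rev_len)
    qed
    then show ?thesis
      using O.ov_cochain_entries(1)[of j c "len - s"] O.ov_cochain_entries(2)[of j e "len - s"] rev.overlap_right_end[OF 2(2)] O.ends_\<omega>(4) 2(3,4)
      by (auto simp: 2(1) datum_cochain_def datum_s_def datum_j_def is_end_def flip_def)
  qed
  note all = this
  show "\<beta> (j - 1) = Inv c \<Longrightarrow> datum_cochain d c s (j - 1) = 0"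
    "\<beta> j = Dir e \<Longrightarrow> datum_cochain d e s (j + 1) \<noteq> 0 \<longleftrightarrow> s = datum_s d \<and> (j - datum_j d) mod int n = 0"
    "is_end (datum_s d) (datum_j d)" "\<exists>e. \<beta> (datum_j d) = Dir e" "cocycle (datum_cochain d)"
    using all[of j c s e] by simp_all
qed

lemma mod_diff_commute: "(i - j) mod int n = 0 \<longleftrightarrow> (j - i) mod int n = 0"
  unfolding dvd_eq_mod_eq_0[symmetric] by (rule dvd_diff_commute)

text \<open>
  The two orientations cannot share a right end, because a pair of places is not aligned for both unless
  the string is trivial, when the two orientations are the same.
\<close>

lemma datum_determined:
  assumes d: "d \<in> data" "d' \<in> data" and s: "datum_s d = datum_s d'" and j: "(datum_j d - datum_j d') mod int n = 0"
  shows "d = d'"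
proof -
  have mixed: False if o: "o1 \<in> overlaps Q I v b" "o2 \<in> overlaps Q I (word_inv Q v) b" "snd v \<noteq> []"
    and s: "end_s o1 = len - end_s o2" and j: "(end_j o1 - end_j o2) mod int n = 0" for o1 o2
  proof -
    have "aligned (end_s o1) (end_j o1)" using overlap_right_end[OF o(1)] by (simp add: right_end_def)
    moreover have "rev.aligned (len - end_s o1) (end_j o1)"
      using rev.overlap_right_end[OF o(2)] s unfolding rev.aligned_cong[OF j] by (simp add: rev.right_end_def)
    ultimately show False using aligned_not_both o(3) by blast
  qed
  from d(1) show ?thesis
  proof (cases rule: data_cases)
    case c1: (1 ov)
    from d(2) show ?thesis
    proof (cases rule: data_cases)
      case (1 ov')
      then show ?thesis
        using overlap_determined_by_end[OF c1(2) 1(2)] s j by (simp add: c1(1) 1(1) datum_s_def datum_j_def)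
    next
      case (2 ov')
      then show ?thesis using mixed[OF c1(2) 2(2,4)] s j by (simp add: c1(1) 2(1,3) datum_s_def datum_j_def)
    qed
  next
    case c2: (2 ov)
    from d(2) show ?thesis
    proof (cases rule: data_cases)
      case (1 ov')
      then show ?thesis using mixed[OF 1(2) c2(2,4)] s j mod_diff_commute[of "datum_j d" "datum_j d'"] by (simp add: 1(1) c2(1,3) datum_s_def datum_j_def)
    next
      case (2 ov')
      then show ?thesis
        using rev.overlap_determined_by_end[OF c2(2) 2(2)] s j by (simp add: c2(1,3) 2(1) datum_s_def datum_j_def)
    qed
  qed
qed

lemma is_end_datum:
  assumes "is_end s j"
  shows "\<exists>d\<in>data. s = datum_s d \<and> (j - datum_j d) mod int n = 0"
proof (cases "right_end s j")
  case True
  obtain ov where ov: "ov \<in> overlaps Q I v b" "end_s ov = s" "(end_j ov - j) mod int n = 0"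
    by (rule right_end_overlap[OF True])
  have "(j - end_j ov) mod int n = 0" by (rule iffD1[OF mod_diff_commute ov(3)])
  then show ?thesis
    using ov(1,2) by (intro bexI[of _ "(v, ov)"]) (simp_all add: datum_s_def datum_j_def overlap_data_def)
next
  case False
  then have r: "rev.right_end (len - s) j" "snd v \<noteq> []" using assms by (auto simp: is_end_def)
  obtain ov where ov: "ov \<in> overlaps Q I (word_inv Q v) b" "end_s ov = len - s" "(end_j ov - j) mod int n = 0"
    by (rule rev.right_end_overlap[OF r(1)])
  have "(j - end_j ov) mod int n = 0" by (rule iffD1[OF mod_diff_commute ov(3)])
  then show ?thesis
    using ov(1,2) word_inv_neq[OF r(2)]
    by (intro bexI[of _ "(word_inv Q v, ov)"]) (simp_all add: datum_s_def datum_j_def overlap_data_def)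
qed

lemma finite_data: "finite data"
proof (rule inj_on_finite)
  have modn: "(i - j) mod int n = 0" if "i mod int n = j mod int n" for i j
    using that by (simp add: mod_eq_dvd_iff mod_0_imp_dvd)
  show "inj_on (\<lambda>d. (datum_s d, datum_j d mod int n)) data"
  proof (rule inj_onI)
    fix d d' assume d: "d \<in> data" "d' \<in> data" and "(datum_s d, datum_j d mod int n) = (datum_s d', datum_j d' mod int n)"
    then have "datum_s d = datum_s d'" "datum_j d mod int n = datum_j d' mod int n" by simp_all
    then show "d = d'" by (intro datum_determined[OF d] modn)
  qed
  show "(\<lambda>d. (datum_s d, datum_j d mod int n)) ` data \<subseteq> {0..len} \<times> {0..<int n}"
  proof
    fix x assume "x \<in> (\<lambda>d. (datum_s d, datum_j d mod int n)) ` data"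
    then obtain d where d: "d \<in> data" "x = (datum_s d, datum_j d mod int n)" by blast
    have "same_vert (datum_s d) (datum_j d)"
      using datum_entries(3)[OF d(1)] aligned_same_vert rev.aligned_same_vert rev_same_vert[of "len - datum_s d" "datum_j d"]
      by (auto simp: is_end_def right_end_def rev.right_end_def)
    then show "x \<in> {0..len} \<times> {0..<int n}" using d(2) n_pos by (simp add: same_vert_def)
  qed
qed simp

end

section \<open>The basis of the extension space\<close>

context string_band_pair
begin

abbreviation Ext where
  "Ext \<equiv> Ext1 \<Lambda> (scal Q I) Mw Nb ::
    ('k, ((('v, 'a) path \<Rightarrow> 'k) set, nat \<Rightarrow> 'k, nat \<Rightarrow> 'k, nat \<Rightarrow> 'k) ext set) module"

definition cls :: "('a \<Rightarrow> int \<Rightarrow> int \<Rightarrow> 'k) \<Rightarrow> ((('v, 'a) path \<Rightarrow> 'k) set, nat \<Rightarrow> 'k, nat \<Rightarrow> 'k, nat \<Rightarrow> 'k) ext set" where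
  "cls f = X.ext_class (cochain_map f)"

lemma cls_class: "X.has_cocycle X (cochain_map f) \<Longrightarrow> ext_equiv \<Lambda> Mw Nb `` {X} = cls f"
  unfolding cls_def by (rule X.ext_equiv_class[OF is_cochain_cochain_map])

lemma cls_carrier:
  assumes "cocycle f"
  shows "cls f \<in> carrier Ext"
proof -
  note C = has_cocycle_cocycle_ext[OF assms]
  have "cls f = ext_equiv \<Lambda> Mw Nb `` {cocycle_ext f}" by (rule cls_class[OF C, symmetric])
  then show ?thesis using X.has_cocycle_extension[OF C] by (simp add: Ext1_def quotientI)
qed

lemma carrier_cls:
  assumes "x \<in> carrier Ext"
  obtains f where "cocycle f" "x = cls f"
proof -
  have "x \<in> extensions \<Lambda> Mw Nb // ext_equiv \<Lambda> Mw Nb" using assms by (simp add: Ext1_def)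
  then obtain X where X: "X \<in> extensions \<Lambda> Mw Nb" "x = ext_equiv \<Lambda> Mw Nb `` {X}" by (rule quotientE)
  obtain f where f: "cocycle f" "X.has_cocycle X (cochain_map f)" by (rule extension_has_cocycle[OF X(1)])
  show ?thesis by (rule that[OF f(1)]) (use X(2) cls_class[OF f(2)] in simp)
qed

lemma cls_add:
  assumes "cocycle f" "cocycle g"
  shows "cls f \<oplus>\<^bsub>Ext\<^esub> cls g = cls (\<lambda>a s j. f a s j + g a s j)"
proof -
  have "cochain_map (\<lambda>a s j. f a s j + g a s j) = X.cochain_add (cochain_map f) (cochain_map g)"
  proof (intro ext)
    fix \<gamma> m i
    show "cochain_map (\<lambda>a s j. f a s j + g a s j) \<gamma> m i = X.cochain_add (cochain_map f) (cochain_map g) \<gamma> m i"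
      unfolding X.cochain_add_def Nb_simps
      by (cases \<gamma>) (simp_all add: cochain_map_def band_vector_def apply_matrix_def sum.distrib distrib_left add_divide_distrib)
  qed
  then show ?thesis
    unfolding cls_def
    using X.baer_sum_classes[OF has_cocycle_cocycle_ext[OF assms(1)] has_cocycle_cocycle_ext[OF assms(2)]
        is_cochain_cochain_map is_cochain_cochain_map]
    by (simp add: Ext1_def)
qed

lemma cls_smult:
  assumes "cocycle f"
  shows "c \<odot>\<^bsub>Ext\<^esub> cls f = cls (\<lambda>a s j. c * f a s j)"
proof -
  have "cochain_map (\<lambda>a s j. c * f a s j) = X.cochain_smult (scal Q I c) (cochain_map f)"
  proof (intro ext)
    fix \<gamma> m i
    have e: "scal Q I c \<odot>\<^bsub>Nb\<^esub> cochain_map f \<gamma> m = (\<lambda>i. c * cochain_map f \<gamma> m i)"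
      using N.smult_gen(1)[OF cochain_map_space, of c f \<gamma> m] by (simp add: Nb_eq)
    show "cochain_map (\<lambda>a s j. c * f a s j) \<gamma> m i = X.cochain_smult (scal Q I c) (cochain_map f) \<gamma> m i"
      unfolding X.cochain_smult_def e
      by (cases \<gamma>) (simp_all add: cochain_map_def band_vector_def apply_matrix_def sum_distrib_left mult_ac)
  qed
  then show ?thesis
    unfolding cls_def
    using X.scalar_mult_class[OF has_cocycle_cocycle_ext[OF assms] is_cochain_cochain_map, of "scal Q I" c, OF scal_carrier scal_central]
    by (simp add: Ext1_def)
qed

lemma cls_zero: "\<zero>\<^bsub>Ext\<^esub> = cls (\<lambda>_ _ _. 0)"
proof -
  have "cochain_map (\<lambda>_ _ _. 0) = (\<lambda>_ _. \<zero>\<^bsub>Nb\<^esub>)"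
    unfolding Nb_simps by (intro ext, rename_tac \<gamma> m i, case_tac \<gamma>) (simp_all add: cochain_map_def band_vector_def apply_matrix_def)
  then show ?thesis unfolding cls_def using X.split_ext_class by (simp add: Ext1_def)
qed

lemma cocycle_zero: "cocycle (\<lambda>_ _ _. 0)"
proof -
  have "coboundary (\<lambda>_ _. 0) = (\<lambda>_ _ _. 0)" by (simp add: coboundary_def lact_def ract_def fun_eq_iff)
  moreover have "hom_matrix (\<lambda>_ _. 0)" by (simp add: hom_matrix_def quasi_periodic_def)
  ultimately show ?thesis using cocycle_coboundary[of "\<lambda>_ _. 0"] by simp
qed

lemma cocycle_add: "cocycle f \<Longrightarrow> cocycle g \<Longrightarrow> cocycle (\<lambda>a s j. f a s j + g a s j)"
  using cocycle_lin[of f g 1] by simp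

lemma cocycle_smult: "cocycle f \<Longrightarrow> cocycle (\<lambda>a s j. c * f a s j)"
  using cocycle_lin[OF cocycle_zero, of f c] by simp

lemma Ext_abelian: "abelian_monoid Ext"
proof (rule abelian_monoidI)
  show "x \<oplus>\<^bsub>Ext\<^esub> y \<in> carrier Ext" if xy: "x \<in> carrier Ext" "y \<in> carrier Ext" for x y
  proof -
    obtain f g where fg: "cocycle f" "x = cls f" "cocycle g" "y = cls g"
      by (rule carrier_cls[OF xy(1)], rule carrier_cls[OF xy(2)])
    show ?thesis unfolding fg(2,4) cls_add[OF fg(1,3)] by (rule cls_carrier[OF cocycle_add[OF fg(1,3)]])
  qed
  show "\<zero>\<^bsub>Ext\<^esub> \<in> carrier Ext" unfolding cls_zero by (rule cls_carrier[OF cocycle_zero])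
  show "x \<oplus>\<^bsub>Ext\<^esub> y \<oplus>\<^bsub>Ext\<^esub> z = x \<oplus>\<^bsub>Ext\<^esub> (y \<oplus>\<^bsub>Ext\<^esub> z)"
    if xyz: "x \<in> carrier Ext" "y \<in> carrier Ext" "z \<in> carrier Ext" for x y z
  proof -
    obtain f g h where f: "cocycle f" "x = cls f" and g: "cocycle g" "y = cls g" and h: "cocycle h" "z = cls h"
      by (rule carrier_cls[OF xyz(1)], rule carrier_cls[OF xyz(2)], rule carrier_cls[OF xyz(3)])
    show ?thesis
      unfolding f(2) g(2) h(2) cls_add[OF f(1) g(1)] cls_add[OF g(1) h(1)] cls_add[OF cocycle_add[OF f(1) g(1)] h(1)]
        cls_add[OF f(1) cocycle_add[OF g(1) h(1)]] add.assoc by (rule refl)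
  qed
  show "\<zero>\<^bsub>Ext\<^esub> \<oplus>\<^bsub>Ext\<^esub> x = x" if x: "x \<in> carrier Ext" for x
  proof -
    obtain f where f: "cocycle f" "x = cls f" by (rule carrier_cls[OF x])
    show ?thesis unfolding f(2) cls_zero cls_add[OF cocycle_zero f(1)] add_0_left by (rule refl)
  qed
  show "x \<oplus>\<^bsub>Ext\<^esub> y = y \<oplus>\<^bsub>Ext\<^esub> x" if xy: "x \<in> carrier Ext" "y \<in> carrier Ext" for x y
  proof -
    obtain f g where fg: "cocycle f" "x = cls f" "cocycle g" "y = cls g"
      by (rule carrier_cls[OF xy(1)], rule carrier_cls[OF xy(2)])
    show ?thesis
      unfolding fg(2,4) cls_add[OF fg(1,3)] cls_add[OF fg(3,1)] by (simp add: add.commute)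
  qed
qed

definition combination :: "(('v, 'a) word \<times> 'a overlap \<Rightarrow> 'k) \<Rightarrow> (('v, 'a) word \<times> 'a overlap) set \<Rightarrow> 'a \<Rightarrow> int \<Rightarrow> int \<Rightarrow> 'k" where
  "combination c S = (\<lambda>a s j. \<Sum>d\<in>S. c d * datum_cochain d a s j)"

lemma cocycle_combination:
  assumes "finite S" "S \<subseteq> data"
  shows "cocycle (combination c S)"
  using assms
proof (induct S rule: finite_induct)
  case empty
  then show ?case using cocycle_zero by (simp add: combination_def)
next
  case (insert d S)
  have e: "combination c (insert d S) = (\<lambda>a s j. combination c S a s j + c d * datum_cochain d a s j)"
    using insert(1,2) by (auto simp: combination_def add.commute)
  show ?case
    unfolding e by (rule cocycle_lin[OF insert(3) datum_entries(5)]) (use insert(4) in auto)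
qed

lemma finsum_Ext:
  assumes "finite S" "S \<subseteq> data"
  shows "finsum Ext (\<lambda>d. c d \<odot>\<^bsub>Ext\<^esub> cls (datum_cochain d)) S = cls (combination c S)"
  using assms
proof (induct S rule: finite_induct)
  case empty
  interpret E: abelian_monoid Ext by (rule Ext_abelian)
  show ?case using cls_zero by (simp add: combination_def)
next
  case (insert d S)
  interpret E: abelian_monoid Ext by (rule Ext_abelian)
  have t: "c d \<odot>\<^bsub>Ext\<^esub> cls (datum_cochain d) = cls (\<lambda>a s j. c d * datum_cochain d a s j)"
    "cocycle (\<lambda>a s j. c d * datum_cochain d a s j)" if "d \<in> data" for d
    using cls_smult[OF datum_entries(5)[OF that]] cocycle_smult[OF datum_entries(5)[OF that]] by auto
  have d: "d \<in> data" and S: "S \<subseteq> data" using insert(4) by auto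
  have cl: "c d \<odot>\<^bsub>Ext\<^esub> cls (datum_cochain d) \<in> carrier Ext" if "d \<in> data" for d
    unfolding t(1)[OF that] by (rule cls_carrier[OF t(2)[OF that]])
  have "finsum Ext (\<lambda>d. c d \<odot>\<^bsub>Ext\<^esub> cls (datum_cochain d)) (insert d S) =
      c d \<odot>\<^bsub>Ext\<^esub> cls (datum_cochain d) \<oplus>\<^bsub>Ext\<^esub> cls (combination c S)"
    unfolding insert(3)[OF S, symmetric] by (rule E.finsum_insert[OF insert(1,2)]) (use cl d S in auto)
  also have "\<dots> = cls (\<lambda>a s j. c d * datum_cochain d a s j + combination c S a s j)"
    unfolding t(1)[OF d] by (rule cls_add[OF t(2)[OF d] cocycle_combination[OF insert(1) S]])
  also have "(\<lambda>a s j. c d * datum_cochain d a s j + combination c S a s j) = combination c (insert d S)"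
    using insert(1,2) by (simp add: combination_def)
  finally show ?case .
qed

lemma cls_eq_if_coboundary:
  assumes f: "cocycle f" and h: "hom_matrix h" and g: "\<And>a s j. g a s j = f a s j + coboundary h a s j"
  shows "cls f = cls g"
proof -
  note C = has_cocycle_cocycle_ext[OF f]
  have fc: "cochain f" using f by (simp add: cocycle_def)
  show ?thesis
    using cls_class[OF C] cls_class[OF has_cocycle_add_coboundary[OF C fc h g]] by simp
qed

text \<open>
  Equal classes have a common member, to which the comparison of two retractions of the same extension
  applies.
\<close>

lemma coboundary_if_cls_eq:
  assumes f: "cocycle f" and g: "cocycle g" and eq: "cls f = cls g"
  obtains h where "hom_matrix h" "\<And>a s j. g a s j = f a s j + coboundary h a s j"
proof -
  note C = has_cocycle_cocycle_ext[OF f]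
  have "cocycle_ext f \<in> cls f" using C by (simp add: cls_def X.ext_class_def)
  then have C': "X.has_cocycle (cocycle_ext f) (cochain_map g)" unfolding eq by (simp add: cls_def X.ext_class_def)
  have fg: "cochain f" "cochain g" using f g by (auto simp: cocycle_def)
  show ?thesis by (rule cohomologous_coboundary[OF C C' fg]) (rule that)
qed

lemma periodic_cong:
  assumes P: "\<And>j. P (j + int n) \<longleftrightarrow> P j" and ij: "(i - j) mod int n = 0"
  shows "P i \<longleftrightarrow> P j"
proof -
  have step: "P (j + int k * int n) \<longleftrightarrow> P j" for j k
  proof (induct k)
    case (Suc k)
    have e: "j + int (Suc k) * int n = j + int k * int n + int n" by (simp add: algebra_simps)
    show ?case unfolding e P by (rule Suc)
  qed simp
  have "int n dvd i - j" using ij by (rule mod_0_imp_dvd)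
  then obtain q where q: "i - j = int n * q" by (rule dvdE)
  show ?thesis
  proof (cases "0 \<le> q")
    case True
    then have "i = j + int (nat q) * int n" using q by (simp add: algebra_simps)
    then show ?thesis using step[of j "nat q"] by simp
  next
    case False
    then have "j = i + int (nat (- q)) * int n" using q by (simp add: algebra_simps)
    then show ?thesis using step[of i "nat (- q)"] by simp
  qed
qed

lemma is_end_cong: "(i - j) mod int n = 0 \<Longrightarrow> is_end s i \<longleftrightarrow> is_end s j"
proof (rule periodic_cong)
  show "is_end s (j + int n) \<longleftrightarrow> is_end s j" for j
    by (simp add: is_end_def right_end_def rev.right_end_def aligned_period rev.aligned_period left_open_period
        rev.left_open_period inf_word_periodic)
qed

lemma quasi_periodic_ratio:
  assumes g: "quasi_periodic g" and h: "quasi_periodic h" and ij: "(i - j) mod int n = 0"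
  shows "g i * h j = g j * h i"
  by (rule periodic_cong[of "\<lambda>i. g i * h j = g j * h i", OF _ ij, THEN iffD2])
    (use \<mu> in \<open>simp_all add: quasi_periodicD(1)[OF g] quasi_periodicD(1)[OF h]\<close>)

text \<open>
  Different data have different right ends, so at each right end only one summand contributes.
\<close>

lemma combination_entries:
  shows "\<beta> (j - 1) = Inv e \<Longrightarrow> combination c data e s (j - 1) = 0"
    and "\<beta> j = Dir e \<Longrightarrow> \<not> is_end s j \<Longrightarrow> combination c data e s (j + 1) = 0"
    and "\<beta> j = Dir e \<Longrightarrow> d \<in> data \<Longrightarrow> s = datum_s d \<Longrightarrow> (j - datum_j d) mod int n = 0 \<Longrightarrow>
      combination c data e s (j + 1) = c d * datum_cochain d e s (j + 1)"
proof -
  show "combination c data e s (j - 1) = 0" if "\<beta> (j - 1) = Inv e"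
    unfolding combination_def using datum_entries(1)[OF _ that] by (intro sum.neutral) simp
  show "combination c data e s (j + 1) = 0" if j: "\<beta> j = Dir e" and ne: "\<not> is_end s j"
    unfolding combination_def
  proof (intro sum.neutral ballI)
    fix d assume d: "d \<in> data"
    have "\<not> (s = datum_s d \<and> (j - datum_j d) mod int n = 0)"
      using datum_entries(3)[OF d] is_end_cong[of j "datum_j d" s] ne by auto
    then have "datum_cochain d e s (j + 1) = 0" using datum_entries(2)[OF d j, of s] by blast
    then show "c d * datum_cochain d e s (j + 1) = 0" by simp
  qed
  show "combination c data e s (j + 1) = c d * datum_cochain d e s (j + 1)"
    if j: "\<beta> j = Dir e" and d: "d \<in> data" "s = datum_s d" "(j - datum_j d) mod int n = 0"
  proof -
    have z: "datum_cochain d' e s (j + 1) = 0" if d': "d' \<in> data" "d' \<noteq> d" for d'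
    proof (rule ccontr)
      assume "datum_cochain d' e s (j + 1) \<noteq> 0"
      then have d'': "s = datum_s d'" "(j - datum_j d') mod int n = 0" using datum_entries(2)[OF d'(1) j, of s] by auto
      have "(datum_j d' - datum_j d) mod int n = ((j - datum_j d) mod int n - (j - datum_j d') mod int n) mod int n"
        unfolding mod_diff_eq by simp
      also have "\<dots> = 0" unfolding d''(2) d(3) by simp
      finally have "d' = d" using datum_determined[OF d'(1) d(1)] d''(1) d(2) by simp
      then show False using d'(2) by simp
    qed
    have "combination c data e s (j + 1) = (\<Sum>d'\<in>data. if d' = d then c d * datum_cochain d e s (j + 1) else 0)"
      unfolding combination_def using z by (intro sum.cong) auto
    then show ?thesis using finite_data d(1) by simp
  qed
qed

text \<open>
  Subtracting a coboundary leaves entries only at right ends, and these can be removed with the cocycles of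
  the overlap extensions. What remains vanishes at all arrows leaving the band, hence everywhere.
\<close>

lemma spanning:
  assumes f: "cocycle f"
  shows "\<exists>c. c \<in> extensional data \<and> cls f = cls (combination c data)"
proof -
  obtain h where h: "hom_matrix h"
    "\<And>s j c. same_vert s j \<Longrightarrow> \<beta> (j - 1) = Inv c \<Longrightarrow> coboundary h c s (j - 1) = f c s (j - 1)"
    "\<And>s j d. same_vert s j \<Longrightarrow> \<beta> j = Dir d \<Longrightarrow> \<not> is_end s j \<Longrightarrow> coboundary h d s (j + 1) = f d s (j + 1)"
  proof (rule cocycle_reduce[OF f])
    fix h assume "hom_matrix h"
      "\<And>s j c. same_vert s j \<Longrightarrow> \<beta> (j - 1) = Inv c \<Longrightarrow> coboundary h c s (j - 1) = f c s (j - 1)"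
      "\<And>s j d. same_vert s j \<Longrightarrow> \<beta> j = Dir d \<Longrightarrow> \<not> is_end s j \<Longrightarrow> coboundary h d s (j + 1) = f d s (j + 1)"
    then show thesis by (rule that)
  qed
  define f' where "f' a s j = f a s j + (- 1) * coboundary h a s j" for a s j
  have f': "cocycle f'" unfolding f'_def[abs_def] by (rule cocycle_lin[OF f cocycle_coboundary[OF h(1)]])
  have ff: "cls f' = cls f" by (rule cls_eq_if_coboundary[OF f' h(1)]) (simp add: f'_def)
  define arr where "arr d = (THE e. \<beta> (datum_j d) = Dir e)" for d
  \<comment> \<open>the coefficients are read off at one representative of each right end; at its translates both entries change by the same factor\<close>
  define c where "c = restrict (\<lambda>d. f' (arr d) (datum_s d) (datum_j d + 1) / datum_cochain d (arr d) (datum_s d) (datum_j d + 1)) data"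
  define g where "g a s j = f' a s j + (- 1) * combination c data a s j" for a s j
  have g: "cocycle g" unfolding g_def[abs_def] by (rule cocycle_lin[OF f' cocycle_combination[OF finite_data subset_refl]])
  have z: "g a s j = 0" for a s j
  proof (rule cocycle_zeroI[OF g])
    show "g c s (j - 1) = 0" if "same_vert s j" "\<beta> (j - 1) = Inv c" for s j c
      using h(2)[OF that] combination_entries(1)[OF that(2)] by (simp add: g_def f'_def)
    show "g e s (j + 1) = 0" if sv: "same_vert s j" and j: "\<beta> j = Dir e" for s j e
    proof (cases "is_end s j")
      case False
      then show ?thesis using h(3)[OF sv j] combination_entries(2)[OF j] by (simp add: g_def f'_def)
    next
      case True
      from is_end_datum[OF True] obtain d
        where d: "d \<in> data" "s = datum_s d" "(j - datum_j d) mod int n = 0" by (elim bexE conjE)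
      have bj: "\<beta> (datum_j d) = Dir e"
        using inf_word_cong[OF d(3), of 0] j unfolding add_0_right by (rule trans[OF sym])
      have ar: "arr d = e" unfolding arr_def bj letter.inject by (rule the_sym_eq_trivial)
      have "(datum_j d - datum_j d) mod int n = 0" unfolding diff_self by (rule mod_0)
      with d(2) have nz: "datum_cochain d e s (datum_j d + 1) \<noteq> 0"
        by (intro datum_entries(2)[OF d(1) bj, of s, THEN iffD2] conjI)
      have fc: "cochain f'" "cochain (datum_cochain d)"
        by (rule f'[unfolded cocycle_def, THEN conjunct1], rule datum_entries(5)[OF d(1), unfolded cocycle_def, THEN conjunct1])
      have qp: "quasi_periodic (f' e s)" "quasi_periodic (datum_cochain d e s)"
        by (rule fc[unfolded cochain_def, THEN conjunct1, rule_format])+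
      have "(j + 1 - (datum_j d + 1)) mod int n = 0" using d(3) by simp
      note ratio = quasi_periodic_ratio[OF qp this]
      have cd: "c d = f' e s (datum_j d + 1) / datum_cochain d e s (datum_j d + 1)"
        unfolding c_def restrict_apply ar d(2)[symmetric] using d(1) by (simp only: if_True)
      have "f' e s (j + 1) = c d * datum_cochain d e s (j + 1)"
        unfolding cd times_divide_eq_left nonzero_eq_divide_eq[OF nz] by (rule ratio)
      then show ?thesis using combination_entries(3)[OF j d, of c] by (simp add: g_def)
    qed
  qed
  have "f' = combination c data"
  proof (intro ext)
    show "f' a s j = combination c data a s j" for a s j using z[of a s j] unfolding g_def by (simp only: mult_minus1 add_uminus_conv_diff right_minus_eq)
  qed
  then have "cls f = cls (combination c data)" unfolding ff[symmetric] by simp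
  then show ?thesis by (intro exI[of _ c]) (simp add: c_def)
qed

text \<open>
  The difference of the two combinations is a coboundary whose entries at the arrows leaving the band are
  concentrated in the right ends, hence vanish there too.
\<close>

lemma independent:
  assumes "cls (combination c data) = cls (combination c' data)" and d: "d \<in> data"
  shows "c d = c' d"
proof -
  note K = cocycle_combination[OF finite_data subset_refl]
  obtain h where h: "hom_matrix h" "\<And>a s j. combination c' data a s j = combination c data a s j + coboundary h a s j"
  proof (rule coboundary_if_cls_eq[OF K K assms(1)])
    fix h assume "hom_matrix h" "\<And>a s j. combination c' data a s j = combination c data a s j + coboundary h a s j"
    then show thesis by (rule that)
  qed
  have cb: "coboundary h a s j = combination c' data a s j - combination c data a s j" for a s j
    unfolding h(2) by simp
  obtain e where e: "\<beta> (datum_j d) = Dir e" using datum_entries(4)[OF d] by blast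
  have "coboundary h e (datum_s d) (datum_j d + 1) = 0"
    by (rule coboundary_zero_at_ends[OF _ _ datum_entries(3)[OF d] e])
      (simp_all add: cb combination_entries(1,2))
  moreover have "datum_cochain d e (datum_s d) (datum_j d + 1) \<noteq> 0" using datum_entries(2)[OF d e] by simp
  ultimately show ?thesis
    unfolding cb using combination_entries(3)[OF e d refl] by simp
qed

lemma Ext_basis:
  "finite_basis Ext data (\<lambda>d. ext_equiv \<Lambda> Mw Nb `` {datum_ext Q I v b t\<^sub>0 \<mu> d})"
proof -
  interpret E: abelian_monoid Ext by (rule Ext_abelian)
  have dc: "ext_equiv \<Lambda> Mw Nb `` {datum_ext Q I v b t\<^sub>0 \<mu> d} = cls (datum_cochain d)" if "d \<in> data" for d
    by (rule cls_class[OF datum_has_cocycle[OF that]])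
  have sm: "c d \<odot>\<^bsub>Ext\<^esub> cls (datum_cochain d) \<in> carrier Ext" if "d \<in> data" for c d
    unfolding cls_smult[OF datum_entries(5)[OF that]] by (rule cls_carrier[OF cocycle_smult[OF datum_entries(5)[OF that]]])
  have fs: "(\<Oplus>\<^bsub>Ext\<^esub>d\<in>data. c d \<odot>\<^bsub>Ext\<^esub> (ext_equiv \<Lambda> Mw Nb `` {datum_ext Q I v b t\<^sub>0 \<mu> d})) = cls (combination c data)" for c
  proof -
    have "(\<Oplus>\<^bsub>Ext\<^esub>d\<in>data. c d \<odot>\<^bsub>Ext\<^esub> (ext_equiv \<Lambda> Mw Nb `` {datum_ext Q I v b t\<^sub>0 \<mu> d})) =
        (\<Oplus>\<^bsub>Ext\<^esub>d\<in>data. c d \<odot>\<^bsub>Ext\<^esub> cls (datum_cochain d))"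
      by (rule E.finsum_cong') (use sm dc in auto)
    then show ?thesis using finsum_Ext[OF finite_data subset_refl] by simp
  qed
  show ?thesis
    unfolding finite_basis_def fs
  proof (intro conjI ballI)
    show "finite data" by (rule finite_data)
    show "(\<lambda>d. ext_equiv \<Lambda> Mw Nb `` {datum_ext Q I v b t\<^sub>0 \<mu> d}) \<in> data \<rightarrow> carrier Ext"
      using dc cls_carrier[OF datum_entries(5)] by simp
    fix x assume "x \<in> carrier Ext"
    then obtain f where f: "cocycle f" "x = cls f" by (rule carrier_cls)
    obtain c where c: "c \<in> extensional data" "cls f = cls (combination c data)" using spanning[OF f(1)] by blast
    show "\<exists>!c. c \<in> extensional data \<and> x = cls (combination c data)"
    proof (rule ex1I[of _ c])
      fix c' assume c': "c' \<in> extensional data \<and> x = cls (combination c' data)"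
      have "cls (combination c' data) = cls (combination c data)" using c' c f(2) by simp
      then show "c' = c" using c' c(1) independent by (intro extensionalityI[of _ data]) auto
    qed (use c f in simp)
  qed
qed

text \<open>
  A split extension has class zero, which is the combination with all coefficients zero.
\<close>

lemma overlap_not_split:
  assumes "ov \<in> overlaps Q I v b"
  shows "\<not> split_ext \<Lambda> Mw (overlap_extension Q I v b t\<^sub>0 \<mu> ov)"
proof
  interpret O: overlap_setup Q I b t\<^sub>0 \<mu> v ov by (rule overlap_setup_v[OF assms])
  have d: "(v, ov) \<in> data" using assms by (simp add: overlap_data_def)
  assume "split_ext \<Lambda> Mw (overlap_extension Q I v b t\<^sub>0 \<mu> ov)"
  then have "overlap_extension Q I v b t\<^sub>0 \<mu> ov \<in> \<zero>\<^bsub>Ext\<^esub>"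
    using O.overlap_extension by (simp add: Ext1_def)
  then have "X.has_cocycle (overlap_extension Q I v b t\<^sub>0 \<mu> ov) (cochain_map (\<lambda>_ _ _. 0))"
    unfolding cls_zero cls_def X.ext_class_def by simp
  from cls_class[OF this] cls_class[OF O.overlap_has_cocycle]
  have eq: "cls (\<lambda>_ _ _. 0) = cls O.ov_cochain" by simp
  define c where "c d' = (if d' = (v, ov) then 1 else 0 :: 'k)" for d'
  have "combination c data = (\<lambda>a s j. \<Sum>d\<in>data. if d = (v, ov) then datum_cochain (v, ov) a s j else 0)"
    unfolding combination_def c_def by (intro ext sum.cong) auto
  then have "combination c data = O.ov_cochain" using finite_data d by (simp add: datum_cochain_def)
  moreover have "combination (\<lambda>_. 0) data = (\<lambda>_ _ _. 0)" by (simp add: combination_def)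
  ultimately have "cls (combination c data) = cls (combination (\<lambda>_. 0) data)" using eq by simp
  from independent[OF this d] show False by (simp add: c_def)
qed

end

section \<open>Rotations of the band\<close>

context string_band_pair
begin

text \<open>
  Subwords of the bi-infinite word of the band; rotations, \<open>m\<close> and \<open>y\<close> are all of this form.
\<close>

definition segment :: "int \<Rightarrow> nat \<Rightarrow> 'a letter list" where
  "segment k l = map (\<lambda>i. \<beta> (k + int i)) [0..<l]"

lemma length_segment [simp]: "length (segment k l) = l"
  by (simp add: segment_def)

lemma segment_add: "segment k (l + l') = segment k l @ segment (k + int l) l'"
proof (rule nth_equalityI)
  fix i assume "i < length (segment k (l + l'))"
  then show "segment k (l + l') ! i = (segment k l @ segment (k + int l) l') ! i"
    by (auto simp: segment_def nth_append)
qed simp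

lemma segment_one: "segment k 1 = [\<beta> k]"
  by (simp add: segment_def)

lemma segment_period: "segment (k + int n) l = segment k l"
proof -
  have e: "k + int n + int i = k + int i + int n" for i by simp
  show ?thesis unfolding segment_def e inf_word_periodic by (rule refl)
qed

lemma segment_power: "segment k (q * n) = concat (replicate q (segment k n))"
  by (induct q) (simp_all add: segment_add segment_period segment_def[of _ 0])

lemma rotate_segment: "rotate r b = segment (int r) n"
proof (rule nth_equalityI)
  fix i assume "i < length (rotate r b)"
  then show "rotate r b ! i = segment (int r) n ! i"
    by (simp add: nth_rotate segment_def inf_word_def nat_mod_distrib flip: of_nat_add)
qed simp

lemma ov_m_segment: "ov \<in> overlaps Q I v b \<Longrightarrow> ov_m ov = segment (int (ov_pos ov)) (length (ov_m ov))"
  by (intro nth_equalityI) (auto simp: segment_def overlaps_def)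

lemma ov_y_segment: "ov_y b ov = segment (int (ov_pos ov)) (length (ov_m ov) + n)"
  by (simp add: ov_y_def segment_def)

text \<open>The band is rotated such that it begins with the letter before \<open>m\<close>, so that \<open>b\<^sub>R\<close> is empty.\<close>

lemma rotation_short_overlap:
  assumes ov: "ov \<in> overlaps Q I v b" and "\<exists>r. strict_sublist (ov_m ov) (rotate r b)"
  shows "\<exists>r bL bR. rotate r b = bR @ [Inv (ov_C ov)] @ ov_m ov @ [Dir (ov_D ov)] @ bL \<and>
    (r + length bR + 1) mod n = ov_pos ov \<and>
    ov_word Q b ov = word_of Q (ov_vR ov @ dir_opt (ov_A ov) @ ov_m ov @ [Dir (ov_D ov)] @ bL @
      bR @ [Inv (ov_C ov)] @ ov_m ov @ inv_opt (ov_B ov) @ ov_vL ov)"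
proof -
  interpret O: overlap_setup Q I b t\<^sub>0 \<mu> v ov by (rule overlap_setup_v[OF ov])
  define p where "p = int (ov_pos ov)"
  define l where "l = length (ov_m ov)"
  have pos: "ov_pos ov < n" using ov by (simp add: overlaps_def)
  have m: "ov_m ov = segment p l" using ov_m_segment[OF ov] by (simp add: p_def l_def)
  have C: "\<beta> (p - 1) = Inv (ov_C ov)" and D: "\<beta> (p + int l) = Dir (ov_D ov)"
    using O.ends_\<omega>(3,4) by (simp_all add: p_def l_def end_j_def)
  have "l < n"
  proof -
    obtain r where r: "sublist (ov_m ov) (rotate r b)" "ov_m ov \<noteq> rotate r b"
      using assms(2) by (auto simp: strict_sublist_def)
    obtain ps ss where e: "rotate r b = ps @ ov_m ov @ ss" using r(1) by (auto simp: sublist_def)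
    have "n = length ps + l + length ss" using arg_cong[OF e, of length] by (simp add: l_def)
    moreover have "length ps + length ss \<noteq> 0" using e r(2) by auto
    ultimately show ?thesis by linarith
  qed
  \<comment> \<open>the letters before and after \<open>m\<close> would be the same place of the band, but one is inverse and one direct\<close>
  moreover have "l + 1 \<noteq> n"
  proof
    assume "l + 1 = n"
    then have e: "p - 1 + int n = p + int l" by simp
    show False using inf_word_periodic(1)[of "p - 1", unfolded e] C D by simp
  qed
  ultimately have n: "n = 1 + (l + (1 + (n - l - 2)))" by linarith
  define bL where "bL = segment (p + int l + 1) (n - l - 2)"
  define r where "r = ov_pos ov + (n - 1)"
  obtain n' where n': "n = Suc n'" using gr0_implies_Suc[OF n_pos] by blast
  have r: "int r = p - 1 + int n" unfolding r_def p_def n' by simp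
  have cyc: "segment (p - 1) n = [Inv (ov_C ov)] @ ov_m ov @ [Dir (ov_D ov)] @ bL"
    by (subst n) (simp only: segment_add segment_one C D m bL_def of_nat_1 diff_add_cancel)
  have "ov_y b ov = ov_m ov @ [Dir (ov_D ov)] @ bL @ [Inv (ov_C ov)] @ ov_m ov"
  proof -
    have e: "l + n = l + (1 + ((n - l - 2) + (1 + l)))" using n by linarith
    have e': "p + int l + 1 + int (n - l - 2) = p - 1 + int n" using n by linarith
    have "segment (p - 1) (1 + l) = [Inv (ov_C ov)] @ ov_m ov"
      by (simp only: segment_add segment_one C m of_nat_1 diff_add_cancel)
    then have "segment (p + int l + 1 + int (n - l - 2)) (1 + l) = [Inv (ov_C ov)] @ ov_m ov"
      unfolding e' segment_period .
    then show ?thesis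
      unfolding ov_y_segment p_def[symmetric] l_def[symmetric] e
      by (simp only: segment_add[of p] segment_add[of "p + int l"] segment_add[of "p + int l + 1"] segment_one D m bL_def of_nat_1 append_assoc)
  qed
  moreover have "rotate r b = [] @ [Inv (ov_C ov)] @ ov_m ov @ [Dir (ov_D ov)] @ bL"
    unfolding rotate_segment r segment_period cyc by simp
  moreover have "(r + length ([] :: 'a letter list) + 1) mod n = ov_pos ov"
  proof -
    have "r + length ([] :: 'a letter list) + 1 = ov_pos ov + n" using n_pos unfolding r_def list.size by linarith
    then show ?thesis using pos by simp
  qed
  ultimately show ?thesis
    by (intro exI[of _ r] exI[of _ bL] exI[of _ "[]"] conjI) (simp_all add: ov_word_def)
qed

text \<open>The band is rotated such that it begins with the letter after the first \<open>|m| mod |b|\<close> letters of \<open>m\<close>.\<close>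

lemma rotation_long_overlap:
  assumes ov: "ov \<in> overlaps Q I v b" and "\<exists>r. sublist (rotate r b) (ov_m ov)"
  shows "\<exists>r b1 b2 k. rotate r b = b1 @ b2 \<and> k \<ge> 1 \<and> ov_m ov = b2 @ concat (replicate k (b1 @ b2)) \<and>
    (r + length b1) mod n = ov_pos ov \<and>
    ov_word Q b ov = word_of Q (ov_vR ov @ dir_opt (ov_A ov) @ b2 @ concat (replicate (k + 1) (b1 @ b2)) @
      inv_opt (ov_B ov) @ ov_vL ov)"
proof -
  define p where "p = int (ov_pos ov)"
  define l where "l = length (ov_m ov)"
  define t where "t = l mod n"
  define k where "k = l div n"
  have pos: "ov_pos ov < n" using ov by (simp add: overlaps_def)
  have m: "ov_m ov = segment p l" using ov_m_segment[OF ov] by (simp add: p_def l_def)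
  obtain r0 where "sublist (rotate r0 b) (ov_m ov)" using assms(2) by blast
  from sublist_length_le[OF this] have "n \<le> l" by (simp add: l_def)
  then have k: "1 \<le> k" using n_pos by (simp add: k_def Suc_le_eq div_greater_zero_iff)
  have t: "t < n" using n_pos by (simp add: t_def)
  have l: "l = t + k * n" by (simp add: t_def k_def)
  define b1 where "b1 = segment (p + int t) (n - t)"
  define b2 where "b2 = segment p t"
  have cyc: "segment (p + int t) n = b1 @ b2"
  proof -
    have e: "n = (n - t) + t" using t by simp
    have "segment (p + int t) n = segment (p + int t) (n - t) @ segment (p + int t + int (n - t)) t"
      by (subst e) (rule segment_add)
    also have "p + int t + int (n - t) = p + int n" using t by simp
    finally show ?thesis unfolding segment_period b1_def b2_def .
  qed
  have "rotate (ov_pos ov + t) b = b1 @ b2"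
    unfolding rotate_segment cyc[symmetric] p_def by simp
  moreover have "ov_m ov = b2 @ concat (replicate k (b1 @ b2))"
    unfolding m l segment_add segment_power cyc b2_def ..
  moreover have "(ov_pos ov + t + length b1) mod n = ov_pos ov"
  proof -
    have e: "ov_pos ov + t + length b1 = ov_pos ov + n" using t by (simp add: b1_def)
    show ?thesis unfolding e using pos by simp
  qed
  moreover have "ov_y b ov = b2 @ concat (replicate (k + 1) (b1 @ b2))"
  proof -
    have e: "l + n = t + (k + 1) * n" using l by simp
    show ?thesis unfolding ov_y_segment p_def[symmetric] l_def[symmetric] e segment_add segment_power cyc b2_def ..
  qed
  ultimately show ?thesis
    using k by (intro exI[of _ "ov_pos ov + t"] exI[of _ b1] exI[of _ b2] exI[of _ k] conjI) (simp_all add: ov_word_def)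
qed

lemma overlap_properties:
  assumes "ov \<in> overlaps Q I v b"
  shows "is_string Q I (ov_word Q b ov)"
    and "overlap_extension Q I v b t\<^sub>0 \<mu> ov \<in> extensions \<Lambda> Mw Nb"
    and "\<not> split_ext \<Lambda> Mw (overlap_extension Q I v b t\<^sub>0 \<mu> ov)"
proof -
  interpret O: overlap_setup Q I b t\<^sub>0 \<mu> v ov by (rule overlap_setup_v[OF assms])
  show "is_string Q I (ov_word Q b ov)" unfolding is_string_iff by (rule O.good_u)
  show "overlap_extension Q I v b t\<^sub>0 \<mu> ov \<in> extensions \<Lambda> Mw Nb" by (rule O.overlap_extension)
  show "\<not> split_ext \<Lambda> Mw (overlap_extension Q I v b t\<^sub>0 \<mu> ov)" by (rule overlap_not_split[OF assms])
qed

end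

theorem theorem2:
  fixes Q :: "('v, 'a) pre_digraph"
    and I :: "(('v, 'a) path \<Rightarrow> 'k::alg_closed_field) set"
    and v :: "('v, 'a) word"
    and b :: "'a letter list"
    and \<mu> :: 'k
    and t\<^sub>0 :: nat
  defines "\<Lambda> \<equiv> gentle_alg Q I"
    and "Mv \<equiv> string_module Q I v"
    and "Bb \<equiv> band_module Q I b t\<^sub>0 \<mu>"
  assumes "gentle Q I"
    and "is_string Q I v"
    and "is_band Q I b"
    and "\<mu> \<noteq> 0"
    and "t\<^sub>0 < length b" and "\<exists>a. b ! t\<^sub>0 = Dir a"
  shows
    "(\<forall>ov\<in>overlaps Q I v b.
        (\<exists>r. strict_sublist (ov_m ov) (rotate r b)) \<longrightarrow>
        (\<exists>r bL bR.
           rotate r b = bR @ [Inv (ov_C ov)] @ ov_m ov @ [Dir (ov_D ov)] @ bL \<and>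
           (r + length bR + 1) mod length b = ov_pos ov \<and>
           ov_word Q b ov =
             word_of Q (ov_vR ov @ dir_opt (ov_A ov) @ ov_m ov @ [Dir (ov_D ov)] @ bL @
                        bR @ [Inv (ov_C ov)] @ ov_m ov @ inv_opt (ov_B ov) @ ov_vL ov)) \<and>
        is_string Q I (ov_word Q b ov) \<and>
        overlap_extension Q I v b t\<^sub>0 \<mu> ov \<in> extensions \<Lambda> Mv Bb \<and>
        \<not> split_ext \<Lambda> Mv (overlap_extension Q I v b t\<^sub>0 \<mu> ov))
     \<and>
     (\<forall>ov\<in>overlaps Q I v b.
        (\<exists>r. sublist (rotate r b) (ov_m ov)) \<longrightarrow>
        (\<exists>r b1 b2 k.
           rotate r b = b1 @ b2 \<and> k \<ge> 1 \<and>
           ov_m ov = b2 @ concat (replicate k (b1 @ b2)) \<and>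
           (r + length b1) mod length b = ov_pos ov \<and>
           ov_word Q b ov =
             word_of Q (ov_vR ov @ dir_opt (ov_A ov) @ b2 @ concat (replicate (k + 1) (b1 @ b2)) @
                        inv_opt (ov_B ov) @ ov_vL ov)) \<and>
        is_string Q I (ov_word Q b ov) \<and>
        overlap_extension Q I v b t\<^sub>0 \<mu> ov \<in> extensions \<Lambda> Mv Bb \<and>
        \<not> split_ext \<Lambda> Mv (overlap_extension Q I v b t\<^sub>0 \<mu> ov))
     \<and>
     finite_basis (Ext1 \<Lambda> (scal Q I) Mv Bb) (overlap_data Q I v b)
       (\<lambda>d. ext_equiv \<Lambda> Mv Bb `` {datum_ext Q I v b t\<^sub>0 \<mu> d})"
proof -
  interpret gentle_quiver Q I by unfold_locales (rule assms(4))
  interpret P: string_band_pair Q I b t\<^sub>0 \<mu> v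
    by unfold_locales (use assms in \<open>simp_all add: is_string_iff\<close>)
  show ?thesis
    unfolding assms(1-3)
    using P.rotation_short_overlap P.rotation_long_overlap P.overlap_properties P.Ext_basis
    by (intro conjI ballI impI)
qed

end
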